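(* Let $R$ be a commutative $\mathbb{Q}$-algebra, let $G$ be a linear algebraic group over $R$, let $BG$ be the stack over $R$ parametrising $G$-torsors, and let $B\in DG^+\mathrm{CAlg}(R)$. Then $(D_*BG)(B)$ is equivalent to the groupoid of pairs $(P,\nabla)$, where $P$ is a $G$-torsor over $B^0$ and $\nabla\colon O(P)\to O(P)\otimes_{B^0}B^1$ is a flat connection acting as a differential with respect to the multiplicative structure on the ring of functions $O(P)$, required to be $G$-equivariant in the sense that \[ \mu\circ\nabla=(\nabla\otimes\mathrm{id})\circ\mu, \] for $\mu\colon O(P)\to O(P)\otimes O(G)$ the co-action.
   Context: $DG^+\mathrm{CAlg}(R)$ is the category of graded-commutative differential graded $R$-algebras $A=(A^0\xrightarrow{\partial}A^1\xrightarrow{\partial}A^2\to\cdots)$ concentrated in non-negative cochain degrees; $A^{\#}$ denotes the underlying graded algebra. A flat connection acting as a differential with respect to the multiplicative structure means that $\nabla$ satisfies the Leibniz rule $\nabla(fg)=\nabla(f)g+f\nabla(g)$, restricts to $\partial_B$ on $B^0$, and extends to a degree $1$ derivation on $O(P)\otimes_{B^0}B^{\#}$, compatible with $\partial_B$, with $\nabla\circ\nabla=0$. Morphisms of pairs are isomorphisms of $G$-torsors intertwining the connections. For $A\in DG^+\mathrm{CAlg}(R)$, $DA$ is the Dold–Kan denormalisation, a cosimplicial commutative $R$-algebra. As a cosimplicial module, $D^nA=\bigoplus_{m+s=n,\ 1\le j_1<\dots<j_s\le n}\partial^{j_s}\cdots\partial^{j_1}A^m$, with cosimplicial operations determined by the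 cosimplicial identities together with $\sigma^i a=0$ and $\partial^0a=\sum_{i=1}^{n+1}(-1)^i\partial^ia-\partial a$ for $a\in A^n$. The product is the Eilenberg–Zilber shuffle product: writing $\partial^I=\partial^{i_s}\cdots\partial^{i_1}$ for $I=\{i_1<\dots<i_s\}$ with $i_1\ge1$, the product of $\partial^Ia$ and $\partial^Jb$ is $(-1)^{(J\setminus I,\,I\setminus J)}\partial^{I\cap J}(ab)$ if $\deg a=|J\setminus I|$ and $\deg b=|I\setminus J|$, and $0$ otherwise, where $(-1)^{(S,T)}$ is the sign of the shuffle permutation of $S\sqcup T$ sending the first $|S|$ elements to $S$ in order and the remaining $|T|$ elements to $T$ in order. For a groupoid-valued functor $F$ on commutative $R$-algebras, $D_*F(B):=\mathrm{holim}_{n\in\Delta}F(D^nB)$. Equivalently, $D_*F(B)$ is the groupoid whose objects are pairs $(x,g)$ with $x\in F(B^0)$ and $g\colon\partial^0x\to\partial^1x$ an isomorphism in $F(D^1B)$ satisfying the cocycle condition $\partial^1g=(\partial^2g)\circ(\partial^0g)$ in $F(D^2B)$, and whose isomorphisms $(x,g)\to(x',g')$ are isomorphisms $h\colon x\to x'$ in $F(B^0)$ with $g'\circ\partial^0h=(\partial^1h)\circ g$.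
   Formalization: In the denormalisation DB, the coface ∂^0 is taken as ∂^0 a = ∂a − Σ_{i≥1}(−1)^i ∂^i a, the negative of the formula given for it, since with the given sign ∂^0 1 = −∂^1 1 and ∂^0 is not a ring map. *)

theory Defs
  imports "HOL-Algebra.Algebra"
begin

section \<open>Groupoids and their equivalence\<close>

text \<open>\<open>cmp C x y z g f\<close> is \<open>g \<circ> f\<close> for \<open>f : x \<rightarrow> y\<close> and \<open>g : y \<rightarrow> z\<close>.\<close>

record ('o, 'm) cat =
  ob :: "'o set"
  arr :: "'o \<Rightarrow> 'o \<Rightarrow> 'm set"
  idn :: "'o \<Rightarrow> 'm"
  cmp :: "'o \<Rightarrow> 'o \<Rightarrow> 'o \<Rightarrow> 'm \<Rightarrow> 'm \<Rightarrow> 'm"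

locale groupoid =
  fixes C :: "('o, 'm) cat"
  assumes idn_arr: "x \<in> ob C \<Longrightarrow> idn C x \<in> arr C x x"
    and cmp_arr: "\<lbrakk>x \<in> ob C; y \<in> ob C; z \<in> ob C; f \<in> arr C x y; g \<in> arr C y z\<rbrakk>
      \<Longrightarrow> cmp C x y z g f \<in> arr C x z"
    and cmp_idn_right: "\<lbrakk>x \<in> ob C; y \<in> ob C; f \<in> arr C x y\<rbrakk> \<Longrightarrow> cmp C x x y f (idn C x) = f"
    and cmp_idn_left: "\<lbrakk>x \<in> ob C; y \<in> ob C; f \<in> arr C x y\<rbrakk> \<Longrightarrow> cmp C x y y (idn C y) f = f"
    and cmp_assoc: "\<lbrakk>x \<in> ob C; y \<in> ob C; z \<in> ob C; w \<in> ob C;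
      f \<in> arr C x y; g \<in> arr C y z; h \<in> arr C z w\<rbrakk>
      \<Longrightarrow> cmp C x z w h (cmp C x y z g f) = cmp C x y w (cmp C y z w h g) f"
    and arr_inv: "\<lbrakk>x \<in> ob C; y \<in> ob C; f \<in> arr C x y\<rbrakk>
      \<Longrightarrow> \<exists>g \<in> arr C y x. cmp C x y x g f = idn C x \<and> cmp C y x y f g = idn C y"

definition is_functor ::
  "('o, 'm) cat \<Rightarrow> ('o2, 'm2) cat \<Rightarrow> ('o \<Rightarrow> 'o2) \<Rightarrow> ('o \<Rightarrow> 'o \<Rightarrow> 'm \<Rightarrow> 'm2) \<Rightarrow> bool" where
  "is_functor C D Fo Fm \<longleftrightarrow>
     (\<forall>x \<in> ob C. Fo x \<in> ob D) \<and>
     (\<forall>x \<in> ob C. \<forall>y \<in> ob C. \<forall>f \<in> arr C x y. Fm x y f \<in> arr D (Fo x) (Fo y)) \<and>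
     (\<forall>x \<in> ob C. Fm x x (idn C x) = idn D (Fo x)) \<and>
     (\<forall>x \<in> ob C. \<forall>y \<in> ob C. \<forall>z \<in> ob C. \<forall>f \<in> arr C x y. \<forall>g \<in> arr C y z.
        Fm x z (cmp C x y z g f) = cmp D (Fo x) (Fo y) (Fo z) (Fm y z g) (Fm x y f))"

text \<open>A natural transformation from the identity to the endofunctor \<open>(Fo, Fm)\<close>; in a groupoid
  it is automatically a natural isomorphism.\<close>

definition nat_from_id ::
  "('o, 'm) cat \<Rightarrow> ('o \<Rightarrow> 'o) \<Rightarrow> ('o \<Rightarrow> 'o \<Rightarrow> 'm \<Rightarrow> 'm) \<Rightarrow> ('o \<Rightarrow> 'm) \<Rightarrow> bool" where
  "nat_from_id C Fo Fm \<eta> \<longleftrightarrow>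
     (\<forall>x \<in> ob C. \<eta> x \<in> arr C x (Fo x)) \<and>
     (\<forall>x \<in> ob C. \<forall>y \<in> ob C. \<forall>f \<in> arr C x y.
        cmp C x (Fo x) (Fo y) (Fm x y f) (\<eta> x) = cmp C x y (Fo y) (\<eta> y) f)"

definition equivalent_groupoids :: "('o, 'm) cat \<Rightarrow> ('o2, 'm2) cat \<Rightarrow> bool" where
  "equivalent_groupoids C D \<longleftrightarrow> groupoid C \<and> groupoid D \<and>
     (\<exists>Fo Fm Go Gm \<eta> \<epsilon>. is_functor C D Fo Fm \<and> is_functor D C Go Gm \<and>
        nat_from_id C (\<lambda>x. Go (Fo x)) (\<lambda>x y f. Gm (Fo x) (Fo y) (Fm x y f)) \<eta> \<and>
        nat_from_id D (\<lambda>x. Fo (Go x)) (\<lambda>x y f. Fm (Go x) (Go y) (Gm x y f)) \<epsilon>)"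


section \<open>Modules, algebras and tensor products\<close>

text \<open>\<open>restr f N\<close> is \<open>N\<close> with scalars restricted along \<open>f\<close>; \<open>unit_map A\<close> is the structure map of
  an algebra; \<open>self A\<close> is a ring as a module over itself.\<close>

definition restr :: "('a \<Rightarrow> 'c) \<Rightarrow> ('c, 'n, 'z) module_scheme \<Rightarrow> ('a, 'n) module" where
  "restr f N = \<lparr>carrier = carrier N, monoid.mult = monoid.mult N, monoid.one = monoid.one N,
     ring.zero = ring.zero N, ring.add = ring.add N, smult = (\<lambda>a n. f a \<odot>\<^bsub>N\<^esub> n)\<rparr>"

definition self :: "('a, 'z) ring_scheme \<Rightarrow> ('a, 'a) module" where
  "self A = \<lparr>carrier = carrier A, monoid.mult = monoid.mult A, monoid.one = monoid.one A,
     ring.zero = ring.zero A, ring.add = ring.add A, smult = monoid.mult A\<rparr>"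

definition unit_map :: "('a, 'c, 'z) module_scheme \<Rightarrow> 'a \<Rightarrow> 'c" where
  "unit_map A a = a \<odot>\<^bsub>A\<^esub> \<one>\<^bsub>A\<^esub>"

definition alg_hom ::
  "('a, 'w) ring_scheme \<Rightarrow> ('a, 's, 'x) module_scheme \<Rightarrow> ('a, 't, 'y) module_scheme \<Rightarrow> ('s \<Rightarrow> 't) set" where
  "alg_hom A S T = {f \<in> ring_hom S T.
     \<forall>a \<in> carrier A. \<forall>s \<in> carrier S. f (a \<odot>\<^bsub>S\<^esub> s) = a \<odot>\<^bsub>T\<^esub> f s}"

text \<open>The tensor product over \<open>A\<close> by generators and relations: a list \<open>[(m\<^sub>1, n\<^sub>1), \<dots>]\<close> stands for
  the formal sum \<open>m\<^sub>1 \<otimes> n\<^sub>1 + \<dots>\<close>, and an element of the tensor product is a class of such lists.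
  The additive inverse of \<open>m \<otimes> n\<close> is \<open>(\<ominus> m) \<otimes> n\<close>, and \<open>m \<otimes> 0 = 0\<close> follows from \<open>balance\<close>.\<close>

type_synonym ('m, 'n) tensor = "('m \<times> 'n) list set"

inductive tens_eq ::
  "('a, 'w) ring_scheme \<Rightarrow> ('a, 'm, 'x) module_scheme \<Rightarrow> ('a, 'n, 'y) module_scheme
   \<Rightarrow> ('m \<times> 'n) list \<Rightarrow> ('m \<times> 'n) list \<Rightarrow> bool"
  for A M N where
  refl: "set xs \<subseteq> carrier M \<times> carrier N \<Longrightarrow> tens_eq A M N xs xs"
| sym: "tens_eq A M N xs ys \<Longrightarrow> tens_eq A M N ys xs"
| trans: "tens_eq A M N xs ys \<Longrightarrow> tens_eq A M N ys zs \<Longrightarrow> tens_eq A M N xs zs"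
| append: "tens_eq A M N xs xs' \<Longrightarrow> tens_eq A M N ys ys' \<Longrightarrow> tens_eq A M N (xs @ ys) (xs' @ ys')"
| commute: "set xs \<subseteq> carrier M \<times> carrier N \<Longrightarrow> set ys \<subseteq> carrier M \<times> carrier N
    \<Longrightarrow> tens_eq A M N (xs @ ys) (ys @ xs)"
| add_left: "m \<in> carrier M \<Longrightarrow> m' \<in> carrier M \<Longrightarrow> n \<in> carrier N
    \<Longrightarrow> tens_eq A M N [(m \<oplus>\<^bsub>M\<^esub> m', n)] [(m, n), (m', n)]"
| add_right: "m \<in> carrier M \<Longrightarrow> n \<in> carrier N \<Longrightarrow> n' \<in> carrier N
    \<Longrightarrow> tens_eq A M N [(m, n \<oplus>\<^bsub>N\<^esub> n')] [(m, n), (m, n')]"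
| zero_left: "n \<in> carrier N \<Longrightarrow> tens_eq A M N [(\<zero>\<^bsub>M\<^esub>, n)] []"
| balance: "a \<in> carrier A \<Longrightarrow> m \<in> carrier M \<Longrightarrow> n \<in> carrier N
    \<Longrightarrow> tens_eq A M N [(a \<odot>\<^bsub>M\<^esub> m, n)] [(m, a \<odot>\<^bsub>N\<^esub> n)]"

definition tens_class ::
  "('a, 'w) ring_scheme \<Rightarrow> ('a, 'm, 'x) module_scheme \<Rightarrow> ('a, 'n, 'y) module_scheme
   \<Rightarrow> ('m \<times> 'n) list \<Rightarrow> ('m, 'n) tensor" where
  "tens_class A M N xs = {ys. tens_eq A M N xs ys}"

definition pure ::
  "('a, 'w) ring_scheme \<Rightarrow> ('a, 'm, 'x) module_scheme \<Rightarrow> ('a, 'n, 'y) module_scheme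
   \<Rightarrow> 'm \<Rightarrow> 'n \<Rightarrow> ('m, 'n) tensor" where
  "pure A M N m n = tens_class A M N [(m, n)]"

definition rep :: "('m, 'n) tensor \<Rightarrow> ('m \<times> 'n) list" where
  "rep u = (SOME xs. xs \<in> u)"

text \<open>Multiplication and unit are those of the tensor product of two \<open>A\<close>-algebras; they are
  irrelevant where \<open>M\<close> or \<open>N\<close> is only a module.\<close>

definition tens ::
  "('a, 'w) ring_scheme \<Rightarrow> ('a, 'm, 'x) module_scheme \<Rightarrow> ('a, 'n, 'y) module_scheme
   \<Rightarrow> ('a, ('m, 'n) tensor) module" where
  "tens A M N =
    \<lparr>carrier = tens_class A M N ` {xs. set xs \<subseteq> carrier M \<times> carrier N},
     monoid.mult = (\<lambda>u v. tens_class A M N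
        [(m \<otimes>\<^bsub>M\<^esub> m', n \<otimes>\<^bsub>N\<^esub> n'). (m, n) \<leftarrow> rep u, (m', n') \<leftarrow> rep v]),
     monoid.one = pure A M N \<one>\<^bsub>M\<^esub> \<one>\<^bsub>N\<^esub>,
     ring.zero = tens_class A M N [],
     ring.add = (\<lambda>u v. tens_class A M N (rep u @ rep v)),
     smult = (\<lambda>a u. tens_class A M N [(a \<odot>\<^bsub>M\<^esub> m, n). (m, n) \<leftarrow> rep u])\<rparr>"

text \<open>The additive map out of a tensor product determined by \<open>m \<otimes> n \<mapsto> \<phi> m n\<close>. It is independent of
  the representative only if \<open>\<phi>\<close> is biadditive and balanced, as it is in every use below.\<close>

definition tens_lift ::
  "('c, 'z) ring_scheme \<Rightarrow> ('m \<Rightarrow> 'n \<Rightarrow> 'c) \<Rightarrow> ('m, 'n) tensor \<Rightarrow> 'c" where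
  "tens_lift Z \<phi> u = foldr (\<lambda>(m, n) s. \<phi> m n \<oplus>\<^bsub>Z\<^esub> s) (rep u) \<zero>\<^bsub>Z\<^esub>"

text \<open>\<open>tens_map A M N f g\<close> is \<open>f \<otimes> g\<close>, with values in the tensor product of \<open>M\<close> and \<open>N\<close>.\<close>

definition tens_map ::
  "('a, 'w) ring_scheme \<Rightarrow> ('a, 'm, 'x) module_scheme \<Rightarrow> ('a, 'n, 'y) module_scheme
   \<Rightarrow> ('m0 \<Rightarrow> 'm) \<Rightarrow> ('n0 \<Rightarrow> 'n) \<Rightarrow> ('m0, 'n0) tensor \<Rightarrow> ('m, 'n) tensor" where
  "tens_map A M N f g = tens_lift (tens A M N) (\<lambda>m n. pure A M N (f m) (g n))"

text \<open>The associativity isomorphism \<open>(M \<otimes> N) \<otimes> K \<rightarrow> M \<otimes> (N \<otimes> K)\<close>.\<close>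

definition tens_assoc ::
  "('a, 'w) ring_scheme \<Rightarrow> ('a, 'm, 'x) module_scheme \<Rightarrow> ('a, 'n, 'y) module_scheme
   \<Rightarrow> ('a, 'k, 'z) module_scheme \<Rightarrow> (('m, 'n) tensor, 'k) tensor \<Rightarrow> ('m, ('n, 'k) tensor) tensor" where
  "tens_assoc A M N K =
     (let Z = tens A M (tens A N K) in
      tens_lift Z (\<lambda>u k. tens_lift Z (\<lambda>m n. pure A M (tens A N K) m (pure A N K n k)) u))"


section \<open>Rational algebras and linear algebraic groups\<close>

definition rat_ring :: "rat ring" where
  "rat_ring = \<lparr>carrier = UNIV, monoid.mult = (*), monoid.one = 1, ring.zero = 0, ring.add = (+)\<rparr>"

definition comm_Q_algebra :: "('r, 'w) ring_scheme \<Rightarrow> bool" where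
  "comm_Q_algebra R \<longleftrightarrow> cring R \<and> (\<exists>\<phi>. \<phi> \<in> ring_hom rat_ring R)"

definition finite_type_algebra :: "('r, 'w) ring_scheme \<Rightarrow> ('r, 'h, 'x) module_scheme \<Rightarrow> bool" where
  "finite_type_algebra R H \<longleftrightarrow> algebra R H \<and>
     (\<exists>S. finite S \<and> S \<subseteq> carrier H \<and>
       (\<forall>K. subring K H \<and> S \<subseteq> K \<and> (\<forall>r \<in> carrier R. \<forall>k \<in> K. r \<odot>\<^bsub>H\<^esub> k \<in> K) \<longrightarrow> K = carrier H))"

text \<open>A linear algebraic group over \<open>R\<close> is an affine group scheme of finite type over \<open>R\<close>, given by
  its coordinate ring, a commutative Hopf algebra.\<close>

record ('r, 'h) hopf = "('r, 'h) module" +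
  comult :: "'h \<Rightarrow> ('h, 'h) tensor"
  counit :: "'h \<Rightarrow> 'r"
  antipode :: "'h \<Rightarrow> 'h"

locale linear_algebraic_group = algebra R G
  for R :: "('r, 'w) ring_scheme" and G :: "('r, 'h) hopf" +
  assumes finite_type: "finite_type_algebra R G"
    and comult_hom: "comult G \<in> alg_hom R G (tens R G G)"
    and counit_hom: "counit G \<in> alg_hom R G (self R)"
    and antipode_hom: "antipode G \<in> alg_hom R G G"
    and coassoc: "h \<in> carrier G \<Longrightarrow>
      tens_assoc R G G G (tens_map R (tens R G G) G (comult G) id (comult G h))
      = tens_map R G (tens R G G) id (comult G) (comult G h)"
    and counit_left: "h \<in> carrier G \<Longrightarrow>
      tens_lift G (\<lambda>x y. counit G x \<odot>\<^bsub>G\<^esub> y) (comult G h) = h"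
    and counit_right: "h \<in> carrier G \<Longrightarrow>
      tens_lift G (\<lambda>x y. counit G y \<odot>\<^bsub>G\<^esub> x) (comult G h) = h"
    and antipode_left: "h \<in> carrier G \<Longrightarrow>
      tens_lift G (\<lambda>x y. antipode G x \<otimes>\<^bsub>G\<^esub> y) (comult G h) = counit G h \<odot>\<^bsub>G\<^esub> \<one>\<^bsub>G\<^esub>"
    and antipode_right: "h \<in> carrier G \<Longrightarrow>
      tens_lift G (\<lambda>x y. x \<otimes>\<^bsub>G\<^esub> antipode G y) (comult G h) = counit G h \<odot>\<^bsub>G\<^esub> \<one>\<^bsub>G\<^esub>"


section \<open>Spaces with G-action and base change\<close>

text \<open>An affine scheme \<open>P\<close> over \<open>Spec A\<close> with a right action of \<open>G\<close>, given by the \<open>A\<close>-algebra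
  \<open>O(P)\<close> and the co-action \<open>O(P) \<rightarrow> O(P) \<otimes>\<^sub>R O(G)\<close>; here \<open>A\<close> is an \<open>R\<close>-algebra.\<close>

record ('a, 'p, 'h) gspace = "('a, 'p) module" +
  coact :: "'p \<Rightarrow> ('p, 'h) tensor"

locale gspace_over =
  fixes R :: "('r, 'w) ring_scheme" and G :: "('r, 'h) hopf" and A :: "('r, 'a) module"
    and P :: "('a, 'p, 'h) gspace"
  assumes alg: "algebra A P"
    and coact_ring_hom: "coact P \<in> ring_hom P (tens R (restr (unit_map A) P) G)"
    and coact_base: "a \<in> carrier A \<Longrightarrow>
      coact P (unit_map P a) = pure R (restr (unit_map A) P) G (unit_map P a) \<one>\<^bsub>G\<^esub>"
    and coact_assoc: "p \<in> carrier P \<Longrightarrow>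
      tens_assoc R (restr (unit_map A) P) G G
        (tens_map R (tens R (restr (unit_map A) P) G) G (coact P) id (coact P p))
      = tens_map R (restr (unit_map A) P) (tens R G G) id (comult G) (coact P p)"
    and coact_counit: "p \<in> carrier P \<Longrightarrow>
      tens_lift P (\<lambda>q h. counit G h \<odot>\<^bsub>restr (unit_map A) P\<^esub> q) (coact P p) = p"

text \<open>Isomorphisms \<open>P \<rightarrow> P'\<close> over \<open>Spec A\<close> compatible with the action of \<open>G\<close>, represented
  contravariantly by the maps \<open>O(P') \<rightarrow> O(P)\<close> of functions (extensional outside the carrier).\<close>

definition gspace_iso ::
  "('r, 'w) ring_scheme \<Rightarrow> ('r, 'h) hopf \<Rightarrow> ('r, 'a) module
   \<Rightarrow> ('a, 'p, 'h) gspace \<Rightarrow> ('a, 'q, 'h) gspace \<Rightarrow> ('q \<Rightarrow> 'p) set" where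
  "gspace_iso R G A P P' =
    {\<phi> \<in> extensional (carrier P'). \<phi> \<in> alg_hom A P' P \<and> bij_betw \<phi> (carrier P') (carrier P) \<and>
       (\<forall>u \<in> carrier P'. coact P (\<phi> u) = tens_map R (restr (unit_map A) P) G \<phi> id (coact P' u))}"

text \<open>The co-action on \<open>O(P) \<otimes>\<^sub>A N\<close> obtained from that of \<open>O(P)\<close>: if \<open>p\<close> goes to \<open>\<Sum> q \<otimes> h\<close> then
  \<open>p \<otimes> n\<close> goes to \<open>\<Sum> (q \<otimes> n) \<otimes> h\<close>. The argument \<open>M\<close> is \<open>O(P) \<otimes>\<^sub>A N\<close> as an \<open>R\<close>-module.\<close>

definition ext_coact ::
  "('r, 'w) ring_scheme \<Rightarrow> ('r, 'h) hopf \<Rightarrow> ('r, 'a) module \<Rightarrow> ('a, 'p, 'h) gspace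
   \<Rightarrow> ('a, 'n) module \<Rightarrow> ('r, ('p, 'n) tensor) module
   \<Rightarrow> ('p, 'n) tensor \<Rightarrow> (('p, 'n) tensor, 'h) tensor" where
  "ext_coact R G A P N M =
     tens_lift (tens R M G) (\<lambda>p n.
       tens_lift (tens R M G) (\<lambda>q h. pure R M G (pure A P N q n) h) (coact P p))"

text \<open>Base change of \<open>P\<close> along a homomorphism \<open>f : A \<rightarrow> A'\<close> of \<open>R\<close>-algebras.\<close>

definition base_change_alg ::
  "('r, 'a) module \<Rightarrow> ('r, 'c) module \<Rightarrow> ('a \<Rightarrow> 'c) \<Rightarrow> ('a, 'p, 'h) gspace
   \<Rightarrow> ('c, ('p, 'c) tensor) module" where
  "base_change_alg A A' f P =
     (let N = restr f (self A'); U = tens A P N in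
      restr (\<lambda>c. pure A P N \<one>\<^bsub>P\<^esub> c) (self U))"

definition base_change ::
  "('r, 'w) ring_scheme \<Rightarrow> ('r, 'h) hopf \<Rightarrow> ('r, 'a) module \<Rightarrow> ('r, 'c) module \<Rightarrow> ('a \<Rightarrow> 'c)
   \<Rightarrow> ('a, 'p, 'h) gspace \<Rightarrow> ('c, ('p, 'c) tensor, 'h) gspace" where
  "base_change R G A A' f P =
     (let U = base_change_alg A A' f P in
      \<lparr>carrier = carrier U, monoid.mult = monoid.mult U, monoid.one = monoid.one U,
       ring.zero = ring.zero U, ring.add = ring.add U, smult = smult U,
       coact = ext_coact R G A P (restr f (self A')) (restr (unit_map A') U)\<rparr>)"

text \<open>Base change of an isomorphism \<open>P \<rightarrow> P'\<close> given by \<open>\<phi> : O(P') \<rightarrow> O(P)\<close>; only \<open>P\<close> is needed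
  to form the target of \<open>\<phi> \<otimes> id\<close>.\<close>

definition base_change_iso ::
  "('r, 'a) module \<Rightarrow> ('r, 'c) module \<Rightarrow> ('a \<Rightarrow> 'c) \<Rightarrow> ('a, 'p, 'h) gspace
   \<Rightarrow> ('q \<Rightarrow> 'p) \<Rightarrow> ('q, 'c) tensor \<Rightarrow> ('p, 'c) tensor" where
  "base_change_iso A A' f P \<phi> = tens_map A P (restr f (self A')) \<phi> id"

text \<open>The canonical isomorphism \<open>(O(P) \<otimes>\<^bsub>A\<^esub> A') \<otimes>\<^bsub>A'\<^esub> A'' \<rightarrow> O(P) \<otimes>\<^bsub>A\<^esub> A''\<close>,
  \<open>(p \<otimes> a') \<otimes> a'' \<mapsto> p \<otimes> k(a') a''\<close>, for \<open>f : A \<rightarrow> A'\<close> and \<open>k : A' \<rightarrow> A''\<close>.\<close>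

definition base_change_comp ::
  "('r, 'a) module \<Rightarrow> ('r, 'd) module \<Rightarrow> ('a \<Rightarrow> 'c) \<Rightarrow> ('c \<Rightarrow> 'd) \<Rightarrow> ('a, 'p, 'h) gspace
   \<Rightarrow> (('p, 'c) tensor, 'd) tensor \<Rightarrow> ('p, 'd) tensor" where
  "base_change_comp A A'' f k P =
     (let N = restr (k \<circ> f) (self A''); U = tens A P N in
      tens_lift U (\<lambda>u d. tens_lift U (\<lambda>p c. pure A P N p (k c \<otimes>\<^bsub>A''\<^esub> d)) u))"


section \<open>Etale coverings and torsors\<close>

definition mpoly_ring :: "('a, 'w) ring_scheme \<Rightarrow> nat \<Rightarrow> (nat multiset \<Rightarrow> 'a) ring" where
  "mpoly_ring A n =
    \<lparr>carrier = ring.indexed_pset A {..<n} (carrier A),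
     monoid.mult = (\<lambda>P Q m. \<Oplus>\<^bsub>A\<^esub>k \<in> {k. k \<subseteq># m}. P k \<otimes>\<^bsub>A\<^esub> Q (m - k)),
     monoid.one = ring.indexed_const A \<one>\<^bsub>A\<^esub>,
     ring.zero = ring.indexed_const A \<zero>\<^bsub>A\<^esub>,
     ring.add = ring.indexed_padd A\<rparr>"

definition mpoly_pderiv ::
  "('a, 'w) ring_scheme \<Rightarrow> nat \<Rightarrow> (nat multiset \<Rightarrow> 'a) \<Rightarrow> nat multiset \<Rightarrow> 'a" where
  "mpoly_pderiv A j P = (\<lambda>m. add_pow A (Suc (count m j)) (P (add_mset j m)))"

text \<open>The \<open>A\<close>-algebra \<open>A[X\<^sub>0, \<dots>, X\<^bsub>n-1\<^esub>] / (F\<^sub>0, \<dots>, F\<^bsub>n-1\<^esub>)\<close>.\<close>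

definition presented_ideal ::
  "('a, 'w) ring_scheme \<Rightarrow> nat \<Rightarrow> (nat \<Rightarrow> nat multiset \<Rightarrow> 'a) \<Rightarrow> (nat multiset \<Rightarrow> 'a) set" where
  "presented_ideal A n F = genideal (mpoly_ring A n) (F ` {..<n})"

definition presented_algebra ::
  "('a, 'w) ring_scheme \<Rightarrow> nat \<Rightarrow> (nat \<Rightarrow> nat multiset \<Rightarrow> 'a)
   \<Rightarrow> ('a, (nat multiset \<Rightarrow> 'a) set) module" where
  "presented_algebra A n F =
     restr (\<lambda>a. presented_ideal A n F +>\<^bsub>mpoly_ring A n\<^esub> ring.indexed_const A a)
       (self (mpoly_ring A n Quot presented_ideal A n F))"

text \<open>An etale \<open>A\<close>-algebra is one with a presentation by as many equations as variables whose
  Jacobian matrix is invertible over the algebra. It is a covering if every prime of \<open>A\<close> is the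
  contraction of a prime.\<close>

definition etale_presentation ::
  "('a, 'w) ring_scheme \<Rightarrow> nat \<Rightarrow> (nat \<Rightarrow> nat multiset \<Rightarrow> 'a) \<Rightarrow> bool" where
  "etale_presentation A n F \<longleftrightarrow>
     (let C = presented_algebra A n F;
          jac = (\<lambda>i j. presented_ideal A n F +>\<^bsub>mpoly_ring A n\<^esub> mpoly_pderiv A j (F i)) in
      (\<forall>i<n. F i \<in> carrier (mpoly_ring A n)) \<and>
      (\<exists>K. (\<forall>i<n. \<forall>j<n. K i j \<in> carrier C) \<and>
        (\<forall>i<n. \<forall>j<n. (\<Oplus>\<^bsub>C\<^esub>l \<in> {..<n}. jac i l \<otimes>\<^bsub>C\<^esub> K l j) = (if i = j then \<one>\<^bsub>C\<^esub> else \<zero>\<^bsub>C\<^esub>))))"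

definition surjective_on_spec :: "('a, 'w) ring_scheme \<Rightarrow> ('a, 'c, 'x) module_scheme \<Rightarrow> bool" where
  "surjective_on_spec A C \<longleftrightarrow>
     (\<forall>p. primeideal p A \<longrightarrow> (\<exists>q. primeideal q C \<and> p = {a \<in> carrier A. unit_map C a \<in> q}))"

text \<open>\<open>G\<close> acting on itself by right translation.\<close>

definition group_gspace :: "('r, 'h) hopf \<Rightarrow> ('r, 'h, 'h) gspace" where
  "group_gspace G = \<lparr>carrier = carrier G, monoid.mult = monoid.mult G, monoid.one = monoid.one G,
     ring.zero = ring.zero G, ring.add = ring.add G, smult = smult G, coact = comult G\<rparr>"

text \<open>A \<open>G\<close>-torsor over \<open>A\<close>: a space with \<open>G\<close>-action which over some etale covering \<open>A \<rightarrow> C\<close> becomes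
  isomorphic to the trivial torsor. Torsors under an affine group are affine, so nothing is lost by
  describing them through their rings of functions. Every etale \<open>A\<close>-algebra has a presentation as
  above, so the covering may be taken of this form.\<close>

definition torsor ::
  "('r, 'w) ring_scheme \<Rightarrow> ('r, 'h) hopf \<Rightarrow> ('r, 'a) module \<Rightarrow> ('a, 'p, 'h) gspace \<Rightarrow> bool" where
  "torsor R G A P \<longleftrightarrow> gspace_over R G A P \<and>
     (\<exists>n F. etale_presentation A n F \<and> surjective_on_spec A (presented_algebra A n F) \<and>
       (let f = unit_map (presented_algebra A n F);
            C = restr (unit_map A) (presented_algebra A n F) in
        gspace_iso R G C (base_change R G A C f P)
          (base_change R G (self R) C (unit_map C) (group_gspace G)) \<noteq> {}))"


section \<open>Differential graded algebras and denormalisation\<close>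

definition signed :: "('a, 'w) ring_scheme \<Rightarrow> nat \<Rightarrow> 'a \<Rightarrow> 'a" where
  "signed B k x = (if even k then x else \<ominus>\<^bsub>B\<^esub> x)"

record ('r, 'b) dga = "('r, 'b) module" +
  gr :: "nat \<Rightarrow> 'b set"
  diff :: "'b \<Rightarrow> 'b"

text \<open>Objects of \<open>DG\<^sup>+CAlg(R)\<close>: the underlying ring is the direct sum of its components \<open>gr B n\<close>.\<close>

locale dg_calg = module R B + ring B
  for R :: "('r, 'w) ring_scheme" and B :: "('r, 'b) dga" +
  assumes smult_mult_left: "\<lbrakk>r \<in> carrier R; x \<in> carrier B; y \<in> carrier B\<rbrakk>
      \<Longrightarrow> (r \<odot>\<^bsub>B\<^esub> x) \<otimes>\<^bsub>B\<^esub> y = r \<odot>\<^bsub>B\<^esub> (x \<otimes>\<^bsub>B\<^esub> y)"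
    and smult_mult_right: "\<lbrakk>r \<in> carrier R; x \<in> carrier B; y \<in> carrier B\<rbrakk>
      \<Longrightarrow> x \<otimes>\<^bsub>B\<^esub> (r \<odot>\<^bsub>B\<^esub> y) = r \<odot>\<^bsub>B\<^esub> (x \<otimes>\<^bsub>B\<^esub> y)"
    and gr_submodule: "submodule (gr B n) R B"
    and gr_direct_sum: "x \<in> carrier B \<Longrightarrow>
      \<exists>!c. (\<forall>n. c n \<in> gr B n) \<and> finite {n. c n \<noteq> \<zero>\<^bsub>B\<^esub>} \<and> x = (\<Oplus>\<^bsub>B\<^esub>n \<in> {n. c n \<noteq> \<zero>\<^bsub>B\<^esub>}. c n)"
    and one_gr: "\<one>\<^bsub>B\<^esub> \<in> gr B 0"
    and mult_gr: "\<lbrakk>x \<in> gr B m; y \<in> gr B n\<rbrakk> \<Longrightarrow> x \<otimes>\<^bsub>B\<^esub> y \<in> gr B (m + n)"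
    and graded_comm: "\<lbrakk>x \<in> gr B m; y \<in> gr B n\<rbrakk> \<Longrightarrow> x \<otimes>\<^bsub>B\<^esub> y = signed B (m * n) (y \<otimes>\<^bsub>B\<^esub> x)"
    and diff_gr: "x \<in> gr B n \<Longrightarrow> diff B x \<in> gr B (Suc n)"
    and diff_add: "\<lbrakk>x \<in> carrier B; y \<in> carrier B\<rbrakk> \<Longrightarrow> diff B (x \<oplus>\<^bsub>B\<^esub> y) = diff B x \<oplus>\<^bsub>B\<^esub> diff B y"
    and diff_smult: "\<lbrakk>r \<in> carrier R; x \<in> carrier B\<rbrakk> \<Longrightarrow> diff B (r \<odot>\<^bsub>B\<^esub> x) = r \<odot>\<^bsub>B\<^esub> diff B x"
    and diff_diff: "x \<in> carrier B \<Longrightarrow> diff B (diff B x) = \<zero>\<^bsub>B\<^esub>"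
    and diff_mult: "\<lbrakk>x \<in> gr B m; y \<in> gr B n\<rbrakk> \<Longrightarrow>
      diff B (x \<otimes>\<^bsub>B\<^esub> y) = diff B x \<otimes>\<^bsub>B\<^esub> y \<oplus>\<^bsub>B\<^esub> signed B m (x \<otimes>\<^bsub>B\<^esub> diff B y)"

text \<open>The \<open>R\<close>-algebra \<open>B\<^sup>0\<close> and the \<open>B\<^sup>0\<close>-modules \<open>B\<^sup>n\<close>.\<close>

definition dg_zero :: "('r, 'b) dga \<Rightarrow> ('r, 'b) module" where
  "dg_zero B = \<lparr>carrier = gr B 0, monoid.mult = monoid.mult B, monoid.one = monoid.one B,
     ring.zero = ring.zero B, ring.add = ring.add B, smult = smult B\<rparr>"

definition dg_mod :: "('r, 'b) dga \<Rightarrow> nat \<Rightarrow> ('b, 'b) module" where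
  "dg_mod B n = \<lparr>carrier = gr B n, monoid.mult = monoid.mult B, monoid.one = monoid.one B,
     ring.zero = ring.zero B, ring.add = ring.add B, smult = monoid.mult B\<rparr>"

text \<open>The shuffle \<open>(S, T)\<close> is even iff its number of inversions is.\<close>

definition shuffle_inversions :: "nat set \<Rightarrow> nat set \<Rightarrow> nat" where
  "shuffle_inversions S T = card {(s, t). s \<in> S \<and> t \<in> T \<and> t < s}"

text \<open>An element \<open>x\<close> of \<open>D\<^sup>nB\<close> is the family of its coefficients: it stands for the sum of the
  \<open>\<partial>\<^sup>I (x I)\<close> over \<open>I \<subseteq> {1..n}\<close>, where \<open>x I\<close> has degree \<open>n - |I|\<close>.
  \<open>den_elt B n I a\<close> is \<open>\<partial>\<^sup>I a\<close>.\<close>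

definition den_elt :: "('r, 'b) dga \<Rightarrow> nat \<Rightarrow> nat set \<Rightarrow> 'b \<Rightarrow> nat set \<Rightarrow> 'b" where
  "den_elt B n I a = (\<lambda>K \<in> Pow {1..n}. if K = I then a else \<zero>\<^bsub>B\<^esub>)"

definition den_mult ::
  "('r, 'b) dga \<Rightarrow> nat \<Rightarrow> (nat set \<Rightarrow> 'b) \<Rightarrow> (nat set \<Rightarrow> 'b) \<Rightarrow> nat set \<Rightarrow> 'b" where
  "den_mult B n x y = (\<lambda>K \<in> Pow {1..n}.
     finsum B (\<lambda>(I, J). signed B (shuffle_inversions (J - I) (I - J)) (x I \<otimes>\<^bsub>B\<^esub> y J))
       {(I, J). I \<subseteq> {1..n} \<and> J \<subseteq> {1..n} \<and> I \<inter> J = K \<and>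
                n - card I = card (J - I) \<and> n - card J = card (I - J)})"

definition den :: "('r, 'b) dga \<Rightarrow> nat \<Rightarrow> ('r, nat set \<Rightarrow> 'b) module" where
  "den B n =
    \<lparr>carrier = (\<Pi>\<^sub>E I \<in> Pow {1..n}. gr B (n - card I)),
     monoid.mult = den_mult B n,
     monoid.one = den_elt B n {1..n} \<one>\<^bsub>B\<^esub>,
     ring.zero = (\<lambda>I \<in> Pow {1..n}. \<zero>\<^bsub>B\<^esub>),
     ring.add = (\<lambda>x y. \<lambda>I \<in> Pow {1..n}. x I \<oplus>\<^bsub>B\<^esub> y I),
     smult = (\<lambda>r x. \<lambda>I \<in> Pow {1..n}. r \<odot>\<^bsub>B\<^esub> x I)\<rparr>"

text \<open>For \<open>i \<ge> 1\<close>, iterating \<open>\<partial>\<^sup>i\<partial>\<^sup>j = \<partial>\<^sup>j\<^sup>+\<^sup>1\<partial>\<^sup>i\<close> for \<open>i \<le> j\<close> gives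
  \<open>\<partial>\<^sup>i\<partial>\<^sup>I = \<partial>\<^sup>I\<^sup>'\<close> with \<open>I' = insert_index i I\<close>.\<close>

definition insert_index :: "nat \<Rightarrow> nat set \<Rightarrow> nat set" where
  "insert_index i I = {j \<in> I. j < i} \<union> {i} \<union> Suc ` {j \<in> I. i \<le> j}"

definition den_coface_pos ::
  "('r, 'b) dga \<Rightarrow> nat \<Rightarrow> nat \<Rightarrow> (nat set \<Rightarrow> 'b) \<Rightarrow> nat set \<Rightarrow> 'b" where
  "den_coface_pos B n i x =
     (\<Oplus>\<^bsub>den B (Suc n)\<^esub>I \<in> Pow {1..n}. den_elt B (Suc n) (insert_index i I) (x I))"

text \<open>For \<open>a\<close> of degree \<open>m\<close>: \<open>\<partial>\<^sup>0 a = \<partial>a - \<Sum>\<^sub>i (-1)\<^sup>i \<partial>\<^sup>i a\<close> over \<open>1 \<le> i \<le> m + 1\<close>. With this sign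
  \<open>\<Sum>\<^sub>i (-1)\<^sup>i \<partial>\<^sup>i a = \<partial>a\<close> over \<open>0 \<le> i \<le> m + 1\<close>, and \<open>\<sigma>\<^sup>0\<partial>\<^sup>0 = id\<close>.\<close>

definition den_coface0_homog :: "('r, 'b) dga \<Rightarrow> nat \<Rightarrow> 'b \<Rightarrow> nat set \<Rightarrow> 'b" where
  "den_coface0_homog B m a =
     den_elt B (Suc m) {} (diff B a) \<oplus>\<^bsub>den B (Suc m)\<^esub>
     (\<Oplus>\<^bsub>den B (Suc m)\<^esub>i \<in> {1..Suc m}. den_elt B (Suc m) {i} (signed B (Suc i) a))"

fun den_coface_seq ::
  "('r, 'b) dga \<Rightarrow> nat \<Rightarrow> nat list \<Rightarrow> (nat set \<Rightarrow> 'b) \<Rightarrow> nat set \<Rightarrow> 'b" where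
  "den_coface_seq B n [] x = x"
| "den_coface_seq B n (j # js) x = den_coface_seq B (Suc n) js (den_coface_pos B n j x)"

text \<open>\<open>\<partial>\<^sup>0\<partial>\<^sup>j\<^sup>s\<dots>\<partial>\<^sup>j\<^sup>1 a = \<partial>\<^sup>j\<^sup>s\<^sup>+\<^sup>1\<dots>\<partial>\<^sup>j\<^sup>1\<^sup>+\<^sup>1\<partial>\<^sup>0 a\<close>.\<close>

definition den_coface0 :: "('r, 'b) dga \<Rightarrow> nat \<Rightarrow> (nat set \<Rightarrow> 'b) \<Rightarrow> nat set \<Rightarrow> 'b" where
  "den_coface0 B n x =
     (\<Oplus>\<^bsub>den B (Suc n)\<^esub>I \<in> Pow {1..n}.
        den_coface_seq B (Suc (n - card I)) (map Suc (sorted_list_of_set I))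
          (den_coface0_homog B (n - card I) (x I)))"

text \<open>\<open>\<partial>\<^sup>i : D\<^sup>nB \<rightarrow> D\<^sup>n\<^sup>+\<^sup>1B\<close> for \<open>0 \<le> i \<le> n + 1\<close>.\<close>

definition den_coface :: "('r, 'b) dga \<Rightarrow> nat \<Rightarrow> nat \<Rightarrow> (nat set \<Rightarrow> 'b) \<Rightarrow> nat set \<Rightarrow> 'b" where
  "den_coface B n i = (if i = 0 then den_coface0 B n else den_coface_pos B n i)"

text \<open>The two maps \<open>B\<^sup>0 \<rightarrow> D\<^sup>1B\<close>, using \<open>D\<^sup>0B = B\<^sup>0\<close>.\<close>

definition den_coface_zero :: "('r, 'b) dga \<Rightarrow> nat \<Rightarrow> 'b \<Rightarrow> nat set \<Rightarrow> 'b" where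
  "den_coface_zero B i = den_coface B 0 i \<circ> den_elt B 0 {}"


section \<open>The groupoid D*BG(B)\<close>

text \<open>\<open>\<partial>\<^sup>i P\<close> for a torsor \<open>P\<close> over \<open>B\<^sup>0\<close>, and \<open>\<partial>\<^sup>k\<partial>\<^sup>i P\<close> over \<open>D\<^sup>2B\<close>.\<close>

definition pull1 ::
  "('r, 'w) ring_scheme \<Rightarrow> ('r, 'h) hopf \<Rightarrow> ('r, 'b) dga \<Rightarrow> nat \<Rightarrow> ('b, 'p, 'h) gspace
   \<Rightarrow> (nat set \<Rightarrow> 'b, ('p, nat set \<Rightarrow> 'b) tensor, 'h) gspace" where
  "pull1 R G B i P = base_change R G (dg_zero B) (den B 1) (den_coface_zero B i) P"

definition pull2 ::
  "('r, 'w) ring_scheme \<Rightarrow> ('r, 'h) hopf \<Rightarrow> ('r, 'b) dga \<Rightarrow> nat \<Rightarrow> nat \<Rightarrow> ('b, 'p, 'h) gspace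
   \<Rightarrow> (nat set \<Rightarrow> 'b, ('p, nat set \<Rightarrow> 'b) tensor, 'h) gspace" where
  "pull2 R G B k i P =
     base_change R G (dg_zero B) (den B 2) (den_coface B 1 k \<circ> den_coface_zero B i) P"

text \<open>For \<open>g : \<partial>\<^sup>0P \<rightarrow> \<partial>\<^sup>1P\<close>, given by \<open>O(\<partial>\<^sup>1P) \<rightarrow> O(\<partial>\<^sup>0P)\<close>, the map \<open>O(\<partial>\<^sup>k\<partial>\<^sup>1P) \<rightarrow> O(\<partial>\<^sup>k\<partial>\<^sup>0P)\<close>
  giving \<open>\<partial>\<^sup>k g\<close>, where the iterated base changes are identified with base changes along composites.\<close>

definition pull_iso ::
  "('r, 'w) ring_scheme \<Rightarrow> ('r, 'h) hopf \<Rightarrow> ('r, 'b) dga \<Rightarrow> nat \<Rightarrow> ('b, 'p, 'h) gspace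
   \<Rightarrow> (('p, nat set \<Rightarrow> 'b) tensor \<Rightarrow> ('p, nat set \<Rightarrow> 'b) tensor)
   \<Rightarrow> ('p, nat set \<Rightarrow> 'b) tensor \<Rightarrow> ('p, nat set \<Rightarrow> 'b) tensor" where
  "pull_iso R G B k P g u =
     (let can = (\<lambda>i. base_change_comp (dg_zero B) (den B 2) (den_coface_zero B i) (den_coface B 1 k) P);
          dom = base_change R G (den B 1) (den B 2) (den_coface B 1 k) (pull1 R G B 1 P) in
      can 0 (base_change_iso (den B 1) (den B 2) (den_coface B 1 k) (pull1 R G B 0 P) g
               (inv_into (carrier dom) (can 1) u)))"

text \<open>The cocycle condition \<open>\<partial>\<^sup>1g = \<partial>\<^sup>2g \<circ> \<partial>\<^sup>0g\<close> of maps \<open>\<partial>\<^sup>1\<partial>\<^sup>0P \<rightarrow> \<partial>\<^sup>1\<partial>\<^sup>1P\<close> becomes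
  \<open>(\<partial>\<^sup>1g)\<^sup># = (\<partial>\<^sup>0g)\<^sup># \<circ> (\<partial>\<^sup>2g)\<^sup>#\<close> on functions; it uses \<open>\<partial>\<^sup>1\<partial>\<^sup>1 = \<partial>\<^sup>2\<partial>\<^sup>1\<close>, \<open>\<partial>\<^sup>2\<partial>\<^sup>0 = \<partial>\<^sup>0\<partial>\<^sup>1\<close>
  and \<open>\<partial>\<^sup>0\<partial>\<^sup>0 = \<partial>\<^sup>1\<partial>\<^sup>0\<close>. Likewise for the composites in \<open>arr\<close> and \<open>cmp\<close>.\<close>

definition cocycle ::
  "('r, 'w) ring_scheme \<Rightarrow> ('r, 'h) hopf \<Rightarrow> ('r, 'b) dga \<Rightarrow> ('b, 'p, 'h) gspace
   \<Rightarrow> (('p, nat set \<Rightarrow> 'b) tensor \<Rightarrow> ('p, nat set \<Rightarrow> 'b) tensor) \<Rightarrow> bool" where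
  "cocycle R G B P g \<longleftrightarrow> (\<forall>u \<in> carrier (pull2 R G B 1 1 P).
     pull_iso R G B 1 P g u = pull_iso R G B 0 P g (pull_iso R G B 2 P g u))"

type_synonym ('b, 'p, 'h) descent_obj =
  "('b, 'p, 'h) gspace \<times> (('p, nat set \<Rightarrow> 'b) tensor \<Rightarrow> ('p, nat set \<Rightarrow> 'b) tensor)"

definition Dstar_BG ::
  "('r, 'w) ring_scheme \<Rightarrow> ('r, 'h) hopf \<Rightarrow> ('r, 'b) dga
   \<Rightarrow> (('b, 'p, 'h) descent_obj, 'p \<Rightarrow> 'p) cat" where
  "Dstar_BG R G B =
    \<lparr>ob = {(P, g). torsor R G (dg_zero B) P \<and>
             g \<in> gspace_iso R G (den B 1) (pull1 R G B 0 P) (pull1 R G B 1 P) \<and>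
             cocycle R G B P g},
     arr = (\<lambda>(P, g) (P', g'). {h \<in> gspace_iso R G (dg_zero B) P P'.
             \<forall>u \<in> carrier (pull1 R G B 1 P').
               base_change_iso (dg_zero B) (den B 1) (den_coface_zero B 0) P h (g' u)
               = g (base_change_iso (dg_zero B) (den B 1) (den_coface_zero B 1) P h u)}),
     idn = (\<lambda>(P, g). \<lambda>p \<in> carrier P. p),
     cmp = (\<lambda>_ _ (P'', g'') h' h. compose (carrier P'') h h')\<rparr>"


section \<open>The groupoid of torsors with flat equivariant connection\<close>

text \<open>The product \<open>(O(P) \<otimes> B\<^sup>m) \<times> (O(P) \<otimes> B\<^sup>n) \<rightarrow> O(P) \<otimes> B\<^sup>m\<^sup>+\<^sup>n\<close>, with tensor products over \<open>B\<^sup>0\<close>.\<close>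

definition form_mult ::
  "('r, 'b) dga \<Rightarrow> ('b, 'p, 'h) gspace \<Rightarrow> nat \<Rightarrow> nat
   \<Rightarrow> ('p, 'b) tensor \<Rightarrow> ('p, 'b) tensor \<Rightarrow> ('p, 'b) tensor" where
  "form_mult B P m n u v =
     (let N = dg_mod B (m + n); Z = tens (dg_zero B) P N in
      tens_lift Z (\<lambda>p b. tens_lift Z (\<lambda>q c. pure (dg_zero B) P N (p \<otimes>\<^bsub>P\<^esub> q) (b \<otimes>\<^bsub>B\<^esub> c)) v) u)"

text \<open>The action of \<open>O(P)\<close> on \<open>O(P) \<otimes> B\<^sup>1\<close>.\<close>

definition form_smult ::
  "('r, 'b) dga \<Rightarrow> ('b, 'p, 'h) gspace \<Rightarrow> 'p \<Rightarrow> ('p, 'b) tensor \<Rightarrow> ('p, 'b) tensor" where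
  "form_smult B P p = tens_map (dg_zero B) P (dg_mod B 1) (\<lambda>q. p \<otimes>\<^bsub>P\<^esub> q) id"

text \<open>The family \<open>D\<close> is a degree 1 derivation of \<open>O(P) \<otimes> B\<^sup>#\<close> with square zero, compatible with the
  differential of \<open>B\<close>.\<close>

definition form_differential ::
  "('r, 'b) dga \<Rightarrow> ('b, 'p, 'h) gspace \<Rightarrow> (nat \<Rightarrow> ('p, 'b) tensor \<Rightarrow> ('p, 'b) tensor) \<Rightarrow> bool" where
  "form_differential B P D \<longleftrightarrow>
     (let \<Omega> = (\<lambda>n. tens (dg_zero B) P (dg_mod B n)) in
      (\<forall>n. D n \<in> carrier (\<Omega> n) \<rightarrow> carrier (\<Omega> (Suc n))) \<and>
      (\<forall>n. \<forall>u \<in> carrier (\<Omega> n). \<forall>v \<in> carrier (\<Omega> n).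
         D n (u \<oplus>\<^bsub>\<Omega> n\<^esub> v) = D n u \<oplus>\<^bsub>\<Omega> (Suc n)\<^esub> D n v) \<and>
      (\<forall>m n. \<forall>u \<in> carrier (\<Omega> m). \<forall>v \<in> carrier (\<Omega> n).
         D (m + n) (form_mult B P m n u v)
         = form_mult B P (Suc m) n (D m u) v \<oplus>\<^bsub>\<Omega> (Suc (m + n))\<^esub>
           signed (\<Omega> (Suc (m + n))) m (form_mult B P m (Suc n) u (D n v))) \<and>
      (\<forall>n. \<forall>b \<in> gr B n. D n (pure (dg_zero B) P (dg_mod B n) \<one>\<^bsub>P\<^esub> b)
         = pure (dg_zero B) P (dg_mod B (Suc n)) \<one>\<^bsub>P\<^esub> (diff B b)) \<and>
      (\<forall>n. \<forall>u \<in> carrier (\<Omega> n). D (Suc n) (D n u) = \<zero>\<^bsub>\<Omega> (Suc (Suc n))\<^esub>))"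

definition flat_connection ::
  "('r, 'b) dga \<Rightarrow> ('b, 'p, 'h) gspace \<Rightarrow> ('p \<Rightarrow> ('p, 'b) tensor) \<Rightarrow> bool" where
  "flat_connection B P nabla \<longleftrightarrow>
     (let \<Omega>1 = tens (dg_zero B) P (dg_mod B 1) in
      nabla \<in> extensional (carrier P) \<and> nabla \<in> carrier P \<rightarrow> carrier \<Omega>1 \<and>
      (\<forall>p \<in> carrier P. \<forall>q \<in> carrier P. nabla (p \<oplus>\<^bsub>P\<^esub> q) = nabla p \<oplus>\<^bsub>\<Omega>1\<^esub> nabla q) \<and>
      (\<forall>p \<in> carrier P. \<forall>q \<in> carrier P.
         nabla (p \<otimes>\<^bsub>P\<^esub> q) = form_smult B P q (nabla p) \<oplus>\<^bsub>\<Omega>1\<^esub> form_smult B P p (nabla q)) \<and>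
      (\<forall>b \<in> gr B 0. nabla (unit_map P b) = pure (dg_zero B) P (dg_mod B 1) \<one>\<^bsub>P\<^esub> (diff B b)) \<and>
      (\<exists>D. form_differential B P D \<and>
         (\<forall>p \<in> carrier P. D 0 (pure (dg_zero B) P (dg_mod B 0) p \<one>\<^bsub>B\<^esub>) = nabla p)))"

text \<open>\<open>\<mu> \<circ> \<nabla> = (\<nabla> \<otimes> id) \<circ> \<mu>\<close>, where on the left \<open>\<mu>\<close> is extended to \<open>O(P) \<otimes> B\<^sup>1\<close> and both sides lie in
  \<open>(O(P) \<otimes> B\<^sup>1) \<otimes>\<^sub>R O(G)\<close>.\<close>

definition equivariant_connection ::
  "('r, 'w) ring_scheme \<Rightarrow> ('r, 'h) hopf \<Rightarrow> ('r, 'b) dga \<Rightarrow> ('b, 'p, 'h) gspace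
   \<Rightarrow> ('p \<Rightarrow> ('p, 'b) tensor) \<Rightarrow> bool" where
  "equivariant_connection R G B P nabla \<longleftrightarrow>
     (let M = restr (unit_map (dg_zero B)) (tens (dg_zero B) P (dg_mod B 1)) in
      \<forall>p \<in> carrier P. ext_coact R G (dg_zero B) P (dg_mod B 1) M (nabla p)
        = tens_map R M G nabla id (coact P p))"

type_synonym ('b, 'p, 'h) connection_obj = "('b, 'p, 'h) gspace \<times> ('p \<Rightarrow> ('p, 'b) tensor)"

definition flat_connections ::
  "('r, 'w) ring_scheme \<Rightarrow> ('r, 'h) hopf \<Rightarrow> ('r, 'b) dga
   \<Rightarrow> (('b, 'p, 'h) connection_obj, 'p \<Rightarrow> 'p) cat" where
  "flat_connections R G B =
    \<lparr>ob = {(P, nabla). torsor R G (dg_zero B) P \<and> flat_connection B P nabla \<and>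
             equivariant_connection R G B P nabla},
     arr = (\<lambda>(P, nabla) (P', nabla'). {h \<in> gspace_iso R G (dg_zero B) P P'.
             \<forall>p \<in> carrier P'. tens_map (dg_zero B) P (dg_mod B 1) h id (nabla' p) = nabla (h p)}),
     idn = (\<lambda>(P, nabla). \<lambda>p \<in> carrier P. p),
     cmp = (\<lambda>_ _ (P'', nabla'') h' h. compose (carrier P'') h h')\<rparr>"

end

theory Submission
  imports Defs
begin

text \<open>
  The proof is a computation with dual numbers. Write \<open>A = B\<^sup>0\<close>. The algebra \<open>D\<^sup>1B\<close> is the square-zero
  extension \<open>A \<oplus> B\<^sup>1\<epsilon>\<close>, in which \<open>\<partial>\<^sup>1a = a\<close> and \<open>\<partial>\<^sup>0a = a + (\<partial>a)\<epsilon>\<close>. On functions a descent datum is a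
  \<open>D\<^sup>1B\<close>-algebra isomorphism \<open>g : O(\<partial>\<^sup>1P) \<rightarrow> O(\<partial>\<^sup>0P)\<close>, and \<open>g\<close> is determined by the elements
  \<open>g(p \<otimes> 1)\<close>. Modulo \<open>\<epsilon>\<close> it is a surjective endomorphism of \<open>O(P)\<close>, and the cocycle condition makes this
  endomorphism idempotent; so it is the identity (\<open>descent_degree_zero\<close>), and \<open>g(p \<otimes> 1) = p \<otimes> 1 - \<nabla>p\<close>
  with \<open>\<nabla>p \<in> O(P) \<otimes> B\<^sup>1\<close>.

  Under \<open>g \<leftrightarrow> \<nabla>\<close> the conditions on both sides correspond one by one. Multiplicativity of \<open>g\<close> is the
  Leibniz rule, because products of two infinitesimals vanish, and linearity over \<open>D\<^sup>1B\<close> says that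
  \<open>\<nabla>\<close> extends \<open>\<partial>\<close>, because \<open>\<partial>\<^sup>0a - (\<partial>a)\<epsilon> = \<partial>\<^sup>1a\<close> (\<open>derivation_of_descent\<close>, \<open>transport_alg_hom\<close>);
  conversely every derivation gives an isomorphism, with inverse \<open>p \<mapsto> p + \<nabla>p\<close> (\<open>transport_bij\<close>).
  The inclusion of \<open>O(P) \<otimes> B\<^sup>1\<close> in \<open>O(\<partial>\<^sup>0P)\<close> has an \<open>R\<close>-linear retraction, hence stays injective after
  tensoring with \<open>O(G)\<close>; so \<open>g\<close> is compatible with the co-actions iff \<open>\<nabla>\<close> is equivariant
  (\<open>transport_equivariant_iff\<close>). Finally the failure of the cocycle condition at \<open>p\<close> is the image of
  \<open>\<nabla>(\<nabla>p)\<close> under the inclusion of \<open>O(P) \<otimes> B\<^sup>2\<close> in the functions of the pullback of \<open>P\<close> to \<open>D\<^sup>2B\<close>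
  (\<open>curvature_identity\<close>), and this inclusion is split as well; so cocycles correspond to flat
  connections (\<open>cocycle_transport_iff\<close>). Here \<open>\<nabla>\<close> on one-forms is the extension \<open>cov_diff\<close>, which
  is the only possible one (\<open>differential_is_cov_diff\<close>).

  An isomorphism of torsors respects \<open>g\<close> and \<open>g'\<close> iff it respects \<open>\<nabla>\<close> and \<open>\<nabla>'\<close> (\<open>morphism_iff\<close>), so the
  two groupoids are isomorphic by a functor that does not change the torsor or the morphisms.

  All of this takes place in tensor products. The method throughout is the universal property: a map out
  of a tensor product is additive and known on pure tensors, and two such maps that agree on pure
  tensors are equal (\<open>tens_hom_eqI\<close>).\<close>

section \<open>Additive maps\<close>

definition addhom :: "('u, 'x) ring_scheme \<Rightarrow> ('v, 'y) ring_scheme \<Rightarrow> ('u \<Rightarrow> 'v) set" where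
  "addhom U V = {f \<in> carrier U \<rightarrow> carrier V.
     \<forall>x \<in> carrier U. \<forall>y \<in> carrier U. f (x \<oplus>\<^bsub>U\<^esub> y) = f x \<oplus>\<^bsub>V\<^esub> f y}"

lemma addhomI:
  assumes "\<And>x. x \<in> carrier U \<Longrightarrow> f x \<in> carrier V"
    and "\<And>x y. x \<in> carrier U \<Longrightarrow> y \<in> carrier U \<Longrightarrow> f (x \<oplus>\<^bsub>U\<^esub> y) = f x \<oplus>\<^bsub>V\<^esub> f y"
  shows "f \<in> addhom U V"
  using assms by (auto simp: addhom_def)

lemma addhom_closed: "f \<in> addhom U V \<Longrightarrow> x \<in> carrier U \<Longrightarrow> f x \<in> carrier V"
  by (auto simp: addhom_def)

lemma addhom_add: "f \<in> addhom U V \<Longrightarrow> x \<in> carrier U \<Longrightarrow> y \<in> carrier U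
    \<Longrightarrow> f (x \<oplus>\<^bsub>U\<^esub> y) = f x \<oplus>\<^bsub>V\<^esub> f y"
  by (auto simp: addhom_def)

lemma addhom_zero:
  assumes "f \<in> addhom U V" "abelian_group U" "abelian_group V"
  shows "f \<zero>\<^bsub>U\<^esub> = \<zero>\<^bsub>V\<^esub>"
proof -
  interpret U: abelian_group U by fact
  interpret V: abelian_group V by fact
  have "f \<zero>\<^bsub>U\<^esub> \<oplus>\<^bsub>V\<^esub> f \<zero>\<^bsub>U\<^esub> = f \<zero>\<^bsub>U\<^esub>"
    using addhom_add[OF assms(1), of "\<zero>\<^bsub>U\<^esub>" "\<zero>\<^bsub>U\<^esub>"] by simp
  then show ?thesis
    using addhom_closed[OF assms(1) U.zero_closed] by (metis V.add.r_cancel_one')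
qed

lemma addhom_minus:
  assumes "f \<in> addhom U V" "abelian_group U" "abelian_group V" "x \<in> carrier U"
  shows "f (\<ominus>\<^bsub>U\<^esub> x) = \<ominus>\<^bsub>V\<^esub> f x"
proof -
  interpret U: abelian_group U by fact
  interpret V: abelian_group V by fact
  have "f (\<ominus>\<^bsub>U\<^esub> x) \<oplus>\<^bsub>V\<^esub> f x = \<zero>\<^bsub>V\<^esub>"
    using addhom_add[OF assms(1), of "\<ominus>\<^bsub>U\<^esub> x" x] addhom_zero[OF assms(1-3)] assms(4)
    by (simp add: U.l_neg)
  then show ?thesis
    using V.minus_equality addhom_closed[OF assms(1)] assms(4) by (metis U.a_inv_closed)
qed

lemma addhom_diff:
  assumes "f \<in> addhom U V" "abelian_group U" "abelian_group V" "x \<in> carrier U" "y \<in> carrier U"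
  shows "f (x \<ominus>\<^bsub>U\<^esub> y) = f x \<ominus>\<^bsub>V\<^esub> f y"
proof -
  interpret U: abelian_group U by fact
  show ?thesis
    unfolding a_minus_def using assms by (simp add: addhom_add[OF assms(1)] addhom_minus)
qed

lemma addhom_comp: "f \<in> addhom U V \<Longrightarrow> g \<in> addhom V W \<Longrightarrow> (\<lambda>x. g (f x)) \<in> addhom U W"
  by (intro addhomI) (simp_all add: addhom_closed addhom_add)

lemma addhom_eq:
  assumes "g \<in> addhom U V" "abelian_group U" "\<And>x. x \<in> carrier U \<Longrightarrow> f x = g x"
  shows "f \<in> addhom U V"
  using assms by (intro addhomI) (simp_all add: addhom_closed addhom_add abelian_groupE(1))

lemma addhom_id: "(\<lambda>x. x) \<in> addhom U U"
  by (auto simp: addhom_def)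

lemma addhom_id': "id \<in> addhom U U"
  by (auto simp: addhom_def)

lemma addhom_plus:
  assumes "f \<in> addhom U V" "g \<in> addhom U V" "abelian_group V"
  shows "(\<lambda>x. f x \<oplus>\<^bsub>V\<^esub> g x) \<in> addhom U V"
proof -
  interpret V: abelian_group V by fact
  show ?thesis
    using assms(1,2) by (intro addhomI) (simp_all add: addhom_closed addhom_add V.a_ac)
qed

lemma addhom_uminus:
  assumes "f \<in> addhom U V" "abelian_group V"
  shows "(\<lambda>x. \<ominus>\<^bsub>V\<^esub> f x) \<in> addhom U V"
proof -
  interpret V: abelian_group V by fact
  show ?thesis
    using assms(1) by (intro addhomI) (simp_all add: addhom_closed addhom_add V.minus_add V.a_ac)
qed

lemma addhom_minus':
  assumes "f \<in> addhom U V" "g \<in> addhom U V" "abelian_group V"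
  shows "(\<lambda>x. f x \<ominus>\<^bsub>V\<^esub> g x) \<in> addhom U V"
  unfolding a_minus_def using assms by (intro addhom_plus addhom_uminus)

lemma addhom_const_zero:
  assumes "abelian_group V"
  shows "(\<lambda>x. \<zero>\<^bsub>V\<^esub>) \<in> addhom U V"
proof -
  interpret V: abelian_group V by fact
  show ?thesis by (intro addhomI) auto
qed

text \<open>The condition on \<open>\<phi>\<close> under which \<open>m \<otimes> n \<mapsto> \<phi> m n\<close> defines an additive map.\<close>

definition balanced :: "('a, 'w) ring_scheme \<Rightarrow> ('a, 'm, 'x) module_scheme
    \<Rightarrow> ('a, 'n, 'y) module_scheme \<Rightarrow> ('c, 'z) ring_scheme \<Rightarrow> ('m \<Rightarrow> 'n \<Rightarrow> 'c) \<Rightarrow> bool" where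
  "balanced A M N Z \<phi> \<longleftrightarrow>
     (\<forall>n \<in> carrier N. (\<lambda>m. \<phi> m n) \<in> addhom M Z) \<and>
     (\<forall>m \<in> carrier M. \<phi> m \<in> addhom N Z) \<and>
     (\<forall>a \<in> carrier A. \<forall>m \<in> carrier M. \<forall>n \<in> carrier N. \<phi> (a \<odot>\<^bsub>M\<^esub> m) n = \<phi> m (a \<odot>\<^bsub>N\<^esub> n))"

lemma balancedI:
  assumes "\<And>n. n \<in> carrier N \<Longrightarrow> (\<lambda>m. \<phi> m n) \<in> addhom M Z"
    and "\<And>m. m \<in> carrier M \<Longrightarrow> \<phi> m \<in> addhom N Z"
    and "\<And>a m n. a \<in> carrier A \<Longrightarrow> m \<in> carrier M \<Longrightarrow> n \<in> carrier N
      \<Longrightarrow> \<phi> (a \<odot>\<^bsub>M\<^esub> m) n = \<phi> m (a \<odot>\<^bsub>N\<^esub> n)"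
  shows "balanced A M N Z \<phi>"
  using assms by (auto simp: balanced_def)

lemma balanced_closed: "balanced A M N Z \<phi> \<Longrightarrow> m \<in> carrier M \<Longrightarrow> n \<in> carrier N \<Longrightarrow> \<phi> m n \<in> carrier Z"
  by (auto simp: balanced_def addhom_def)

section \<open>The tensor product\<close>

definition lsum :: "('c, 'z) ring_scheme \<Rightarrow> ('m \<Rightarrow> 'n \<Rightarrow> 'c) \<Rightarrow> ('m \<times> 'n) list \<Rightarrow> 'c" where
  "lsum Z \<phi> xs = foldr (\<lambda>(m, n) s. \<phi> m n \<oplus>\<^bsub>Z\<^esub> s) xs \<zero>\<^bsub>Z\<^esub>"

lemma lsum_simps [simp]:
  "lsum Z \<phi> [] = \<zero>\<^bsub>Z\<^esub>"
  "lsum Z \<phi> ((m, n) # xs) = \<phi> m n \<oplus>\<^bsub>Z\<^esub> lsum Z \<phi> xs"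
  by (simp_all add: lsum_def)

lemma tens_lift_lsum: "tens_lift Z \<phi> u = lsum Z \<phi> (rep u)"
  by (simp add: tens_lift_def lsum_def)

lemma tens_eq_cong:
  assumes "carrier N = carrier N'" "ring.add N = ring.add N'"
    and "\<And>a n. a \<in> carrier A \<Longrightarrow> n \<in> carrier N \<Longrightarrow> a \<odot>\<^bsub>N\<^esub> n = a \<odot>\<^bsub>N'\<^esub> n"
    and "tens_eq A M N xs ys"
  shows "tens_eq A M N' xs ys"
  using assms(4)
proof induction
  case (balance a m n)
  then have "tens_eq A M N' [(a \<odot>\<^bsub>M\<^esub> m, n)] [(m, a \<odot>\<^bsub>N'\<^esub> n)]"
    using tens_eq.balance[of a A m M n N'] assms(1) by simp
  then show ?case using balance assms(3) by simp
next
  case (add_right m n n')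
  then show ?case using tens_eq.add_right[of m M n N' n' A] assms(1,2) by simp
qed (auto intro: tens_eq.intros simp: assms(1,2))

lemma tens_eq_carrier:
  assumes "module A M" "module A N" "tens_eq A M N xs ys"
  shows "set xs \<subseteq> carrier M \<times> carrier N \<and> set ys \<subseteq> carrier M \<times> carrier N"
proof -
  interpret M: module A M by fact
  interpret N: module A N by fact
  show ?thesis using assms(3) by induction auto
qed

lemma tens_class_eqI: "tens_eq A M N xs ys \<Longrightarrow> tens_class A M N xs = tens_class A M N ys"
  unfolding tens_class_def by (auto intro: tens_eq.intros(2,3))

context
  fixes A :: "('a, 'w) ring_scheme" and M :: "('a, 'm, 'x) module_scheme"
    and N :: "('a, 'n, 'y) module_scheme"
  assumes M: "module A M" and N: "module A N"
begin

interpretation M: module A M by (rule M)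
interpretation N: module A N by (rule N)

abbreviation (input) "valid xs \<equiv> set xs \<subseteq> carrier M \<times> carrier N"

lemma rep_tens_class:
  assumes "valid xs"
  shows "tens_eq A M N xs (rep (tens_class A M N xs))"
proof -
  have "xs \<in> tens_class A M N xs"
    using assms by (simp add: tens_class_def tens_eq.refl)
  then have "rep (tens_class A M N xs) \<in> tens_class A M N xs"
    unfolding rep_def by (rule someI)
  then show ?thesis by (simp add: tens_class_def)
qed

lemma tens_carrierE:
  assumes "u \<in> carrier (tens A M N)"
  obtains "valid (rep u)" "u = tens_class A M N (rep u)"
proof -
  obtain xs where xs: "valid xs" "u = tens_class A M N xs"
    using assms by (auto simp: tens_def)
  have "tens_eq A M N xs (rep u)" using rep_tens_class xs by simp
  then show ?thesis
    using that tens_eq_carrier[OF M N] tens_class_eqI xs(2) by metis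
qed

lemma tens_class_closed: "valid xs \<Longrightarrow> tens_class A M N xs \<in> carrier (tens A M N)"
  by (auto simp: tens_def)

lemma tens_add_class:
  assumes "valid xs" "valid ys"
  shows "tens_class A M N xs \<oplus>\<^bsub>tens A M N\<^esub> tens_class A M N ys = tens_class A M N (xs @ ys)"
proof -
  have "tens_eq A M N (xs @ ys) (rep (tens_class A M N xs) @ rep (tens_class A M N ys))"
    using assms by (intro tens_eq.append rep_tens_class)
  then show ?thesis by (simp add: tens_def tens_class_eqI)
qed

lemma tens_zero_class: "\<zero>\<^bsub>tens A M N\<^esub> = tens_class A M N []"
  by (simp add: tens_def)

text \<open>The defining relations mention no subtraction, so that a list and its negative cancel has to be
  derived from the relation for zero.\<close>

lemma tens_neg_class:
  assumes "valid xs"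
  shows "tens_eq A M N (map (\<lambda>(m, n). (\<ominus>\<^bsub>M\<^esub> m, n)) xs @ xs) []"
  using assms
proof (induction xs)
  case Nil
  then show ?case by (simp add: tens_eq.refl)
next
  case (Cons x xs)
  obtain m n where x: "x = (m, n)" "m \<in> carrier M" "n \<in> carrier N" using Cons.prems by auto
  let ?f = "\<lambda>(m, n). (\<ominus>\<^bsub>M\<^esub> m, n)"
  have wf: "valid xs" "valid (map ?f xs)" using Cons.prems by auto
  have "tens_eq A M N [(\<ominus>\<^bsub>M\<^esub> m \<oplus>\<^bsub>M\<^esub> m, n)] ([(\<ominus>\<^bsub>M\<^esub> m, n)] @ [(m, n)])"
    using tens_eq.add_left[of "\<ominus>\<^bsub>M\<^esub> m" M m n N A] x by simp
  moreover have "\<ominus>\<^bsub>M\<^esub> m \<oplus>\<^bsub>M\<^esub> m = \<zero>\<^bsub>M\<^esub>" using x by (simp add: M.l_neg)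
  ultimately have 1: "tens_eq A M N ([(\<ominus>\<^bsub>M\<^esub> m, n)] @ [(m, n)]) []"
    using tens_eq.zero_left[of n N A M] x by (metis tens_eq.sym tens_eq.trans)
  have "tens_eq A M N (map ?f xs @ [(m, n)]) ([(m, n)] @ map ?f xs)"
    using x wf by (intro tens_eq.commute) auto
  then have "tens_eq A M N (map ?f xs @ [(m, n)] @ xs) ([(m, n)] @ map ?f xs @ xs)"
    using tens_eq.append[OF _ tens_eq.refl[OF wf(1)], of A "map ?f xs @ [(m, n)]" "[(m, n)] @ map ?f xs"]
    by simp
  note 2 = this
  have "tens_eq A M N [(\<ominus>\<^bsub>M\<^esub> m, n)] [(\<ominus>\<^bsub>M\<^esub> m, n)]" using x by (intro tens_eq.refl) auto
  from tens_eq.append[OF this 2]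
  have "tens_eq A M N ([(\<ominus>\<^bsub>M\<^esub> m, n)] @ map ?f xs @ [(m, n)] @ xs)
      ([(\<ominus>\<^bsub>M\<^esub> m, n)] @ [(m, n)] @ map ?f xs @ xs)" .
  moreover have "tens_eq A M N (([(\<ominus>\<^bsub>M\<^esub> m, n)] @ [(m, n)]) @ map ?f xs @ xs) ([] @ [])"
    using 1 Cons.IH wf by (intro tens_eq.append)
  ultimately have "tens_eq A M N ([(\<ominus>\<^bsub>M\<^esub> m, n)] @ map ?f xs @ [(m, n)] @ xs) []"
    using tens_eq.trans by fastforce
  then show ?case by (simp add: x)
qed

lemma tens_abelian_group: "abelian_group (tens A M N)"
proof (rule abelian_groupI)
  fix u v w assume u: "u \<in> carrier (tens A M N)" and v: "v \<in> carrier (tens A M N)"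
    and w: "w \<in> carrier (tens A M N)"
  obtain xs where xs: "valid xs" "u = tens_class A M N xs" using tens_carrierE[OF u] by metis
  obtain ys where ys: "valid ys" "v = tens_class A M N ys" using tens_carrierE[OF v] by metis
  obtain zs where zs: "valid zs" "w = tens_class A M N zs" using tens_carrierE[OF w] by metis
  show "u \<oplus>\<^bsub>tens A M N\<^esub> v \<oplus>\<^bsub>tens A M N\<^esub> w = u \<oplus>\<^bsub>tens A M N\<^esub> (v \<oplus>\<^bsub>tens A M N\<^esub> w)"
    using xs ys zs by (simp add: tens_add_class)
next
  fix u v assume u: "u \<in> carrier (tens A M N)" and v: "v \<in> carrier (tens A M N)"
  obtain xs where xs: "valid xs" "u = tens_class A M N xs" using tens_carrierE[OF u] by metis
  obtain ys where ys: "valid ys" "v = tens_class A M N ys" using tens_carrierE[OF v] by metis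
  show "u \<oplus>\<^bsub>tens A M N\<^esub> v \<in> carrier (tens A M N)"
    using xs ys by (simp add: tens_add_class tens_class_closed)
  show "u \<oplus>\<^bsub>tens A M N\<^esub> v = v \<oplus>\<^bsub>tens A M N\<^esub> u"
    using xs ys by (simp add: tens_add_class tens_class_eqI tens_eq.commute)
next
  show "\<zero>\<^bsub>tens A M N\<^esub> \<in> carrier (tens A M N)"
    by (simp add: tens_zero_class tens_class_closed)
next
  fix u assume u: "u \<in> carrier (tens A M N)"
  obtain xs where xs: "valid xs" "u = tens_class A M N xs" using tens_carrierE[OF u] by metis
  show "\<zero>\<^bsub>tens A M N\<^esub> \<oplus>\<^bsub>tens A M N\<^esub> u = u"
    using xs by (simp add: tens_zero_class tens_add_class)
  let ?ys = "map (\<lambda>(m, n). (\<ominus>\<^bsub>M\<^esub> m, n)) xs"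
  have "valid ?ys" using xs by auto
  then show "\<exists>v \<in> carrier (tens A M N). v \<oplus>\<^bsub>tens A M N\<^esub> u = \<zero>\<^bsub>tens A M N\<^esub>"
    using xs tens_neg_class[OF xs(1)] by (intro bexI[of _ "tens_class A M N ?ys"])
      (simp_all add: tens_add_class tens_class_closed tens_zero_class tens_class_eqI)
qed

lemma pure_closed: "m \<in> carrier M \<Longrightarrow> n \<in> carrier N \<Longrightarrow> pure A M N m n \<in> carrier (tens A M N)"
  by (simp add: pure_def tens_class_closed)

lemma pure_balanced: "balanced A M N (tens A M N) (pure A M N)"
proof (intro balancedI addhomI)
  fix m m' n assume "m \<in> carrier M" "m' \<in> carrier M" "n \<in> carrier N"
  then show "pure A M N (m \<oplus>\<^bsub>M\<^esub> m') n = pure A M N m n \<oplus>\<^bsub>tens A M N\<^esub> pure A M N m' n"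
    by (simp add: pure_def tens_add_class tens_class_eqI tens_eq.add_left)
next
  fix m n n' assume "m \<in> carrier M" "n \<in> carrier N" "n' \<in> carrier N"
  then show "pure A M N m (n \<oplus>\<^bsub>N\<^esub> n') = pure A M N m n \<oplus>\<^bsub>tens A M N\<^esub> pure A M N m n'"
    by (simp add: pure_def tens_add_class tens_class_eqI tens_eq.add_right)
next
  fix a m n assume "a \<in> carrier A" "m \<in> carrier M" "n \<in> carrier N"
  then show "pure A M N (a \<odot>\<^bsub>M\<^esub> m) n = pure A M N m (a \<odot>\<^bsub>N\<^esub> n)"
    by (simp add: pure_def tens_class_eqI tens_eq.balance)
qed (auto intro: pure_closed)

lemma tens_class_lsum: "valid xs \<Longrightarrow> tens_class A M N xs = lsum (tens A M N) (pure A M N) xs"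
proof (induction xs)
  case Nil
  then show ?case by (simp add: tens_zero_class)
next
  case (Cons x xs)
  then show ?case
    using tens_add_class[of "[x]" xs] by (cases x) (simp add: pure_def)
qed

lemma tens_induct:
  assumes u: "u \<in> carrier (tens A M N)"
    and "Q \<zero>\<^bsub>tens A M N\<^esub>"
    and "\<And>m n. m \<in> carrier M \<Longrightarrow> n \<in> carrier N \<Longrightarrow> Q (pure A M N m n)"
    and "\<And>v w. v \<in> carrier (tens A M N) \<Longrightarrow> w \<in> carrier (tens A M N) \<Longrightarrow> Q v \<Longrightarrow> Q w
      \<Longrightarrow> Q (v \<oplus>\<^bsub>tens A M N\<^esub> w)"
  shows "Q u"
proof -
  interpret T: abelian_group "tens A M N" by (rule tens_abelian_group)
  have "Q (lsum (tens A M N) (pure A M N) xs) \<and> lsum (tens A M N) (pure A M N) xs \<in> carrier (tens A M N)"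
    if "valid xs" for xs
    using that by (induction xs) (auto intro!: assms(2-) simp: pure_closed)
  then show ?thesis using u tens_class_lsum by (metis tens_carrierE)
qed

text \<open>The workhorse of the development: pure tensors generate.\<close>

lemma tens_hom_eqI:
  assumes "f \<in> addhom (tens A M N) Z" "g \<in> addhom (tens A M N) Z" "abelian_group Z"
    and "\<And>m n. m \<in> carrier M \<Longrightarrow> n \<in> carrier N \<Longrightarrow> f (pure A M N m n) = g (pure A M N m n)"
    and u: "u \<in> carrier (tens A M N)"
  shows "f u = g u"
  using u
proof (induction rule: tens_induct[consumes 1])
  case 1
  show ?case
    by (simp add: addhom_zero[OF assms(1) tens_abelian_group assms(3)]
        addhom_zero[OF assms(2) tens_abelian_group assms(3)])
qed (use assms in \<open>simp_all add: addhom_add[OF assms(1)] addhom_add[OF assms(2)]\<close>)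

context
  fixes Z :: "('c, 'z) ring_scheme" and \<phi>
  assumes Z: "abelian_group Z" and \<phi>: "balanced A M N Z \<phi>"
begin

interpretation Z: abelian_group Z by (rule Z)

lemma lsum_closed: "valid xs \<Longrightarrow> lsum Z \<phi> xs \<in> carrier Z"
  by (induction xs) (auto simp: balanced_closed[OF \<phi>])

lemma lsum_append: "valid xs \<Longrightarrow> valid ys \<Longrightarrow> lsum Z \<phi> (xs @ ys) = lsum Z \<phi> xs \<oplus>\<^bsub>Z\<^esub> lsum Z \<phi> ys"
  by (induction xs) (auto simp: balanced_closed[OF \<phi>] lsum_closed Z.a_assoc)

text \<open>Every defining relation of the tensor product holds between the values of a balanced map. This makes
  \<open>tens_lift\<close> independent of the representative list that it is computed from.\<close>

lemma lsum_tens_eq: "tens_eq A M N xs ys \<Longrightarrow> lsum Z \<phi> xs = lsum Z \<phi> ys"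
proof (induction rule: tens_eq.induct)
  case (append xs xs' ys ys')
  then show ?case using tens_eq_carrier[OF M N] lsum_append by metis
next
  case (commute xs ys)
  then show ?case by (simp add: lsum_append lsum_closed Z.a_comm)
next
  case (add_left m m' n)
  then have "(\<lambda>m. \<phi> m n) \<in> addhom M Z" using \<phi> by (simp add: balanced_def)
  then have "\<phi> (m \<oplus>\<^bsub>M\<^esub> m') n = \<phi> m n \<oplus>\<^bsub>Z\<^esub> \<phi> m' n" using add_left by (simp add: addhom_def)
  then show ?case using add_left by (simp add: balanced_closed[OF \<phi>] Z.a_assoc)
next
  case (add_right m n n')
  then have "\<phi> m \<in> addhom N Z" using \<phi> by (simp add: balanced_def)
  then have "\<phi> m (n \<oplus>\<^bsub>N\<^esub> n') = \<phi> m n \<oplus>\<^bsub>Z\<^esub> \<phi> m n'" using add_right by (simp add: addhom_def)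
  then show ?case using add_right by (simp add: balanced_closed[OF \<phi>] Z.a_assoc)
next
  case (zero_left n)
  then have "(\<lambda>m. \<phi> m n) \<in> addhom M Z" using \<phi> by (simp add: balanced_def)
  then have "\<phi> \<zero>\<^bsub>M\<^esub> n = \<zero>\<^bsub>Z\<^esub>" using addhom_zero[OF _ M.M.abelian_group_axioms Z] by fastforce
  then show ?case by simp
next
  case (balance a m n)
  then show ?case using \<phi> by (simp add: balanced_def)
qed simp_all

lemma tens_lift_class: "valid xs \<Longrightarrow> tens_lift Z \<phi> (tens_class A M N xs) = lsum Z \<phi> xs"
  using lsum_tens_eq[OF rep_tens_class] by (simp add: tens_lift_lsum)

lemma tens_lift_pure: "m \<in> carrier M \<Longrightarrow> n \<in> carrier N \<Longrightarrow> tens_lift Z \<phi> (pure A M N m n) = \<phi> m n"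
  by (simp add: pure_def tens_lift_class balanced_closed[OF \<phi>])

lemma tens_lift_hom: "tens_lift Z \<phi> \<in> addhom (tens A M N) Z"
proof (rule addhomI)
  fix u v assume u: "u \<in> carrier (tens A M N)" and v: "v \<in> carrier (tens A M N)"
  obtain xs where xs: "valid xs" "u = tens_class A M N xs" using tens_carrierE[OF u] by metis
  obtain ys where ys: "valid ys" "v = tens_class A M N ys" using tens_carrierE[OF v] by metis
  show "tens_lift Z \<phi> u \<in> carrier Z"
    using xs by (simp add: tens_lift_class lsum_closed)
  show "tens_lift Z \<phi> (u \<oplus>\<^bsub>tens A M N\<^esub> v) = tens_lift Z \<phi> u \<oplus>\<^bsub>Z\<^esub> tens_lift Z \<phi> v"
    using xs ys by (simp add: tens_lift_class tens_add_class lsum_append)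
qed

end

lemma tens_smult_lift:
  assumes "u \<in> carrier (tens A M N)" "a \<in> carrier A"
  shows "a \<odot>\<^bsub>tens A M N\<^esub> u = tens_lift (tens A M N) (\<lambda>m n. pure A M N (a \<odot>\<^bsub>M\<^esub> m) n) u"
proof -
  have *: "lsum (tens A M N) (pure A M N) (map (\<lambda>(m, n). (a \<odot>\<^bsub>M\<^esub> m, n)) xs)
      = lsum (tens A M N) (\<lambda>m n. pure A M N (a \<odot>\<^bsub>M\<^esub> m) n) xs" for xs
    by (induction xs) auto
  have wf: "valid (rep u)" using tens_carrierE[OF assms(1)] by blast
  then have "valid (map (\<lambda>(m, n). (a \<odot>\<^bsub>M\<^esub> m, n)) (rep u))" using assms(2) by auto
  then have "a \<odot>\<^bsub>tens A M N\<^esub> u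
      = lsum (tens A M N) (pure A M N) (map (\<lambda>(m, n). (a \<odot>\<^bsub>M\<^esub> m, n)) (rep u))"
    by (subst tens_class_lsum[symmetric]) (simp_all add: tens_def)
  then show ?thesis by (simp only: * tens_lift_lsum)
qed

lemma tens_smult_balanced:
  assumes "a \<in> carrier A"
  shows "balanced A M N (tens A M N) (\<lambda>m n. pure A M N (a \<odot>\<^bsub>M\<^esub> m) n)"
proof (rule balancedI)
  fix n assume n: "n \<in> carrier N"
  have "(\<lambda>m. a \<odot>\<^bsub>M\<^esub> m) \<in> addhom M M"
    using assms by (intro addhomI) (simp_all add: M.smult_r_distr)
  then show "(\<lambda>m. pure A M N (a \<odot>\<^bsub>M\<^esub> m) n) \<in> addhom M (tens A M N)"
    using addhom_comp pure_balanced n unfolding balanced_def by blast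
next
  fix b m n assume b: "b \<in> carrier A" "m \<in> carrier M" "n \<in> carrier N"
  then have "pure A M N (b \<odot>\<^bsub>M\<^esub> (a \<odot>\<^bsub>M\<^esub> m)) n = pure A M N (a \<odot>\<^bsub>M\<^esub> m) (b \<odot>\<^bsub>N\<^esub> n)"
    using pure_balanced assms unfolding balanced_def by simp
  moreover have "a \<odot>\<^bsub>M\<^esub> (b \<odot>\<^bsub>M\<^esub> m) = b \<odot>\<^bsub>M\<^esub> (a \<odot>\<^bsub>M\<^esub> m)"
    using b assms by (simp add: M.R.m_comm flip: M.smult_assoc1)
  ultimately show "pure A M N (a \<odot>\<^bsub>M\<^esub> (b \<odot>\<^bsub>M\<^esub> m)) n = pure A M N (a \<odot>\<^bsub>M\<^esub> m) (b \<odot>\<^bsub>N\<^esub> n)"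
    by simp
qed (use assms pure_balanced in \<open>auto simp: balanced_def\<close>)

lemma tens_smult_hom: "a \<in> carrier A \<Longrightarrow> (\<lambda>u. a \<odot>\<^bsub>tens A M N\<^esub> u) \<in> addhom (tens A M N) (tens A M N)"
  by (rule addhom_eq[OF tens_lift_hom[OF tens_abelian_group tens_smult_balanced] tens_abelian_group])
    (simp_all add: tens_smult_lift)

lemma tens_smult_pure: "a \<in> carrier A \<Longrightarrow> m \<in> carrier M \<Longrightarrow> n \<in> carrier N \<Longrightarrow>
    a \<odot>\<^bsub>tens A M N\<^esub> pure A M N m n = pure A M N (a \<odot>\<^bsub>M\<^esub> m) n"
  by (simp add: tens_smult_lift pure_closed tens_lift_pure[OF tens_abelian_group tens_smult_balanced])

lemma pure_add_left: "m \<in> carrier M \<Longrightarrow> m' \<in> carrier M \<Longrightarrow> n \<in> carrier N \<Longrightarrow>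
    pure A M N (m \<oplus>\<^bsub>M\<^esub> m') n = pure A M N m n \<oplus>\<^bsub>tens A M N\<^esub> pure A M N m' n"
  using pure_balanced by (simp add: balanced_def addhom_def)

lemma pure_add_right: "m \<in> carrier M \<Longrightarrow> n \<in> carrier N \<Longrightarrow> n' \<in> carrier N \<Longrightarrow>
    pure A M N m (n \<oplus>\<^bsub>N\<^esub> n') = pure A M N m n \<oplus>\<^bsub>tens A M N\<^esub> pure A M N m n'"
  using pure_balanced by (simp add: balanced_def addhom_def)

lemma pure_smult: "a \<in> carrier A \<Longrightarrow> m \<in> carrier M \<Longrightarrow> n \<in> carrier N \<Longrightarrow>
    pure A M N (a \<odot>\<^bsub>M\<^esub> m) n = pure A M N m (a \<odot>\<^bsub>N\<^esub> n)"
  using pure_balanced by (simp add: balanced_def)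

lemma pure_left_hom: "n \<in> carrier N \<Longrightarrow> (\<lambda>m. pure A M N m n) \<in> addhom M (tens A M N)"
  using pure_balanced by (simp add: balanced_def)

lemma pure_right_hom: "m \<in> carrier M \<Longrightarrow> pure A M N m \<in> addhom N (tens A M N)"
  using pure_balanced by (simp add: balanced_def)

lemma tens_module: "module A (tens A M N)"
proof (rule moduleI)
  fix a b x assume ab: "a \<in> carrier A" "b \<in> carrier A" and x: "x \<in> carrier (tens A M N)"
  note sm = tens_smult_hom
  have 1: "(\<lambda>x. a \<odot>\<^bsub>tens A M N\<^esub> x \<oplus>\<^bsub>tens A M N\<^esub> b \<odot>\<^bsub>tens A M N\<^esub> x) \<in> addhom (tens A M N) (tens A M N)"
    using ab by (intro addhom_plus sm tens_abelian_group)
  show "(a \<oplus>\<^bsub>A\<^esub> b) \<odot>\<^bsub>tens A M N\<^esub> x = a \<odot>\<^bsub>tens A M N\<^esub> x \<oplus>\<^bsub>tens A M N\<^esub> b \<odot>\<^bsub>tens A M N\<^esub> x"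
    by (rule tens_hom_eqI[OF sm 1 tens_abelian_group])
      (use ab x in \<open>simp_all add: tens_smult_pure M.smult_l_distr pure_add_left\<close>)
  have 2: "(\<lambda>x. a \<odot>\<^bsub>tens A M N\<^esub> (b \<odot>\<^bsub>tens A M N\<^esub> x)) \<in> addhom (tens A M N) (tens A M N)"
    using ab by (intro addhom_comp[OF sm sm])
  show "(a \<otimes>\<^bsub>A\<^esub> b) \<odot>\<^bsub>tens A M N\<^esub> x = a \<odot>\<^bsub>tens A M N\<^esub> (b \<odot>\<^bsub>tens A M N\<^esub> x)"
    by (rule tens_hom_eqI[OF sm 2 tens_abelian_group])
      (use ab x in \<open>simp_all add: tens_smult_pure M.smult_assoc1\<close>)
next
  fix x assume x: "x \<in> carrier (tens A M N)"
  show "\<one>\<^bsub>A\<^esub> \<odot>\<^bsub>tens A M N\<^esub> x = x"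
    by (rule tens_hom_eqI[OF tens_smult_hom addhom_id tens_abelian_group])
      (use x in \<open>simp_all add: tens_smult_pure\<close>)
next
  fix a x y assume "a \<in> carrier A" "x \<in> carrier (tens A M N)" "y \<in> carrier (tens A M N)"
  then show "a \<odot>\<^bsub>tens A M N\<^esub> (x \<oplus>\<^bsub>tens A M N\<^esub> y) = a \<odot>\<^bsub>tens A M N\<^esub> x \<oplus>\<^bsub>tens A M N\<^esub> a \<odot>\<^bsub>tens A M N\<^esub> y"
    using tens_smult_hom addhom_add by metis
next
  fix a x assume "a \<in> carrier A" "x \<in> carrier (tens A M N)"
  then show "a \<odot>\<^bsub>tens A M N\<^esub> x \<in> carrier (tens A M N)"
    using tens_smult_hom addhom_closed by metis
qed (rule M.R.cring_axioms tens_abelian_group)+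

end

section \<open>Maps between tensor products\<close>

definition linmap :: "('a, 'w) ring_scheme \<Rightarrow> ('a, 'm, 'x) module_scheme
    \<Rightarrow> ('a, 'n, 'y) module_scheme \<Rightarrow> ('m \<Rightarrow> 'n) set" where
  "linmap A M N = {f \<in> addhom M N. \<forall>a \<in> carrier A. \<forall>m \<in> carrier M. f (a \<odot>\<^bsub>M\<^esub> m) = a \<odot>\<^bsub>N\<^esub> f m}"

lemma linmap_id: "id \<in> linmap A M M"
  by (auto simp: linmap_def addhom_id')

lemma tens_map_balanced:
  assumes "module A M0" "module A N0" "module A M" "module A N"
    and f: "f \<in> linmap A M0 M" and g: "g \<in> linmap A N0 N"
  shows "balanced A M0 N0 (tens A M N) (\<lambda>m n. pure A M N (f m) (g n))"
proof (rule balancedI)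
  have fg: "f \<in> addhom M0 M" "g \<in> addhom N0 N" using f g by (auto simp: linmap_def)
  show "(\<lambda>m. pure A M N (f m) (g n)) \<in> addhom M0 (tens A M N)" if "n \<in> carrier N0" for n
    using that fg addhom_comp[OF fg(1) pure_left_hom[OF assms(3,4)]] by (simp add: addhom_closed)
  show "(\<lambda>n. pure A M N (f m) (g n)) \<in> addhom N0 (tens A M N)" if "m \<in> carrier M0" for m
    using that fg addhom_comp[OF fg(2) pure_right_hom[OF assms(3,4)]] by (simp add: addhom_closed)
  show "pure A M N (f (a \<odot>\<^bsub>M0\<^esub> m)) (g n) = pure A M N (f m) (g (a \<odot>\<^bsub>N0\<^esub> n))"
    if "a \<in> carrier A" "m \<in> carrier M0" "n \<in> carrier N0" for a m n
    using that f g fg by (simp add: linmap_def addhom_closed pure_smult[OF assms(3,4)])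
qed

lemma tens_map_hom:
  assumes "module A M0" "module A N0" "module A M" "module A N"
    and "f \<in> linmap A M0 M" and "g \<in> linmap A N0 N"
  shows "tens_map A M N f g \<in> addhom (tens A M0 N0) (tens A M N)"
  unfolding tens_map_def using tens_map_balanced[OF assms] assms
  by (intro tens_lift_hom tens_abelian_group)

lemma tens_map_pure:
  assumes "module A M0" "module A N0" "module A M" "module A N"
    and "f \<in> linmap A M0 M" and "g \<in> linmap A N0 N"
    and "m \<in> carrier M0" "n \<in> carrier N0"
  shows "tens_map A M N f g (pure A M0 N0 m n) = pure A M N (f m) (g n)"
  unfolding tens_map_def using tens_map_balanced[OF assms(1-6)] assms
  by (intro tens_lift_pure tens_abelian_group)

text \<open>Biadditive maps on a pair of tensor products: the product of a tensor product of algebras and the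
  product of differential forms are both of this form.\<close>

definition tens_lift2 :: "('c, 'z) ring_scheme \<Rightarrow> ('m \<Rightarrow> 'n \<Rightarrow> 'm1 \<Rightarrow> 'n1 \<Rightarrow> 'c)
    \<Rightarrow> ('m, 'n) tensor \<Rightarrow> ('m1, 'n1) tensor \<Rightarrow> 'c" where
  "tens_lift2 Z \<phi> u v = tens_lift Z (\<lambda>m n. tens_lift Z (\<phi> m n) v) u"

context
  fixes A :: "('a, 'w) ring_scheme" and M :: "('a, 'm, 'x) module_scheme"
    and N :: "('a, 'n, 'y) module_scheme" and M' :: "('a, 'm1, 'x1) module_scheme"
    and N' :: "('a, 'n1, 'y1) module_scheme" and Z :: "('c, 'z) ring_scheme" and \<phi>
  assumes MN: "module A M" "module A N" and MN': "module A M'" "module A N'"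
    and Z: "abelian_group Z"
    and right: "\<And>m n. m \<in> carrier M \<Longrightarrow> n \<in> carrier N \<Longrightarrow> balanced A M' N' Z (\<phi> m n)"
    and left: "\<And>m n. m \<in> carrier M' \<Longrightarrow> n \<in> carrier N' \<Longrightarrow> balanced A M N Z (\<lambda>m' n'. \<phi> m' n' m n)"
begin

private lemma inner_hom: "m \<in> carrier M \<Longrightarrow> n \<in> carrier N \<Longrightarrow> tens_lift Z (\<phi> m n) \<in> addhom (tens A M' N') Z"
  by (intro tens_lift_hom MN' Z right)

private lemma inner_pure: "m \<in> carrier M \<Longrightarrow> n \<in> carrier N \<Longrightarrow> m' \<in> carrier M' \<Longrightarrow> n' \<in> carrier N'
    \<Longrightarrow> tens_lift Z (\<phi> m n) (pure A M' N' m' n') = \<phi> m n m' n'"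
  by (intro tens_lift_pure MN' Z right)

private lemma outer_balanced:
  assumes v: "v \<in> carrier (tens A M' N')"
  shows "balanced A M N Z (\<lambda>m n. tens_lift Z (\<phi> m n) v)"
proof (intro balancedI addhomI)
  interpret M: module A M by (rule MN)
  interpret N: module A N by (rule MN)
  note left' = left[unfolded balanced_def addhom_def]
  show "tens_lift Z (\<phi> m n) v \<in> carrier Z" if "m \<in> carrier M" "n \<in> carrier N" for m n
    using inner_hom[OF that] v by (rule addhom_closed)
  then show "tens_lift Z (\<phi> m n) v \<in> carrier Z" if "m \<in> carrier M" "n \<in> carrier N" for m n
    using that .
  show "tens_lift Z (\<phi> (m \<oplus>\<^bsub>M\<^esub> m') n) v = tens_lift Z (\<phi> m n) v \<oplus>\<^bsub>Z\<^esub> tens_lift Z (\<phi> m' n) v"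
    if "m \<in> carrier M" "m' \<in> carrier M" "n \<in> carrier N" for m m' n
    by (rule tens_hom_eqI[OF MN' inner_hom addhom_plus[OF inner_hom inner_hom Z] Z])
      (use that v left' in \<open>simp_all add: inner_pure\<close>)
  show "tens_lift Z (\<phi> m (n \<oplus>\<^bsub>N\<^esub> n')) v = tens_lift Z (\<phi> m n) v \<oplus>\<^bsub>Z\<^esub> tens_lift Z (\<phi> m n') v"
    if "m \<in> carrier M" "n \<in> carrier N" "n' \<in> carrier N" for m n n'
    by (rule tens_hom_eqI[OF MN' inner_hom addhom_plus[OF inner_hom inner_hom Z] Z])
      (use that v left' in \<open>simp_all add: inner_pure\<close>)
  show "tens_lift Z (\<phi> (a \<odot>\<^bsub>M\<^esub> m) n) v = tens_lift Z (\<phi> m (a \<odot>\<^bsub>N\<^esub> n)) v"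
    if "a \<in> carrier A" "m \<in> carrier M" "n \<in> carrier N" for a m n
    by (rule tens_hom_eqI[OF MN' inner_hom inner_hom Z])
      (use that v left' in \<open>simp_all add: inner_pure\<close>)
qed

lemma tens_lift2_hom_left:
  "v \<in> carrier (tens A M' N') \<Longrightarrow> (\<lambda>u. tens_lift2 Z \<phi> u v) \<in> addhom (tens A M N) Z"
  unfolding tens_lift2_def by (intro tens_lift_hom MN Z outer_balanced)

lemma tens_lift2_pure_left:
  "m \<in> carrier M \<Longrightarrow> n \<in> carrier N \<Longrightarrow> v \<in> carrier (tens A M' N') \<Longrightarrow>
    tens_lift2 Z \<phi> (pure A M N m n) v = tens_lift Z (\<phi> m n) v"
  unfolding tens_lift2_def by (intro tens_lift_pure MN Z outer_balanced)

lemma tens_lift2_pure: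
  "m \<in> carrier M \<Longrightarrow> n \<in> carrier N \<Longrightarrow> m' \<in> carrier M' \<Longrightarrow> n' \<in> carrier N' \<Longrightarrow>
    tens_lift2 Z \<phi> (pure A M N m n) (pure A M' N' m' n') = \<phi> m n m' n'"
  by (simp add: tens_lift2_pure_left pure_closed[OF MN'] inner_pure)

text \<open>The definition lifts over the second argument first, so additivity there is not immediate; but both
  sides are additive in the first argument and may be compared on pure tensors.\<close>

lemma tens_lift2_hom_right:
  assumes u: "u \<in> carrier (tens A M N)"
  shows "tens_lift2 Z \<phi> u \<in> addhom (tens A M' N') Z"
proof (rule addhomI)
  fix v w assume v: "v \<in> carrier (tens A M' N')" and w: "w \<in> carrier (tens A M' N')"
  interpret T: abelian_group "tens A M' N'" by (rule tens_abelian_group[OF MN'])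
  show "tens_lift2 Z \<phi> u v \<in> carrier Z"
    using tens_lift2_hom_left[OF v] u by (rule addhom_closed)
  show "tens_lift2 Z \<phi> u (v \<oplus>\<^bsub>tens A M' N'\<^esub> w) = tens_lift2 Z \<phi> u v \<oplus>\<^bsub>Z\<^esub> tens_lift2 Z \<phi> u w"
    by (rule tens_hom_eqI[OF MN tens_lift2_hom_left addhom_plus[OF tens_lift2_hom_left tens_lift2_hom_left Z] Z])
      (use u v w in \<open>simp_all add: tens_lift2_pure_left addhom_add[OF inner_hom]\<close>)
qed

end

section \<open>Tensor products of algebras\<close>

lemma (in algebra) smult_assoc2_right: "a \<in> carrier R \<Longrightarrow> x \<in> carrier M \<Longrightarrow> y \<in> carrier M \<Longrightarrow>
    x \<otimes>\<^bsub>M\<^esub> (a \<odot>\<^bsub>M\<^esub> y) = a \<odot>\<^bsub>M\<^esub> (x \<otimes>\<^bsub>M\<^esub> y)"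
  by (metis m_comm smult_assoc2 smult_closed)

context
  fixes A :: "('a, 'w) ring_scheme" and S :: "('a, 'm, 'x) module_scheme"
    and T :: "('a, 'n, 'y) module_scheme"
  assumes S: "algebra A S" and T: "algebra A T"
begin

interpretation S: algebra A S by (rule S)
interpretation T: algebra A T by (rule T)

private lemmas mods = S.module T.module
private lemmas AG = tens_abelian_group[OF mods]

text \<open>Multiplication is defined on representatives by expanding the product of two sums; as an iterated
  lift it is visibly well defined and biadditive.\<close>

lemma tens_mult_lift:
  assumes "u \<in> carrier (tens A S T)" "v \<in> carrier (tens A S T)"
  shows "u \<otimes>\<^bsub>tens A S T\<^esub> v = tens_lift (tens A S T) (\<lambda>m n. tens_lift (tens A S T)
    (\<lambda>m' n'. pure A S T (m \<otimes>\<^bsub>S\<^esub> m') (n \<otimes>\<^bsub>T\<^esub> n')) v) u"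
proof -
  let ?W = "tens A S T"
  interpret W: abelian_group ?W by (rule AG)
  have 1: "lsum ?W (pure A S T) (map (\<lambda>(m', n'). (m \<otimes>\<^bsub>S\<^esub> m', n \<otimes>\<^bsub>T\<^esub> n')) ys)
      = lsum ?W (\<lambda>m' n'. pure A S T (m \<otimes>\<^bsub>S\<^esub> m') (n \<otimes>\<^bsub>T\<^esub> n')) ys" for m n ys
    by (induction ys) auto
  have 2: "lsum ?W (pure A S T) (xs @ ys) = lsum ?W (pure A S T) xs \<oplus>\<^bsub>?W\<^esub> lsum ?W (pure A S T) ys"
    if "set xs \<subseteq> carrier S \<times> carrier T" "set ys \<subseteq> carrier S \<times> carrier T" for xs ys
    using lsum_append[OF mods AG pure_balanced[OF mods]] that by simp
  have sub: "set [(m \<otimes>\<^bsub>S\<^esub> m', n \<otimes>\<^bsub>T\<^esub> n'). (m, n) \<leftarrow> xs, (m', n') \<leftarrow> ys] \<subseteq> carrier S \<times> carrier T"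
    if "set xs \<subseteq> carrier S \<times> carrier T" "set ys \<subseteq> carrier S \<times> carrier T" for xs ys
    using that by fastforce
  have 3: "lsum ?W (pure A S T) [(m \<otimes>\<^bsub>S\<^esub> m', n \<otimes>\<^bsub>T\<^esub> n'). (m, n) \<leftarrow> xs, (m', n') \<leftarrow> ys]
      = lsum ?W (\<lambda>m n. lsum ?W (\<lambda>m' n'. pure A S T (m \<otimes>\<^bsub>S\<^esub> m') (n \<otimes>\<^bsub>T\<^esub> n')) ys) xs"
    if "set xs \<subseteq> carrier S \<times> carrier T" "set ys \<subseteq> carrier S \<times> carrier T" for xs ys
    using that(1)
  proof (induction xs)
    case (Cons x xs)
    obtain m n where x: "x = (m, n)" "m \<in> carrier S" "n \<in> carrier T" using Cons.prems by auto
    have "set (map (\<lambda>(m', n'). (m \<otimes>\<^bsub>S\<^esub> m', n \<otimes>\<^bsub>T\<^esub> n')) ys) \<subseteq> carrier S \<times> carrier T"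
      using x that(2) by fastforce
    then show ?case using Cons x sub[OF _ that(2), of xs] by (simp add: 1 2)
  qed simp
  have wf: "set (rep u) \<subseteq> carrier S \<times> carrier T" "set (rep v) \<subseteq> carrier S \<times> carrier T"
    using tens_carrierE[OF mods assms(1)] tens_carrierE[OF mods assms(2)] by metis+
  have "u \<otimes>\<^bsub>?W\<^esub> v = tens_class A S T [(m \<otimes>\<^bsub>S\<^esub> m', n \<otimes>\<^bsub>T\<^esub> n'). (m, n) \<leftarrow> rep u, (m', n') \<leftarrow> rep v]"
    by (simp add: tens_def)
  also have "\<dots> = lsum ?W (pure A S T) [(m \<otimes>\<^bsub>S\<^esub> m', n \<otimes>\<^bsub>T\<^esub> n'). (m, n) \<leftarrow> rep u, (m', n') \<leftarrow> rep v]"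
    by (intro tens_class_lsum[OF mods] sub wf)
  finally show ?thesis by (simp only: 3[OF wf] tens_lift_lsum)
qed

lemma tens_mult_inner:
  assumes m: "m \<in> carrier S" and n: "n \<in> carrier T"
  shows "balanced A S T (tens A S T) (\<lambda>m' n'. pure A S T (m \<otimes>\<^bsub>S\<^esub> m') (n \<otimes>\<^bsub>T\<^esub> n'))"
proof (rule balancedI)
  have 1: "(\<lambda>m'. m \<otimes>\<^bsub>S\<^esub> m') \<in> addhom S S" "(\<lambda>n'. n \<otimes>\<^bsub>T\<^esub> n') \<in> addhom T T"
    using m n by (auto intro!: addhomI simp: S.r_distr T.r_distr)
  show "(\<lambda>m'. pure A S T (m \<otimes>\<^bsub>S\<^esub> m') (n \<otimes>\<^bsub>T\<^esub> n')) \<in> addhom S (tens A S T)" if "n' \<in> carrier T" for n'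
    using that n addhom_comp[OF 1(1) pure_left_hom[OF mods]] by simp
  show "(\<lambda>n'. pure A S T (m \<otimes>\<^bsub>S\<^esub> m') (n \<otimes>\<^bsub>T\<^esub> n')) \<in> addhom T (tens A S T)" if "m' \<in> carrier S" for m'
    using that m addhom_comp[OF 1(2) pure_right_hom[OF mods]] by simp
  show "pure A S T (m \<otimes>\<^bsub>S\<^esub> (a \<odot>\<^bsub>S\<^esub> m')) (n \<otimes>\<^bsub>T\<^esub> n') = pure A S T (m \<otimes>\<^bsub>S\<^esub> m') (n \<otimes>\<^bsub>T\<^esub> (a \<odot>\<^bsub>T\<^esub> n'))"
    if "a \<in> carrier A" "m' \<in> carrier S" "n' \<in> carrier T" for a m' n'
    using that m n pure_smult[OF mods]
    by (metis S.m_comm S.smult_assoc2 S.smult_closed T.m_comm T.smult_assoc2 T.smult_closed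
        S.m_closed T.m_closed)
qed

lemma tens_mult_left:
  assumes "m \<in> carrier S" "n \<in> carrier T"
  shows "balanced A S T (tens A S T) (\<lambda>m' n'. pure A S T (m' \<otimes>\<^bsub>S\<^esub> m) (n' \<otimes>\<^bsub>T\<^esub> n))"
  using tens_mult_inner[OF assms] assms by (simp add: balanced_def addhom_def S.m_comm T.m_comm Pi_iff)

private lemmas mult2 = mods mods AG tens_mult_inner tens_mult_left

lemma tens_mult_lift2:
  assumes "u \<in> carrier (tens A S T)" "v \<in> carrier (tens A S T)"
  shows "u \<otimes>\<^bsub>tens A S T\<^esub> v = tens_lift2 (tens A S T)
    (\<lambda>m n m' n'. pure A S T (m \<otimes>\<^bsub>S\<^esub> m') (n \<otimes>\<^bsub>T\<^esub> n')) u v"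
  unfolding tens_lift2_def by (rule tens_mult_lift[OF assms])

lemma tens_mult_hom_left:
  "v \<in> carrier (tens A S T) \<Longrightarrow> (\<lambda>u. u \<otimes>\<^bsub>tens A S T\<^esub> v) \<in> addhom (tens A S T) (tens A S T)"
  by (rule addhom_eq[OF tens_lift2_hom_left[OF mult2] AG]) (simp_all add: tens_mult_lift2)

lemma tens_mult_hom_right:
  "v \<in> carrier (tens A S T) \<Longrightarrow> (\<lambda>u. v \<otimes>\<^bsub>tens A S T\<^esub> u) \<in> addhom (tens A S T) (tens A S T)"
  by (rule addhom_eq[OF tens_lift2_hom_right[OF mult2] AG]) (simp_all add: tens_mult_lift2)

lemma tens_mult_pure:
  "m \<in> carrier S \<Longrightarrow> n \<in> carrier T \<Longrightarrow> m' \<in> carrier S \<Longrightarrow> n' \<in> carrier T \<Longrightarrow>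
    pure A S T m n \<otimes>\<^bsub>tens A S T\<^esub> pure A S T m' n' = pure A S T (m \<otimes>\<^bsub>S\<^esub> m') (n \<otimes>\<^bsub>T\<^esub> n')"
  by (simp add: tens_mult_lift2 pure_closed[OF mods] tens_lift2_pure[OF mult2])

lemma tens_mult_comm:
  assumes u: "u \<in> carrier (tens A S T)" and v: "v \<in> carrier (tens A S T)"
  shows "u \<otimes>\<^bsub>tens A S T\<^esub> v = v \<otimes>\<^bsub>tens A S T\<^esub> u"
proof -
  let ?W = "tens A S T"
  have 1: "pure A S T m n \<otimes>\<^bsub>?W\<^esub> v = v \<otimes>\<^bsub>?W\<^esub> pure A S T m n"
    if "m \<in> carrier S" "n \<in> carrier T" "v \<in> carrier ?W" for m n v
    by (rule tens_hom_eqI[OF mods tens_mult_hom_right tens_mult_hom_left AG])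
      (use that in \<open>simp_all add: pure_closed[OF mods] tens_mult_pure S.m_comm T.m_comm\<close>)
  show ?thesis
    by (rule tens_hom_eqI[OF mods tens_mult_hom_left tens_mult_hom_right AG]) (use u v in \<open>simp_all add: 1\<close>)
qed

lemma tens_one: "\<one>\<^bsub>tens A S T\<^esub> = pure A S T \<one>\<^bsub>S\<^esub> \<one>\<^bsub>T\<^esub>"
  by (simp add: tens_def)

text \<open>The ring axioms are additive in each variable, so they reduce to pure tensors, one variable at a time.\<close>

lemma tens_cring: "cring (tens A S T)"
proof (rule cringI[OF AG])
  let ?W = "tens A S T"
  note L = tens_mult_hom_left and Rt = tens_mult_hom_right
  note cl = addhom_closed[OF tens_mult_hom_left]
  show "(x \<oplus>\<^bsub>?W\<^esub> y) \<otimes>\<^bsub>?W\<^esub> z = x \<otimes>\<^bsub>?W\<^esub> z \<oplus>\<^bsub>?W\<^esub> y \<otimes>\<^bsub>?W\<^esub> z"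
    if "x \<in> carrier ?W" "y \<in> carrier ?W" "z \<in> carrier ?W" for x y z
    using addhom_add[OF L] that by blast
  have one: "\<one>\<^bsub>?W\<^esub> \<in> carrier ?W" by (simp add: tens_one pure_closed[OF mods])
  have a1: "(pure A S T m n \<otimes>\<^bsub>?W\<^esub> pure A S T m' n') \<otimes>\<^bsub>?W\<^esub> z = pure A S T m n \<otimes>\<^bsub>?W\<^esub> (pure A S T m' n' \<otimes>\<^bsub>?W\<^esub> z)"
    if "m \<in> carrier S" "n \<in> carrier T" "m' \<in> carrier S" "n' \<in> carrier T" "z \<in> carrier ?W" for m n m' n' z
    by (rule tens_hom_eqI[OF mods Rt addhom_comp[OF Rt Rt] AG])
      (use that in \<open>simp_all add: cl pure_closed[OF mods] tens_mult_pure S.m_assoc T.m_assoc\<close>)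
  have a2: "(pure A S T m n \<otimes>\<^bsub>?W\<^esub> y) \<otimes>\<^bsub>?W\<^esub> z = pure A S T m n \<otimes>\<^bsub>?W\<^esub> (y \<otimes>\<^bsub>?W\<^esub> z)"
    if "m \<in> carrier S" "n \<in> carrier T" "y \<in> carrier ?W" "z \<in> carrier ?W" for m n y z
    by (rule tens_hom_eqI[OF mods addhom_comp[OF Rt L] addhom_comp[OF L Rt] AG])
      (use that in \<open>simp_all add: a1 pure_closed[OF mods]\<close>)
  have a3: "(x \<otimes>\<^bsub>?W\<^esub> y) \<otimes>\<^bsub>?W\<^esub> z = x \<otimes>\<^bsub>?W\<^esub> (y \<otimes>\<^bsub>?W\<^esub> z)"
    if "x \<in> carrier ?W" "y \<in> carrier ?W" "z \<in> carrier ?W" for x y z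
    by (rule tens_hom_eqI[OF mods addhom_comp[OF L L] L AG])
      (use that in \<open>simp_all add: a2 cl\<close>)
  have l1: "\<one>\<^bsub>?W\<^esub> \<otimes>\<^bsub>?W\<^esub> x = x" if "x \<in> carrier ?W" for x
    by (rule tens_hom_eqI[OF mods Rt addhom_id AG])
      (use that in \<open>simp_all add: one tens_one tens_mult_pure pure_closed[OF mods]\<close>)
  show "comm_monoid ?W"
    by (rule comm_monoidI) (simp_all add: one cl a3 l1, simp add: tens_mult_comm)
qed

end

section \<open>Restriction of scalars and base change\<close>

lemma restr_simps [simp]:
  "carrier (restr f N) = carrier N" "monoid.mult (restr f N) = monoid.mult N"
  "monoid.one (restr f N) = monoid.one N" "ring.zero (restr f N) = ring.zero N"
  "ring.add (restr f N) = ring.add N" "smult (restr f N) = (\<lambda>a n. f a \<odot>\<^bsub>N\<^esub> n)"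
  by (simp_all add: restr_def)

lemma self_simps [simp]:
  "carrier (self N) = carrier N" "monoid.mult (self N) = monoid.mult N"
  "monoid.one (self N) = monoid.one N" "ring.zero (self N) = ring.zero N"
  "ring.add (self N) = ring.add N" "smult (self N) = monoid.mult N"
  by (simp_all add: self_def)

lemma abelian_group_cong:
  assumes "abelian_group U" "carrier V = carrier U" "ring.zero V = ring.zero U" "ring.add V = ring.add U"
  shows "abelian_group V"
proof -
  interpret U: abelian_group U by fact
  show ?thesis by (rule abelian_groupI) (auto simp: assms(2-) U.a_ac intro: U.l_neg exI[of _ "\<ominus>\<^bsub>U\<^esub> _"])
qed

lemma cring_cong:
  assumes "cring U" "carrier V = carrier U" "ring.zero V = ring.zero U" "ring.add V = ring.add U"
    "monoid.one V = monoid.one U" "monoid.mult V = monoid.mult U"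
  shows "cring V"
proof -
  interpret U: cring U by fact
  have "abelian_group V" using abelian_group_cong U.abelian_group_axioms assms(2-4) by metis
  then show ?thesis
    by (rule cringI) (auto intro!: comm_monoidI simp: assms(2-) U.m_assoc U.l_distr intro: U.m_comm)
qed

lemma addhom_cong:
  assumes "carrier U' = carrier U" "ring.add U' = ring.add U" "carrier V' = carrier V" "ring.add V' = ring.add V"
  shows "addhom U' V' = addhom U V"
  by (simp add: addhom_def assms)

lemma module_restr:
  assumes "f \<in> ring_hom A D" "cring A" "module D N"
  shows "module A (restr f N)"
proof -
  interpret N: module D N by fact
  have "abelian_group (restr f N)"
    by (rule abelian_group_cong[OF N.M.abelian_group_axioms]) simp_all
  then show ?thesis
    using assms(2) by (intro moduleI)
      (simp_all add: ring_hom_closed[OF assms(1)] ring_hom_add[OF assms(1)] ring_hom_mult[OF assms(1)]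
        ring_hom_one[OF assms(1)] N.smult_l_distr N.smult_r_distr N.smult_assoc1)
qed

lemma algebra_self: "cring D \<Longrightarrow> algebra D (self D)"
proof -
  assume "cring D"
  then interpret cring D .
  have "cring (self D)" by (rule cring_cong[OF cring_axioms]) simp_all
  then show ?thesis by (intro algebraI cring_axioms) (simp_all add: l_distr r_distr m_assoc)
qed

lemma algebra_restr:
  assumes "f \<in> ring_hom A D" "cring A" "algebra D S"
  shows "algebra A (restr f S)"
proof -
  interpret S: algebra D S by fact
  interpret M: module A "restr f S" by (rule module_restr[OF assms(1,2) S.module])
  have "cring (restr f S)" by (rule cring_cong[OF S.M_cring]) simp_all
  then show ?thesis
    using assms(2) M.smult_l_distr M.smult_r_distr M.smult_assoc1 M.smult_one M.smult_closed
    by (intro algebraI) (simp_all add: S.smult_assoc2 ring_hom_closed[OF assms(1)])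
qed

lemma unit_map_hom:
  assumes "algebra A S"
  shows "unit_map S \<in> ring_hom A S"
proof -
  interpret S: algebra A S by fact
  show ?thesis
    unfolding unit_map_def
    by (intro ring_hom_memI) (simp_all add: S.smult_l_distr S.smult_assoc2 S.smult_assoc1)
qed

text \<open>A tensor product depends only on how the scalars in the carrier act. This matters because the
  cosimplicial identities are identities between restrictions to \<open>B\<^sup>0\<close> of total functions.\<close>

lemma tens_cong_right:
  assumes "carrier N = carrier N'" "ring.add N = ring.add N'" "monoid.mult N = monoid.mult N'"
    "monoid.one N = monoid.one N'"
    and "\<And>a n. a \<in> carrier A \<Longrightarrow> n \<in> carrier N \<Longrightarrow> a \<odot>\<^bsub>N\<^esub> n = a \<odot>\<^bsub>N'\<^esub> n"
  shows "tens A M N = tens A M N'" "pure A M N = pure A M N'"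
proof -
  have "tens_eq A M N xs ys \<longleftrightarrow> tens_eq A M N' xs ys" for xs ys
  proof
    show "tens_eq A M N xs ys \<Longrightarrow> tens_eq A M N' xs ys"
      by (rule tens_eq_cong[OF assms(1,2,5)])
    show "tens_eq A M N' xs ys \<Longrightarrow> tens_eq A M N xs ys"
      by (rule tens_eq_cong[OF assms(1,2)[symmetric] assms(5)[symmetric]]) (simp_all add: assms(1))
  qed
  then have "tens_class A M N xs = tens_class A M N' xs" for xs
    unfolding tens_class_def by (intro Collect_cong)
  then have eq: "tens_class A M N = tens_class A M N'" by (rule ext)
  show "tens A M N = tens A M N'"
    unfolding tens_def pure_def eq by (simp add: assms(1,3,4))
  show "pure A M N = pure A M N'"
    unfolding pure_def eq ..
qed

text \<open>Degrees and coface indices are numerals throughout; rewriting 1 to a successor would hide them from the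
  rules below.\<close>

declare One_nat_def [simp del]

section \<open>The denormalisation in degrees at most two\<close>

lemma dg_zero_simps [simp]:
  "carrier (dg_zero B) = gr B 0" "monoid.mult (dg_zero B) = monoid.mult B"
  "monoid.one (dg_zero B) = monoid.one B" "ring.zero (dg_zero B) = ring.zero B"
  "ring.add (dg_zero B) = ring.add B" "smult (dg_zero B) = smult B"
  by (simp_all add: dg_zero_def)

lemma dg_mod_simps [simp]:
  "carrier (dg_mod B n) = gr B n"  "ring.zero (dg_mod B n) = ring.zero B"
  "ring.add (dg_mod B n) = ring.add B" "smult (dg_mod B n) = monoid.mult B"
  by (simp_all add: dg_mod_def)

text \<open>\<open>elt1 x y\<close> is the dual number \<open>\<partial>\<^sup>1x + y = x + y\<epsilon>\<close> of \<open>D\<^sup>1B\<close>: the key \<open>{1}\<close> carries degree 0, the empty key degree 1.\<close>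

definition elt1 :: "'b \<Rightarrow> 'b \<Rightarrow> nat set \<Rightarrow> 'b" where
  "elt1 x y = (\<lambda>I \<in> Pow {1..1}. if I = {} then y else x)"

text \<open>\<open>elt2 w x y z\<close> is \<open>\<partial>\<^sup>2\<partial>\<^sup>1w + \<partial>\<^sup>1x + \<partial>\<^sup>2y + z\<close> in \<open>D\<^sup>2B\<close>, with \<open>w\<close>, \<open>x\<close> and \<open>y\<close>, \<open>z\<close> of degrees 0, 1, 2.\<close>

definition elt2 :: "'b \<Rightarrow> 'b \<Rightarrow> 'b \<Rightarrow> 'b \<Rightarrow> nat set \<Rightarrow> 'b" where
  "elt2 w x y z = (\<lambda>I \<in> Pow {1..2}. if I = {} then z else if I = {1} then x else if I = {2} then y else w)"

lemma Pow1: "Pow {1..1::nat} = {{}, {1}}"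
  by (auto simp: Pow_def subset_singleton_iff)

lemma int12: "{1..2::nat} = {1, 2}" by auto

lemma sub12: "I \<subseteq> {1, 2::nat} \<longleftrightarrow> I = {} \<or> I = {1} \<or> I = {2} \<or> I = {1, 2}" by blast

lemma Pow2: "Pow {1..2::nat} = {{}, {1}, {2}, {1, 2}}"
  unfolding int12 Pow_def by (auto simp: sub12)

lemma subsets12: "{1, 2::nat} \<noteq> {1}" "{1, 2::nat} \<noteq> {2}" "{1::nat} \<noteq> {2}" "{2::nat} \<noteq> {1}"
  "{1} \<noteq> {1, 2::nat}" "{2} \<noteq> {1, 2::nat}" "{1, 2::nat} - {1} = {2}" "{1, 2::nat} - {2} = {1}"
  "{1, 2::nat} \<inter> {1} = {1}" "{1, 2::nat} \<inter> {2} = {2}" "card {1, 2::nat} = 2"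
  by (auto simp: doubleton_eq_iff)

text \<open>The nine products of components that do not vanish for degree reasons.\<close>

lemma complementary_degrees_2:
  "I \<in> {{}, {1}, {2}, {1, 2}} \<Longrightarrow> J \<in> {{}, {1}, {2}, {1, 2}} \<Longrightarrow>
    (2 - card I = card (J - I) \<and> 2 - card J = card (I - J)) \<longleftrightarrow>
    (I, J) \<in> {({1, 2}, {1, 2}), ({1, 2}, {1}), ({1}, {1, 2}), ({1, 2}, {2}), ({2}, {1, 2}),
      ({1, 2}, {}), ({1}, {2}), ({2}, {1}), ({}, {1, 2::nat})}"
  by (elim insertE emptyE; hypsubst) (simp_all add: subsets12 del: insert_Diff_if)

lemma elt1_eq_iff [simp]: "elt1 x y = elt1 x' y' \<longleftrightarrow> x = x' \<and> y = y'"
proof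
  assume "elt1 x y = elt1 x' y'"
  from fun_cong[OF this, of "{}"] fun_cong[OF this, of "{1}"] show "x = x' \<and> y = y'"
    by (simp add: elt1_def)
qed simp

lemma elt2_eq_iff [simp]: "elt2 w x y z = elt2 w' x' y' z' \<longleftrightarrow> w = w' \<and> x = x' \<and> y = y' \<and> z = z'"
proof
  assume eq: "elt2 w x y z = elt2 w' x' y' z'"
  show "w = w' \<and> x = x' \<and> y = y' \<and> z = z'"
    using fun_cong[OF eq, of "{}"] fun_cong[OF eq, of "{1}"] fun_cong[OF eq, of "{2}"]
      fun_cong[OF eq, of "{1, 2}"] by (simp add: elt2_def doubleton_eq_iff)
qed simp

lemma elt1_cases: "f \<in> extensional (Pow {1..1}) \<Longrightarrow> f = elt1 (f {1}) (f {})"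
proof (rule extensionalityI[of _ "Pow {1..1}"])
  fix I :: "nat set" assume "I \<in> Pow {1..1}"
  then have "I = {} \<or> I = {1}" unfolding Pow1 by simp
  then show "f I = elt1 (f {1}) (f {}) I" by (auto simp: elt1_def)
qed (simp_all add: elt1_def)

lemma elt2_cases: "f \<in> extensional (Pow {1..2}) \<Longrightarrow> f = elt2 (f {1, 2}) (f {1}) (f {2}) (f {})"
proof (rule extensionalityI[of _ "Pow {1..2}"])
  fix I :: "nat set" assume "I \<in> Pow {1..2}"
  then have "I = {} \<or> I = {1} \<or> I = {2} \<or> I = {1, 2}" unfolding Pow2 by simp
  then show "f I = elt2 (f {1, 2}) (f {1}) (f {2}) (f {}) I" by (auto simp: elt2_def doubleton_eq_iff)
qed (simp_all add: elt2_def)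

lemma elt1_eqI:
  "f \<in> extensional (Pow {1..1}) \<Longrightarrow> f {1} = x \<Longrightarrow> f {} = y \<Longrightarrow> f = elt1 x y"
  using elt1_cases by metis

lemma elt2_eqI:
  "f \<in> extensional (Pow {1..2}) \<Longrightarrow> f {1, 2} = w \<Longrightarrow> f {1} = x \<Longrightarrow> f {2} = y \<Longrightarrow> f {} = z
    \<Longrightarrow> f = elt2 w x y z"
  using elt2_cases by metis

lemma elt1_ext: "elt1 x y \<in> extensional (Pow {1..1})"
  by (simp add: elt1_def)

lemma elt2_ext: "elt2 w x y z \<in> extensional (Pow {1..2})"
  by (simp add: elt2_def)

lemma elt1_apply [simp]: "elt1 x y {1} = x" "elt1 x y {} = y"
  by (simp_all add: elt1_def)

lemma elt2_apply [simp]: "elt2 w x y z {1, 2} = w" "elt2 w x y z {1} = x" "elt2 w x y z {2} = y"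
  "elt2 w x y z {} = z"
  by (simp_all add: elt2_def doubleton_eq_iff)

lemma shuffle_inv_12 [simp]:
  "shuffle_inversions {1} {2} = 0" "shuffle_inversions {2} {1} = 1"
  "shuffle_inversions {} S = 0" "shuffle_inversions S {} = 0"
proof -
  have "{(s, t). s \<in> {2::nat} \<and> t \<in> {1} \<and> t < s} = {(2, 1)}" by auto
  then show "shuffle_inversions {2} {1} = 1" by (simp add: shuffle_inversions_def)
  have "{(s, t). s \<in> {1::nat} \<and> t \<in> {2} \<and> t < s} = {}" by auto
  then show "shuffle_inversions {1} {2} = 0" unfolding shuffle_inversions_def by (simp only: card.empty)
qed (simp_all add: shuffle_inversions_def)

lemma finsum_single:
  assumes "abelian_group M" "f i \<in> carrier M"
  shows "finsum M f {i} = f i"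
proof -
  interpret M: abelian_group M by fact
  show ?thesis using assms(2) by (simp add: M.finsum_insert)
qed

lemma finsum_pair:
  assumes "abelian_group M" "f i \<in> carrier M" "f j \<in> carrier M" "i \<noteq> j"
  shows "finsum M f {i, j} = f i \<oplus>\<^bsub>M\<^esub> f j"
proof -
  interpret M: abelian_group M by fact
  show ?thesis using assms(2-) by (simp add: M.finsum_insert)
qed

context dg_calg
begin

abbreviation "A0 \<equiv> dg_zero B"
abbreviation "D1 \<equiv> den B 1"
abbreviation "D2 \<equiv> den B 2"

lemma gr_carrier: "x \<in> gr B n \<Longrightarrow> x \<in> carrier B"
  using gr_submodule[of n] submoduleE(1) by blast

lemma gr_add: "x \<in> gr B n \<Longrightarrow> y \<in> gr B n \<Longrightarrow> x \<oplus>\<^bsub>B\<^esub> y \<in> gr B n"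
  using gr_submodule[of n] submoduleE(5) by blast

lemma gr_minus: "x \<in> gr B n \<Longrightarrow> \<ominus>\<^bsub>B\<^esub> x \<in> gr B n"
  using gr_submodule[of n] submoduleE(3) by blast

lemma gr_zero: "\<zero>\<^bsub>B\<^esub> \<in> gr B n"
  using subgroup.one_closed[OF submodule.axioms(1)[OF gr_submodule[of n]]] by simp

lemma gr_smult: "r \<in> carrier R \<Longrightarrow> x \<in> gr B n \<Longrightarrow> r \<odot>\<^bsub>B\<^esub> x \<in> gr B n"
  using gr_submodule[of n] submoduleE(4) by blast

lemma gr_mult0l: "x \<in> gr B 0 \<Longrightarrow> y \<in> gr B n \<Longrightarrow> x \<otimes>\<^bsub>B\<^esub> y \<in> gr B n"
  using mult_gr[of x 0 y n] by simp

lemma gr_mult0r: "x \<in> gr B n \<Longrightarrow> y \<in> gr B 0 \<Longrightarrow> x \<otimes>\<^bsub>B\<^esub> y \<in> gr B n"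
  using mult_gr[of x n y 0] by simp

lemma gr_mult11: "x \<in> gr B 1 \<Longrightarrow> y \<in> gr B 1 \<Longrightarrow> x \<otimes>\<^bsub>B\<^esub> y \<in> gr B 2"
  using mult_gr[of x 1 y 1] by simp

lemma diff_gr0: "x \<in> gr B 0 \<Longrightarrow> diff B x \<in> gr B 1"
  using diff_gr[of x 0] by (simp add: One_nat_def)

lemma diff_gr1: "x \<in> gr B 1 \<Longrightarrow> diff B x \<in> gr B 2"
  using diff_gr[of x 1] by simp

lemmas gr_closed = gr_add gr_minus gr_zero gr_smult gr_mult0l gr_mult0r gr_mult11 diff_gr0 diff_gr1
  one_gr diff_gr

lemma mult0_comm: "a \<in> gr B 0 \<Longrightarrow> x \<in> gr B n \<Longrightarrow> x \<otimes>\<^bsub>B\<^esub> a = a \<otimes>\<^bsub>B\<^esub> x"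
  using graded_comm[of x n a 0] by (simp add: signed_def)

lemma mult11_comm: "x \<in> gr B 1 \<Longrightarrow> y \<in> gr B 1 \<Longrightarrow> x \<otimes>\<^bsub>B\<^esub> y = \<ominus>\<^bsub>B\<^esub> (y \<otimes>\<^bsub>B\<^esub> x)"
  using graded_comm[of x 1 y 1] by (simp add: signed_def)

text \<open>That the differential preserves the whole algebra follows from its behaviour on homogeneous elements,
  by additivity over the decomposition into components.\<close>

lemma diff_hom: "diff B \<in> addhom B B"
proof (rule addhomI)
  fix x assume x: "x \<in> carrier B"
  show "diff B x \<in> carrier B"
  proof -
    obtain c where c: "\<forall>n. c n \<in> gr B n" "finite {n. c n \<noteq> \<zero>\<^bsub>B\<^esub>}"
      "x = (\<Oplus>\<^bsub>B\<^esub>n \<in> {n. c n \<noteq> \<zero>\<^bsub>B\<^esub>}. c n)"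
      using gr_direct_sum[OF x] by auto
    have z: "diff B \<zero>\<^bsub>B\<^esub> \<in> carrier B" using diff_gr[OF gr_zero] gr_carrier by blast
    have "finsum B c F \<in> carrier B \<and> diff B (finsum B c F) \<in> carrier B" if "finite F" for F
      using that
    proof (induction F)
      case (insert n F)
      have cl: "c n \<in> carrier B" "c \<in> F \<rightarrow> carrier B" "diff B (c n) \<in> carrier B"
        using c(1) gr_carrier diff_gr by blast+
      then show ?case using insert diff_add by (simp add: finsum_insert)
    qed (simp add: z)
    then show ?thesis using c by simp
  qed
qed (rule diff_add)

lemma diff_carrier: "x \<in> carrier B \<Longrightarrow> diff B x \<in> carrier B"
  using addhom_closed[OF diff_hom] .

lemma diff_zero: "diff B \<zero>\<^bsub>B\<^esub> = \<zero>\<^bsub>B\<^esub>"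
  using addhom_zero[OF diff_hom abelian_group_axioms abelian_group_axioms] .

lemma diff_mult0: "x \<in> gr B 0 \<Longrightarrow> y \<in> gr B n \<Longrightarrow>
    diff B (x \<otimes>\<^bsub>B\<^esub> y) = diff B x \<otimes>\<^bsub>B\<^esub> y \<oplus>\<^bsub>B\<^esub> x \<otimes>\<^bsub>B\<^esub> diff B y"
  using diff_mult[of x 0 y n] by (simp add: signed_def)

lemma diff_one: "diff B \<one>\<^bsub>B\<^esub> = \<zero>\<^bsub>B\<^esub>"
proof -
  have c: "diff B \<one>\<^bsub>B\<^esub> \<in> carrier B" using diff_gr[OF one_gr] gr_carrier by blast
  have "diff B \<one>\<^bsub>B\<^esub> \<oplus>\<^bsub>B\<^esub> diff B \<one>\<^bsub>B\<^esub> = diff B \<one>\<^bsub>B\<^esub>"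
    using diff_mult0[OF one_gr one_gr] c by simp
  then show ?thesis using c by (metis add.r_cancel_one')
qed

lemma abelian_group_gr:
  assumes "carrier M = gr B n" "ring.add M = ring.add B" "ring.zero M = ring.zero B"
  shows "abelian_group M"
proof (rule abelian_groupI)
  show "\<exists>y\<in>carrier M. y \<oplus>\<^bsub>M\<^esub> x = \<zero>\<^bsub>M\<^esub>" if "x \<in> carrier M" for x
    using that by (intro bexI[of _ "\<ominus>\<^bsub>B\<^esub> x"]) (simp_all add: assms gr_closed gr_carrier l_neg)
qed (simp_all add: assms gr_closed gr_carrier a_assoc, simp add: assms gr_carrier a_comm)

lemma A0_cring: "cring A0"
proof (rule cringI)
  show "abelian_group A0" by (rule abelian_group_gr) simp_all
  show "comm_monoid A0"
    by (rule comm_monoidI) (simp_all add: gr_closed gr_carrier m_assoc, simp add: mult0_comm[of _ _ 0])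
qed (simp add: gr_carrier l_distr)

lemma A0_algebra: "algebra R A0"
  by (rule algebraI) (simp_all add: A0_cring gr_closed gr_carrier smult_l_distr smult_r_distr
      smult_assoc1 smult_mult_left R.cring_axioms)

lemma dg_mod_module: "module A0 (dg_mod B n)"
proof (rule moduleI)
  show "abelian_group (dg_mod B n)" by (rule abelian_group_gr) simp_all
qed (simp_all add: A0_cring gr_closed gr_carrier l_distr r_distr m_assoc)

lemma R_unit_hom: "unit_map A0 \<in> ring_hom R A0"
  by (rule unit_map_hom[OF A0_algebra])

lemma den_simps:
  "carrier (den B n) = (\<Pi>\<^sub>E I \<in> Pow {1..n}. gr B (n - card I))"
  "\<zero>\<^bsub>den B n\<^esub> = (\<lambda>I \<in> Pow {1..n}. \<zero>\<^bsub>B\<^esub>)"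
  "x \<oplus>\<^bsub>den B n\<^esub> y = (\<lambda>I \<in> Pow {1..n}. x I \<oplus>\<^bsub>B\<^esub> y I)"
  "r \<odot>\<^bsub>den B n\<^esub> x = (\<lambda>I \<in> Pow {1..n}. r \<odot>\<^bsub>B\<^esub> x I)"
  "\<one>\<^bsub>den B n\<^esub> = den_elt B n {1..n} \<one>\<^bsub>B\<^esub>"
  "x \<otimes>\<^bsub>den B n\<^esub> y = den_mult B n x y"
  by (simp_all add: den_def)

lemma den_apply_carrier: "x \<in> carrier (den B n) \<Longrightarrow> I \<subseteq> {1..n} \<Longrightarrow> x I \<in> carrier B"
  using gr_carrier unfolding den_simps PiE_iff by blast

lemma den_abelian_group: "abelian_group (den B n)"
proof (rule abelian_groupI)
  fix x y z assume x: "x \<in> carrier (den B n)" and y: "y \<in> carrier (den B n)" and z: "z \<in> carrier (den B n)"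
  have c: "x I \<in> carrier B" "y I \<in> carrier B" "z I \<in> carrier B" if "I \<subseteq> {1..n}" for I
    using den_apply_carrier x y z that by blast+
  show "x \<oplus>\<^bsub>den B n\<^esub> y \<oplus>\<^bsub>den B n\<^esub> z = x \<oplus>\<^bsub>den B n\<^esub> (y \<oplus>\<^bsub>den B n\<^esub> z)"
    by (rule extensionalityI[of _ "Pow {1..n}"]) (auto simp: den_simps c a_assoc)
next
  fix x y assume x: "x \<in> carrier (den B n)" and y: "y \<in> carrier (den B n)"
  have c: "x I \<in> carrier B" "y I \<in> carrier B" if "I \<subseteq> {1..n}" for I
    using den_apply_carrier x y that by blast+
  show "x \<oplus>\<^bsub>den B n\<^esub> y = y \<oplus>\<^bsub>den B n\<^esub> x"
    by (rule extensionalityI[of _ "Pow {1..n}"]) (auto simp: den_simps c a_comm)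
  show "x \<oplus>\<^bsub>den B n\<^esub> y \<in> carrier (den B n)"
    using x y gr_closed(1) by (auto simp: den_simps PiE_iff)
next
  show "\<zero>\<^bsub>den B n\<^esub> \<in> carrier (den B n)" using gr_zero by (auto simp: den_simps)
next
  fix x assume x: "x \<in> carrier (den B n)"
  have c: "x I \<in> carrier B" if "I \<subseteq> {1..n}" for I
    using den_apply_carrier x that by blast
  have ex: "x \<in> extensional (Pow {1..n})" using x by (auto simp: den_simps PiE_iff)
  show "\<zero>\<^bsub>den B n\<^esub> \<oplus>\<^bsub>den B n\<^esub> x = x"
    by (rule extensionalityI[of _ "Pow {1..n}"]) (auto simp: den_simps c ex)
  show "\<exists>y\<in>carrier (den B n). y \<oplus>\<^bsub>den B n\<^esub> x = \<zero>\<^bsub>den B n\<^esub>"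
  proof
    show "(\<lambda>I \<in> Pow {1..n}. \<ominus>\<^bsub>B\<^esub> x I) \<in> carrier (den B n)"
      using x gr_minus by (auto simp: den_simps PiE_iff)
    show "(\<lambda>I \<in> Pow {1..n}. \<ominus>\<^bsub>B\<^esub> x I) \<oplus>\<^bsub>den B n\<^esub> x = \<zero>\<^bsub>den B n\<^esub>"
      by (rule extensionalityI[of _ "Pow {1..n}"]) (auto simp: den_simps c l_neg)
  qed
qed

subsection \<open>Degree one\<close>

lemma D1_carrier: "elt1 x y \<in> carrier D1 \<longleftrightarrow> x \<in> gr B 0 \<and> y \<in> gr B 1"
  using elt1_ext[of x y] unfolding den_simps(1) PiE_iff Pow1 by auto

lemma D1E:
  assumes "c \<in> carrier D1"
  obtains x y where "c = elt1 x y" "x \<in> gr B 0" "y \<in> gr B 1"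
proof -
  have "c = elt1 (c {1}) (c {})" using assms by (intro elt1_cases) (auto simp: den_simps PiE_iff)
  then show ?thesis using that D1_carrier assms by metis
qed

lemma D1_zero: "\<zero>\<^bsub>D1\<^esub> = elt1 \<zero>\<^bsub>B\<^esub> \<zero>\<^bsub>B\<^esub>"
  by (auto simp: den_simps elt1_def)

lemma D1_add: "elt1 x y \<oplus>\<^bsub>D1\<^esub> elt1 x' y' = elt1 (x \<oplus>\<^bsub>B\<^esub> x') (y \<oplus>\<^bsub>B\<^esub> y')"
  by (rule elt1_eqI) (simp_all add: den_simps)

lemma D1_smult: "r \<odot>\<^bsub>D1\<^esub> elt1 x y = elt1 (r \<odot>\<^bsub>B\<^esub> x) (r \<odot>\<^bsub>B\<^esub> y)"
  by (rule elt1_eqI) (simp_all add: den_simps)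

lemma den_elt_1: "den_elt B 1 {} b = elt1 \<zero>\<^bsub>B\<^esub> b" "den_elt B 1 {1} a = elt1 a \<zero>\<^bsub>B\<^esub>"
  by (rule elt1_eqI; simp add: den_elt_def)+

lemma D1_one: "\<one>\<^bsub>D1\<^esub> = elt1 \<one>\<^bsub>B\<^esub> \<zero>\<^bsub>B\<^esub>"
  by (simp add: den_simps den_elt_1)

text \<open>The term \<open>y y'\<close> is missing: infinitesimals have square zero.\<close>

lemma D1_mult:
  assumes "x \<in> gr B 0" "y \<in> gr B 1" "x' \<in> gr B 0" "y' \<in> gr B 1"
  shows "elt1 x y \<otimes>\<^bsub>D1\<^esub> elt1 x' y' = elt1 (x \<otimes>\<^bsub>B\<^esub> x') (x \<otimes>\<^bsub>B\<^esub> y' \<oplus>\<^bsub>B\<^esub> y \<otimes>\<^bsub>B\<^esub> x')"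
proof (rule elt1_eqI)
  note c = assms[THEN gr_carrier]
  show "elt1 x y \<otimes>\<^bsub>D1\<^esub> elt1 x' y' \<in> extensional (Pow {1..1})"
    by (simp add: den_simps den_mult_def)
  have 1: "{(I, J). I \<subseteq> {1..1::nat} \<and> J \<subseteq> {1..1} \<and> I \<inter> J = {1} \<and>
      1 - card I = card (J - I) \<and> 1 - card J = card (I - J)} = {({1}, {1})}"
    by (auto simp: subset_singleton_iff)
  have 2: "{(I, J). I \<subseteq> {1..1::nat} \<and> J \<subseteq> {1..1} \<and> I \<inter> J = {} \<and>
      1 - card I = card (J - I) \<and> 1 - card J = card (I - J)} = {({1}, {}), ({}, {1})}"
    by (auto simp: subset_singleton_iff)
  show "(elt1 x y \<otimes>\<^bsub>D1\<^esub> elt1 x' y') {1} = x \<otimes>\<^bsub>B\<^esub> x'"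
    using c by (simp add: den_simps den_mult_def 1 signed_def finsum_insert del: atLeastAtMost_singleton)
  show "(elt1 x y \<otimes>\<^bsub>D1\<^esub> elt1 x' y') {} = x \<otimes>\<^bsub>B\<^esub> y' \<oplus>\<^bsub>B\<^esub> y \<otimes>\<^bsub>B\<^esub> x'"
    using c by (simp add: den_simps den_mult_def 2 signed_def finsum_insert del: atLeastAtMost_singleton)
qed

lemma D1_cring: "cring D1"
proof (rule cringI[OF den_abelian_group])
  show "comm_monoid D1"
  proof (rule comm_monoidI)
    fix u v w assume "u \<in> carrier D1" "v \<in> carrier D1" "w \<in> carrier D1"
    then show "u \<otimes>\<^bsub>D1\<^esub> v \<otimes>\<^bsub>D1\<^esub> w = u \<otimes>\<^bsub>D1\<^esub> (v \<otimes>\<^bsub>D1\<^esub> w)"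
      by (elim D1E) (simp add: D1_mult gr_closed gr_carrier l_distr r_distr m_assoc a_assoc)
  next
    fix u v assume uv: "u \<in> carrier D1" "v \<in> carrier D1"
    then show "u \<otimes>\<^bsub>D1\<^esub> v \<in> carrier D1"
      by (elim D1E) (simp add: D1_mult D1_carrier gr_closed)
    from uv show "u \<otimes>\<^bsub>D1\<^esub> v = v \<otimes>\<^bsub>D1\<^esub> u"
    proof (elim D1E)
      fix x y x' y' assume h: "u = elt1 x y" "v = elt1 x' y'"
        "x \<in> gr B 0" "y \<in> gr B 1" "x' \<in> gr B 0" "y' \<in> gr B 1"
      have "x' \<otimes>\<^bsub>B\<^esub> x = x \<otimes>\<^bsub>B\<^esub> x'" "x' \<otimes>\<^bsub>B\<^esub> y = y \<otimes>\<^bsub>B\<^esub> x'" "y' \<otimes>\<^bsub>B\<^esub> x = x \<otimes>\<^bsub>B\<^esub> y'"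
        using h mult0_comm by metis+
      with h show ?thesis
        by (simp add: D1_mult gr_carrier a_comm)
    qed
  qed (simp add: D1_one D1_carrier gr_closed,
      elim D1E, simp add: D1_one D1_mult D1_carrier gr_closed gr_carrier)
  fix u v w assume "u \<in> carrier D1" "v \<in> carrier D1" "w \<in> carrier D1"
  then show "(u \<oplus>\<^bsub>D1\<^esub> v) \<otimes>\<^bsub>D1\<^esub> w = u \<otimes>\<^bsub>D1\<^esub> w \<oplus>\<^bsub>D1\<^esub> v \<otimes>\<^bsub>D1\<^esub> w"
    by (elim D1E) (simp add: D1_add D1_mult gr_closed gr_carrier l_distr a_ac)
qed

subsection \<open>Degree two\<close>

lemma D2_carrier: "elt2 w x y z \<in> carrier D2 \<longleftrightarrow> w \<in> gr B 0 \<and> x \<in> gr B 1 \<and> y \<in> gr B 1 \<and> z \<in> gr B 2"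
  using elt2_ext[of w x y z] unfolding den_simps(1) PiE_iff Pow2 by auto

lemma D2E:
  assumes "c \<in> carrier D2"
  obtains w x y z where "c = elt2 w x y z" "w \<in> gr B 0" "x \<in> gr B 1" "y \<in> gr B 1" "z \<in> gr B 2"
proof -
  have "c = elt2 (c {1, 2}) (c {1}) (c {2}) (c {})" using assms by (intro elt2_cases) (auto simp: den_simps PiE_iff)
  then show ?thesis using that D2_carrier assms by metis
qed

lemma D2_add: "elt2 w x y z \<oplus>\<^bsub>D2\<^esub> elt2 w' x' y' z'
    = elt2 (w \<oplus>\<^bsub>B\<^esub> w') (x \<oplus>\<^bsub>B\<^esub> x') (y \<oplus>\<^bsub>B\<^esub> y') (z \<oplus>\<^bsub>B\<^esub> z')"
  by (rule elt2_eqI) (simp_all add: den_simps)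

lemma den_elt_2: "den_elt B 2 {} b = elt2 \<zero>\<^bsub>B\<^esub> \<zero>\<^bsub>B\<^esub> \<zero>\<^bsub>B\<^esub> b" "den_elt B 2 {1} b = elt2 \<zero>\<^bsub>B\<^esub> b \<zero>\<^bsub>B\<^esub> \<zero>\<^bsub>B\<^esub>"
  "den_elt B 2 {2} b = elt2 \<zero>\<^bsub>B\<^esub> \<zero>\<^bsub>B\<^esub> b \<zero>\<^bsub>B\<^esub>" "den_elt B 2 {1, 2} b = elt2 b \<zero>\<^bsub>B\<^esub> \<zero>\<^bsub>B\<^esub> \<zero>\<^bsub>B\<^esub>"
  by (rule elt2_eqI; simp add: den_elt_def doubleton_eq_iff)+

lemma D2_one: "\<one>\<^bsub>D2\<^esub> = elt2 \<one>\<^bsub>B\<^esub> \<zero>\<^bsub>B\<^esub> \<zero>\<^bsub>B\<^esub> \<zero>\<^bsub>B\<^esub>"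
  by (simp add: den_simps int12 den_elt_2)

text \<open>The two products of one-forms come from the shuffles \<open>({2}, {1})\<close>, which is odd, and \<open>({1}, {2})\<close>, which
  is even. Their opposite signs are what turns the cocycle condition into a statement about curvature.\<close>

lemma D2_mult:
  assumes "w \<in> gr B 0" "x \<in> gr B 1" "y \<in> gr B 1" "z \<in> gr B 2"
    "w' \<in> gr B 0" "x' \<in> gr B 1" "y' \<in> gr B 1" "z' \<in> gr B 2"
  shows "elt2 w x y z \<otimes>\<^bsub>D2\<^esub> elt2 w' x' y' z' = elt2 (w \<otimes>\<^bsub>B\<^esub> w')
    (w \<otimes>\<^bsub>B\<^esub> x' \<oplus>\<^bsub>B\<^esub> x \<otimes>\<^bsub>B\<^esub> w') (w \<otimes>\<^bsub>B\<^esub> y' \<oplus>\<^bsub>B\<^esub> y \<otimes>\<^bsub>B\<^esub> w')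
    (w \<otimes>\<^bsub>B\<^esub> z' \<oplus>\<^bsub>B\<^esub> (\<ominus>\<^bsub>B\<^esub> (x \<otimes>\<^bsub>B\<^esub> y') \<oplus>\<^bsub>B\<^esub> (y \<otimes>\<^bsub>B\<^esub> x' \<oplus>\<^bsub>B\<^esub> z \<otimes>\<^bsub>B\<^esub> w')))"
proof (rule elt2_eqI)
  note c = assms[THEN gr_carrier]
  let ?S = "\<lambda>K. {(I, J). I \<subseteq> {1..2::nat} \<and> J \<subseteq> {1..2} \<and> I \<inter> J = K \<and>
      2 - card I = card (J - I) \<and> 2 - card J = card (I - J)}"
  show "elt2 w x y z \<otimes>\<^bsub>D2\<^esub> elt2 w' x' y' z' \<in> extensional (Pow {1..2})"
    by (simp add: den_simps den_mult_def)
  have S: "(I, J) \<in> ?S K \<longleftrightarrow> (I, J) \<in> {({1, 2}, {1, 2}), ({1, 2}, {1}), ({1}, {1, 2}),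
      ({1, 2}, {2}), ({2}, {1, 2}), ({1, 2}, {}), ({1}, {2}), ({2}, {1}), ({}, {1, 2})} \<and> I \<inter> J = K"
    (is "_ \<longleftrightarrow> _ \<in> ?L \<and> _") for I J K
  proof -
    have "?L \<subseteq> {{}, {1}, {2}, {1, 2}} \<times> {{}, {1}, {2}, {1, 2}}" by simp
    then have "(I, J) \<in> ?L \<Longrightarrow> I \<in> Pow {1..2} \<and> J \<in> Pow {1..2}" unfolding Pow2 by blast
    moreover have "I \<in> Pow {1..2} \<Longrightarrow> J \<in> Pow {1..2} \<Longrightarrow>
        (2 - card I = card (J - I) \<and> 2 - card J = card (I - J)) \<longleftrightarrow> (I, J) \<in> ?L"
      unfolding Pow2 by (rule complementary_degrees_2)
    ultimately show ?thesis unfolding mem_Collect_eq prod.case Pow_iff by iprover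
  qed
  have ins: "{x. x \<in> insert a L \<and> Q x} = (if Q a then insert a {x. x \<in> L \<and> Q x} else {x. x \<in> L \<and> Q x})"
    for a L and Q :: "nat set \<times> nat set \<Rightarrow> bool" by auto
  have S': "?S K = {x. x \<in> {({1, 2}, {1, 2}), ({1, 2}, {1}), ({1}, {1, 2}),
      ({1, 2}, {2}), ({2}, {1, 2}), ({1, 2}, {}), ({1}, {2}), ({2}, {1}), ({}, {1, 2})} \<and>
      fst x \<inter> snd x = K}" for K
  proof (rule Set.set_eqI)
    fix x :: "nat set \<times> nat set"
    obtain I J where x: "x = (I, J)" by (cases x)
    show "x \<in> ?S K \<longleftrightarrow> x \<in> {x. x \<in> {({1, 2}, {1, 2}), ({1, 2}, {1}), ({1}, {1, 2}),
      ({1, 2}, {2}), ({2}, {1, 2}), ({1, 2}, {}), ({1}, {2}), ({2}, {1}), ({}, {1, 2})} \<and>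
      fst x \<inter> snd x = K}"
      using S[of I J K] unfolding x mem_Collect_eq fst_conv snd_conv .
  qed
  have 1: "?S {1, 2} = {({1, 2}, {1, 2})}"
    unfolding S' ins by (simp add: subsets12 del: insert_Diff_if)
  have 2: "?S {1} = {({1, 2}, {1}), ({1}, {1, 2})}"
    unfolding S' ins by (simp add: subsets12 del: insert_Diff_if)
  have 3: "?S {2} = {({1, 2}, {2}), ({2}, {1, 2})}"
    unfolding S' ins by (simp add: subsets12 del: insert_Diff_if)
  have 4: "?S {} = {({1, 2}, {}), ({1}, {2}), ({2}, {1}), ({}, {1, 2})}"
    unfolding S' ins by (simp add: subsets12 del: insert_Diff_if)
  note s = den_simps den_mult_def signed_def finsum_insert subsets12
  show "(elt2 w x y z \<otimes>\<^bsub>D2\<^esub> elt2 w' x' y' z') {1, 2} = w \<otimes>\<^bsub>B\<^esub> w'"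
    using c by (simp add: s 1)
  show "(elt2 w x y z \<otimes>\<^bsub>D2\<^esub> elt2 w' x' y' z') {1} = w \<otimes>\<^bsub>B\<^esub> x' \<oplus>\<^bsub>B\<^esub> x \<otimes>\<^bsub>B\<^esub> w'"
    using c by (simp add: s 2)
  show "(elt2 w x y z \<otimes>\<^bsub>D2\<^esub> elt2 w' x' y' z') {2} = w \<otimes>\<^bsub>B\<^esub> y' \<oplus>\<^bsub>B\<^esub> y \<otimes>\<^bsub>B\<^esub> w'"
    using c by (simp add: s 3)
  show "(elt2 w x y z \<otimes>\<^bsub>D2\<^esub> elt2 w' x' y' z') {} =
      w \<otimes>\<^bsub>B\<^esub> z' \<oplus>\<^bsub>B\<^esub> (\<ominus>\<^bsub>B\<^esub> (x \<otimes>\<^bsub>B\<^esub> y') \<oplus>\<^bsub>B\<^esub> (y \<otimes>\<^bsub>B\<^esub> x' \<oplus>\<^bsub>B\<^esub> z \<otimes>\<^bsub>B\<^esub> w'))"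
    using c by (simp add: s 4)
qed

lemma D2_cring: "cring D2"
proof (rule cringI[OF den_abelian_group])
  show "comm_monoid D2"
  proof (rule comm_monoidI)
    fix u v w assume "u \<in> carrier D2" "v \<in> carrier D2" "w \<in> carrier D2"
    then show "u \<otimes>\<^bsub>D2\<^esub> v \<otimes>\<^bsub>D2\<^esub> w = u \<otimes>\<^bsub>D2\<^esub> (v \<otimes>\<^bsub>D2\<^esub> w)"
      by (elim D2E) (simp add: D2_mult gr_closed gr_carrier l_distr r_distr m_assoc l_minus r_minus minus_add a_ac)
  next
    fix u v assume uv: "u \<in> carrier D2" "v \<in> carrier D2"
    then show "u \<otimes>\<^bsub>D2\<^esub> v \<in> carrier D2"
      by (elim D2E) (simp add: D2_mult D2_carrier gr_closed)
    from uv show "u \<otimes>\<^bsub>D2\<^esub> v = v \<otimes>\<^bsub>D2\<^esub> u"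
    proof (elim D2E)
      fix w x y z w' x' y' z' assume h: "u = elt2 w x y z" "v = elt2 w' x' y' z'"
        "w \<in> gr B 0" "x \<in> gr B 1" "y \<in> gr B 1" "z \<in> gr B 2"
        "w' \<in> gr B 0" "x' \<in> gr B 1" "y' \<in> gr B 1" "z' \<in> gr B 2"
      have "x' \<otimes>\<^bsub>B\<^esub> y = \<ominus>\<^bsub>B\<^esub> (y \<otimes>\<^bsub>B\<^esub> x')" "y' \<otimes>\<^bsub>B\<^esub> x = \<ominus>\<^bsub>B\<^esub> (x \<otimes>\<^bsub>B\<^esub> y')"
        using h mult11_comm by blast+
      moreover have "w' \<otimes>\<^bsub>B\<^esub> w = w \<otimes>\<^bsub>B\<^esub> w'" "w' \<otimes>\<^bsub>B\<^esub> x = x \<otimes>\<^bsub>B\<^esub> w'" "w' \<otimes>\<^bsub>B\<^esub> y = y \<otimes>\<^bsub>B\<^esub> w'"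
        "w' \<otimes>\<^bsub>B\<^esub> z = z \<otimes>\<^bsub>B\<^esub> w'" "x' \<otimes>\<^bsub>B\<^esub> w = w \<otimes>\<^bsub>B\<^esub> x'" "y' \<otimes>\<^bsub>B\<^esub> w = w \<otimes>\<^bsub>B\<^esub> y'"
        "z' \<otimes>\<^bsub>B\<^esub> w = w \<otimes>\<^bsub>B\<^esub> z'"
        using h mult0_comm by metis+
      ultimately show ?thesis
        using h by (simp add: D2_mult gr_carrier a_ac)
    qed
  qed (simp add: D2_one D2_carrier gr_closed,
      elim D2E, simp add: D2_one D2_mult D2_carrier gr_closed gr_carrier)
  fix u v w assume "u \<in> carrier D2" "v \<in> carrier D2" "w \<in> carrier D2"
  then show "(u \<oplus>\<^bsub>D2\<^esub> v) \<otimes>\<^bsub>D2\<^esub> w = u \<otimes>\<^bsub>D2\<^esub> w \<oplus>\<^bsub>D2\<^esub> v \<otimes>\<^bsub>D2\<^esub> w"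
    by (elim D2E) (simp add: D2_add D2_mult gr_closed gr_carrier l_distr minus_add a_ac)
qed

subsection \<open>Cofaces\<close>

abbreviation "d0 \<equiv> den_coface_zero B 0"
abbreviation "d1 \<equiv> den_coface_zero B 1"
abbreviation "th \<equiv> den_coface B 1"

lemma den_elt_D1: "a \<in> gr B 0 \<Longrightarrow> den_elt B 1 {1} a \<in> carrier D1"
  "b \<in> gr B 1 \<Longrightarrow> den_elt B 1 {} b \<in> carrier D1"
  by (simp_all add: den_elt_1 D1_carrier gr_closed)

lemma insert_index_simps [simp]:
  "insert_index i {} = {i}" "insert_index 1 {1} = {1, 2}" "insert_index 2 {1} = {1, 2}"
proof -
  have "{j::nat. j = 1 \<and> j < 1} = {}" "{j::nat. j = 1 \<and> 1 \<le> j} = {1}" "{j::nat. j = 1 \<and> j < 2} = {1}"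
    "{j::nat. j = 1 \<and> 2 \<le> j} = {}" by auto
  then show "insert_index i {} = {i}" "insert_index 1 {1} = {1, 2}" "insert_index 2 {1} = {1, 2}"
    by (auto simp: insert_index_def)
qed

lemma den_elt_0: "den_elt B 0 {} a {} = a" by (simp add: den_elt_def)

lemma d1_eq:
  assumes "a \<in> gr B 0" shows "d1 a = elt1 a \<zero>\<^bsub>B\<^esub>"
proof -
  have "d1 a = (\<Oplus>\<^bsub>D1\<^esub>I\<in>{{}}. den_elt B 1 (insert_index 1 I) (den_elt B 0 {} a I))"
    by (simp add: den_coface_zero_def den_coface_def den_coface_pos_def flip: One_nat_def)
  also have "\<dots> = den_elt B 1 {1} a"
    using assms by (subst finsum_single[OF den_abelian_group]) (simp_all add: den_elt_0 den_elt_D1)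
  finally show ?thesis by (simp add: den_elt_1)
qed

lemma coface0_homog_0:
  assumes "a \<in> gr B 0" shows "den_coface0_homog B 0 a = elt1 a (diff B a)"
proof -
  have s: "signed B (Suc 1) a = a" by (simp add: signed_def)
  have "(\<Oplus>\<^bsub>D1\<^esub>i \<in> {1}. den_elt B 1 {i} (signed B (Suc i) a)) = den_elt B 1 {1} a"
    using assms by (subst finsum_single[OF den_abelian_group]) (simp_all add: den_elt_D1 s del: Suc_1)
  then show ?thesis
    using assms by (simp add: den_coface0_homog_def One_nat_def[symmetric] den_elt_1 D1_add gr_closed gr_carrier diff_carrier)
qed

lemma d0_eq:
  assumes "a \<in> gr B 0" shows "d0 a = elt1 a (diff B a)"
proof -
  have "d0 a = (\<Oplus>\<^bsub>D1\<^esub>I\<in>{{}}. den_coface_seq B (Suc (0 - card I)) (map Suc (sorted_list_of_set I))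
        (den_coface0_homog B (0 - card I) (den_elt B 0 {} a I)))"
    by (simp add: den_coface_zero_def den_coface_def den_coface0_def flip: One_nat_def)
  also have "\<dots> = elt1 a (diff B a)"
    using assms by (subst finsum_single[OF den_abelian_group]) (simp_all add: den_elt_0 coface0_homog_0 D1_carrier gr_closed)
  finally show ?thesis .
qed

lemma th_pos_eq:
  assumes "i = 1 \<or> i = 2" "a \<in> gr B 0" "b \<in> gr B 1"
  shows "den_coface_pos B 1 i (elt1 a b) = den_elt B 2 {1, 2} a \<oplus>\<^bsub>D2\<^esub> den_elt B 2 {i} b"
proof -
  have "den_coface_pos B 1 i (elt1 a b) = (\<Oplus>\<^bsub>D2\<^esub>I\<in>{{1}, {}}. den_elt B 2 (insert_index i I) (elt1 a b I))"
    unfolding den_coface_pos_def Pow1 Suc_1 by (simp add: insert_commute)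
  also have "\<dots> = den_elt B 2 {1, 2} a \<oplus>\<^bsub>D2\<^esub> den_elt B 2 {i} b"
    using assms by (subst finsum_pair[OF den_abelian_group])
      (auto simp: den_elt_2 D2_carrier gr_closed)
  finally show ?thesis .
qed

lemma th1_eq: "a \<in> gr B 0 \<Longrightarrow> b \<in> gr B 1 \<Longrightarrow> th 1 (elt1 a b) = elt2 a b \<zero>\<^bsub>B\<^esub> \<zero>\<^bsub>B\<^esub>"
  by (simp add: den_coface_def th_pos_eq den_elt_2 D2_add gr_carrier)

lemma th2_eq: "a \<in> gr B 0 \<Longrightarrow> b \<in> gr B 1 \<Longrightarrow> th 2 (elt1 a b) = elt2 a \<zero>\<^bsub>B\<^esub> b \<zero>\<^bsub>B\<^esub>"
  by (simp add: den_coface_def th_pos_eq den_elt_2 D2_add gr_carrier)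

text \<open>The only coface that involves the differential; on a one-form \<open>b\<close> it is \<open>\<partial>\<^sup>0b = \<partial>b + \<partial>\<^sup>1b - \<partial>\<^sup>2b\<close>.\<close>

lemma th0_eq:
  assumes a: "a \<in> gr B 0" and b: "b \<in> gr B 1"
  shows "th 0 (elt1 a b) = elt2 a b (diff B a \<ominus>\<^bsub>B\<^esub> b) (diff B b)"
proof -
  have s: "signed B (Suc 1) b = b" "signed B 3 b = \<ominus>\<^bsub>B\<^esub> b" by (simp_all add: signed_def)
  have "(\<Oplus>\<^bsub>D2\<^esub>i \<in> {1, 2}. den_elt B 2 {i} (signed B (Suc i) b)) = den_elt B 2 {1} b \<oplus>\<^bsub>D2\<^esub> den_elt B 2 {2} (\<ominus>\<^bsub>B\<^esub> b)"
    using b by (subst finsum_pair[OF den_abelian_group])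
      (simp_all add: s den_elt_2 D2_carrier gr_closed del: Suc_1)
  then have h1: "den_coface0_homog B 1 b = elt2 \<zero>\<^bsub>B\<^esub> b (\<ominus>\<^bsub>B\<^esub> b) (diff B b)"
    using b by (simp add: den_coface0_homog_def int12 den_elt_2 D2_add gr_closed gr_carrier diff_carrier)
  have seq: "den_coface_seq B 1 [2] (elt1 a (diff B a)) = elt2 a \<zero>\<^bsub>B\<^esub> (diff B a) \<zero>\<^bsub>B\<^esub>"
    using a by (simp add: th_pos_eq den_elt_2 D2_add gr_closed gr_carrier diff_carrier)
  have "th 0 (elt1 a b) = (\<Oplus>\<^bsub>D2\<^esub>I\<in>{{1}, {}}. den_coface_seq B (Suc (1 - card I)) (map Suc (sorted_list_of_set I))
        (den_coface0_homog B (1 - card I) (elt1 a b I)))"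
    unfolding den_coface_def den_coface0_def Pow1 Suc_1 by (simp add: insert_commute)
  also have "\<dots> = elt2 a \<zero>\<^bsub>B\<^esub> (diff B a) \<zero>\<^bsub>B\<^esub> \<oplus>\<^bsub>D2\<^esub> elt2 \<zero>\<^bsub>B\<^esub> b (\<ominus>\<^bsub>B\<^esub> b) (diff B b)"
  proof -
    let ?f = "\<lambda>I. den_coface_seq B (Suc (1 - card I)) (map Suc (sorted_list_of_set I))
        (den_coface0_homog B (1 - card I) (elt1 a b I))"
    have 1: "?f {1} = elt2 a \<zero>\<^bsub>B\<^esub> (diff B a) \<zero>\<^bsub>B\<^esub>"
      using seq a by (simp add: coface0_homog_0 flip: One_nat_def)
    have 2: "?f {} = elt2 \<zero>\<^bsub>B\<^esub> b (\<ominus>\<^bsub>B\<^esub> b) (diff B b)"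
      by (simp add: h1)
    show ?thesis
      using a b by (subst finsum_pair[OF den_abelian_group]; (subst 1)?; (subst 2)?)
        (simp_all add: D2_carrier gr_closed)
  qed
  also have "\<dots> = elt2 a b (diff B a \<ominus>\<^bsub>B\<^esub> b) (diff B b)"
    using a b by (simp add: D2_add gr_closed gr_carrier diff_carrier a_minus_def)
  finally show ?thesis .
qed

lemma d_hom: "d0 \<in> ring_hom A0 D1" "d1 \<in> ring_hom A0 D1"
proof -
  show "d1 \<in> ring_hom A0 D1"
    by (rule ring_hom_memI) (simp_all add: d1_eq D1_carrier D1_mult D1_add D1_one gr_closed gr_carrier diff_carrier)
  show "d0 \<in> ring_hom A0 D1"
  proof (rule ring_hom_memI)
    fix x y assume "x \<in> carrier A0" "y \<in> carrier A0"
    then show "d0 (x \<otimes>\<^bsub>A0\<^esub> y) = d0 x \<otimes>\<^bsub>D1\<^esub> d0 y"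
      by (simp add: d0_eq D1_mult gr_closed gr_carrier diff_carrier diff_mult0 diff_carrier a_comm)
  qed (simp_all add: d0_eq D1_carrier D1_add D1_one gr_closed gr_carrier diff_carrier diff_add diff_one)
qed

lemma D1_ring_homI:
  assumes "\<And>x y. x \<in> gr B 0 \<Longrightarrow> y \<in> gr B 1 \<Longrightarrow> f (elt1 x y) \<in> carrier S"
    and "\<And>x y x' y'. x \<in> gr B 0 \<Longrightarrow> y \<in> gr B 1 \<Longrightarrow> x' \<in> gr B 0 \<Longrightarrow> y' \<in> gr B 1 \<Longrightarrow>
      f (elt1 x y \<otimes>\<^bsub>D1\<^esub> elt1 x' y') = f (elt1 x y) \<otimes>\<^bsub>S\<^esub> f (elt1 x' y')"
    and "\<And>x y x' y'. x \<in> gr B 0 \<Longrightarrow> y \<in> gr B 1 \<Longrightarrow> x' \<in> gr B 0 \<Longrightarrow> y' \<in> gr B 1 \<Longrightarrow>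
      f (elt1 x y \<oplus>\<^bsub>D1\<^esub> elt1 x' y') = f (elt1 x y) \<oplus>\<^bsub>S\<^esub> f (elt1 x' y')"
    and "f \<one>\<^bsub>D1\<^esub> = \<one>\<^bsub>S\<^esub>"
  shows "f \<in> ring_hom D1 S"
  using assms D1E by (intro ring_hom_memI) metis+

lemma th_hom: "th 0 \<in> ring_hom D1 D2" "th 1 \<in> ring_hom D1 D2" "th 2 \<in> ring_hom D1 D2"
proof -
  show "th 1 \<in> ring_hom D1 D2"
  proof (rule D1_ring_homI)
    fix x y x' y' assume h: "x \<in> gr B 0" "y \<in> gr B 1" "x' \<in> gr B 0" "y' \<in> gr B 1"
    show "th 1 (elt1 x y) \<in> carrier D2" using h by (simp add: th1_eq D2_carrier gr_closed)
    show "th 1 (elt1 x y \<otimes>\<^bsub>D1\<^esub> elt1 x' y') = th 1 (elt1 x y) \<otimes>\<^bsub>D2\<^esub> th 1 (elt1 x' y')"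
      using h by (simp add: D1_mult th1_eq D2_mult gr_closed gr_carrier)
    show "th 1 (elt1 x y \<oplus>\<^bsub>D1\<^esub> elt1 x' y') = th 1 (elt1 x y) \<oplus>\<^bsub>D2\<^esub> th 1 (elt1 x' y')"
      using h by (simp add: D1_add th1_eq D2_add gr_closed gr_carrier)
  qed (simp add: D1_one D2_one th1_eq gr_closed)
  show "th 2 \<in> ring_hom D1 D2"
  proof (rule D1_ring_homI)
    fix x y x' y' assume h: "x \<in> gr B 0" "y \<in> gr B 1" "x' \<in> gr B 0" "y' \<in> gr B 1"
    show "th 2 (elt1 x y) \<in> carrier D2" using h by (simp add: th2_eq D2_carrier gr_closed)
    show "th 2 (elt1 x y \<otimes>\<^bsub>D1\<^esub> elt1 x' y') = th 2 (elt1 x y) \<otimes>\<^bsub>D2\<^esub> th 2 (elt1 x' y')"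
      using h by (simp add: D1_mult th2_eq D2_mult gr_closed gr_carrier)
    show "th 2 (elt1 x y \<oplus>\<^bsub>D1\<^esub> elt1 x' y') = th 2 (elt1 x y) \<oplus>\<^bsub>D2\<^esub> th 2 (elt1 x' y')"
      using h by (simp add: D1_add th2_eq D2_add gr_closed gr_carrier)
  qed (simp add: D1_one D2_one th2_eq gr_closed)
  show "th 0 \<in> ring_hom D1 D2"
  proof (rule D1_ring_homI)
    fix x y x' y' assume h: "x \<in> gr B 0" "y \<in> gr B 1" "x' \<in> gr B 0" "y' \<in> gr B 1"
    have g: "diff B x \<in> gr B 1" "diff B x' \<in> gr B 1" "diff B y \<in> gr B 2" "diff B y' \<in> gr B 2"
      using h by (simp_all add: diff_gr0 diff_gr1)
    note hc = h[THEN gr_carrier] g[THEN gr_carrier]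
    have d: "diff B (x \<otimes>\<^bsub>B\<^esub> y' \<oplus>\<^bsub>B\<^esub> y \<otimes>\<^bsub>B\<^esub> x')
        = diff B x \<otimes>\<^bsub>B\<^esub> y' \<oplus>\<^bsub>B\<^esub> x \<otimes>\<^bsub>B\<^esub> diff B y' \<oplus>\<^bsub>B\<^esub> (diff B y \<otimes>\<^bsub>B\<^esub> x' \<ominus>\<^bsub>B\<^esub> y \<otimes>\<^bsub>B\<^esub> diff B x')"
      using diff_mult[of y 1 x' 0] diff_mult0[OF h(1,4)] h hc
      by (simp add: signed_def a_minus_def diff_add)
    have c: "x' \<otimes>\<^bsub>B\<^esub> diff B x = diff B x \<otimes>\<^bsub>B\<^esub> x'" using mult0_comm h g by metis
    show "th 0 (elt1 x y) \<in> carrier D2"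
      using h g by (simp add: th0_eq D2_carrier gr_closed a_minus_def)
    show "th 0 (elt1 x y \<otimes>\<^bsub>D1\<^esub> elt1 x' y') = th 0 (elt1 x y) \<otimes>\<^bsub>D2\<^esub> th 0 (elt1 x' y')"
    proof -
      have 2: "diff B (x \<otimes>\<^bsub>B\<^esub> x') \<ominus>\<^bsub>B\<^esub> (x \<otimes>\<^bsub>B\<^esub> y' \<oplus>\<^bsub>B\<^esub> y \<otimes>\<^bsub>B\<^esub> x')
          = x \<otimes>\<^bsub>B\<^esub> (diff B x' \<ominus>\<^bsub>B\<^esub> y') \<oplus>\<^bsub>B\<^esub> (diff B x \<ominus>\<^bsub>B\<^esub> y) \<otimes>\<^bsub>B\<^esub> x'"
        using hc by (simp add: diff_mult0[OF h(1,3)] a_minus_def l_distr r_distr l_minus r_minus minus_add a_ac)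
      have q: "x \<otimes>\<^bsub>B\<^esub> diff B y' \<oplus>\<^bsub>B\<^esub> (\<ominus>\<^bsub>B\<^esub> (y \<otimes>\<^bsub>B\<^esub> (diff B x' \<ominus>\<^bsub>B\<^esub> y')) \<oplus>\<^bsub>B\<^esub>
            ((diff B x \<ominus>\<^bsub>B\<^esub> y) \<otimes>\<^bsub>B\<^esub> y' \<oplus>\<^bsub>B\<^esub> diff B y \<otimes>\<^bsub>B\<^esub> x'))
          = x \<otimes>\<^bsub>B\<^esub> diff B y' \<oplus>\<^bsub>B\<^esub> (\<ominus>\<^bsub>B\<^esub> (y \<otimes>\<^bsub>B\<^esub> diff B x') \<oplus>\<^bsub>B\<^esub> (y \<otimes>\<^bsub>B\<^esub> y' \<oplus>\<^bsub>B\<^esub> (\<ominus>\<^bsub>B\<^esub> (y \<otimes>\<^bsub>B\<^esub> y')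
            \<oplus>\<^bsub>B\<^esub> (diff B x \<otimes>\<^bsub>B\<^esub> y' \<oplus>\<^bsub>B\<^esub> diff B y \<otimes>\<^bsub>B\<^esub> x'))))"
        using hc by (simp add: a_minus_def l_distr r_distr l_minus r_minus minus_add a_ac)
      have 0: "diff B (x \<otimes>\<^bsub>B\<^esub> y' \<oplus>\<^bsub>B\<^esub> y \<otimes>\<^bsub>B\<^esub> x')
          = x \<otimes>\<^bsub>B\<^esub> diff B y' \<oplus>\<^bsub>B\<^esub> (\<ominus>\<^bsub>B\<^esub> (y \<otimes>\<^bsub>B\<^esub> (diff B x' \<ominus>\<^bsub>B\<^esub> y')) \<oplus>\<^bsub>B\<^esub>
            ((diff B x \<ominus>\<^bsub>B\<^esub> y) \<otimes>\<^bsub>B\<^esub> y' \<oplus>\<^bsub>B\<^esub> diff B y \<otimes>\<^bsub>B\<^esub> x'))"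
        unfolding q d using hc by (simp add: r_neg2) (simp add: a_minus_def a_ac)
      have m: "diff B x' \<ominus>\<^bsub>B\<^esub> y' \<in> gr B 1" "diff B x \<ominus>\<^bsub>B\<^esub> y \<in> gr B 1"
        using h g by (simp_all add: a_minus_def gr_closed)
      show ?thesis
        using h g m by (simp add: D1_mult th0_eq D2_mult gr_mult0l gr_mult0r gr_add 2 0)
    qed
    show "th 0 (elt1 x y \<oplus>\<^bsub>D1\<^esub> elt1 x' y') = th 0 (elt1 x y) \<oplus>\<^bsub>D2\<^esub> th 0 (elt1 x' y')"
      using h hc by (simp add: D1_add th0_eq D2_add gr_closed a_minus_def diff_add minus_add a_ac)
  qed (simp add: D1_one D2_one th0_eq gr_closed diff_one diff_zero a_minus_def)
qed

lemma cosimplicial: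
  assumes "a \<in> gr B 0"
  shows "th 1 (d1 a) = th 2 (d1 a)" "th 2 (d0 a) = th 0 (d1 a)" "th 0 (d0 a) = th 1 (d0 a)"
  using assms by (simp_all add: d0_eq d1_eq th0_eq th1_eq th2_eq gr_closed gr_carrier diff_carrier diff_diff diff_zero
      a_minus_def r_neg)

end

section \<open>Linear maps and base change\<close>

lemma linmap_addhom: "f \<in> linmap A M N \<Longrightarrow> f \<in> addhom M N"
  by (simp add: linmap_def)

lemma linmap_closed: "f \<in> linmap A M N \<Longrightarrow> x \<in> carrier M \<Longrightarrow> f x \<in> carrier N"
  by (auto simp: linmap_def addhom_closed)

lemma linmap_smult: "f \<in> linmap A M N \<Longrightarrow> a \<in> carrier A \<Longrightarrow> x \<in> carrier M \<Longrightarrow>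
    f (a \<odot>\<^bsub>M\<^esub> x) = a \<odot>\<^bsub>N\<^esub> f x"
  by (auto simp: linmap_def)

lemma linmapI:
  assumes "f \<in> addhom M N" "\<And>a x. a \<in> carrier A \<Longrightarrow> x \<in> carrier M \<Longrightarrow> f (a \<odot>\<^bsub>M\<^esub> x) = a \<odot>\<^bsub>N\<^esub> f x"
  shows "f \<in> linmap A M N"
  using assms by (simp add: linmap_def)

lemma linmap_comp: "f \<in> linmap A M N \<Longrightarrow> g \<in> linmap A N K \<Longrightarrow> (\<lambda>x. g (f x)) \<in> linmap A M K"
  using addhom_comp[of f M N g K] by (intro linmapI) (auto simp: linmap_def addhom_closed)

lemma linmap_minus:
  assumes "f \<in> linmap A M N" "g \<in> linmap A M N" "module A N"
  shows "(\<lambda>x. f x \<ominus>\<^bsub>N\<^esub> g x) \<in> linmap A M N"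
proof -
  interpret N: module A N by fact
  have 1: "f \<in> addhom M N" "g \<in> addhom M N" using assms by (simp_all add: linmap_def)
  have 2: "f (a \<odot>\<^bsub>M\<^esub> x) \<ominus>\<^bsub>N\<^esub> g (a \<odot>\<^bsub>M\<^esub> x) = a \<odot>\<^bsub>N\<^esub> (f x \<ominus>\<^bsub>N\<^esub> g x)"
    if that: "a \<in> carrier A" "x \<in> carrier M" for a x
  proof -
    have 1: "f x \<in> carrier N" "g x \<in> carrier N" using linmap_closed assms that by metis+
    have 2: "f (a \<odot>\<^bsub>M\<^esub> x) = a \<odot>\<^bsub>N\<^esub> f x" "g (a \<odot>\<^bsub>M\<^esub> x) = a \<odot>\<^bsub>N\<^esub> g x"
      using linmap_smult assms that by metis+
    show ?thesis
      unfolding 2 a_minus_def using 1 that by (simp add: N.smult_r_distr N.smult_r_minus)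
  qed
  show ?thesis
    using addhom_minus'[OF 1 N.M.abelian_group_axioms] 2 by (simp add: linmap_def)
qed

lemma linmap_eq:
  assumes "g \<in> linmap A M N" "module A M" "\<And>x. x \<in> carrier M \<Longrightarrow> f x = g x"
  shows "f \<in> linmap A M N"
proof -
  interpret M: module A M by fact
  show ?thesis
    using addhom_eq[OF linmap_addhom[OF assms(1)] M.M.abelian_group_axioms assms(3)] assms(1,3)
    by (simp add: linmap_def)
qed

context
  fixes A :: "('a, 'w) ring_scheme" and M0 :: "('a, 'm0, 'x0) module_scheme"
    and M :: "('a, 'm, 'x) module_scheme" and N :: "('a, 'n, 'y) module_scheme"
  assumes M0: "module A M0" and M: "module A M" and N: "module A N"
begin

private lemmas map_hom = tens_map_hom[OF M0 N M N _ linmap_id]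
private lemmas map_on_pure = tens_map_pure[OF M0 N M N _ linmap_id]
private lemmas map_AG = tens_abelian_group[OF M N]

lemma tens_map_cong:
  assumes "f \<in> linmap A M0 M" "\<And>x. x \<in> carrier M0 \<Longrightarrow> f x = g x" "u \<in> carrier (tens A M0 N)"
  shows "tens_map A M N f id u = tens_map A M N g id u"
proof -
  have g: "g \<in> linmap A M0 M" using linmap_eq[OF assms(1) M0] assms(2) by metis
  show ?thesis
    by (rule tens_hom_eqI[OF M0 N map_hom[OF assms(1)] map_hom[OF g] map_AG])
      (use assms g in \<open>simp_all add: map_on_pure\<close>)
qed

lemma tens_map_diff:
  assumes "f \<in> linmap A M0 M" "g \<in> linmap A M0 M" "u \<in> carrier (tens A M0 N)"
  shows "tens_map A M N (\<lambda>x. f x \<ominus>\<^bsub>M\<^esub> g x) id u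
    = tens_map A M N f id u \<ominus>\<^bsub>tens A M N\<^esub> tens_map A M N g id u"
proof -
  interpret M: module A M by (rule M)
  interpret T: abelian_group "tens A M N" by (rule map_AG)
  note l = linmap_minus[OF assms(1,2) M]
  have "pure A M N (f m \<ominus>\<^bsub>M\<^esub> g m) n = pure A M N (f m) n \<ominus>\<^bsub>tens A M N\<^esub> pure A M N (g m) n"
    if "m \<in> carrier M0" "n \<in> carrier N" for m n
    using addhom_diff[OF pure_left_hom[OF M N] M.M.abelian_group_axioms map_AG] that
      linmap_closed[OF assms(1)] linmap_closed[OF assms(2)] by simp
  then show ?thesis
    by (intro tens_hom_eqI[OF M0 N map_hom[OF l] addhom_minus'[OF map_hom[OF assms(1)] map_hom[OF assms(2)] map_AG] map_AG _ assms(3)])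
      (use assms l in \<open>simp_all add: map_on_pure\<close>)
qed

end

lemma tens_map_comp:
  assumes "module A M0" "module A M1" "module A M2" "module A N"
    and f: "f \<in> linmap A M0 M1" and g: "g \<in> linmap A M1 M2" and u: "u \<in> carrier (tens A M0 N)"
  shows "tens_map A M2 N g id (tens_map A M1 N f id u) = tens_map A M2 N (\<lambda>x. g (f x)) id u"
proof -
  note h1 = tens_map_hom[OF assms(1,4,2,4) f linmap_id]
  note h2 = tens_map_hom[OF assms(2,4,3,4) g linmap_id]
  note gf = linmap_comp[OF f g]
  note h3 = tens_map_hom[OF assms(1,4,3,4) gf linmap_id]
  show ?thesis
    by (rule tens_hom_eqI[OF assms(1,4) addhom_comp[OF h1 h2] h3 tens_abelian_group[OF assms(3,4)] _ u])
      (simp add: tens_map_pure[OF assms(1,4,2,4) f linmap_id] tens_map_pure[OF assms(2,4,3,4) g linmap_id]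
        tens_map_pure[OF assms(1,4,3,4) gf linmap_id] linmap_closed[OF f])
qed

lemma tens_map_id:
  assumes "module A M" "module A N" and f: "\<And>x. x \<in> carrier M \<Longrightarrow> f x = x" and u: "u \<in> carrier (tens A M N)"
  shows "tens_map A M N f id u = u"
proof -
  have l: "f \<in> linmap A M M" by (rule linmap_eq[OF linmap_id assms(1)]) (simp add: f)
  show ?thesis
    by (rule tens_hom_eqI[OF assms(1,2) tens_map_hom[OF assms(1,2,1,2) l linmap_id] addhom_id
        tens_abelian_group[OF assms(1,2)] _ u])
      (simp add: tens_map_pure[OF assms(1,2,1,2) l linmap_id] f)
qed

text \<open>Tensoring does not preserve injectivity in general; this is why the inclusions of infinitesimals and of
  two-forms below come with linear retractions.\<close>

lemma tens_map_retract:
  assumes "module A M0" "module A M" "module A N"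
    and f: "f \<in> linmap A M0 M" and r: "r \<in> linmap A M M0" and rf: "\<And>x. x \<in> carrier M0 \<Longrightarrow> r (f x) = x"
    and uv: "u \<in> carrier (tens A M0 N)" "v \<in> carrier (tens A M0 N)"
    and eq: "tens_map A M N f id u = tens_map A M N f id v"
  shows "u = v"
proof -
  have "w = tens_map A M0 N r id (tens_map A M N f id w)" if "w \<in> carrier (tens A M0 N)" for w
    using tens_map_comp[OF assms(1,2,1,3) f r that]
      tens_map_id[OF assms(1,3), of "\<lambda>x. r (f x)" w] rf that by simp
  then show ?thesis using uv eq by metis
qed

subsection \<open>Extension of scalars\<close>

lemma base_change_simps [simp]:
  "carrier (base_change R G A D f P) = carrier (tens A P (restr f (self D)))"
  "monoid.mult (base_change R G A D f P) = monoid.mult (tens A P (restr f (self D)))"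
  "monoid.one (base_change R G A D f P) = monoid.one (tens A P (restr f (self D)))"
  "ring.zero (base_change R G A D f P) = ring.zero (tens A P (restr f (self D)))"
  "ring.add (base_change R G A D f P) = ring.add (tens A P (restr f (self D)))"
  "smult (base_change R G A D f P) = (\<lambda>c u. pure A P (restr f (self D)) \<one>\<^bsub>P\<^esub> c \<otimes>\<^bsub>tens A P (restr f (self D))\<^esub> u)"
  by (simp_all add: base_change_def base_change_alg_def Let_def)

context
  fixes A :: "('a, 'w) ring_scheme" and P :: "('a, 'p, 'z) module_scheme"
    and D :: "('c, 'y) ring_scheme" and f :: "'a \<Rightarrow> 'c"
  assumes P: "algebra A P" and D: "cring D" and f: "f \<in> ring_hom A D"
begin

interpretation P: algebra A P by (rule P)
interpretation D: cring D by (rule D)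

private abbreviation "N \<equiv> restr f (self D)"
private abbreviation "U \<equiv> tens A P N"

lemma bc_alg: "algebra A (restr f (self D))"
  by (rule algebra_restr[OF f P.R_cring algebra_self[OF D]])

lemma bc_mod: "module A (restr f (self D))"
  by (rule algebra.module[OF bc_alg])

lemma bc_cring: "cring (tens A P (restr f (self D)))"
  by (rule tens_cring[OF P bc_alg])

private lemmas bc_mods = P.module bc_mod
private lemmas mult_pure = tens_mult_pure[OF P bc_alg, simplified]

lemma bc_scalars_hom: "(\<lambda>c. pure A P (restr f (self D)) \<one>\<^bsub>P\<^esub> c) \<in> ring_hom D (tens A P (restr f (self D)))"
  by (rule ring_hom_memI) (simp_all add: pure_closed[OF bc_mods] mult_pure
      pure_add_right[OF bc_mods, simplified] tens_one[OF P bc_alg])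

lemma bc_pure_eq:
  "p \<in> carrier P \<Longrightarrow> c \<in> carrier D \<Longrightarrow> pure A P (restr f (self D)) p c =
    pure A P (restr f (self D)) \<one>\<^bsub>P\<^esub> c \<otimes>\<^bsub>tens A P (restr f (self D))\<^esub> pure A P (restr f (self D)) p \<one>\<^bsub>D\<^esub>"
  by (simp add: mult_pure)

lemma bc_scalar_pure:
  "p \<in> carrier P \<Longrightarrow> c \<in> carrier D \<Longrightarrow> d \<in> carrier D \<Longrightarrow>
    pure A P (restr f (self D)) \<one>\<^bsub>P\<^esub> c \<otimes>\<^bsub>tens A P (restr f (self D))\<^esub> pure A P (restr f (self D)) p d
    = pure A P (restr f (self D)) p (c \<otimes>\<^bsub>D\<^esub> d)"
  by (simp add: mult_pure)

lemma bc_mult_pure: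
  "p \<in> carrier P \<Longrightarrow> q \<in> carrier P \<Longrightarrow> c \<in> carrier D \<Longrightarrow> d \<in> carrier D \<Longrightarrow>
    pure A P (restr f (self D)) p c \<otimes>\<^bsub>tens A P (restr f (self D))\<^esub> pure A P (restr f (self D)) q d
    = pure A P (restr f (self D)) (p \<otimes>\<^bsub>P\<^esub> q) (c \<otimes>\<^bsub>D\<^esub> d)"
  by (rule mult_pure)

lemma bc_pure_smult:
  "a \<in> carrier A \<Longrightarrow> p \<in> carrier P \<Longrightarrow> c \<in> carrier D \<Longrightarrow>
    pure A P (restr f (self D)) (a \<odot>\<^bsub>P\<^esub> p) c = pure A P (restr f (self D)) p (f a \<otimes>\<^bsub>D\<^esub> c)"
  using pure_smult[OF bc_mods] by simp

lemma bc_scalar_closed: "c \<in> carrier D \<Longrightarrow> pure A P (restr f (self D)) \<one>\<^bsub>P\<^esub> c \<in> carrier (tens A P (restr f (self D)))"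
  by (simp add: pure_closed[OF bc_mods])

end

lemma base_change_algebra:
  fixes P :: "('a, 'p, 'h) gspace"
  assumes P: "algebra A P" and D: "cring D" and f: "f \<in> ring_hom A D"
  shows "algebra D (base_change R G A D f P)"
proof -
  interpret U: cring "tens A P (restr f (self D))" by (rule bc_cring[OF P D f])
  note k = bc_scalars_hom[OF P D f]
  have "cring (base_change R G A D f P)" by (rule cring_cong[OF U.cring_axioms]) simp_all
  then show ?thesis
    using D by (intro algebraI) (simp_all add: ring_hom_closed[OF k] ring_hom_add[OF k] ring_hom_mult[OF k]
      ring_hom_one[OF k] U.l_distr U.r_distr U.m_assoc)
qed

context
  fixes R :: "('r, 'w) ring_scheme" and G :: "('r, 'h) hopf" and A :: "('r, 'a) module"
    and P :: "('a, 'p, 'h) gspace" and D :: "('r, 'c) module" and f :: "'a \<Rightarrow> 'c"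
    and D2 :: "('r, 'd) module" and k :: "'c \<Rightarrow> 'd"
  assumes P: "algebra A P" and D: "cring D" and f: "f \<in> ring_hom A D"
    and D2: "cring D2" and k: "k \<in> ring_hom D D2"
begin

interpretation P: algebra A P by (rule P)
interpretation D: cring D by (rule D)
interpretation D2: cring D2 by (rule D2)

private abbreviation "N1 \<equiv> restr f (self D)"
private abbreviation "N2 \<equiv> restr (k \<circ> f) (self D2)"
private abbreviation "U1 \<equiv> tens A P N1"
private abbreviation "W \<equiv> tens A P N2"
private abbreviation "BC \<equiv> base_change R G A D f P"
private abbreviation "K \<equiv> restr k (self D2)"

lemma bc_comp_hom: "k \<circ> f \<in> ring_hom A D2"
  by (rule ring_hom_trans[OF f k])

private lemmas kf = bc_comp_hom

interpretation W: cring "tens A P (restr (k \<circ> f) (self D2))" by (rule bc_cring[OF P D2 kf])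
interpretation U1: cring "tens A P (restr f (self D))" by (rule bc_cring[OF P D f])

private lemmas modU = P.module bc_mod[OF P D f]
private lemmas modW = P.module bc_mod[OF P D2 kf]

lemma bc_module: "module D (base_change R G A D f P)"
  by (rule algebra.module[OF base_change_algebra[OF P D f]])

lemma bc_module2: "module D (restr k (self D2))"
  by (rule module_restr[OF k D algebra.module[OF algebra_self[OF D2]]])

private lemmas modT = bc_module bc_module2

text \<open>The map \<open>id \<otimes> k\<close>, which changes the coefficients of a base change. It is semilinear along \<open>k\<close>, and
  every statement about the comparison with an iterated base change is expressed by it.\<close>

definition bc_star where "bc_star = tens_map A P (restr (k \<circ> f) (self D2)) id k"

private lemma k_lin: "k \<in> linmap A N1 N2"
  by (auto simp: linmap_def addhom_def ring_hom_closed[OF k] ring_hom_add[OF k] ring_hom_mult[OF k]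
      ring_hom_closed[OF f])

lemma bc_star_hom: "bc_star \<in> addhom (tens A P (restr f (self D))) (tens A P (restr (k \<circ> f) (self D2)))"
  unfolding bc_star_def by (rule tens_map_hom[OF modU modW linmap_id k_lin])

lemma bc_star_pure: "p \<in> carrier P \<Longrightarrow> c \<in> carrier D \<Longrightarrow>
    bc_star (pure A P (restr f (self D)) p c) = pure A P (restr (k \<circ> f) (self D2)) p (k c)"
  unfolding bc_star_def using tens_map_pure[OF modU modW linmap_id k_lin] by simp

lemma bc_star_scalar:
  assumes c: "c \<in> carrier D" and u: "u \<in> carrier (tens A P (restr f (self D)))"
  shows "bc_star (pure A P (restr f (self D)) \<one>\<^bsub>P\<^esub> c \<otimes>\<^bsub>tens A P (restr f (self D))\<^esub> u) =
    pure A P (restr (k \<circ> f) (self D2)) \<one>\<^bsub>P\<^esub> (k c) \<otimes>\<^bsub>tens A P (restr (k \<circ> f) (self D2))\<^esub> bc_star u"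
proof (rule tens_hom_eqI[OF modU _ _ W.abelian_group_axioms _ u])
  show "(\<lambda>u. bc_star (pure A P N1 \<one>\<^bsub>P\<^esub> c \<otimes>\<^bsub>U1\<^esub> u)) \<in> addhom U1 W"
    by (rule addhom_comp[OF tens_mult_hom_right[OF P bc_alg[OF P D f]] bc_star_hom])
      (simp add: bc_scalar_closed[OF P D f] c)
  show "(\<lambda>u. pure A P N2 \<one>\<^bsub>P\<^esub> (k c) \<otimes>\<^bsub>W\<^esub> bc_star u) \<in> addhom U1 W"
    by (rule addhom_comp[OF bc_star_hom tens_mult_hom_right[OF P bc_alg[OF P D2 kf]]])
      (simp add: bc_scalar_closed[OF P D2 kf] c ring_hom_closed[OF k])
next
  fix p d assume pd: "p \<in> carrier P" "d \<in> carrier N1"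
  then have "pure A P N1 \<one>\<^bsub>P\<^esub> c \<otimes>\<^bsub>U1\<^esub> pure A P N1 p d = pure A P N1 p (c \<otimes>\<^bsub>D\<^esub> d)"
    using c by (intro bc_scalar_pure[OF P D f]) simp_all
  moreover have "pure A P N2 \<one>\<^bsub>P\<^esub> (k c) \<otimes>\<^bsub>W\<^esub> pure A P N2 p (k d) = pure A P N2 p (k c \<otimes>\<^bsub>D2\<^esub> k d)"
    using c pd by (intro bc_scalar_pure[OF P D2 kf]) (simp_all add: ring_hom_closed[OF k])
  ultimately show "bc_star (pure A P N1 \<one>\<^bsub>P\<^esub> c \<otimes>\<^bsub>U1\<^esub> pure A P N1 p d)
      = pure A P N2 \<one>\<^bsub>P\<^esub> (k c) \<otimes>\<^bsub>W\<^esub> bc_star (pure A P N1 p d)"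
    using c pd by (simp only: bc_star_pure restr_simps self_simps D.m_closed ring_hom_mult[OF k])
qed

private lemma can_balanced:
  "balanced D BC K W (\<lambda>u d. pure A P N2 \<one>\<^bsub>P\<^esub> d \<otimes>\<^bsub>W\<^esub> bc_star u)"
proof (intro balancedI addhomI)
  note cl = bc_scalar_closed[OF P D2 kf] addhom_closed[OF bc_star_hom]
  fix c u d assume "c \<in> carrier D" "u \<in> carrier BC" "d \<in> carrier K"
  then show "pure A P N2 \<one>\<^bsub>P\<^esub> d \<otimes>\<^bsub>W\<^esub> bc_star (c \<odot>\<^bsub>BC\<^esub> u) = pure A P N2 \<one>\<^bsub>P\<^esub> (c \<odot>\<^bsub>K\<^esub> d) \<otimes>\<^bsub>W\<^esub> bc_star u"
    by (simp add: bc_star_scalar ring_hom_mult[OF bc_scalars_hom[OF P D2 kf]] ring_hom_closed[OF k] cl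
        W.m_ac)
qed (simp_all add: bc_scalar_closed[OF P D2 kf] addhom_closed[OF bc_star_hom] addhom_add[OF bc_star_hom]
    W.l_distr W.r_distr ring_hom_add[OF bc_scalars_hom[OF P D2 kf]])

private lemma can_inner:
  assumes "u \<in> carrier U1" "d \<in> carrier D2"
  shows "tens_lift W (\<lambda>p c. pure A P N2 p (k c \<otimes>\<^bsub>D2\<^esub> d)) u = pure A P N2 \<one>\<^bsub>P\<^esub> d \<otimes>\<^bsub>W\<^esub> bc_star u"
proof -
  have eq: "pure A P N2 p (k c \<otimes>\<^bsub>D2\<^esub> d) = pure A P N2 \<one>\<^bsub>P\<^esub> d \<otimes>\<^bsub>W\<^esub> pure A P N2 p (k c)"
    if "p \<in> carrier P" "c \<in> carrier D" for p c
    using that assms by (simp add: bc_scalar_pure[OF P D2 kf] ring_hom_closed[OF k] D2.m_comm)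
  have b: "balanced A P N1 W (\<lambda>p c. pure A P N2 p (k c \<otimes>\<^bsub>D2\<^esub> d))"
  proof (intro balancedI addhomI)
  qed (use assms(2) in \<open>simp_all add: pure_closed[OF modW] ring_hom_closed[OF k] ring_hom_closed[OF f]
      ring_hom_add[OF k] ring_hom_mult[OF k] pure_add_left[OF modW] D2.l_distr
      pure_add_right[OF modW, simplified] bc_pure_smult[OF P D2 kf] D2.m_assoc\<close>)
  show ?thesis
    by (rule tens_hom_eqI[OF modU tens_lift_hom[OF modU W.abelian_group_axioms b]
        addhom_comp[OF bc_star_hom tens_mult_hom_right[OF P bc_alg[OF P D2 kf]]] W.abelian_group_axioms])
      (use assms in \<open>simp_all add: tens_lift_pure[OF modU W.abelian_group_axioms b] eq bc_star_pure
        bc_scalar_closed[OF P D2 kf]\<close>)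
qed

lemma base_change_comp_hom:
  "base_change_comp A D2 f k P \<in> addhom (tens D BC K) W"
  and base_change_comp_pure: "u \<in> carrier U1 \<Longrightarrow> d \<in> carrier D2 \<Longrightarrow>
    base_change_comp A D2 f k P (pure D BC K u d) = pure A P N2 \<one>\<^bsub>P\<^esub> d \<otimes>\<^bsub>W\<^esub> bc_star u"
proof -
  let ?\<phi> = "\<lambda>u d. tens_lift W (\<lambda>p c. pure A P N2 p (k c \<otimes>\<^bsub>D2\<^esub> d)) u"
  have b: "balanced D BC K W ?\<phi>"
    using can_balanced bc_module bc_module2 module.axioms
    by (auto simp: balanced_def addhom_def can_inner Pi_iff abelian_groupE(1)[OF module.axioms(2)[OF bc_module], simplified]
        abelian_groupE(1)[OF module.axioms(2)[OF bc_module2], simplified]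
        module.smult_closed[OF bc_module, simplified] module.smult_closed[OF bc_module2, simplified])
  have eq: "base_change_comp A D2 f k P = tens_lift W ?\<phi>"
    by (simp add: base_change_comp_def Let_def)
  show "base_change_comp A D2 f k P \<in> addhom (tens D BC K) W"
    unfolding eq by (rule tens_lift_hom[OF modT W.abelian_group_axioms b])
  show "base_change_comp A D2 f k P (pure D BC K u d) = pure A P N2 \<one>\<^bsub>P\<^esub> d \<otimes>\<^bsub>W\<^esub> bc_star u"
    if "u \<in> carrier U1" "d \<in> carrier D2"
    unfolding eq using tens_lift_pure[OF modT W.abelian_group_axioms b] that by (simp add: can_inner)
qed

text \<open>The comparison of an iterated base change with the base change along the composite is an isomorphism,
  and its inverse \<open>p \<otimes> d \<mapsto> (p \<otimes> 1) \<otimes> d\<close> is again given by a formula on pure tensors. It replaces the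
  inverse image that enters the definition of \<open>pull_iso\<close>.\<close>

lemma base_change_comp_inverse:
  obtains s where "s \<in> addhom W (tens D BC K)"
    "\<And>p d. p \<in> carrier P \<Longrightarrow> d \<in> carrier D2 \<Longrightarrow> s (pure A P N2 p d) = pure D BC K (pure A P N1 p \<one>\<^bsub>D\<^esub>) d"
    "\<And>w. w \<in> carrier W \<Longrightarrow> inv_into (carrier (tens D BC K)) (base_change_comp A D2 f k P) w = s w"
proof -
  let ?T = "tens D BC K" and ?c = "base_change_comp A D2 f k P"
  interpret T: abelian_group ?T by (rule tens_abelian_group[OF modT])
  have cl: "pure A P N1 p \<one>\<^bsub>D\<^esub> \<in> carrier U1" if "p \<in> carrier P" for p
    using that by (simp add: pure_closed[OF modU])
  have sm: "pure D BC K (pure A P N1 p c) d = pure D BC K (pure A P N1 p \<one>\<^bsub>D\<^esub>) (k c \<otimes>\<^bsub>D2\<^esub> d)"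
    if "p \<in> carrier P" "c \<in> carrier D" "d \<in> carrier D2" for p c d
    using pure_smult[OF modT, of c "pure A P N1 p \<one>\<^bsub>D\<^esub>" d] that cl
    by (simp add: bc_scalar_pure[OF P D f])
  let ?\<sigma> = "\<lambda>p d. pure D BC K (pure A P N1 p \<one>\<^bsub>D\<^esub>) d"
  have b: "balanced A P N2 ?T ?\<sigma>"
  proof (intro balancedI addhomI)
    fix a p d assume h: "a \<in> carrier A" "p \<in> carrier P" "d \<in> carrier N2"
    have "pure A P N1 (a \<odot>\<^bsub>P\<^esub> p) \<one>\<^bsub>D\<^esub> = pure A P N1 p (f a)"
      using h by (simp add: bc_pure_smult[OF P D f] ring_hom_closed[OF f])
    then show "?\<sigma> (a \<odot>\<^bsub>P\<^esub> p) d = ?\<sigma> p (a \<odot>\<^bsub>N2\<^esub> d)"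
      using h by (simp add: sm ring_hom_closed[OF f])
  next
    fix p p' d assume "p \<in> carrier P" "p' \<in> carrier P" "d \<in> carrier N2"
    then show "?\<sigma> (p \<oplus>\<^bsub>P\<^esub> p') d = ?\<sigma> p d \<oplus>\<^bsub>?T\<^esub> ?\<sigma> p' d"
      using pure_add_left[OF modT, of "pure A P N1 p \<one>\<^bsub>D\<^esub>" "pure A P N1 p' \<one>\<^bsub>D\<^esub>" d] cl
      by (simp add: pure_add_left[OF modU])
  next
    fix p d d' assume "p \<in> carrier P" "d \<in> carrier N2" "d' \<in> carrier N2"
    then show "?\<sigma> p (d \<oplus>\<^bsub>N2\<^esub> d') = ?\<sigma> p d \<oplus>\<^bsub>?T\<^esub> ?\<sigma> p d'"
      using pure_add_right[OF modT, of "pure A P N1 p \<one>\<^bsub>D\<^esub>" d d'] cl by simp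
  qed (simp_all add: pure_closed[OF modT] cl)
  let ?s = "tens_lift ?T ?\<sigma>"
  note s_hom = tens_lift_hom[OF modW T.abelian_group_axioms b]
  note s_pure = tens_lift_pure[OF modW T.abelian_group_axioms b]
  \<comment> \<open>It suffices to treat \<open>x = (p \<otimes> c) \<otimes> d\<close>, which goes to \<open>p \<otimes> k(c)d\<close> and back to \<open>(p \<otimes> 1) \<otimes> k(c)d\<close>.\<close>
  have sc: "?s (?c x) = x" if x: "x \<in> carrier ?T" for x
  proof (rule tens_hom_eqI[OF modT addhom_comp[OF base_change_comp_hom s_hom] addhom_id T.abelian_group_axioms _ x])
    fix u d assume u: "u \<in> carrier BC" and d: "d \<in> carrier K"
    then have u': "u \<in> carrier U1" and d': "d \<in> carrier D2" by simp_all
    have h: "(\<lambda>u. ?c (pure D BC K u d)) \<in> addhom U1 W"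
      using addhom_comp[OF pure_left_hom[OF modT d] base_change_comp_hom]
      by (simp add: addhom_cong[of BC U1 W W])
    have h2: "(\<lambda>u. pure D BC K u d) \<in> addhom U1 ?T"
      using pure_left_hom[OF modT d] by (simp add: addhom_cong[of BC U1 ?T ?T])
    show "?s (?c (pure D BC K u d)) = pure D BC K u d"
    proof (rule tens_hom_eqI[OF modU addhom_comp[OF h s_hom] h2 T.abelian_group_axioms _ u'])
      fix p c assume pc: "p \<in> carrier P" "c \<in> carrier N1"
      then have "?c (pure D BC K (pure A P N1 p c) d) = pure A P N2 p (k c \<otimes>\<^bsub>D2\<^esub> d)"
        using d' by (simp add: base_change_comp_pure pure_closed[OF modU] bc_star_pure
            bc_scalar_pure[OF P D2 kf] ring_hom_closed[OF k] D2.m_comm)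
      then show "?s (?c (pure D BC K (pure A P N1 p c) d)) = pure D BC K (pure A P N1 p c) d"
        using pc d' by (simp add: s_pure ring_hom_closed[OF k] sm)
    qed
  qed
  have cs: "?c (?s w) = w" if w: "w \<in> carrier W" for w
    by (rule tens_hom_eqI[OF modW addhom_comp[OF s_hom base_change_comp_hom] addhom_id W.abelian_group_axioms _ w])
      (simp add: s_pure base_change_comp_pure cl bc_star_pure bc_scalar_pure[OF P D2 kf] ring_hom_one[OF k])
  have inj: "inj_on ?c (carrier ?T)" by (rule inj_on_inverseI[of _ ?s]) (rule sc)
  show ?thesis
  proof (rule that[OF s_hom])
    show "?s (pure A P N2 p d) = pure D BC K (pure A P N1 p \<one>\<^bsub>D\<^esub>) d" if "p \<in> carrier P" "d \<in> carrier D2" for p d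
      using s_pure that by simp
    show "inv_into (carrier ?T) ?c w = ?s w" if "w \<in> carrier W" for w
      by (rule inv_into_f_eq[OF inj addhom_closed[OF s_hom that] cs[OF that]])
  qed
qed

end

section \<open>Co-actions\<close>

context
  fixes R :: "('r, 'w) ring_scheme" and G :: "('r, 'h) hopf" and A :: "('r, 'a) module"
    and P :: "('a, 'p, 'h) gspace" and N :: "('a, 'n) module" and M :: "('r, ('p, 'n) tensor) module"
  assumes A: "algebra R A" and G: "algebra R G" and P: "gspace_over R G A P" and N: "module A N"
    and M: "module R M" and M_carrier: "carrier M = carrier (tens A P N)"
    and M_add: "ring.add M = ring.add (tens A P N)"
    and lin: "\<And>n. n \<in> carrier N \<Longrightarrow> (\<lambda>q. pure A P N q n) \<in> linmap R (restr (unit_map A) P) M"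
begin

interpretation G: algebra R G by (rule G)
interpretation P: gspace_over R G A P by (rule P)
interpretation PA: algebra A P by (rule P.alg)

private abbreviation "PR \<equiv> restr (unit_map A) P"

lemma restr_gspace_algebra: "algebra R (restr (unit_map A) P)"
  by (rule algebra_restr[OF unit_map_hom[OF A] G.R_cring P.alg])

private lemmas PRm = algebra.module[OF restr_gspace_algebra]
private lemmas coact_AG = tens_abelian_group[OF M G.module]
private lemmas modAN = PA.module N

private lemma inner: "n \<in> carrier N \<Longrightarrow> w \<in> carrier (tens R PR G) \<Longrightarrow>
    tens_lift (tens R M G) (\<lambda>q h. pure R M G (pure A P N q n) h) w = tens_map R M G (\<lambda>q. pure A P N q n) id w"
  by (simp add: tens_map_def)

private lemmas L_hom = tens_map_hom[OF PRm G.module M G.module lin linmap_id]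
private lemmas L_pure = tens_map_pure[OF PRm G.module M G.module lin linmap_id]

private lemma coact_closed: "p \<in> carrier P \<Longrightarrow> coact P p \<in> carrier (tens R PR G)"
  using ring_hom_closed[OF P.coact_ring_hom] .

private lemma outer:
  "balanced A P N (tens R M G) (\<lambda>p n. tens_lift (tens R M G) (\<lambda>q h. pure R M G (pure A P N q n) h) (coact P p))"
proof (intro balancedI addhomI)
  interpret N: module A N by (rule N)
  interpret T: abelian_group "tens R M G" by (rule coact_AG)
  show "tens_lift (tens R M G) (\<lambda>q h. pure R M G (pure A P N q n) h) (coact P p) \<in> carrier (tens R M G)"
    if "p \<in> carrier P" "n \<in> carrier N" for p n
    using that by (simp add: inner coact_closed addhom_closed[OF L_hom])
  then show "tens_lift (tens R M G) (\<lambda>q h. pure R M G (pure A P N q n) h) (coact P p) \<in> carrier (tens R M G)"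
    if "p \<in> carrier P" "n \<in> carrier N" for p n
    using that .
  show "tens_lift (tens R M G) (\<lambda>q. pure R M G (pure A P N q n)) (coact P (p \<oplus>\<^bsub>P\<^esub> p')) =
      tens_lift (tens R M G) (\<lambda>q. pure R M G (pure A P N q n)) (coact P p) \<oplus>\<^bsub>tens R M G\<^esub>
      tens_lift (tens R M G) (\<lambda>q. pure R M G (pure A P N q n)) (coact P p')"
    if "p \<in> carrier P" "p' \<in> carrier P" "n \<in> carrier N" for p p' n
    using that by (simp add: inner coact_closed ring_hom_add[OF P.coact_ring_hom] addhom_add[OF L_hom]
        abelian_groupE(1)[OF tens_abelian_group[OF PRm G.module]])
  show "tens_lift (tens R M G) (\<lambda>q. pure R M G (pure A P N q (n \<oplus>\<^bsub>N\<^esub> n'))) (coact P p) =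
      tens_lift (tens R M G) (\<lambda>q. pure R M G (pure A P N q n)) (coact P p) \<oplus>\<^bsub>tens R M G\<^esub>
      tens_lift (tens R M G) (\<lambda>q. pure R M G (pure A P N q n')) (coact P p)"
    if "p \<in> carrier P" "n \<in> carrier N" "n' \<in> carrier N" for p n n'
  proof -
    note n = that(2,3) N.a_closed[OF that(2,3)]
    have "tens_map R M G (\<lambda>q. pure A P N q (n \<oplus>\<^bsub>N\<^esub> n')) id (coact P p) =
      tens_map R M G (\<lambda>q. pure A P N q n) id (coact P p) \<oplus>\<^bsub>tens R M G\<^esub>
      tens_map R M G (\<lambda>q. pure A P N q n') id (coact P p)"
    proof (rule tens_hom_eqI[OF PRm G.module L_hom[OF n(3)] addhom_plus[OF L_hom[OF n(1)] L_hom[OF n(2)] coact_AG] coact_AG])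
      fix q h assume qh: "q \<in> carrier PR" "h \<in> carrier G"
      then have "pure R M G (pure A P N q n \<oplus>\<^bsub>M\<^esub> pure A P N q n') h =
          pure R M G (pure A P N q n) h \<oplus>\<^bsub>tens R M G\<^esub> pure R M G (pure A P N q n') h"
        using n by (intro pure_add_left[OF M G.module]) (simp_all add: M_carrier pure_closed[OF modAN])
      then show "tens_map R M G (\<lambda>q. pure A P N q (n \<oplus>\<^bsub>N\<^esub> n')) id (pure R PR G q h) =
         tens_map R M G (\<lambda>q. pure A P N q n) id (pure R PR G q h) \<oplus>\<^bsub>tens R M G\<^esub>
         tens_map R M G (\<lambda>q. pure A P N q n') id (pure R PR G q h)"
        using qh n by (simp add: L_pure pure_add_right[OF modAN] M_add)
    qed (rule coact_closed[OF that(1)])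
    then show ?thesis using that n by (simp add: inner coact_closed)
  qed
  show "tens_lift (tens R M G) (\<lambda>q. pure R M G (pure A P N q n)) (coact P (a \<odot>\<^bsub>P\<^esub> p)) =
       tens_lift (tens R M G) (\<lambda>q. pure R M G (pure A P N q (a \<odot>\<^bsub>N\<^esub> n))) (coact P p)"
    if "a \<in> carrier A" "p \<in> carrier P" "n \<in> carrier N" for a p n
  proof -
    let ?e = "pure R PR G (unit_map P a) \<one>\<^bsub>G\<^esub>"
    have ua: "unit_map P a \<in> carrier P" using that by (simp add: unit_map_def)
    have e: "?e \<in> carrier (tens R PR G)" using ua by (simp add: pure_closed[OF PRm G.module])
    have an: "a \<odot>\<^bsub>N\<^esub> n \<in> carrier N" using that by simp
    have "a \<odot>\<^bsub>P\<^esub> p = unit_map P a \<otimes>\<^bsub>P\<^esub> p" using that by (simp add: unit_map_def PA.smult_assoc2)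
    then have c: "coact P (a \<odot>\<^bsub>P\<^esub> p) = ?e \<otimes>\<^bsub>tens R PR G\<^esub> coact P p"
      using that ua by (simp add: ring_hom_mult[OF P.coact_ring_hom] P.coact_base)
    have "tens_map R M G (\<lambda>q. pure A P N q n) id (?e \<otimes>\<^bsub>tens R PR G\<^esub> w) =
      tens_map R M G (\<lambda>q. pure A P N q (a \<odot>\<^bsub>N\<^esub> n)) id w" if w: "w \<in> carrier (tens R PR G)" for w
    proof (rule tens_hom_eqI[OF PRm G.module addhom_comp[OF tens_mult_hom_right[OF restr_gspace_algebra G e]
            L_hom[OF \<open>n \<in> carrier N\<close>]] L_hom[OF an] coact_AG _ w])
      fix q h assume qh: "q \<in> carrier PR" "h \<in> carrier G"
      have "?e \<otimes>\<^bsub>tens R PR G\<^esub> pure R PR G q h = pure R PR G (a \<odot>\<^bsub>P\<^esub> q) h"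
        using qh ua \<open>a \<in> carrier A\<close> by (simp add: tens_mult_pure[OF restr_gspace_algebra G]
            unit_map_def PA.smult_assoc2)
      then show "tens_map R M G (\<lambda>q. pure A P N q n) id (?e \<otimes>\<^bsub>tens R PR G\<^esub> pure R PR G q h) =
         tens_map R M G (\<lambda>q. pure A P N q (a \<odot>\<^bsub>N\<^esub> n)) id (pure R PR G q h)"
        using qh an \<open>a \<in> carrier A\<close> \<open>n \<in> carrier N\<close> by (simp add: L_pure pure_smult[OF modAN])
    qed
    then show ?thesis using that an e by (simp add: inner coact_closed c
        abelian_groupE(1) cring.cring_simprules(5)[OF tens_cring[OF restr_gspace_algebra G]])
  qed
qed

text \<open>The extended co-action respects the balancing relation because the co-action is multiplicative and
  trivial on the base.\<close>

lemma ext_coact_hom: "ext_coact R G A P N M \<in> addhom (tens A P N) (tens R M G)"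
  unfolding ext_coact_def by (rule tens_lift_hom[OF modAN coact_AG outer])

lemma ext_coact_pure: "p \<in> carrier P \<Longrightarrow> n \<in> carrier N \<Longrightarrow>
    ext_coact R G A P N M (pure A P N p n) = tens_map R M G (\<lambda>q. pure A P N q n) id (coact P p)"
  unfolding ext_coact_def by (simp add: tens_lift_pure[OF modAN coact_AG outer] inner coact_closed)

end

section \<open>From derivations to infinitesimal descent data\<close>

context dg_calg
begin

abbreviation "fib i \<equiv> restr (den_coface_zero B i) (self (den B 1))"

lemma d_eq: "i \<le> 1 \<Longrightarrow> a \<in> gr B 0 \<Longrightarrow> den_coface_zero B i a = elt1 a (if i = 0 then diff B a else \<zero>\<^bsub>B\<^esub>)"
  using d0_eq d1_eq by (cases "i = 0") (auto simp: le_Suc_eq One_nat_def)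

lemma d_ring_hom: "i \<le> 1 \<Longrightarrow> den_coface_zero B i \<in> ring_hom A0 D1"
  using d_hom by (cases "i = 0") (auto simp: le_Suc_eq One_nat_def)

lemma d_closed: "i \<le> 1 \<Longrightarrow> a \<in> gr B 0 \<Longrightarrow> den_coface_zero B i a \<in> carrier D1"
  using ring_hom_closed[OF d_ring_hom] by simp

lemma elt1_hom: "elt1 \<zero>\<^bsub>B\<^esub> \<in> addhom (dg_mod B 1) D1"
  by (rule addhomI) (simp_all add: D1_carrier D1_add gr_closed)

lemma elt1_eps_mult: "a \<in> gr B 0 \<Longrightarrow> y \<in> gr B 1 \<Longrightarrow> b \<in> gr B 1 \<Longrightarrow>
    elt1 a y \<otimes>\<^bsub>D1\<^esub> elt1 \<zero>\<^bsub>B\<^esub> b = elt1 \<zero>\<^bsub>B\<^esub> (a \<otimes>\<^bsub>B\<^esub> b)"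
  by (simp add: D1_mult gr_closed gr_carrier)

lemma elt1_split: "a \<in> gr B 0 \<Longrightarrow> y \<in> gr B 1 \<Longrightarrow> elt1 a y = elt1 a \<zero>\<^bsub>B\<^esub> \<oplus>\<^bsub>D1\<^esub> elt1 \<zero>\<^bsub>B\<^esub> y"
  by (simp add: D1_add gr_carrier)

end

text \<open>\<open>Om n\<close> is \<open>O(P) \<otimes> B\<^sup>n\<close> and \<open>U i\<close> is \<open>O(\<partial>\<^sup>iP)\<close>, with pure tensors written \<open>om n p b\<close> and \<open>pu i p c\<close>.
  A scalar \<open>c\<close> of \<open>D\<^sup>1B\<close> acts on \<open>U i\<close> as multiplication by \<open>pu i 1 c\<close>.\<close>

locale algebra_over_dg_zero = dg_calg R B
  for R :: "('r, 'w) ring_scheme" and B :: "('r, 'b) dga" +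
  fixes P :: "('b, 'p, 'h) gspace"
  assumes P_alg: "algebra (dg_zero B) P"
begin

sublocale P: algebra "dg_zero B" P by (rule P_alg)

abbreviation "Om n \<equiv> tens A0 P (dg_mod B n)"
abbreviation "U i \<equiv> tens A0 P (fib i)"
abbreviation "pu i \<equiv> pure A0 P (fib i)"
abbreviation "om n \<equiv> pure A0 P (dg_mod B n)"

lemmas modOm = P.module dg_mod_module
lemmas AG_Om = tens_abelian_group[OF modOm]
lemma Om_module: "module A0 (Om n)" by (rule tens_module[OF modOm])

lemma fib_algebra: "i \<le> 1 \<Longrightarrow> algebra A0 (fib i)"
  by (rule bc_alg[OF P_alg D1_cring d_ring_hom])

lemma fib_module: "i \<le> 1 \<Longrightarrow> module A0 (fib i)"
  by (rule algebra.module[OF fib_algebra])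

lemma U_cring: "i \<le> 1 \<Longrightarrow> cring (U i)"
  by (rule bc_cring[OF P_alg D1_cring d_ring_hom])

lemma AG_U: "i \<le> 1 \<Longrightarrow> abelian_group (U i)"
  by (rule tens_abelian_group[OF P.module fib_module])

lemma pu_closed: "i \<le> 1 \<Longrightarrow> p \<in> carrier P \<Longrightarrow> c \<in> carrier D1 \<Longrightarrow> pu i p c \<in> carrier (U i)"
  using pure_closed[OF P.module fib_module] by simp

lemma om_closed: "p \<in> carrier P \<Longrightarrow> b \<in> gr B n \<Longrightarrow> om n p b \<in> carrier (Om n)"
  using pure_closed[OF modOm] by simp

lemma sc_hom: "i \<le> 1 \<Longrightarrow> pu i \<one>\<^bsub>P\<^esub> \<in> ring_hom D1 (U i)"
  using bc_scalars_hom[OF P_alg D1_cring d_ring_hom] by simp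

lemma sc_closed: "i \<le> 1 \<Longrightarrow> c \<in> carrier D1 \<Longrightarrow> pu i \<one>\<^bsub>P\<^esub> c \<in> carrier (U i)"
  using ring_hom_closed[OF sc_hom] .

lemma sc_pu: "i \<le> 1 \<Longrightarrow> p \<in> carrier P \<Longrightarrow> c \<in> carrier D1 \<Longrightarrow> d \<in> carrier D1 \<Longrightarrow>
    pu i \<one>\<^bsub>P\<^esub> c \<otimes>\<^bsub>U i\<^esub> pu i p d = pu i p (c \<otimes>\<^bsub>D1\<^esub> d)"
  by (rule bc_scalar_pure[OF P_alg D1_cring d_ring_hom])

lemma pu_mult: "i \<le> 1 \<Longrightarrow> p \<in> carrier P \<Longrightarrow> q \<in> carrier P \<Longrightarrow> c \<in> carrier D1 \<Longrightarrow> d \<in> carrier D1 \<Longrightarrow>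
    pu i p c \<otimes>\<^bsub>U i\<^esub> pu i q d = pu i (p \<otimes>\<^bsub>P\<^esub> q) (c \<otimes>\<^bsub>D1\<^esub> d)"
  by (rule bc_mult_pure[OF P_alg D1_cring d_ring_hom])

lemma pu_smult: "i \<le> 1 \<Longrightarrow> a \<in> gr B 0 \<Longrightarrow> p \<in> carrier P \<Longrightarrow> c \<in> carrier D1 \<Longrightarrow>
    pu i (a \<odot>\<^bsub>P\<^esub> p) c = pu i p (den_coface_zero B i a \<otimes>\<^bsub>D1\<^esub> c)"
  by (rule bc_pure_smult[OF P_alg D1_cring d_ring_hom]) simp_all

lemma om_smult: "a \<in> gr B 0 \<Longrightarrow> p \<in> carrier P \<Longrightarrow> b \<in> gr B n \<Longrightarrow> om n (a \<odot>\<^bsub>P\<^esub> p) b = om n p (a \<otimes>\<^bsub>B\<^esub> b)"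
  using pure_smult[OF modOm, of a p b n] by simp

lemma U_one: "\<one>\<^bsub>U i\<^esub> = pu i \<one>\<^bsub>P\<^esub> \<one>\<^bsub>D1\<^esub>"
  by (simp add: tens_def)

lemma pu_add_right: "i \<le> 1 \<Longrightarrow> p \<in> carrier P \<Longrightarrow> c \<in> carrier D1 \<Longrightarrow> d \<in> carrier D1 \<Longrightarrow>
    pu i p (c \<oplus>\<^bsub>D1\<^esub> d) = pu i p c \<oplus>\<^bsub>U i\<^esub> pu i p d"
  using pure_add_right[OF P.module fib_module] by simp

lemmas om_add_right = pure_add_right[OF modOm, simplified]
lemmas om_add_left = pure_add_left[OF modOm, simplified]

lemma U_hom_eqI:
  assumes "i \<le> 1" "f \<in> addhom (U i) Z" "g \<in> addhom (U i) Z" "abelian_group Z"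
    and "\<And>p x y. p \<in> carrier P \<Longrightarrow> x \<in> gr B 0 \<Longrightarrow> y \<in> gr B 1 \<Longrightarrow> f (pu i p (elt1 x y)) = g (pu i p (elt1 x y))"
    and u: "u \<in> carrier (U i)"
  shows "f u = g u"
  by (rule tens_hom_eqI[OF P.module fib_module[OF assms(1)] assms(2-4) _ u])
    (use assms(5) D1E in \<open>metis restr_simps(1) self_simps(1)\<close>)

lemma Om_hom_eqI:
  assumes "f \<in> addhom (Om n) Z" "g \<in> addhom (Om n) Z" "abelian_group Z"
    and "\<And>p b. p \<in> carrier P \<Longrightarrow> b \<in> gr B n \<Longrightarrow> f (om n p b) = g (om n p b)"
    and u: "u \<in> carrier (Om n)"
  shows "f u = g u"
  by (rule tens_hom_eqI[OF modOm assms(1-3) _ u]) (simp add: assms(4))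

subsection \<open>The infinitesimal part of the two pullbacks\<close>

text \<open>\<open>O(\<partial>\<^sup>iP)\<close> is an extension of \<open>O(P)\<close> by the infinitesimal part \<open>O(P) \<otimes> B\<^sup>1\<close>. The projection to \<open>O(P)\<close> is
  \<open>augment i\<close> and the inclusion is \<open>eps i\<close>. For \<open>i = 0\<close> the base acts through \<open>\<partial>\<^sup>0\<close>, and since
  \<open>x + y\<epsilon> = \<partial>\<^sup>0x + (y - \<partial>x)\<epsilon>\<close> the map \<open>x + y\<epsilon> \<mapsto> y - \<partial>x\<close> is linear for this action; it gives the
  retraction \<open>eps_retract\<close>.\<close>

definition "eps i = tens_map A0 P (fib i) id (elt1 \<zero>\<^bsub>B\<^esub>)"
definition "eps_retract = tens_map A0 P (dg_mod B 1) id (\<lambda>c. c {} \<ominus>\<^bsub>B\<^esub> diff B (c {1}))"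
definition "augment i = tens_lift P (\<lambda>p c. c {1} \<odot>\<^bsub>P\<^esub> p)" for i :: nat

lemma eps_linmap: "i \<le> 1 \<Longrightarrow> elt1 \<zero>\<^bsub>B\<^esub> \<in> linmap A0 (dg_mod B 1) (fib i)"
  by (rule linmapI) (simp_all add: addhom_cong[of "dg_mod B 1" "dg_mod B 1" "fib i" D1] elt1_hom
      d_eq elt1_eps_mult gr_closed)

lemma eps_hom: "i \<le> 1 \<Longrightarrow> eps i \<in> addhom (Om 1) (U i)"
  unfolding eps_def by (rule tens_map_hom[OF modOm P.module fib_module linmap_id eps_linmap])

lemma eps_pure: "i \<le> 1 \<Longrightarrow> p \<in> carrier P \<Longrightarrow> b \<in> gr B 1 \<Longrightarrow> eps i (om 1 p b) = pu i p (elt1 \<zero>\<^bsub>B\<^esub> b)"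
  unfolding eps_def
  using tens_map_pure[OF modOm P.module fib_module linmap_id eps_linmap, where m = p and n = b] by simp

lemma eps_retract_linmap: "(\<lambda>c. c {} \<ominus>\<^bsub>B\<^esub> diff B (c {1})) \<in> linmap A0 (fib 0) (dg_mod B 1)"
proof (intro linmapI addhomI)
  fix c c' assume "c \<in> carrier (fib 0)" "c' \<in> carrier (fib 0)"
  then obtain x y x' y' where h: "c = elt1 x y" "x \<in> gr B 0" "y \<in> gr B 1" "c' = elt1 x' y'"
    "x' \<in> gr B 0" "y' \<in> gr B 1" using D1E by (metis restr_simps(1) self_simps(1))
  then show "c {} \<ominus>\<^bsub>B\<^esub> diff B (c {1}) \<in> carrier (dg_mod B 1)"
    by (simp add: a_minus_def gr_closed)
  show "(c \<oplus>\<^bsub>fib 0\<^esub> c') {} \<ominus>\<^bsub>B\<^esub> diff B ((c \<oplus>\<^bsub>fib 0\<^esub> c') {1}) =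
       c {} \<ominus>\<^bsub>B\<^esub> diff B (c {1}) \<oplus>\<^bsub>dg_mod B 1\<^esub> (c' {} \<ominus>\<^bsub>B\<^esub> diff B (c' {1}))"
    using h by (simp add: D1_add gr_carrier diff_add diff_carrier a_minus_def minus_add a_ac)
next
  fix a c assume "a \<in> carrier A0" "c \<in> carrier (fib 0)"
  then obtain x y where h: "c = elt1 x y" "x \<in> gr B 0" "y \<in> gr B 1" "a \<in> gr B 0"
    using D1E by (metis restr_simps(1) self_simps(1) dg_zero_simps(1))
  have xa: "diff B a \<otimes>\<^bsub>B\<^esub> x \<in> carrier B" "diff B (a \<otimes>\<^bsub>B\<^esub> x) = diff B a \<otimes>\<^bsub>B\<^esub> x \<oplus>\<^bsub>B\<^esub> a \<otimes>\<^bsub>B\<^esub> diff B x"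
    using h by (simp_all add: diff_mult0[of a x 0] gr_carrier diff_carrier)
  have "a \<otimes>\<^bsub>B\<^esub> y \<oplus>\<^bsub>B\<^esub> diff B a \<otimes>\<^bsub>B\<^esub> x \<ominus>\<^bsub>B\<^esub> (diff B a \<otimes>\<^bsub>B\<^esub> x \<oplus>\<^bsub>B\<^esub> a \<otimes>\<^bsub>B\<^esub> diff B x) = a \<otimes>\<^bsub>B\<^esub> (y \<ominus>\<^bsub>B\<^esub> diff B x)"
  proof -
    have c: "a \<otimes>\<^bsub>B\<^esub> diff B x \<in> carrier B" using h by (simp add: gr_carrier diff_carrier)
    then have "diff B a \<otimes>\<^bsub>B\<^esub> x \<oplus>\<^bsub>B\<^esub> (\<ominus>\<^bsub>B\<^esub> (a \<otimes>\<^bsub>B\<^esub> diff B x) \<oplus>\<^bsub>B\<^esub> \<ominus>\<^bsub>B\<^esub> (diff B a \<otimes>\<^bsub>B\<^esub> x))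
        = \<ominus>\<^bsub>B\<^esub> (a \<otimes>\<^bsub>B\<^esub> diff B x)"
      using xa(1) a_lcomm[of "diff B a \<otimes>\<^bsub>B\<^esub> x" "\<ominus>\<^bsub>B\<^esub> (a \<otimes>\<^bsub>B\<^esub> diff B x)" "\<ominus>\<^bsub>B\<^esub> (diff B a \<otimes>\<^bsub>B\<^esub> x)"]
      by (simp add: r_neg)
    then show ?thesis
      using h xa(1) by (simp add: gr_carrier diff_carrier a_minus_def minus_add r_distr r_minus a_ac)
  qed
  then show "(a \<odot>\<^bsub>fib 0\<^esub> c) {} \<ominus>\<^bsub>B\<^esub> diff B ((a \<odot>\<^bsub>fib 0\<^esub> c) {1}) = a \<odot>\<^bsub>dg_mod B 1\<^esub> (c {} \<ominus>\<^bsub>B\<^esub> diff B (c {1}))"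
    using h by (simp add: d0_eq D1_mult gr_closed xa(2))
qed

lemma eps_retract_hom: "eps_retract \<in> addhom (U 0) (Om 1)"
  unfolding eps_retract_def by (rule tens_map_hom[OF P.module fib_module modOm linmap_id eps_retract_linmap]) simp

lemma eps_retract_pure: "p \<in> carrier P \<Longrightarrow> x \<in> gr B 0 \<Longrightarrow> y \<in> gr B 1 \<Longrightarrow>
    eps_retract (pu 0 p (elt1 x y)) = om 1 p (y \<ominus>\<^bsub>B\<^esub> diff B x)"
  unfolding eps_retract_def using tens_map_pure[OF P.module fib_module modOm linmap_id eps_retract_linmap, where m = p and n = "elt1 x y"]
  by (simp add: D1_carrier)

lemma eps_retract_eps: "\<omega> \<in> carrier (Om 1) \<Longrightarrow> eps_retract (eps 0 \<omega>) = \<omega>"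
  by (rule Om_hom_eqI[OF addhom_comp[OF eps_hom eps_retract_hom] addhom_id AG_Om])
    (simp_all add: eps_pure eps_retract_pure gr_closed diff_zero a_minus_def gr_carrier)

lemma eps_retract_pu_one: "p \<in> carrier P \<Longrightarrow> eps_retract (pu 0 p \<one>\<^bsub>D1\<^esub>) = \<zero>\<^bsub>Om 1\<^esub>"
  using addhom_zero[OF pure_right_hom[OF modOm] _ AG_Om, of p 1] abelian_group_gr[of "dg_mod B 1" 1]
  by (simp add: D1_one eps_retract_pure gr_closed diff_one a_minus_def)

lemma augment_balanced: "i \<le> 1 \<Longrightarrow> balanced A0 P (fib i) P (\<lambda>p c. c {1} \<odot>\<^bsub>P\<^esub> p)"
proof (intro balancedI addhomI)
  fix a p c assume i: "i \<le> 1" and "a \<in> carrier A0" "p \<in> carrier P" "c \<in> carrier (fib i)"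
  then obtain x y where h: "c = elt1 x y" "x \<in> gr B 0" "y \<in> gr B 1" "a \<in> gr B 0" "p \<in> carrier P"
    using D1E by (metis restr_simps(1) self_simps(1) dg_zero_simps(1))
  then show "c {1} \<odot>\<^bsub>P\<^esub> (a \<odot>\<^bsub>P\<^esub> p) = (a \<odot>\<^bsub>fib i\<^esub> c) {1} \<odot>\<^bsub>P\<^esub> p"
    using P.smult_assoc1[of x a p] i by (simp add: d_eq D1_mult gr_closed mult0_comm[of a x 0])
next
  fix p c c' assume i: "i \<le> 1" and "p \<in> carrier P" "c \<in> carrier (fib i)" "c' \<in> carrier (fib i)"
  then obtain x y x' y' where h: "c = elt1 x y" "x \<in> gr B 0" "y \<in> gr B 1" "p \<in> carrier P"
    "c' = elt1 x' y'" "x' \<in> gr B 0" "y' \<in> gr B 1"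
    using D1E by (metis restr_simps(1) self_simps(1))
  then show "(c \<oplus>\<^bsub>fib i\<^esub> c') {1} \<odot>\<^bsub>P\<^esub> p = c {1} \<odot>\<^bsub>P\<^esub> p \<oplus>\<^bsub>P\<^esub> c' {1} \<odot>\<^bsub>P\<^esub> p"
    using P.smult_l_distr[of x x' p] by (simp add: D1_add)
next
  fix p p' c assume "p \<in> carrier P" "p' \<in> carrier P" "c \<in> carrier (fib i)"
  then obtain x y where h: "c = elt1 x y" "x \<in> gr B 0" "y \<in> gr B 1" "p \<in> carrier P" "p' \<in> carrier P"
    using D1E by (metis restr_simps(1) self_simps(1))
  then show "c {1} \<odot>\<^bsub>P\<^esub> (p \<oplus>\<^bsub>P\<^esub> p') = c {1} \<odot>\<^bsub>P\<^esub> p \<oplus>\<^bsub>P\<^esub> c {1} \<odot>\<^bsub>P\<^esub> p'"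
    by (simp add: P.smult_r_distr)
qed (use D1E in \<open>metis restr_simps(1) self_simps(1) dg_zero_simps(1) P.smult_closed elt1_apply(1)\<close>)+

lemma augment_hom: "i \<le> 1 \<Longrightarrow> augment i \<in> addhom (U i) P"
  unfolding augment_def by (rule tens_lift_hom[OF P.module fib_module P.is_abelian_group augment_balanced])

lemma augment_pure: "i \<le> 1 \<Longrightarrow> p \<in> carrier P \<Longrightarrow> x \<in> gr B 0 \<Longrightarrow> y \<in> gr B 1 \<Longrightarrow> augment i (pu i p (elt1 x y)) = x \<odot>\<^bsub>P\<^esub> p"
  unfolding augment_def using tens_lift_pure[OF P.module fib_module P.is_abelian_group augment_balanced, where m = p and n = "elt1 x y"]
  by (simp add: D1_carrier)

text \<open>The exact sequence \<open>0 \<rightarrow> O(P) \<otimes> B\<^sup>1 \<rightarrow> O(\<partial>\<^sup>0P) \<rightarrow> O(P) \<rightarrow> 0\<close> splits additively.\<close>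

lemma U0_split: "u \<in> carrier (U 0) \<Longrightarrow> u = pu 0 (augment 0 u) \<one>\<^bsub>D1\<^esub> \<oplus>\<^bsub>U 0\<^esub> eps 0 (eps_retract u)"
proof -
  assume u: "u \<in> carrier (U 0)"
  have 1: "(\<lambda>p. pu 0 p \<one>\<^bsub>D1\<^esub>) \<in> addhom P (U 0)"
    using pure_left_hom[OF P.module fib_module, of 0 "\<one>\<^bsub>D1\<^esub>"] by (simp add: D1_one D1_carrier gr_closed)
  show ?thesis
  proof (rule U_hom_eqI[OF _ addhom_id addhom_plus[OF addhom_comp[OF augment_hom 1] addhom_comp[OF eps_retract_hom eps_hom] AG_U] AG_U _ u])
    fix p x y assume h: "p \<in> carrier P" "x \<in> gr B 0" "y \<in> gr B 1"
    have "pu 0 (x \<odot>\<^bsub>P\<^esub> p) \<one>\<^bsub>D1\<^esub> = pu 0 p (elt1 x (diff B x))"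
      using h by (simp add: pu_smult d0_eq D1_one D1_carrier D1_mult gr_closed gr_carrier diff_carrier)
    moreover have "pu 0 p (elt1 x (diff B x)) \<oplus>\<^bsub>U 0\<^esub> pu 0 p (elt1 \<zero>\<^bsub>B\<^esub> (y \<ominus>\<^bsub>B\<^esub> diff B x)) = pu 0 p (elt1 x y)"
    proof -
      have "diff B x \<oplus>\<^bsub>B\<^esub> (y \<ominus>\<^bsub>B\<^esub> diff B x) = y"
        using h by (simp add: gr_carrier diff_carrier a_minus_def a_ac r_neg)
      then show ?thesis using h
        by (subst pu_add_right[symmetric]) (simp_all add: D1_carrier D1_add gr_closed gr_carrier a_minus_def)
    qed
    ultimately show "pu 0 p (elt1 x y) = pu 0 (augment 0 (pu 0 p (elt1 x y))) \<one>\<^bsub>D1\<^esub> \<oplus>\<^bsub>U 0\<^esub> eps 0 (eps_retract (pu 0 p (elt1 x y)))"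
      using h by (simp add: augment_pure eps_retract_pure eps_pure gr_closed a_minus_def)
  qed simp_all
qed

lemma eps_scalar:
  assumes i: "i \<le> 1" and a: "a \<in> gr B 0" "y \<in> gr B 1" and \<omega>: "\<omega> \<in> carrier (Om 1)"
  shows "pu i \<one>\<^bsub>P\<^esub> (elt1 a y) \<otimes>\<^bsub>U i\<^esub> eps i \<omega> = eps i (a \<odot>\<^bsub>Om 1\<^esub> \<omega>)"
proof (rule Om_hom_eqI[OF addhom_comp[OF eps_hom[OF i] tens_mult_hom_right[OF P_alg fib_algebra[OF i]]]
      addhom_comp[OF tens_smult_hom[OF modOm] eps_hom[OF i]] AG_U[OF i] _ \<omega>])
  fix p b assume h: "p \<in> carrier P" "b \<in> gr B 1"
  then have "pu i \<one>\<^bsub>P\<^esub> (elt1 a y) \<otimes>\<^bsub>U i\<^esub> eps i (om 1 p b) = pu i p (elt1 \<zero>\<^bsub>B\<^esub> (a \<otimes>\<^bsub>B\<^esub> b))"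
    using i a by (simp add: eps_pure sc_pu D1_carrier gr_closed elt1_eps_mult)
  also have "\<dots> = eps i (a \<odot>\<^bsub>Om 1\<^esub> om 1 p b)"
    using i a h by (simp add: tens_smult_pure[OF modOm] om_smult eps_pure gr_closed)
  finally show "pu i \<one>\<^bsub>P\<^esub> (elt1 a y) \<otimes>\<^bsub>U i\<^esub> eps i (om 1 p b) = eps i (a \<odot>\<^bsub>Om 1\<^esub> om 1 p b)" .
qed (use a in \<open>simp_all add: sc_closed i D1_carrier\<close>)

lemma eps_sqzero:
  assumes i: "i \<le> 1" and \<omega>: "\<omega> \<in> carrier (Om 1)" and \<eta>: "\<eta> \<in> carrier (Om 1)"
  shows "eps i \<omega> \<otimes>\<^bsub>U i\<^esub> eps i \<eta> = \<zero>\<^bsub>U i\<^esub>"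
proof -
  note L = addhom_comp[OF eps_hom[OF i] tens_mult_hom_left[OF P_alg fib_algebra[OF i]]]
  note Rt = addhom_comp[OF eps_hom[OF i] tens_mult_hom_right[OF P_alg fib_algebra[OF i]]]
  note z = addhom_const_zero[OF AG_U[OF i]]
  have z2: "pu i q (elt1 \<zero>\<^bsub>B\<^esub> \<zero>\<^bsub>B\<^esub>) = \<zero>\<^bsub>U i\<^esub>" if "q \<in> carrier P" for q
    using addhom_zero[OF pure_right_hom[OF P.module fib_module[OF i] that] _ AG_U[OF i]]
      module.axioms(2)[OF fib_module[OF i]] by (simp add: D1_zero)
  have 1: "eps i (om 1 p b) \<otimes>\<^bsub>U i\<^esub> eps i \<eta> = \<zero>\<^bsub>U i\<^esub>" if "p \<in> carrier P" "b \<in> gr B 1" for p b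
  proof (rule Om_hom_eqI[OF Rt z AG_U[OF i] _ \<eta>])
    fix q b' assume "q \<in> carrier P" "b' \<in> gr B 1"
    then show "eps i (om 1 p b) \<otimes>\<^bsub>U i\<^esub> eps i (om 1 q b') = \<zero>\<^bsub>U i\<^esub>"
      using that i by (simp add: eps_pure pu_mult D1_carrier gr_closed elt1_eps_mult z2 gr_carrier)
  qed (use that i in \<open>simp add: eps_pure pu_closed D1_carrier gr_closed\<close>)
  show ?thesis
    by (rule Om_hom_eqI[OF L z AG_U[OF i] 1 \<omega>]) (simp_all add: addhom_closed[OF eps_hom[OF i] \<eta>])
qed

lemma form_smult_linmap: "q \<in> carrier P \<Longrightarrow> (\<lambda>x. q \<otimes>\<^bsub>P\<^esub> x) \<in> linmap A0 P P"
  by (intro linmapI addhomI) (simp_all add: P.r_distr P.smult_assoc2_right)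

lemma form_smult_hom: "q \<in> carrier P \<Longrightarrow> form_smult B P q \<in> addhom (Om 1) (Om 1)"
  unfolding form_smult_def by (rule tens_map_hom[OF modOm modOm form_smult_linmap linmap_id])

lemma form_smult_pure: "q \<in> carrier P \<Longrightarrow> p \<in> carrier P \<Longrightarrow> b \<in> gr B 1 \<Longrightarrow>
    form_smult B P q (om 1 p b) = om 1 (q \<otimes>\<^bsub>P\<^esub> p) b"
  unfolding form_smult_def using tens_map_pure[OF modOm modOm form_smult_linmap linmap_id, where m = p and n = b] by simp

lemma eps_form_smult:
  assumes i: "i \<le> 1" and q: "q \<in> carrier P" and \<omega>: "\<omega> \<in> carrier (Om 1)"
  shows "eps i (form_smult B P q \<omega>) = pu i q \<one>\<^bsub>D1\<^esub> \<otimes>\<^bsub>U i\<^esub> eps i \<omega>"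
proof (rule Om_hom_eqI[OF addhom_comp[OF form_smult_hom eps_hom] addhom_comp[OF eps_hom tens_mult_hom_right[OF P_alg fib_algebra]] AG_U _ \<omega>])
  fix p b assume "p \<in> carrier P" "b \<in> gr B 1"
  then show "eps i (form_smult B P q (om 1 p b)) = pu i q \<one>\<^bsub>D1\<^esub> \<otimes>\<^bsub>U i\<^esub> eps i (om 1 p b)"
    using i q by (simp add: form_smult_pure eps_pure pu_mult D1_one D1_carrier gr_closed elt1_eps_mult gr_carrier)
qed (use i q in \<open>simp_all add: pu_closed D1_one D1_carrier gr_closed\<close>)

lemma form_smult_unit: "a \<in> gr B 0 \<Longrightarrow> \<omega> \<in> carrier (Om 1) \<Longrightarrow> form_smult B P (unit_map P a) \<omega> = a \<odot>\<^bsub>Om 1\<^esub> \<omega>"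
  by (rule Om_hom_eqI[OF form_smult_hom tens_smult_hom[OF modOm] AG_Om])
    (simp_all add: form_smult_pure tens_smult_pure[OF modOm] unit_map_def P.smult_assoc2)

end

context algebra_over_dg_zero
begin

subsection \<open>Algebra maps between the two pullbacks\<close>

text \<open>A \<open>D\<^sup>1B\<close>-linear map from \<open>O(\<partial>\<^sup>iP)\<close> to \<open>O(\<partial>\<^sup>jP)\<close> is the same as a map \<open>t\<close> on \<open>O(P)\<close> that is semilinear:
  scalars \<open>a\<close> in \<open>B\<^sup>0\<close> come out as \<open>\<partial>\<^sup>ia\<close>.\<close>

definition "twist j t = tens_lift (U j) (\<lambda>p c. pu j \<one>\<^bsub>P\<^esub> c \<otimes>\<^bsub>U j\<^esub> t p)"

context
  fixes i j :: nat and t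
  assumes i: "i \<le> 1" and j: "j \<le> 1" and t_hom: "t \<in> addhom P (U j)"
    and t_smult: "\<And>a p. a \<in> gr B 0 \<Longrightarrow> p \<in> carrier P \<Longrightarrow>
      t (a \<odot>\<^bsub>P\<^esub> p) = pu j \<one>\<^bsub>P\<^esub> (den_coface_zero B i a) \<otimes>\<^bsub>U j\<^esub> t p"
begin

interpretation Uj: cring "U j" by (rule U_cring[OF j])

private lemma twist_balanced: "balanced A0 P (fib i) (U j) (\<lambda>p c. pu j \<one>\<^bsub>P\<^esub> c \<otimes>\<^bsub>U j\<^esub> t p)"
proof (intro balancedI addhomI)
  fix a p c assume h: "a \<in> carrier A0" "p \<in> carrier P" "c \<in> carrier (fib i)"
  then have "pu j \<one>\<^bsub>P\<^esub> (den_coface_zero B i a \<otimes>\<^bsub>D1\<^esub> c) = pu j \<one>\<^bsub>P\<^esub> (den_coface_zero B i a) \<otimes>\<^bsub>U j\<^esub> pu j \<one>\<^bsub>P\<^esub> c"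
    using i by (simp add: ring_hom_mult[OF sc_hom[OF j]] d_closed)
  then show "pu j \<one>\<^bsub>P\<^esub> c \<otimes>\<^bsub>U j\<^esub> t (a \<odot>\<^bsub>P\<^esub> p) = pu j \<one>\<^bsub>P\<^esub> (a \<odot>\<^bsub>fib i\<^esub> c) \<otimes>\<^bsub>U j\<^esub> t p"
    using h i by (simp add: t_smult sc_closed[OF j] d_closed addhom_closed[OF t_hom] Uj.m_ac)
qed (simp_all add: sc_closed[OF j] addhom_closed[OF t_hom] addhom_add[OF t_hom] Uj.r_distr Uj.l_distr
    pu_add_right[OF j])

lemma twist_hom: "twist j t \<in> addhom (U i) (U j)"
  unfolding twist_def by (rule tens_lift_hom[OF P.module fib_module[OF i] AG_U[OF j] twist_balanced])

lemma twist_pure: "p \<in> carrier P \<Longrightarrow> c \<in> carrier D1 \<Longrightarrow> twist j t (pu i p c) = pu j \<one>\<^bsub>P\<^esub> c \<otimes>\<^bsub>U j\<^esub> t p"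
  unfolding twist_def using tens_lift_pure[OF P.module fib_module[OF i] AG_U[OF j] twist_balanced] by simp

lemma twist_pure_one: "p \<in> carrier P \<Longrightarrow> twist j t (pu i p \<one>\<^bsub>D1\<^esub>) = t p"
  using cring.cring_simprules(6)[OF D1_cring]
  by (simp add: twist_pure ring_hom_one[OF sc_hom[OF j]] addhom_closed[OF t_hom])

lemma twist_scalar:
  assumes c: "c \<in> carrier D1" and u: "u \<in> carrier (U i)"
  shows "twist j t (pu i \<one>\<^bsub>P\<^esub> c \<otimes>\<^bsub>U i\<^esub> u) = pu j \<one>\<^bsub>P\<^esub> c \<otimes>\<^bsub>U j\<^esub> twist j t u"
proof (rule tens_hom_eqI[OF P.module fib_module[OF i]
      addhom_comp[OF tens_mult_hom_right[OF P_alg fib_algebra[OF i] sc_closed[OF i c]] twist_hom]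
      addhom_comp[OF twist_hom tens_mult_hom_right[OF P_alg fib_algebra[OF j] sc_closed[OF j c]]] AG_U[OF j] _ u])
  fix p d assume "p \<in> carrier P" "d \<in> carrier (fib i)"
  then show "twist j t (pu i \<one>\<^bsub>P\<^esub> c \<otimes>\<^bsub>U i\<^esub> pu i p d) = pu j \<one>\<^bsub>P\<^esub> c \<otimes>\<^bsub>U j\<^esub> twist j t (pu i p d)"
    using c by (simp add: sc_pu[OF i] twist_pure cring.cring_simprules(5)[OF D1_cring] ring_hom_mult[OF sc_hom[OF j]]
        Uj.m_assoc sc_closed[OF j] addhom_closed[OF t_hom])
qed

lemma twist_mult:
  assumes t_mult: "\<And>p q. p \<in> carrier P \<Longrightarrow> q \<in> carrier P \<Longrightarrow> t (p \<otimes>\<^bsub>P\<^esub> q) = t p \<otimes>\<^bsub>U j\<^esub> t q"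
    and u: "u \<in> carrier (U i)" and v: "v \<in> carrier (U i)"
  shows "twist j t (u \<otimes>\<^bsub>U i\<^esub> v) = twist j t u \<otimes>\<^bsub>U j\<^esub> twist j t v"
proof -
  interpret Ui: cring "U i" by (rule U_cring[OF i])
  note Rt = addhom_comp[OF tens_mult_hom_right[OF P_alg fib_algebra[OF i]] twist_hom]
    and Rt' = addhom_comp[OF twist_hom tens_mult_hom_right[OF P_alg fib_algebra[OF j]]]
    and L = addhom_comp[OF tens_mult_hom_left[OF P_alg fib_algebra[OF i]] twist_hom]
    and L' = addhom_comp[OF twist_hom tens_mult_hom_left[OF P_alg fib_algebra[OF j]]]
  have cl: "twist j t u \<in> carrier (U j)" if "u \<in> carrier (U i)" for u
    using addhom_closed[OF twist_hom that] .
  have 1: "twist j t (pu i p c \<otimes>\<^bsub>U i\<^esub> v) = twist j t (pu i p c) \<otimes>\<^bsub>U j\<^esub> twist j t v"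
    if pc: "p \<in> carrier P" "c \<in> carrier D1" for p c
  proof (rule tens_hom_eqI[OF P.module fib_module[OF i] Rt Rt' AG_U[OF j] _ v])
    show "pu i p c \<in> carrier (U i)" using pc by (simp add: pu_closed[OF i])
    then show "twist j t (pu i p c) \<in> carrier (U j)" by (rule cl)
    fix q d assume "q \<in> carrier P" "d \<in> carrier (fib i)"
    then show "twist j t (pu i p c \<otimes>\<^bsub>U i\<^esub> pu i q d) = twist j t (pu i p c) \<otimes>\<^bsub>U j\<^esub> twist j t (pu i q d)"
      using pc by (simp add: pu_mult[OF i] twist_pure cring.cring_simprules(5)[OF D1_cring] ring_hom_mult[OF sc_hom[OF j]]
        Uj.m_ac sc_closed[OF j] addhom_closed[OF t_hom] t_mult)
  qed
  show ?thesis
    by (rule tens_hom_eqI[OF P.module fib_module[OF i] L[OF v] L'[OF cl[OF v]] AG_U[OF j] _ u]) (simp add: 1)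
qed

end

text \<open>The part of the definition of a flat connection that concerns functions only, without its extension
  to forms.\<close>

definition derivation :: "('p \<Rightarrow> ('p, 'b) tensor) \<Rightarrow> bool" where
  "derivation nabla \<longleftrightarrow> nabla \<in> extensional (carrier P) \<and> nabla \<in> carrier P \<rightarrow> carrier (Om 1) \<and>
     (\<forall>p \<in> carrier P. \<forall>q \<in> carrier P. nabla (p \<oplus>\<^bsub>P\<^esub> q) = nabla p \<oplus>\<^bsub>Om 1\<^esub> nabla q) \<and>
     (\<forall>p \<in> carrier P. \<forall>q \<in> carrier P.
         nabla (p \<otimes>\<^bsub>P\<^esub> q) = form_smult B P q (nabla p) \<oplus>\<^bsub>Om 1\<^esub> form_smult B P p (nabla q)) \<and>
     (\<forall>b \<in> gr B 0. nabla (unit_map P b) = om 1 \<one>\<^bsub>P\<^esub> (diff B b))"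

text \<open>The value \<open>g(p \<otimes> 1)\<close> of the descent datum of a derivation; \<open>transport\<close> is the datum itself.\<close>

definition "translate nabla p = pu 0 p \<one>\<^bsub>D1\<^esub> \<ominus>\<^bsub>U 0\<^esub> eps 0 (nabla p)"

definition "transport nabla = restrict (twist 0 (translate nabla)) (carrier (U 1))"

lemma D1_one_closed: "\<one>\<^bsub>D1\<^esub> \<in> carrier D1"
  using cring.cring_simprules(6)[OF D1_cring] .

lemma pu_one_hom: "i \<le> 1 \<Longrightarrow> (\<lambda>p. pu i p \<one>\<^bsub>D1\<^esub>) \<in> addhom P (U i)"
  using pure_left_hom[OF P.module fib_module, of i "\<one>\<^bsub>D1\<^esub>"] D1_one_closed by simp

context
  fixes nabla assumes der: "derivation nabla"
begin

lemma der_hom: "nabla \<in> addhom P (Om 1)"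
  using der by (auto simp: derivation_def addhom_def)

lemma der_closed: "p \<in> carrier P \<Longrightarrow> nabla p \<in> carrier (Om 1)"
  by (rule addhom_closed[OF der_hom])

lemma der_smult:
  assumes a: "a \<in> gr B 0" and p: "p \<in> carrier P"
  shows "nabla (a \<odot>\<^bsub>P\<^esub> p) = om 1 p (diff B a) \<oplus>\<^bsub>Om 1\<^esub> a \<odot>\<^bsub>Om 1\<^esub> nabla p"
proof -
  have ua: "unit_map P a \<in> carrier P" using a by (simp add: unit_map_def)
  have "a \<odot>\<^bsub>P\<^esub> p = unit_map P a \<otimes>\<^bsub>P\<^esub> p" using a p by (simp add: unit_map_def P.smult_assoc2)
  then have "nabla (a \<odot>\<^bsub>P\<^esub> p) = form_smult B P p (om 1 \<one>\<^bsub>P\<^esub> (diff B a)) \<oplus>\<^bsub>Om 1\<^esub> form_smult B P (unit_map P a) (nabla p)"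
    using der a p ua by (simp add: derivation_def)
  then show ?thesis
    using a p by (simp add: form_smult_pure gr_closed form_smult_unit der_closed)
qed

lemma der_one: "nabla \<one>\<^bsub>P\<^esub> = \<zero>\<^bsub>Om 1\<^esub>"
proof -
  have "unit_map P \<one>\<^bsub>B\<^esub> = \<one>\<^bsub>P\<^esub>" using P.smult_one[of "\<one>\<^bsub>P\<^esub>"] by (simp add: unit_map_def)
  then have "nabla \<one>\<^bsub>P\<^esub> = om 1 \<one>\<^bsub>P\<^esub> \<zero>\<^bsub>B\<^esub>"
    using der one_gr diff_one by (auto simp: derivation_def)
  then show ?thesis
    using addhom_zero[OF pure_right_hom[OF modOm] _ AG_Om, of "\<one>\<^bsub>P\<^esub>" 1] abelian_group_gr[of "dg_mod B 1" 1]
    by simp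
qed

interpretation U0: cring "U 0" by (rule U_cring) simp
interpretation U1: cring "U 1" by (rule U_cring) simp

lemma eps_der_hom: "i \<le> 1 \<Longrightarrow> (\<lambda>p. eps i (nabla p)) \<in> addhom P (U i)"
  by (rule addhom_comp[OF der_hom eps_hom])

lemma translate_hom: "translate nabla \<in> addhom P (U 0)"
  unfolding translate_def[abs_def]
  by (rule addhom_minus'[OF pu_one_hom eps_der_hom AG_U]) simp_all

text \<open>Semilinearity fixes the sign in \<open>p - \<nabla>p\<close>: the correction \<open>(\<partial>a)\<epsilon>\<close> in \<open>\<partial>\<^sup>0a\<close> has to cancel the
  term \<open>p \<otimes> \<partial>a\<close> of \<open>\<nabla>(ap)\<close>.\<close>

lemma translate_smult:
  assumes a: "a \<in> gr B 0" and p: "p \<in> carrier P"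
  shows "translate nabla (a \<odot>\<^bsub>P\<^esub> p) = pu 0 \<one>\<^bsub>P\<^esub> (den_coface_zero B 1 a) \<otimes>\<^bsub>U 0\<^esub> translate nabla p"
proof -
  let ?X = "pu 0 p (elt1 a \<zero>\<^bsub>B\<^esub>)" and ?Y = "pu 0 p (elt1 \<zero>\<^bsub>B\<^esub> (diff B a))" and ?Z = "eps 0 (a \<odot>\<^bsub>Om 1\<^esub> nabla p)"
  have cl: "?X \<in> carrier (U 0)" "?Y \<in> carrier (U 0)" "?Z \<in> carrier (U 0)"
    using a p by (simp_all add: pu_closed D1_carrier gr_closed addhom_closed[OF eps_hom]
        der_closed addhom_closed[OF tens_smult_hom[OF modOm]])
  have "pu 0 (a \<odot>\<^bsub>P\<^esub> p) \<one>\<^bsub>D1\<^esub> = pu 0 p (elt1 a (diff B a))"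
    using a p by (simp add: pu_smult d0_eq D1_one D1_carrier D1_mult gr_closed gr_carrier diff_carrier)
  also have "\<dots> = ?X \<oplus>\<^bsub>U 0\<^esub> ?Y"
    using a p by (subst elt1_split) (simp_all add: pu_add_right D1_carrier gr_closed)
  finally have 1: "pu 0 (a \<odot>\<^bsub>P\<^esub> p) \<one>\<^bsub>D1\<^esub> = ?X \<oplus>\<^bsub>U 0\<^esub> ?Y" .
  have 2: "eps 0 (nabla (a \<odot>\<^bsub>P\<^esub> p)) = ?Y \<oplus>\<^bsub>U 0\<^esub> ?Z"
    using a p by (simp add: der_smult addhom_add[OF eps_hom] om_closed gr_closed eps_pure
        der_closed addhom_closed[OF tens_smult_hom[OF modOm]])
  have 3: "pu 0 \<one>\<^bsub>P\<^esub> (den_coface_zero B 1 a) \<otimes>\<^bsub>U 0\<^esub> pu 0 p \<one>\<^bsub>D1\<^esub> = ?X"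
    using a p by (simp add: sc_pu d1_eq D1_one D1_carrier D1_mult gr_closed gr_carrier)
  have 4: "pu 0 \<one>\<^bsub>P\<^esub> (den_coface_zero B 1 a) \<otimes>\<^bsub>U 0\<^esub> eps 0 (nabla p) = ?Z"
    using a p by (simp add: d1_eq eps_scalar gr_closed der_closed)
  have "pu 0 \<one>\<^bsub>P\<^esub> (den_coface_zero B 1 a) \<otimes>\<^bsub>U 0\<^esub> translate nabla p = ?X \<ominus>\<^bsub>U 0\<^esub> ?Z"
    unfolding translate_def a_minus_def using a p
    by (simp add: U0.r_distr U0.r_minus 3 4 sc_closed d_closed pu_closed D1_one_closed
        addhom_closed[OF eps_hom] der_closed)
  moreover have "?X \<oplus>\<^bsub>U 0\<^esub> ?Y \<ominus>\<^bsub>U 0\<^esub> (?Y \<oplus>\<^bsub>U 0\<^esub> ?Z) = ?X \<ominus>\<^bsub>U 0\<^esub> ?Z"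
    using cl by algebra
  ultimately show ?thesis by (simp add: translate_def 1 2)
qed

text \<open>Multiplicativity is the Leibniz rule up to the product of two infinitesimals.\<close>

lemma translate_mult:
  assumes p: "p \<in> carrier P" and q: "q \<in> carrier P"
  shows "translate nabla (p \<otimes>\<^bsub>P\<^esub> q) = translate nabla p \<otimes>\<^bsub>U 0\<^esub> translate nabla q"
proof -
  let ?x = "pu 0 p \<one>\<^bsub>D1\<^esub>" and ?y = "pu 0 q \<one>\<^bsub>D1\<^esub>" and ?e = "eps 0 (nabla p)" and ?f = "eps 0 (nabla q)"
  have cl: "?x \<in> carrier (U 0)" "?y \<in> carrier (U 0)" "?e \<in> carrier (U 0)" "?f \<in> carrier (U 0)"
    using p q by (simp_all add: pu_closed D1_one_closed addhom_closed[OF eps_hom] der_closed)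
  have 1: "pu 0 (p \<otimes>\<^bsub>P\<^esub> q) \<one>\<^bsub>D1\<^esub> = ?x \<otimes>\<^bsub>U 0\<^esub> ?y"
    using p q by (simp add: pu_mult D1_one_closed cring.cring_simprules(12)[OF D1_cring])
  have "nabla (p \<otimes>\<^bsub>P\<^esub> q) = form_smult B P q (nabla p) \<oplus>\<^bsub>Om 1\<^esub> form_smult B P p (nabla q)"
    using der p q by (simp add: derivation_def)
  then have 2: "eps 0 (nabla (p \<otimes>\<^bsub>P\<^esub> q)) = ?y \<otimes>\<^bsub>U 0\<^esub> ?e \<oplus>\<^bsub>U 0\<^esub> ?x \<otimes>\<^bsub>U 0\<^esub> ?f"
    using p q by (simp add: addhom_add[OF eps_hom] addhom_closed[OF form_smult_hom] der_closed eps_form_smult)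
  have 3: "?e \<otimes>\<^bsub>U 0\<^esub> ?f = \<zero>\<^bsub>U 0\<^esub>" using p q by (simp add: eps_sqzero der_closed)
  have "(?x \<ominus>\<^bsub>U 0\<^esub> ?e) \<otimes>\<^bsub>U 0\<^esub> (?y \<ominus>\<^bsub>U 0\<^esub> ?f) = ?x \<otimes>\<^bsub>U 0\<^esub> ?y \<ominus>\<^bsub>U 0\<^esub> (?y \<otimes>\<^bsub>U 0\<^esub> ?e \<oplus>\<^bsub>U 0\<^esub> ?x \<otimes>\<^bsub>U 0\<^esub> ?f) \<oplus>\<^bsub>U 0\<^esub> ?e \<otimes>\<^bsub>U 0\<^esub> ?f"
    using cl by algebra
  then show ?thesis
    using cl by (simp add: translate_def 1 2 3)
qed

lemma translate_one: "translate nabla \<one>\<^bsub>P\<^esub> = \<one>\<^bsub>U 0\<^esub>"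
  using addhom_zero[OF eps_hom AG_Om AG_U, of 0]
  by (simp add: translate_def der_one U_one[symmetric] a_minus_def)

lemmas transport_facts = twist_hom[of 1 0, OF _ _ translate_hom translate_smult] twist_pure[of 1 0, OF _ _ translate_hom translate_smult]
  twist_pure_one[of 1 0, OF _ _ translate_hom translate_smult] twist_scalar[of 1 0, OF _ _ translate_hom translate_smult]
  twist_mult[of 1 0, OF _ _ translate_hom translate_smult translate_mult]

lemma transport_hom: "transport nabla \<in> addhom (U 1) (U 0)"
  unfolding transport_def
  by (rule addhom_eq[OF transport_facts(1) AG_U]) simp_all

lemma transport_pure: "p \<in> carrier P \<Longrightarrow> c \<in> carrier D1 \<Longrightarrow>
    transport nabla (pu 1 p c) = pu 0 \<one>\<^bsub>P\<^esub> c \<otimes>\<^bsub>U 0\<^esub> translate nabla p"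
  by (simp add: transport_def transport_facts(2) pu_closed)

lemma transport_pure_one: "p \<in> carrier P \<Longrightarrow> transport nabla (pu 1 p \<one>\<^bsub>D1\<^esub>) = translate nabla p"
  by (simp add: transport_def transport_facts(3) pu_closed D1_one_closed)

lemma transport_scalar: "c \<in> carrier D1 \<Longrightarrow> u \<in> carrier (U 1) \<Longrightarrow>
    transport nabla (pu 1 \<one>\<^bsub>P\<^esub> c \<otimes>\<^bsub>U 1\<^esub> u) = pu 0 \<one>\<^bsub>P\<^esub> c \<otimes>\<^bsub>U 0\<^esub> transport nabla u"
  by (simp add: transport_def transport_facts(4) sc_closed)

lemma transport_alg_hom: "transport nabla \<in> alg_hom D1 (pull1 R G B 1 P) (pull1 R G B 0 P)"
proof -
  have "transport nabla \<in> ring_hom (pull1 R G B 1 P) (pull1 R G B 0 P)"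
    by (rule ring_hom_memI)
      (simp_all add: pull1_def addhom_closed[OF transport_hom] addhom_add[OF transport_hom] U_one transport_pure_one
        translate_one[unfolded U_one] P.one_closed, simp add: transport_def transport_facts(5))
  then show ?thesis by (simp add: alg_hom_def transport_scalar pull1_def)
qed

text \<open>The inverse of \<open>p \<mapsto> p - \<nabla>p\<close> is \<open>p \<mapsto> p + \<nabla>p\<close>, because infinitesimals square to zero.\<close>

definition "cotranslate p = pu 1 p \<one>\<^bsub>D1\<^esub> \<oplus>\<^bsub>U 1\<^esub> eps 1 (nabla p)"

lemma cotranslate_hom: "cotranslate \<in> addhom P (U 1)"
  unfolding cotranslate_def[abs_def] by (rule addhom_plus[OF pu_one_hom eps_der_hom AG_U]) simp_all

lemma cotranslate_smult:
  assumes a: "a \<in> gr B 0" and p: "p \<in> carrier P"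
  shows "cotranslate (a \<odot>\<^bsub>P\<^esub> p) = pu 1 \<one>\<^bsub>P\<^esub> (den_coface_zero B 0 a) \<otimes>\<^bsub>U 1\<^esub> cotranslate p"
proof -
  let ?X = "pu 1 p (elt1 a \<zero>\<^bsub>B\<^esub>)" and ?Y = "pu 1 p (elt1 \<zero>\<^bsub>B\<^esub> (diff B a))" and ?Z = "eps 1 (a \<odot>\<^bsub>Om 1\<^esub> nabla p)"
  have cl: "?X \<in> carrier (U 1)" "?Y \<in> carrier (U 1)" "?Z \<in> carrier (U 1)"
    using a p by (simp_all add: pu_closed D1_carrier gr_closed addhom_closed[OF eps_hom]
        der_closed addhom_closed[OF tens_smult_hom[OF modOm]])
  have 1: "pu 1 (a \<odot>\<^bsub>P\<^esub> p) \<one>\<^bsub>D1\<^esub> = ?X"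
    using a p by (simp add: pu_smult d1_eq D1_one D1_carrier D1_mult gr_closed gr_carrier)
  have 2: "eps 1 (nabla (a \<odot>\<^bsub>P\<^esub> p)) = ?Y \<oplus>\<^bsub>U 1\<^esub> ?Z"
    using a p by (simp add: der_smult addhom_add[OF eps_hom] om_closed gr_closed eps_pure
        der_closed addhom_closed[OF tens_smult_hom[OF modOm]])
  have "pu 1 \<one>\<^bsub>P\<^esub> (den_coface_zero B 0 a) \<otimes>\<^bsub>U 1\<^esub> pu 1 p \<one>\<^bsub>D1\<^esub> = pu 1 p (elt1 a (diff B a))"
    using a p by (simp add: sc_pu d0_eq D1_one D1_carrier D1_mult gr_closed gr_carrier diff_carrier)
  also have "\<dots> = ?X \<oplus>\<^bsub>U 1\<^esub> ?Y"
    using a p by (subst elt1_split) (simp_all add: pu_add_right D1_carrier gr_closed)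
  finally have 3: "pu 1 \<one>\<^bsub>P\<^esub> (den_coface_zero B 0 a) \<otimes>\<^bsub>U 1\<^esub> pu 1 p \<one>\<^bsub>D1\<^esub> = ?X \<oplus>\<^bsub>U 1\<^esub> ?Y" .
  have 4: "pu 1 \<one>\<^bsub>P\<^esub> (den_coface_zero B 0 a) \<otimes>\<^bsub>U 1\<^esub> eps 1 (nabla p) = ?Z"
    using a p by (simp add: d0_eq eps_scalar gr_closed der_closed)
  have "pu 1 \<one>\<^bsub>P\<^esub> (den_coface_zero B 0 a) \<otimes>\<^bsub>U 1\<^esub> cotranslate p = ?X \<oplus>\<^bsub>U 1\<^esub> ?Y \<oplus>\<^bsub>U 1\<^esub> ?Z"
    unfolding cotranslate_def using a p
    by (simp add: U1.r_distr 3 4 sc_closed d_closed pu_closed D1_one_closed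
        addhom_closed[OF eps_hom] der_closed)
  then show ?thesis using cl by (simp add: cotranslate_def 1 2 U1.a_assoc)
qed

lemmas cotransport_facts = twist_hom[of 0 1, OF _ _ cotranslate_hom cotranslate_smult] twist_pure[of 0 1, OF _ _ cotranslate_hom cotranslate_smult]
  twist_pure_one[of 0 1, OF _ _ cotranslate_hom cotranslate_smult] twist_scalar[of 0 1, OF _ _ cotranslate_hom cotranslate_smult]

lemma transport_eps: "\<omega> \<in> carrier (Om 1) \<Longrightarrow> transport nabla (eps 1 \<omega>) = eps 0 \<omega>"
proof (rule Om_hom_eqI[OF addhom_comp[OF eps_hom transport_hom] eps_hom AG_U])
  fix p b assume h: "p \<in> carrier P" "b \<in> gr B 1"
  then have "pu 0 \<one>\<^bsub>P\<^esub> (elt1 \<zero>\<^bsub>B\<^esub> b) \<otimes>\<^bsub>U 0\<^esub> eps 0 (nabla p) = \<zero>\<^bsub>U 0\<^esub>"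
    using eps_scalar[of 0 "\<zero>\<^bsub>B\<^esub>" b "nabla p"] module.smult_l_null[OF Om_module] der_closed
      addhom_zero[OF eps_hom AG_Om AG_U, of 0] by (simp add: gr_closed)
  then show "transport nabla (eps 1 (om 1 p b)) = eps 0 (om 1 p b)"
    using h by (simp add: eps_pure transport_pure D1_carrier gr_closed translate_def a_minus_def U0.r_distr U0.r_minus
        sc_closed pu_closed D1_one_closed addhom_closed[OF eps_hom] der_closed sc_pu
        cring.cring_simprules(12)[OF D1_cring] cring.cring_simprules(6)[OF D1_cring] elt1_eps_mult
        D1_one D1_mult gr_carrier)
qed simp_all

lemma cotransport_eps: "\<omega> \<in> carrier (Om 1) \<Longrightarrow> twist 1 cotranslate (eps 0 \<omega>) = eps 1 \<omega>"
proof (rule Om_hom_eqI[OF addhom_comp[OF eps_hom cotransport_facts(1)] eps_hom AG_U])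
  fix p b assume h: "p \<in> carrier P" "b \<in> gr B 1"
  then have "pu 1 \<one>\<^bsub>P\<^esub> (elt1 \<zero>\<^bsub>B\<^esub> b) \<otimes>\<^bsub>U 1\<^esub> eps 1 (nabla p) = \<zero>\<^bsub>U 1\<^esub>"
    using eps_scalar[of 1 "\<zero>\<^bsub>B\<^esub>" b "nabla p"] module.smult_l_null[OF Om_module] der_closed
      addhom_zero[OF eps_hom AG_Om AG_U, of 1] by (simp add: gr_closed)
  then show "twist 1 cotranslate (eps 0 (om 1 p b)) = eps 1 (om 1 p b)"
    using h by (simp add: eps_pure cotransport_facts(2) D1_carrier gr_closed cotranslate_def U1.r_distr
        sc_closed pu_closed D1_one_closed addhom_closed[OF eps_hom] der_closed sc_pu
        D1_one D1_mult gr_carrier)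
qed simp_all

lemma transport_cotranslate: "p \<in> carrier P \<Longrightarrow> transport nabla (cotranslate p) = pu 0 p \<one>\<^bsub>D1\<^esub>"
proof -
  assume p: "p \<in> carrier P"
  have cl: "pu 0 p \<one>\<^bsub>D1\<^esub> \<in> carrier (U 0)" "eps 0 (nabla p) \<in> carrier (U 0)"
    using p by (simp_all add: pu_closed D1_one_closed addhom_closed[OF eps_hom] der_closed)
  have "transport nabla (cotranslate p) = translate nabla p \<oplus>\<^bsub>U 0\<^esub> eps 0 (nabla p)"
    using p by (simp add: cotranslate_def addhom_add[OF transport_hom] pu_closed D1_one_closed
        addhom_closed[OF eps_hom] der_closed transport_pure_one transport_eps)
  also have "\<dots> = pu 0 p \<one>\<^bsub>D1\<^esub>" unfolding translate_def using cl by algebra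
  finally show ?thesis .
qed

lemma cotransport_translate: "p \<in> carrier P \<Longrightarrow> twist 1 cotranslate (translate nabla p) = pu 1 p \<one>\<^bsub>D1\<^esub>"
proof -
  assume p: "p \<in> carrier P"
  have cl: "pu 1 p \<one>\<^bsub>D1\<^esub> \<in> carrier (U 1)" "eps 1 (nabla p) \<in> carrier (U 1)"
    using p by (simp_all add: pu_closed D1_one_closed addhom_closed[OF eps_hom] der_closed)
  have "twist 1 cotranslate (translate nabla p) = cotranslate p \<ominus>\<^bsub>U 1\<^esub> eps 1 (nabla p)"
    using p by (simp add: translate_def addhom_diff[OF cotransport_facts(1) AG_U AG_U] pu_closed D1_one_closed
        addhom_closed[OF eps_hom] der_closed cotransport_facts(3) cotransport_eps)
  also have "\<dots> = pu 1 p \<one>\<^bsub>D1\<^esub>" unfolding cotranslate_def using cl by algebra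
  finally show ?thesis .
qed

lemma transport_bij: "bij_betw (transport nabla) (carrier (U 1)) (carrier (U 0))"
proof (rule bij_betw_byWitness[where f' = "twist 1 cotranslate"])
  have "twist 1 cotranslate (transport nabla u) = u" if u: "u \<in> carrier (U 1)" for u
  proof (rule tens_hom_eqI[OF P.module fib_module addhom_comp[OF transport_hom cotransport_facts(1)] addhom_id AG_U _ u])
    fix p c assume "p \<in> carrier P" "c \<in> carrier (fib 1)"
    then show "twist 1 cotranslate (transport nabla (pu 1 p c)) = pu 1 p c"
      by (simp add: transport_pure cotransport_facts(4) addhom_closed[OF translate_hom] cotransport_translate sc_pu D1_one_closed
          cring.cring_simprules(6,12,14)[OF D1_cring] monoid.r_one[OF ring.is_monoid[OF cring.axioms(1)[OF D1_cring]]])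
  qed simp_all
  then show "\<forall>u\<in>carrier (U 1). twist 1 cotranslate (transport nabla u) = u" by blast
  have "transport nabla (twist 1 cotranslate u) = u" if u: "u \<in> carrier (U 0)" for u
  proof (rule tens_hom_eqI[OF P.module fib_module addhom_comp[OF cotransport_facts(1) transport_hom] addhom_id AG_U _ u])
    fix p c assume "p \<in> carrier P" "c \<in> carrier (fib 0)"
    then show "transport nabla (twist 1 cotranslate (pu 0 p c)) = pu 0 p c"
      by (simp add: cotransport_facts(2) transport_scalar addhom_closed[OF cotranslate_hom] transport_cotranslate sc_pu D1_one_closed
          monoid.r_one[OF ring.is_monoid[OF cring.axioms(1)[OF D1_cring]]])
  qed simp_all
  then show "\<forall>u\<in>carrier (U 0). transport nabla (twist 1 cotranslate u) = u" by blast
  show "transport nabla ` carrier (U 1) \<subseteq> carrier (U 0)" using addhom_closed[OF transport_hom] by blast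
  show "twist 1 cotranslate ` carrier (U 0) \<subseteq> carrier (U 1)" using addhom_closed[OF cotransport_facts(1)] by auto
qed

lemma eps_retract_translate: "p \<in> carrier P \<Longrightarrow> eps_retract (translate nabla p) = \<ominus>\<^bsub>Om 1\<^esub> nabla p"
proof -
  assume p: "p \<in> carrier P"
  interpret O: abelian_group "Om 1" by (rule AG_Om)
  have "eps_retract (translate nabla p) = \<zero>\<^bsub>Om 1\<^esub> \<ominus>\<^bsub>Om 1\<^esub> nabla p"
    using p by (simp add: translate_def addhom_diff[OF eps_retract_hom AG_U AG_Om] pu_closed D1_one_closed
        addhom_closed[OF eps_hom] der_closed eps_retract_pu_one eps_retract_eps)
  then show ?thesis using p by (simp add: a_minus_def der_closed)
qed

end

lemma transport_inj:
  assumes "derivation nabla" "derivation nabla'" "transport nabla = transport nabla'"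
  shows "nabla = nabla'"
proof (rule extensionalityI[of _ "carrier P"])
  interpret O: abelian_group "Om 1" by (rule AG_Om)
  fix p assume p: "p \<in> carrier P"
  have "translate nabla p = translate nabla' p"
    using transport_pure_one[OF assms(1) p] transport_pure_one[OF assms(2) p] assms(3) by simp
  then have "\<ominus>\<^bsub>Om 1\<^esub> nabla p = \<ominus>\<^bsub>Om 1\<^esub> nabla' p"
    using eps_retract_translate[OF assms(1) p] eps_retract_translate[OF assms(2) p] by simp
  then show "nabla p = nabla' p"
    using der_closed[OF assms(1) p] der_closed[OF assms(2) p] O.minus_minus by metis
qed (use assms in \<open>simp_all add: derivation_def\<close>)

text \<open>If the degree-zero part of \<open>g\<close> is the identity, then \<open>\<nabla>\<close> is minus the infinitesimal part of \<open>g\<close>.\<close>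

lemma derivation_of_descent:
  assumes g: "g \<in> alg_hom D1 (pull1 R G B 1 P) (pull1 R G B 0 P)" and ext: "g \<in> extensional (carrier (U 1))"
    and id: "\<And>p. p \<in> carrier P \<Longrightarrow> augment 0 (g (pu 1 p \<one>\<^bsub>D1\<^esub>)) = p"
  obtains nabla where "derivation nabla" "g = transport nabla"
proof -
  interpret O: abelian_group "Om 1" by (rule AG_Om)
  interpret U0: cring "U 0" by (rule U_cring) simp
  have g_mult: "g (u \<otimes>\<^bsub>U 1\<^esub> v) = g u \<otimes>\<^bsub>U 0\<^esub> g v" if "u \<in> carrier (U 1)" "v \<in> carrier (U 1)" for u v
    using g that by (auto simp: alg_hom_def ring_hom_def pull1_def addhom_def)
  have g_hom: "g \<in> addhom (U 1) (U 0)"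
    using g by (auto simp: alg_hom_def ring_hom_def pull1_def addhom_def)
  have g_scalar: "g (pu 1 \<one>\<^bsub>P\<^esub> c \<otimes>\<^bsub>U 1\<^esub> u) = pu 0 \<one>\<^bsub>P\<^esub> c \<otimes>\<^bsub>U 0\<^esub> g u"
    if "c \<in> carrier D1" "u \<in> carrier (U 1)" for c u
    using g that by (auto simp: alg_hom_def pull1_def)
  have g_one: "g \<one>\<^bsub>U 1\<^esub> = \<one>\<^bsub>U 0\<^esub>" using g by (auto simp: alg_hom_def ring_hom_def pull1_def)
  let ?t = "\<lambda>p. g (pu 1 p \<one>\<^bsub>D1\<^esub>)"
  define nabla where "nabla = (\<lambda>p \<in> carrier P. \<ominus>\<^bsub>Om 1\<^esub> eps_retract (?t p))"
  have t_hom: "?t \<in> addhom P (U 0)" by (rule addhom_comp[OF pu_one_hom g_hom]) simp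
  note t_cl = addhom_closed[OF t_hom] and eps_retract_cl = addhom_closed[OF eps_retract_hom]
  have n_eq: "nabla p = \<ominus>\<^bsub>Om 1\<^esub> eps_retract (?t p)" if "p \<in> carrier P" for p using that by (simp add: nabla_def)
  have n_cl: "nabla p \<in> carrier (Om 1)" if "p \<in> carrier P" for p
    using that by (simp add: n_eq t_cl eps_retract_cl)
  have t_eq: "?t p = translate nabla p" if p: "p \<in> carrier P" for p
  proof -
    have "?t p = pu 0 p \<one>\<^bsub>D1\<^esub> \<oplus>\<^bsub>U 0\<^esub> eps 0 (eps_retract (?t p))"
      using U0_split[OF t_cl[OF p]] id[OF p] by simp
    also have "eps 0 (eps_retract (?t p)) = \<ominus>\<^bsub>U 0\<^esub> eps 0 (nabla p)"
      using p by (simp add: n_eq addhom_minus[OF eps_hom AG_Om AG_U] t_cl eps_retract_cl addhom_closed[OF eps_hom])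
    finally show ?thesis by (simp add: translate_def a_minus_def)
  qed
  have "derivation nabla"
    unfolding derivation_def
  proof (intro conjI ballI)
    show "nabla \<in> extensional (carrier P)" by (simp add: nabla_def)
    show "nabla \<in> carrier P \<rightarrow> carrier (Om 1)" using n_cl by simp
    show "nabla (p \<oplus>\<^bsub>P\<^esub> q) = nabla p \<oplus>\<^bsub>Om 1\<^esub> nabla q" if "p \<in> carrier P" "q \<in> carrier P" for p q
      using that by (simp add: n_eq addhom_add[OF t_hom] addhom_add[OF eps_retract_hom] t_cl eps_retract_cl O.minus_add O.a_comm)
    show "nabla (unit_map P a) = om 1 \<one>\<^bsub>P\<^esub> (diff B a)" if a: "a \<in> gr B 0" for a
    proof -
      have "?t (unit_map P a) = pu 0 \<one>\<^bsub>P\<^esub> (elt1 a \<zero>\<^bsub>B\<^esub>)"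
      proof -
        have "pu 1 (unit_map P a) \<one>\<^bsub>D1\<^esub> = pu 1 \<one>\<^bsub>P\<^esub> (elt1 a \<zero>\<^bsub>B\<^esub>)"
          using a by (simp add: unit_map_def pu_smult d1_eq D1_one D1_carrier D1_mult gr_closed gr_carrier)
        also have "\<dots> = pu 1 \<one>\<^bsub>P\<^esub> (elt1 a \<zero>\<^bsub>B\<^esub>) \<otimes>\<^bsub>U 1\<^esub> \<one>\<^bsub>U 1\<^esub>"
          using a by (simp add: U_one sc_pu D1_one D1_carrier D1_mult gr_closed gr_carrier)
        finally have "?t (unit_map P a) = pu 0 \<one>\<^bsub>P\<^esub> (elt1 a \<zero>\<^bsub>B\<^esub>) \<otimes>\<^bsub>U 0\<^esub> \<one>\<^bsub>U 0\<^esub>"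
          using a g_scalar[of "elt1 a \<zero>\<^bsub>B\<^esub>" "\<one>\<^bsub>U 1\<^esub>"] g_one cring.cring_simprules(6)[OF U_cring, of 1]
          by (simp add: D1_carrier gr_closed)
        then show ?thesis using a by (simp add: sc_closed D1_carrier gr_closed)
      qed
      moreover have "\<ominus>\<^bsub>Om 1\<^esub> om 1 \<one>\<^bsub>P\<^esub> (\<zero>\<^bsub>B\<^esub> \<ominus>\<^bsub>B\<^esub> diff B a) = om 1 \<one>\<^bsub>P\<^esub> (diff B a)"
      proof -
        have "om 1 \<one>\<^bsub>P\<^esub> (\<ominus>\<^bsub>dg_mod B 1\<^esub> (\<zero>\<^bsub>B\<^esub> \<ominus>\<^bsub>B\<^esub> diff B a)) = \<ominus>\<^bsub>Om 1\<^esub> om 1 \<one>\<^bsub>P\<^esub> (\<zero>\<^bsub>B\<^esub> \<ominus>\<^bsub>B\<^esub> diff B a)"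
          using a by (intro addhom_minus[OF pure_right_hom[OF modOm] abelian_group_gr AG_Om])
            (simp_all add: a_minus_def gr_closed)
        moreover have "\<ominus>\<^bsub>dg_mod B 1\<^esub> (\<zero>\<^bsub>B\<^esub> \<ominus>\<^bsub>B\<^esub> diff B a) = diff B a"
          using a by (intro abelian_group.minus_equality[OF abelian_group_gr])
            (simp_all add: a_minus_def gr_closed gr_carrier diff_carrier r_neg)
        ultimately show ?thesis by simp
      qed
      moreover have "unit_map P a \<in> carrier P" using a by (simp add: unit_map_def)
      ultimately show ?thesis using a by (simp add: n_eq eps_retract_pure gr_closed)
    qed
    show "nabla (p \<otimes>\<^bsub>P\<^esub> q) = form_smult B P q (nabla p) \<oplus>\<^bsub>Om 1\<^esub> form_smult B P p (nabla q)"
      if p: "p \<in> carrier P" and q: "q \<in> carrier P" for p q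
    proof -
      let ?x = "pu 0 p \<one>\<^bsub>D1\<^esub>" and ?y = "pu 0 q \<one>\<^bsub>D1\<^esub>" and ?e = "eps 0 (nabla p)" and ?f = "eps 0 (nabla q)"
      have cl: "?x \<in> carrier (U 0)" "?y \<in> carrier (U 0)" "?e \<in> carrier (U 0)" "?f \<in> carrier (U 0)"
        using p q by (simp_all add: pu_closed D1_one_closed addhom_closed[OF eps_hom] n_cl)
      have one: "\<one>\<^bsub>D1\<^esub> \<otimes>\<^bsub>D1\<^esub> \<one>\<^bsub>D1\<^esub> = \<one>\<^bsub>D1\<^esub>"
        by (simp add: D1_one_closed cring.cring_simprules(12)[OF D1_cring])
      have "?t (p \<otimes>\<^bsub>P\<^esub> q) = ?t p \<otimes>\<^bsub>U 0\<^esub> ?t q"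
        using p q g_mult[of "pu 1 p \<one>\<^bsub>D1\<^esub>" "pu 1 q \<one>\<^bsub>D1\<^esub>"] one by (simp add: pu_mult D1_one_closed pu_closed)
      also have "\<dots> = (?x \<ominus>\<^bsub>U 0\<^esub> ?e) \<otimes>\<^bsub>U 0\<^esub> (?y \<ominus>\<^bsub>U 0\<^esub> ?f)"
        using p q by (simp add: t_eq translate_def)
      also have "\<dots> = ?x \<otimes>\<^bsub>U 0\<^esub> ?y \<ominus>\<^bsub>U 0\<^esub> (?y \<otimes>\<^bsub>U 0\<^esub> ?e \<oplus>\<^bsub>U 0\<^esub> ?x \<otimes>\<^bsub>U 0\<^esub> ?f) \<oplus>\<^bsub>U 0\<^esub> ?e \<otimes>\<^bsub>U 0\<^esub> ?f"
        using cl by algebra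
      also have "\<dots> = pu 0 (p \<otimes>\<^bsub>P\<^esub> q) \<one>\<^bsub>D1\<^esub> \<ominus>\<^bsub>U 0\<^esub> eps 0 (form_smult B P q (nabla p) \<oplus>\<^bsub>Om 1\<^esub> form_smult B P p (nabla q))"
        using p q cl one by (simp add: eps_sqzero n_cl pu_mult D1_one_closed addhom_add[OF eps_hom]
            addhom_closed[OF form_smult_hom] eps_form_smult U0.minus_closed pu_closed)
      finally have "eps_retract (?t (p \<otimes>\<^bsub>P\<^esub> q)) = \<ominus>\<^bsub>Om 1\<^esub> (form_smult B P q (nabla p) \<oplus>\<^bsub>Om 1\<^esub> form_smult B P p (nabla q))"
      proof -
        assume 1: "?t (p \<otimes>\<^bsub>P\<^esub> q) = pu 0 (p \<otimes>\<^bsub>P\<^esub> q) \<one>\<^bsub>D1\<^esub> \<ominus>\<^bsub>U 0\<^esub> eps 0 (form_smult B P q (nabla p) \<oplus>\<^bsub>Om 1\<^esub> form_smult B P p (nabla q))"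
        have c: "form_smult B P q (nabla p) \<oplus>\<^bsub>Om 1\<^esub> form_smult B P p (nabla q) \<in> carrier (Om 1)"
          using p q by (simp add: addhom_closed[OF form_smult_hom] n_cl)
        have "eps_retract (?t (p \<otimes>\<^bsub>P\<^esub> q)) = \<zero>\<^bsub>Om 1\<^esub> \<ominus>\<^bsub>Om 1\<^esub> (form_smult B P q (nabla p) \<oplus>\<^bsub>Om 1\<^esub> form_smult B P p (nabla q))"
          unfolding 1 using p q c by (simp add: addhom_diff[OF eps_retract_hom AG_U AG_Om] pu_closed D1_one_closed eps_retract_pu_one eps_retract_eps
            addhom_closed[OF eps_hom])
        then show ?thesis using c by (simp add: a_minus_def)
      qed
      then show ?thesis
        using p q by (simp add: n_eq[OF P.m_closed[OF p q]] addhom_closed[OF form_smult_hom] n_cl)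
    qed
  qed
  moreover have "g = transport nabla"
  proof (rule extensionalityI[of _ "carrier (U 1)"])
    show "transport nabla \<in> extensional (carrier (U 1))" by (simp add: transport_def)
    fix u assume u: "u \<in> carrier (U 1)"
    show "g u = transport nabla u"
    proof (rule tens_hom_eqI[OF P.module fib_module g_hom transport_hom[OF \<open>derivation nabla\<close>] AG_U _ u])
      fix p c assume "p \<in> carrier P" "c \<in> carrier (fib 1)"
      then have h: "p \<in> carrier P" "c \<in> carrier D1" by simp_all
      have "pu 1 p c = pu 1 \<one>\<^bsub>P\<^esub> c \<otimes>\<^bsub>U 1\<^esub> pu 1 p \<one>\<^bsub>D1\<^esub>"
        using h by (intro bc_pure_eq[OF P_alg D1_cring d_ring_hom]) simp_all
      then show "g (pu 1 p c) = transport nabla (pu 1 p c)"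
        using h g_scalar[OF h(2), of "pu 1 p \<one>\<^bsub>D1\<^esub>"]
        by (simp add: transport_scalar[OF \<open>derivation nabla\<close>] transport_pure_one[OF \<open>derivation nabla\<close>] t_eq
            pu_closed D1_one_closed)
    qed simp_all
  qed (rule ext)
  ultimately show ?thesis by (rule that)
qed

end

section \<open>Equivariance\<close>

context dg_calg
begin

lemma D1_algebra: "algebra R D1"
proof (rule algebraI[OF R.cring_axioms D1_cring])
  fix r u assume r: "r \<in> carrier R" and u: "u \<in> carrier D1"
  then show "r \<odot>\<^bsub>D1\<^esub> u \<in> carrier D1"
    by (elim D1E) (simp add: D1_smult D1_carrier gr_closed)
next
  fix r s u assume "r \<in> carrier R" "s \<in> carrier R" "u \<in> carrier D1"
  then show "(r \<oplus>\<^bsub>R\<^esub> s) \<odot>\<^bsub>D1\<^esub> u = r \<odot>\<^bsub>D1\<^esub> u \<oplus>\<^bsub>D1\<^esub> s \<odot>\<^bsub>D1\<^esub> u"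
    "(r \<otimes>\<^bsub>R\<^esub> s) \<odot>\<^bsub>D1\<^esub> u = r \<odot>\<^bsub>D1\<^esub> (s \<odot>\<^bsub>D1\<^esub> u)"
    by (elim D1E, simp add: D1_smult D1_add gr_carrier smult_l_distr smult_assoc1)+
next
  fix r u v assume "r \<in> carrier R" "u \<in> carrier D1" "v \<in> carrier D1"
  then show "r \<odot>\<^bsub>D1\<^esub> (u \<oplus>\<^bsub>D1\<^esub> v) = r \<odot>\<^bsub>D1\<^esub> u \<oplus>\<^bsub>D1\<^esub> r \<odot>\<^bsub>D1\<^esub> v"
    "(r \<odot>\<^bsub>D1\<^esub> u) \<otimes>\<^bsub>D1\<^esub> v = r \<odot>\<^bsub>D1\<^esub> (u \<otimes>\<^bsub>D1\<^esub> v)"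
    by (elim D1E, simp add: D1_smult D1_add D1_mult gr_closed gr_carrier smult_r_distr smult_mult_left)+
next
  fix u assume "u \<in> carrier D1"
  then show "\<one>\<^bsub>R\<^esub> \<odot>\<^bsub>D1\<^esub> u = u" by (elim D1E) (simp add: D1_smult gr_carrier)
qed

lemma unit_D1: "r \<in> carrier R \<Longrightarrow> unit_map D1 r = elt1 (r \<odot>\<^bsub>B\<^esub> \<one>\<^bsub>B\<^esub>) \<zero>\<^bsub>B\<^esub>"
  by (simp add: unit_map_def D1_one D1_smult)

lemma unit_A0: "unit_map A0 r = r \<odot>\<^bsub>B\<^esub> \<one>\<^bsub>B\<^esub>"
  by (simp add: unit_map_def)

lemma const_gr: "r \<in> carrier R \<Longrightarrow> r \<odot>\<^bsub>B\<^esub> \<one>\<^bsub>B\<^esub> \<in> gr B 0"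
  by (simp add: gr_closed)

lemma diff_const: "r \<in> carrier R \<Longrightarrow> diff B (r \<odot>\<^bsub>B\<^esub> \<one>\<^bsub>B\<^esub>) = \<zero>\<^bsub>B\<^esub>"
  by (simp add: diff_smult diff_one)

lemma d_const: "i \<le> 1 \<Longrightarrow> r \<in> carrier R \<Longrightarrow> den_coface_zero B i (r \<odot>\<^bsub>B\<^esub> \<one>\<^bsub>B\<^esub>) = elt1 (r \<odot>\<^bsub>B\<^esub> \<one>\<^bsub>B\<^esub>) \<zero>\<^bsub>B\<^esub>"
  by (simp add: d_eq const_gr diff_const)

end

text \<open>Restriction of scalars changes the record but not the additive group.\<close>

lemma a_minus_cong:
  assumes "carrier V = carrier U" "ring.add V = ring.add U" "ring.zero V = ring.zero U"
  shows "a_minus V = a_minus U"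
  by (intro ext) (simp add: a_minus_def a_inv_def m_inv_def assms)

locale gspace_over_dg_zero = dg_calg R B
  for R :: "('r, 'w) ring_scheme" and B :: "('r, 'b) dga" +
  fixes G :: "('r, 'h) hopf" and P :: "('b, 'p, 'h) gspace"
  assumes G_alg: "algebra R G" and P_space: "gspace_over R G (dg_zero B) P"
begin

sublocale algebra_over_dg_zero R B P
  by (intro algebra_over_dg_zero.intro algebra_over_dg_zero_axioms.intro dg_calg_axioms
      gspace_over.alg[OF P_space])

sublocale PS: gspace_over R G A0 P by (rule P_space)

lemma G_module: "module R G" by (rule algebra.module[OF G_alg])

abbreviation "PR \<equiv> restr (unit_map A0) P"
abbreviation "MU i \<equiv> restr (unit_map D1) (pull1 R G B i P)"
abbreviation "MO \<equiv> restr (unit_map A0) (Om 1)"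

lemma pull1_simps:
  "carrier (pull1 R G B i P) = carrier (U i)"
  "monoid.mult (pull1 R G B i P) = monoid.mult (U i)"
  "monoid.one (pull1 R G B i P) = monoid.one (U i)"
  "ring.zero (pull1 R G B i P) = ring.zero (U i)"
  "ring.add (pull1 R G B i P) = ring.add (U i)"
  "smult (pull1 R G B i P) = (\<lambda>c u. pu i \<one>\<^bsub>P\<^esub> c \<otimes>\<^bsub>U i\<^esub> u)"
  by (simp_all add: pull1_def)

lemma PR_module: "module R PR"
  by (rule module_restr[OF R_unit_hom R.cring_axioms P.module])

lemma MO_module: "module R MO"
  by (rule module_restr[OF R_unit_hom R.cring_axioms Om_module])

lemma pull1_algebra: "i \<le> 1 \<Longrightarrow> algebra D1 (pull1 R G B i P)"
  unfolding pull1_def by (rule base_change_algebra[OF P_alg D1_cring d_ring_hom])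

lemma MU_module: "i \<le> 1 \<Longrightarrow> module R (MU i)"
  by (rule module_restr[OF unit_map_hom[OF D1_algebra] R.cring_axioms algebra.module[OF pull1_algebra]])

lemma addhom_to_MU: "addhom Z (MU i) = addhom Z (U i)"
  by (simp add: addhom_def pull1_simps)

lemma addhom_from_MU: "addhom (MU i) Z = addhom (U i) Z"
  by (simp add: addhom_def pull1_simps)

lemmas addhom_MU = addhom_to_MU addhom_from_MU

lemma addhom_to_MO: "addhom Z MO = addhom Z (Om 1)"
  by (simp add: addhom_def)

lemma addhom_from_MO: "addhom MO Z = addhom (Om 1) Z"
  by (simp add: addhom_def)

lemmas addhom_MO = addhom_to_MO addhom_from_MO

lemma addhom_PR: "addhom PR Z = addhom P Z"
  by (simp add: addhom_def)

lemma pu_linmap: "i \<le> 1 \<Longrightarrow> c \<in> carrier D1 \<Longrightarrow> (\<lambda>q. pu i q c) \<in> linmap R PR (MU i)"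
  using pure_left_hom[OF P.module fib_module, of i c]
  by (intro linmapI) (simp_all add: addhom_MU addhom_PR pull1_simps unit_A0 pu_smult d_const const_gr
      unit_D1 sc_pu D1_carrier gr_closed)

lemma om_linmap: "b \<in> gr B 1 \<Longrightarrow> (\<lambda>q. om 1 q b) \<in> linmap R PR MO"
  using pure_left_hom[OF modOm, of b 1]
  by (intro linmapI) (simp_all add: addhom_MO addhom_PR unit_A0 const_gr tens_smult_pure[OF modOm])

lemma eps_R_linmap: "i \<le> 1 \<Longrightarrow> eps i \<in> linmap R MO (MU i)"
  using eps_hom[of i]
  by (intro linmapI) (simp_all add: addhom_MO addhom_MU pull1_simps unit_A0 unit_D1 eps_scalar const_gr gr_closed)

lemma eps_retract_R_linmap: "eps_retract \<in> linmap R (MU 0) MO"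
proof (rule linmapI)
  show "eps_retract \<in> addhom (MU 0) MO" using eps_retract_hom by (simp add: addhom_MU addhom_MO)
  fix r u assume r: "r \<in> carrier R" and "u \<in> carrier (MU 0)"
  then have u: "u \<in> carrier (U 0)" by (simp add: pull1_simps)
  let ?a = "r \<odot>\<^bsub>B\<^esub> \<one>\<^bsub>B\<^esub>"
  have a: "?a \<in> gr B 0" "diff B ?a = \<zero>\<^bsub>B\<^esub>" using r by (simp_all add: const_gr diff_const)
  have e: "elt1 ?a \<zero>\<^bsub>B\<^esub> \<in> carrier D1" using a by (simp add: D1_carrier gr_closed)
  have "eps_retract (pu 0 \<one>\<^bsub>P\<^esub> (elt1 ?a \<zero>\<^bsub>B\<^esub>) \<otimes>\<^bsub>U 0\<^esub> u) = ?a \<odot>\<^bsub>Om 1\<^esub> eps_retract u"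
  proof (rule U_hom_eqI[OF _ addhom_comp[OF tens_mult_hom_right[OF P_alg fib_algebra] eps_retract_hom]
        addhom_comp[OF eps_retract_hom tens_smult_hom[OF modOm]] AG_Om _ u])
    fix p x y assume h: "p \<in> carrier P" "x \<in> gr B 0" "y \<in> gr B 1"
    have "?a \<otimes>\<^bsub>B\<^esub> y \<ominus>\<^bsub>B\<^esub> diff B (?a \<otimes>\<^bsub>B\<^esub> x) = ?a \<otimes>\<^bsub>B\<^esub> (y \<ominus>\<^bsub>B\<^esub> diff B x)"
    proof -
      have "diff B (?a \<otimes>\<^bsub>B\<^esub> x) = ?a \<otimes>\<^bsub>B\<^esub> diff B x"
        using diff_mult0[OF a(1) h(2)] h a by (simp add: gr_carrier[of _ 0] diff_carrier)
      then show ?thesis using h a(1)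
        by (simp only: a_minus_def) (simp add: gr_carrier r_distr r_minus diff_carrier)
    qed
    then show "eps_retract (pu 0 \<one>\<^bsub>P\<^esub> (elt1 ?a \<zero>\<^bsub>B\<^esub>) \<otimes>\<^bsub>U 0\<^esub> pu 0 p (elt1 x y)) = ?a \<odot>\<^bsub>Om 1\<^esub> eps_retract (pu 0 p (elt1 x y))"
      using h a e by (simp add: sc_pu D1_carrier D1_mult gr_closed gr_carrier eps_retract_pure tens_smult_pure[OF modOm] om_smult
          a_minus_def)
  qed (use e a in \<open>simp_all add: sc_closed\<close>)
  then show "eps_retract (r \<odot>\<^bsub>MU 0\<^esub> u) = r \<odot>\<^bsub>MO\<^esub> eps_retract u"
    using r by (simp add: pull1_simps unit_A0 unit_D1)
qed

lemma scalar_linmap: "c \<in> carrier D1 \<Longrightarrow> (\<lambda>u. pu 0 \<one>\<^bsub>P\<^esub> c \<otimes>\<^bsub>U 0\<^esub> u) \<in> linmap R (MU 0) (MU 0)"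
proof (rule linmapI)
  interpret U0: cring "U 0" by (rule U_cring) simp
  assume c: "c \<in> carrier D1"
  show "(\<lambda>u. pu 0 \<one>\<^bsub>P\<^esub> c \<otimes>\<^bsub>U 0\<^esub> u) \<in> addhom (MU 0) (MU 0)"
    using tens_mult_hom_right[OF P_alg fib_algebra] c by (simp add: addhom_MU sc_closed)
  show "pu 0 \<one>\<^bsub>P\<^esub> c \<otimes>\<^bsub>U 0\<^esub> (r \<odot>\<^bsub>MU 0\<^esub> u) = r \<odot>\<^bsub>MU 0\<^esub> (pu 0 \<one>\<^bsub>P\<^esub> c \<otimes>\<^bsub>U 0\<^esub> u)"
    if "r \<in> carrier R" "u \<in> carrier (MU 0)" for r u
    using that c by (simp add: pull1_simps U0.m_lcomm sc_closed ring_hom_closed[OF unit_map_hom[OF D1_algebra]])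
qed

subsection \<open>The co-actions on the pullbacks\<close>

lemma coact_pull1: "coact (pull1 R G B i P) = ext_coact R G A0 P (fib i) (MU i)"
proof -
  have "restr (unit_map D1) (base_change_alg A0 D1 (den_coface_zero B i) P) = MU i"
    by (simp add: pull1_def base_change_def Let_def restr_def)
  moreover have "coact (pull1 R G B i P) = ext_coact R G A0 P (fib i)
      (restr (unit_map D1) (base_change_alg A0 D1 (den_coface_zero B i) P))"
    by (simp add: pull1_def base_change_def Let_def)
  ultimately show ?thesis by simp
qed

abbreviation "coO \<equiv> ext_coact R G A0 P (dg_mod B 1) MO"

lemma coact_closed: "p \<in> carrier P \<Longrightarrow> coact P p \<in> carrier (tens R PR G)"
  using ring_hom_closed[OF PS.coact_ring_hom] .

lemma pull_co_hom: "i \<le> 1 \<Longrightarrow> coact (pull1 R G B i P) \<in> addhom (U i) (tens R (MU i) G)"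
  unfolding coact_pull1
  by (rule ext_coact_hom[OF A0_algebra G_alg P_space fib_module MU_module])
    (simp_all add: pull1_simps pu_linmap)

lemma pull_co_pure: "i \<le> 1 \<Longrightarrow> p \<in> carrier P \<Longrightarrow> c \<in> carrier D1 \<Longrightarrow>
    coact (pull1 R G B i P) (pu i p c) = tens_map R (MU i) G (\<lambda>q. pu i q c) id (coact P p)"
  unfolding coact_pull1
  by (rule ext_coact_pure[OF A0_algebra G_alg P_space fib_module MU_module])
    (simp_all add: pull1_simps pu_linmap)

lemma coO_hom: "coO \<in> addhom (Om 1) (tens R MO G)"
  by (rule ext_coact_hom[OF A0_algebra G_alg P_space dg_mod_module MO_module])
    (simp_all add: om_linmap)

lemma coO_pure: "p \<in> carrier P \<Longrightarrow> b \<in> gr B 1 \<Longrightarrow>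
    coO (om 1 p b) = tens_map R MO G (\<lambda>q. om 1 q b) id (coact P p)"
  by (rule ext_coact_pure[OF A0_algebra G_alg P_space dg_mod_module MO_module])
    (simp_all add: om_linmap)

lemmas AG_MUG = tens_abelian_group[OF MU_module G_module]
lemma co_eps:
  assumes i: "i \<le> 1" and \<omega>: "\<omega> \<in> carrier (Om 1)"
  shows "coact (pull1 R G B i P) (eps i \<omega>) = tens_map R (MU i) G (eps i) id (coO \<omega>)"
proof (rule Om_hom_eqI[OF addhom_comp[OF eps_hom[OF i] pull_co_hom[OF i]] addhom_comp[OF coO_hom
      tens_map_hom[OF MO_module G_module MU_module[OF i] G_module eps_R_linmap[OF i] linmap_id]] AG_MUG[OF i] _ \<omega>])
  fix p b assume h: "p \<in> carrier P" "b \<in> gr B 1"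
  have "tens_map R (MU i) G (eps i) id (tens_map R MO G (\<lambda>q. om 1 q b) id (coact P p))
      = tens_map R (MU i) G (\<lambda>q. eps i (om 1 q b)) id (coact P p)"
    by (rule tens_map_comp[OF PR_module MO_module MU_module[OF i] G_module om_linmap[OF h(2)] eps_R_linmap[OF i]
        coact_closed[OF h(1)]])
  also have "\<dots> = tens_map R (MU i) G (\<lambda>q. pu i q (elt1 \<zero>\<^bsub>B\<^esub> b)) id (coact P p)"
    by (rule tens_map_cong[OF PR_module MU_module[OF i] G_module linmap_comp[OF om_linmap[OF h(2)] eps_R_linmap[OF i]]
        _ coact_closed[OF h(1)]]) (use i h in \<open>simp add: eps_pure\<close>)
  finally show "coact (pull1 R G B i P) (eps i (om 1 p b)) = tens_map R (MU i) G (eps i) id (coO (om 1 p b))"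
    using i h by (simp add: eps_pure pull_co_pure coO_pure D1_carrier gr_closed)
qed

lemma co_scalar:
  assumes c: "c \<in> carrier D1" and u: "u \<in> carrier (U 0)"
  shows "coact (pull1 R G B 0 P) (pu 0 \<one>\<^bsub>P\<^esub> c \<otimes>\<^bsub>U 0\<^esub> u)
    = tens_map R (MU 0) G (\<lambda>v. pu 0 \<one>\<^bsub>P\<^esub> c \<otimes>\<^bsub>U 0\<^esub> v) id (coact (pull1 R G B 0 P) u)"
proof (rule tens_hom_eqI[OF P.module fib_module addhom_comp[OF tens_mult_hom_right[OF P_alg fib_algebra] pull_co_hom]
      addhom_comp[OF pull_co_hom tens_map_hom[OF MU_module G_module MU_module G_module scalar_linmap[OF c] linmap_id]]
      AG_MUG _ u])
  fix p d assume "p \<in> carrier P" "d \<in> carrier (fib 0)"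
  then have h: "p \<in> carrier P" "d \<in> carrier D1" by simp_all
  have cd: "c \<otimes>\<^bsub>D1\<^esub> d \<in> carrier D1" using c h cring.cring_simprules(5)[OF D1_cring] by blast
  have "tens_map R (MU 0) G (\<lambda>v. pu 0 \<one>\<^bsub>P\<^esub> c \<otimes>\<^bsub>U 0\<^esub> v) id (tens_map R (MU 0) G (\<lambda>q. pu 0 q d) id (coact P p))
      = tens_map R (MU 0) G (\<lambda>q. pu 0 \<one>\<^bsub>P\<^esub> c \<otimes>\<^bsub>U 0\<^esub> pu 0 q d) id (coact P p)"
    by (rule tens_map_comp[OF PR_module MU_module MU_module G_module pu_linmap scalar_linmap[OF c] coact_closed[OF h(1)]])
      (simp_all add: h)
  also have "\<dots> = tens_map R (MU 0) G (\<lambda>q. pu 0 q (c \<otimes>\<^bsub>D1\<^esub> d)) id (coact P p)"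
    by (rule tens_map_cong[OF PR_module MU_module G_module linmap_comp[OF pu_linmap scalar_linmap[OF c]] _ coact_closed[OF h(1)]])
      (simp_all add: h c sc_pu)
  finally show "coact (pull1 R G B 0 P) (pu 0 \<one>\<^bsub>P\<^esub> c \<otimes>\<^bsub>U 0\<^esub> pu 0 p d)
    = tens_map R (MU 0) G (\<lambda>v. pu 0 \<one>\<^bsub>P\<^esub> c \<otimes>\<^bsub>U 0\<^esub> v) id (coact (pull1 R G B 0 P) (pu 0 p d))"
    using h c cd by (simp add: sc_pu pull_co_pure)
qed (simp_all add: c sc_closed)

context
  fixes nabla assumes der: "derivation nabla"
begin

lemma der_R_linmap: "nabla \<in> linmap R PR MO"
proof (rule linmapI)
  show "nabla \<in> addhom PR MO" using der_hom[OF der] by (simp add: addhom_PR addhom_MO)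
  fix r p assume r: "r \<in> carrier R" "p \<in> carrier PR"
  interpret O: module A0 "Om 1" by (rule Om_module)
  have "om 1 p \<zero>\<^bsub>B\<^esub> = \<zero>\<^bsub>Om 1\<^esub>"
    using addhom_zero[OF pure_right_hom[OF modOm] _ AG_Om, of p 1] abelian_group_gr[of "dg_mod B 1" 1] r by simp
  then show "nabla (r \<odot>\<^bsub>PR\<^esub> p) = r \<odot>\<^bsub>MO\<^esub> nabla p"
    using r by (simp add: unit_A0 der_smult[OF der] const_gr diff_const der_closed[OF der] abelian_groupE(5)[OF AG_Om])
qed

lemma translate_R_linmap: "translate nabla \<in> linmap R PR (MU 0)"
  using translate_hom[OF der]
  by (intro linmapI) (simp_all add: addhom_PR addhom_MU pull1_simps unit_A0 unit_D1 translate_smult[OF der] const_gr d1_eq)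

lemma transport_R_linmap: "transport nabla \<in> linmap R (MU 1) (MU 0)"
  using transport_hom[OF der]
  by (intro linmapI) (simp_all add: addhom_MU pull1_simps transport_scalar[OF der] ring_hom_closed[OF unit_map_hom[OF D1_algebra]])

text \<open>Both sides of the first equation have the same image in degree zero, namely the co-action of \<open>p\<close>. Their
  difference lies in the infinitesimal part tensored with \<open>O(G)\<close>, where the retraction detects equality.\<close>

lemma translate_equivariant_iff:
  assumes p: "p \<in> carrier P"
  shows "coact (pull1 R G B 0 P) (translate nabla p) = tens_map R (MU 0) G (translate nabla) id (coact P p) \<longleftrightarrow>
    coO (nabla p) = tens_map R MO G nabla id (coact P p)"
proof -
  have le: "(0::nat) \<le> 1" by simp
  interpret T: abelian_group "tens R (MU 0) G" by (rule AG_MUG) simp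
  let ?E = "tens_map R (MU 0) G (eps 0) id"
  let ?x = "tens_map R (MU 0) G (\<lambda>q. pu 0 q \<one>\<^bsub>D1\<^esub>) id (coact P p)"
  note n = der_closed[OF der p] and cp = coact_closed[OF p]
  have E_hom: "?E \<in> addhom (tens R MO G) (tens R (MU 0) G)"
    by (rule tens_map_hom[OF MO_module G_module MU_module G_module eps_R_linmap linmap_id]) simp_all
  have y: "coO (nabla p) \<in> carrier (tens R MO G)" using addhom_closed[OF coO_hom n] .
  have z: "tens_map R MO G nabla id (coact P p) \<in> carrier (tens R MO G)"
    using addhom_closed[OF tens_map_hom[OF PR_module G_module MO_module G_module der_R_linmap linmap_id] cp] .
  have x: "?x \<in> carrier (tens R (MU 0) G)"
    using addhom_closed[OF tens_map_hom[OF PR_module G_module MU_module G_module pu_linmap linmap_id] cp]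
    by (simp add: D1_one_closed)
  have 1: "coact (pull1 R G B 0 P) (translate nabla p) = ?x \<ominus>\<^bsub>tens R (MU 0) G\<^esub> ?E (coO (nabla p))"
    using p n by (simp add: translate_def addhom_diff[OF pull_co_hom AG_U AG_MUG] pu_closed D1_one_closed
        addhom_closed[OF eps_hom] pull_co_pure co_eps)
  have "tens_map R (MU 0) G (translate nabla) id (coact P p)
      = tens_map R (MU 0) G (\<lambda>q. pu 0 q \<one>\<^bsub>D1\<^esub> \<ominus>\<^bsub>MU 0\<^esub> eps 0 (nabla q)) id (coact P p)"
    using a_minus_cong[of "MU 0" "U 0"] by (simp add: translate_def[abs_def] pull1_simps)
  also have "\<dots> = ?x \<ominus>\<^bsub>tens R (MU 0) G\<^esub> tens_map R (MU 0) G (\<lambda>q. eps 0 (nabla q)) id (coact P p)"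
    by (rule tens_map_diff[OF PR_module MU_module[OF le] G_module pu_linmap[OF le] linmap_comp[OF der_R_linmap eps_R_linmap[OF le]] cp])
      (rule D1_one_closed)
  also have "tens_map R (MU 0) G (\<lambda>q. eps 0 (nabla q)) id (coact P p) = ?E (tens_map R MO G nabla id (coact P p))"
    by (rule tens_map_comp[symmetric, OF PR_module MO_module MU_module[OF le] G_module der_R_linmap eps_R_linmap[OF le] cp])
  finally have 2: "tens_map R (MU 0) G (translate nabla) id (coact P p)
      = ?x \<ominus>\<^bsub>tens R (MU 0) G\<^esub> ?E (tens_map R MO G nabla id (coact P p))" .
  have inj: "coO (nabla p) = tens_map R MO G nabla id (coact P p)"
    if "?E (coO (nabla p)) = ?E (tens_map R MO G nabla id (coact P p))"
    by (rule tens_map_retract[OF MO_module MU_module[OF le] G_module eps_R_linmap[OF le] eps_retract_R_linmap _ y z that])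
      (simp add: eps_retract_eps)
  have "?E (coO (nabla p)) = ?E (tens_map R MO G nabla id (coact P p))"
    if "?x \<ominus>\<^bsub>tens R (MU 0) G\<^esub> ?E (coO (nabla p)) = ?x \<ominus>\<^bsub>tens R (MU 0) G\<^esub> ?E (tens_map R MO G nabla id (coact P p))"
    using that x addhom_closed[OF E_hom y] addhom_closed[OF E_hom z]
    by (metis T.a_inv_closed T.add.l_cancel T.minus_minus a_minus_def)
  then show ?thesis unfolding 1 2 using inj by metis
qed

lemma transport_equivariant_iff:
  "(\<forall>u \<in> carrier (U 1). coact (pull1 R G B 0 P) (transport nabla u)
      = tens_map R (MU 0) G (transport nabla) id (coact (pull1 R G B 1 P) u)) \<longleftrightarrow>
    equivariant_connection R G B P nabla" (is "?lhs \<longleftrightarrow> _")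
proof -
  have lhs: "tens_map R (MU 0) G (transport nabla) id (coact (pull1 R G B 1 P) (pu 1 p c))
      = tens_map R (MU 0) G (\<lambda>v. pu 0 \<one>\<^bsub>P\<^esub> c \<otimes>\<^bsub>U 0\<^esub> v) id (tens_map R (MU 0) G (translate nabla) id (coact P p))"
    if p: "p \<in> carrier P" and c: "c \<in> carrier D1" for p c
  proof -
    have "tens_map R (MU 0) G (transport nabla) id (coact (pull1 R G B 1 P) (pu 1 p c))
        = tens_map R (MU 0) G (\<lambda>q. transport nabla (pu 1 q c)) id (coact P p)"
      using p c by (simp add: pull_co_pure) (rule tens_map_comp[OF PR_module MU_module MU_module G_module
            pu_linmap transport_R_linmap coact_closed[OF p]], simp_all)
    also have "\<dots> = tens_map R (MU 0) G (\<lambda>q. pu 0 \<one>\<^bsub>P\<^esub> c \<otimes>\<^bsub>U 0\<^esub> translate nabla q) id (coact P p)"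
      by (rule tens_map_cong[OF PR_module MU_module G_module linmap_comp[OF pu_linmap transport_R_linmap] _ coact_closed[OF p]])
        (use c in \<open>simp_all add: transport_pure[OF der]\<close>)
    also have "\<dots> = tens_map R (MU 0) G (\<lambda>v. pu 0 \<one>\<^bsub>P\<^esub> c \<otimes>\<^bsub>U 0\<^esub> v) id (tens_map R (MU 0) G (translate nabla) id (coact P p))"
      by (rule tens_map_comp[symmetric, OF PR_module MU_module MU_module G_module translate_R_linmap scalar_linmap[OF c] coact_closed[OF p]])
        simp_all
    finally show ?thesis .
  qed
  have rhs: "coact (pull1 R G B 0 P) (transport nabla (pu 1 p c))
      = tens_map R (MU 0) G (\<lambda>v. pu 0 \<one>\<^bsub>P\<^esub> c \<otimes>\<^bsub>U 0\<^esub> v) id (coact (pull1 R G B 0 P) (translate nabla p))"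
    if "p \<in> carrier P" "c \<in> carrier D1" for p c
    using that by (simp add: transport_pure[OF der] co_scalar addhom_closed[OF translate_hom[OF der]])
  have "?lhs \<longleftrightarrow> (\<forall>p \<in> carrier P. coact (pull1 R G B 0 P) (translate nabla p) = tens_map R (MU 0) G (translate nabla) id (coact P p))"
  proof (intro iffI ballI)
    fix p assume l: ?lhs and p: "p \<in> carrier P"
    have 1: "coact (pull1 R G B 0 P) (translate nabla p) = tens_map R (MU 0) G (transport nabla) id (coact (pull1 R G B 1 P) (pu 1 p \<one>\<^bsub>D1\<^esub>))"
      using l p transport_pure_one[OF der p] by (metis pu_closed D1_one_closed le_refl)
    also have "\<dots> = tens_map R (MU 0) G (\<lambda>q. transport nabla (pu 1 q \<one>\<^bsub>D1\<^esub>)) id (coact P p)"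
      using p D1_one_closed by (simp add: pull_co_pure) (rule tens_map_comp[OF PR_module MU_module MU_module G_module
            pu_linmap transport_R_linmap coact_closed[OF p]], simp_all)
    also have "\<dots> = tens_map R (MU 0) G (translate nabla) id (coact P p)"
      by (rule tens_map_cong[OF PR_module MU_module G_module linmap_comp[OF pu_linmap transport_R_linmap] _ coact_closed[OF p]])
        (simp_all add: D1_one_closed transport_pure_one[OF der])
    finally show "coact (pull1 R G B 0 P) (translate nabla p) = tens_map R (MU 0) G (translate nabla) id (coact P p)" .
  next
    fix u assume r: "\<forall>p \<in> carrier P. coact (pull1 R G B 0 P) (translate nabla p) = tens_map R (MU 0) G (translate nabla) id (coact P p)"
      and u: "u \<in> carrier (U 1)"
    show "coact (pull1 R G B 0 P) (transport nabla u) = tens_map R (MU 0) G (transport nabla) id (coact (pull1 R G B 1 P) u)"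
      by (rule tens_hom_eqI[OF P.module fib_module addhom_comp[OF transport_hom[OF der] pull_co_hom]
          addhom_comp[OF pull_co_hom tens_map_hom[OF MU_module G_module MU_module G_module transport_R_linmap linmap_id]] AG_MUG _ u])
        (use r in \<open>simp_all add: lhs rhs\<close>)
  qed
  also have "\<dots> \<longleftrightarrow> equivariant_connection R G B P nabla"
    by (simp add: equivariant_connection_def Let_def translate_equivariant_iff)
  finally show ?thesis .
qed

end

end

section \<open>Flatness\<close>

context algebra_over_dg_zero
begin

subsection \<open>Products of forms\<close>

lemma form_mult_lift2: "form_mult B P m n u v = tens_lift2 (Om (m + n)) (\<lambda>p b q c. om (m + n) (p \<otimes>\<^bsub>P\<^esub> q) (b \<otimes>\<^bsub>B\<^esub> c)) u v"
  by (simp add: form_mult_def tens_lift2_def Let_def)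

lemma form_mult_right: "p \<in> carrier P \<Longrightarrow> b \<in> carrier (dg_mod B m) \<Longrightarrow>
    balanced A0 P (dg_mod B n) (Om (m + n)) (\<lambda>q c. om (m + n) (p \<otimes>\<^bsub>P\<^esub> q) (b \<otimes>\<^bsub>B\<^esub> c))"
proof (intro balancedI addhomI)
  fix a q c assume h: "p \<in> carrier P" "b \<in> carrier (dg_mod B m)" "a \<in> carrier A0" "q \<in> carrier P" "c \<in> carrier (dg_mod B n)"
  then have "b \<otimes>\<^bsub>B\<^esub> (a \<otimes>\<^bsub>B\<^esub> c) = a \<otimes>\<^bsub>B\<^esub> (b \<otimes>\<^bsub>B\<^esub> c)"
    using mult0_comm[of a b m] by (simp add: gr_carrier flip: m_assoc)
  then show "om (m + n) (p \<otimes>\<^bsub>P\<^esub> (a \<odot>\<^bsub>P\<^esub> q)) (b \<otimes>\<^bsub>B\<^esub> c) = om (m + n) (p \<otimes>\<^bsub>P\<^esub> q) (b \<otimes>\<^bsub>B\<^esub> (a \<odot>\<^bsub>dg_mod B n\<^esub> c))"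
    using h by (simp add: P.smult_assoc2_right om_smult mult_gr)
qed (simp_all add: om_closed mult_gr P.r_distr om_add_left om_add_right r_distr gr_carrier)

lemma form_mult_left: "q \<in> carrier P \<Longrightarrow> c \<in> carrier (dg_mod B n) \<Longrightarrow>
    balanced A0 P (dg_mod B m) (Om (m + n)) (\<lambda>p b. om (m + n) (p \<otimes>\<^bsub>P\<^esub> q) (b \<otimes>\<^bsub>B\<^esub> c))"
  by (intro balancedI addhomI)
    (simp_all add: om_closed mult_gr P.l_distr om_add_left om_add_right l_distr gr_carrier
      P.smult_assoc2 om_smult m_assoc)

lemmas form_mult_facts = modOm modOm AG_Om form_mult_right form_mult_left

lemma form_mult_hom_left: "v \<in> carrier (Om n) \<Longrightarrow> (\<lambda>u. form_mult B P m n u v) \<in> addhom (Om m) (Om (m + n))"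
  unfolding form_mult_lift2 by (rule tens_lift2_hom_left[OF form_mult_facts])

lemma form_mult_hom_right: "u \<in> carrier (Om m) \<Longrightarrow> form_mult B P m n u \<in> addhom (Om n) (Om (m + n))"
  unfolding form_mult_lift2[abs_def] by (rule tens_lift2_hom_right[OF form_mult_facts])

lemma form_mult_pure: "p \<in> carrier P \<Longrightarrow> b \<in> gr B m \<Longrightarrow> q \<in> carrier P \<Longrightarrow> c \<in> gr B n \<Longrightarrow>
    form_mult B P m n (om m p b) (om n q c) = om (m + n) (p \<otimes>\<^bsub>P\<^esub> q) (b \<otimes>\<^bsub>B\<^esub> c)"
  unfolding form_mult_lift2 by (rule tens_lift2_pure[OF form_mult_facts]) simp_all

text \<open>Right multiplication of one-forms by \<open>b \<in> B\<^sup>n\<close>, the special case of the product of forms that enters the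
  extension of a derivation.\<close>

definition "wedge n b = tens_map A0 P (dg_mod B (Suc n)) id (\<lambda>b'. b' \<otimes>\<^bsub>B\<^esub> b)"

lemma gr_mult_Suc: "b' \<in> gr B 1 \<Longrightarrow> b \<in> gr B n \<Longrightarrow> b' \<otimes>\<^bsub>B\<^esub> b \<in> gr B (Suc n)"
  using mult_gr[of b' 1 b n] by (simp add: plus_1_eq_Suc)

lemma wedge_linmap: "b \<in> gr B n \<Longrightarrow> (\<lambda>b'. b' \<otimes>\<^bsub>B\<^esub> b) \<in> linmap A0 (dg_mod B 1) (dg_mod B (Suc n))"
  by (intro linmapI addhomI) (simp_all add: gr_mult_Suc l_distr gr_carrier m_assoc)

lemma wedge_hom: "b \<in> gr B n \<Longrightarrow> wedge n b \<in> addhom (Om 1) (Om (Suc n))"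
  unfolding wedge_def by (rule tens_map_hom[OF modOm modOm linmap_id wedge_linmap])

lemma wedge_pure: "p \<in> carrier P \<Longrightarrow> b' \<in> gr B 1 \<Longrightarrow> b \<in> gr B n \<Longrightarrow>
    wedge n b (om 1 p b') = om (Suc n) p (b' \<otimes>\<^bsub>B\<^esub> b)"
  unfolding wedge_def using tens_map_pure[OF modOm modOm linmap_id wedge_linmap, where m = p and n = b'] by simp

lemma wedge_closed: "b \<in> gr B n \<Longrightarrow> \<omega> \<in> carrier (Om 1) \<Longrightarrow> wedge n b \<omega> \<in> carrier (Om (Suc n))"
  using addhom_closed[OF wedge_hom] .

lemma wedge_add:
  assumes b: "b \<in> gr B n" "c \<in> gr B n" and \<omega>: "\<omega> \<in> carrier (Om 1)"
  shows "wedge n (b \<oplus>\<^bsub>B\<^esub> c) \<omega> = wedge n b \<omega> \<oplus>\<^bsub>Om (Suc n)\<^esub> wedge n c \<omega>"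
  by (rule Om_hom_eqI[OF wedge_hom addhom_plus[OF wedge_hom wedge_hom AG_Om] AG_Om _ \<omega>])
    (use b in \<open>simp_all add: wedge_pure r_distr gr_carrier om_add_right gr_mult_Suc gr_add\<close>)

lemma wedge_scalar:
  assumes a: "a \<in> gr B 0" and b: "b \<in> gr B n" and \<omega>: "\<omega> \<in> carrier (Om 1)"
  shows "wedge n (a \<otimes>\<^bsub>B\<^esub> b) \<omega> = wedge n b (a \<odot>\<^bsub>Om 1\<^esub> \<omega>)"
proof (rule Om_hom_eqI[OF wedge_hom addhom_comp[OF tens_smult_hom[OF modOm] wedge_hom] AG_Om _ \<omega>])
  fix p b' assume h: "p \<in> carrier P" "b' \<in> gr B 1"
  then have "b' \<otimes>\<^bsub>B\<^esub> (a \<otimes>\<^bsub>B\<^esub> b) = a \<otimes>\<^bsub>B\<^esub> b' \<otimes>\<^bsub>B\<^esub> b"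
    using mult0_comm[OF a h(2)] a b by (simp add: gr_carrier flip: m_assoc)
  then show "wedge n (a \<otimes>\<^bsub>B\<^esub> b) (om 1 p b') = wedge n b (a \<odot>\<^bsub>Om 1\<^esub> om 1 p b')"
    using h a b by (simp add: wedge_pure tens_smult_pure[OF modOm] om_smult gr_mult0l)
qed (use a b in \<open>simp_all add: gr_mult0l\<close>)

lemma wedge_form_mult:
  assumes b: "b \<in> gr B n" and \<omega>: "\<omega> \<in> carrier (Om 1)"
  shows "form_mult B P 1 n \<omega> (om n \<one>\<^bsub>P\<^esub> b) = wedge n b \<omega>"
proof (rule Om_hom_eqI[OF form_mult_hom_left[of _ n 1, unfolded plus_1_eq_Suc] wedge_hom AG_Om _ \<omega>])
  fix p b' assume "p \<in> carrier P" "b' \<in> gr B 1"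
  then show "form_mult B P 1 n (om 1 p b') (om n \<one>\<^bsub>P\<^esub> b) = wedge n b (om 1 p b')"
    using b form_mult_pure[of p b' 1 "\<one>\<^bsub>P\<^esub>" b n] by (simp add: wedge_pure plus_1_eq_Suc)
qed (use b in \<open>simp_all add: om_closed\<close>)

text \<open>The covariant exterior derivative of \<open>\<nabla>\<close>, the only candidate for its extension to forms.\<close>

definition "cov_diff nabla n = tens_lift (Om (Suc n)) (\<lambda>p b. wedge n b (nabla p) \<oplus>\<^bsub>Om (Suc n)\<^esub> om (Suc n) p (diff B b))"

lemma signed_hom: "abelian_group Z \<Longrightarrow> f \<in> addhom Y Z \<Longrightarrow> (\<lambda>x. signed Z k (f x)) \<in> addhom Y Z"
  by (cases "even k") (simp_all add: signed_def addhom_uminus)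

lemma om_signed: "p \<in> carrier P \<Longrightarrow> b \<in> gr B n \<Longrightarrow> signed (Om n) k (om n p b) = om n p (signed B k b)"
proof -
  assume h: "p \<in> carrier P" "b \<in> gr B n"
  have ag: "abelian_group (dg_mod B n)" by (rule abelian_group_gr) simp_all
  have "\<ominus>\<^bsub>dg_mod B n\<^esub> b = \<ominus>\<^bsub>B\<^esub> b"
    by (rule abelian_group.minus_equality[OF ag]) (use h in \<open>simp_all add: gr_closed gr_carrier l_neg\<close>)
  then show ?thesis
    using addhom_minus[OF pure_right_hom[OF modOm h(1), of n] ag AG_Om, of b] h by (simp add: signed_def)
qed

context
  fixes nabla assumes der: "derivation nabla"
begin

private lemmas n_cl = der_closed[OF der]
private lemmas n_add = addhom_add[OF der_hom[OF der]]

lemma cov_diff_balanced: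
  "balanced A0 P (dg_mod B n) (Om (Suc n)) (\<lambda>p b. wedge n b (nabla p) \<oplus>\<^bsub>Om (Suc n)\<^esub> om (Suc n) p (diff B b))"
proof (intro balancedI addhomI)
  interpret S: abelian_group "Om (Suc n)" by (rule AG_Om)
  fix a p b assume "a \<in> carrier A0" "p \<in> carrier P" "b \<in> carrier (dg_mod B n)"
  then have h: "a \<in> gr B 0" "p \<in> carrier P" "b \<in> gr B n" by simp_all
  have cl: "wedge n b (a \<odot>\<^bsub>Om 1\<^esub> nabla p) \<in> carrier (Om (Suc n))"
    "om (Suc n) p (diff B a \<otimes>\<^bsub>B\<^esub> b) \<in> carrier (Om (Suc n))"
    "om (Suc n) p (a \<otimes>\<^bsub>B\<^esub> diff B b) \<in> carrier (Om (Suc n))"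
    using h by (simp_all add: wedge_closed om_closed gr_mult_Suc gr_mult0l diff_gr diff_gr0 n_cl
        addhom_closed[OF tens_smult_hom[OF modOm]])
  have "wedge n b (nabla (a \<odot>\<^bsub>P\<^esub> p)) = om (Suc n) p (diff B a \<otimes>\<^bsub>B\<^esub> b) \<oplus>\<^bsub>Om (Suc n)\<^esub> wedge n b (a \<odot>\<^bsub>Om 1\<^esub> nabla p)"
    using h by (simp add: der_smult[OF der] addhom_add[OF wedge_hom] om_closed diff_gr0 wedge_pure n_cl
        addhom_closed[OF tens_smult_hom[OF modOm]])
  moreover have "om (Suc n) p (diff B (a \<otimes>\<^bsub>B\<^esub> b)) = om (Suc n) p (diff B a \<otimes>\<^bsub>B\<^esub> b) \<oplus>\<^bsub>Om (Suc n)\<^esub> om (Suc n) p (a \<otimes>\<^bsub>B\<^esub> diff B b)"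
    using h by (simp add: diff_mult0 om_add_right gr_mult_Suc gr_mult0l diff_gr diff_gr0)
  ultimately show "wedge n b (nabla (a \<odot>\<^bsub>P\<^esub> p)) \<oplus>\<^bsub>Om (Suc n)\<^esub> om (Suc n) (a \<odot>\<^bsub>P\<^esub> p) (diff B b) =
       wedge n (a \<odot>\<^bsub>dg_mod B n\<^esub> b) (nabla p) \<oplus>\<^bsub>Om (Suc n)\<^esub> om (Suc n) p (diff B (a \<odot>\<^bsub>dg_mod B n\<^esub> b))"
    using h cl by (simp add: om_smult diff_gr wedge_scalar n_cl S.a_ac)
next
  interpret S: abelian_group "Om (Suc n)" by (rule AG_Om)
  fix p p' b assume h: "p \<in> carrier P" "p' \<in> carrier P" "b \<in> carrier (dg_mod B n)"
  then show "wedge n b (nabla p) \<oplus>\<^bsub>Om (Suc n)\<^esub> om (Suc n) p (diff B b) \<in> carrier (Om (Suc n))"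
    by (simp add: wedge_closed om_closed diff_gr n_cl)
  then show "wedge n b (nabla p) \<oplus>\<^bsub>Om (Suc n)\<^esub> om (Suc n) p (diff B b) \<in> carrier (Om (Suc n))" .
  show "wedge n b (nabla (p \<oplus>\<^bsub>P\<^esub> p')) \<oplus>\<^bsub>Om (Suc n)\<^esub> om (Suc n) (p \<oplus>\<^bsub>P\<^esub> p') (diff B b) =
       wedge n b (nabla p) \<oplus>\<^bsub>Om (Suc n)\<^esub> om (Suc n) p (diff B b) \<oplus>\<^bsub>Om (Suc n)\<^esub>
       (wedge n b (nabla p') \<oplus>\<^bsub>Om (Suc n)\<^esub> om (Suc n) p' (diff B b))"
    using h by (simp add: n_add addhom_add[OF wedge_hom] n_cl om_add_left diff_gr wedge_closed om_closed S.a_ac)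
next
  interpret S: abelian_group "Om (Suc n)" by (rule AG_Om)
  fix p b b' assume h: "p \<in> carrier P" "b \<in> carrier (dg_mod B n)" "b' \<in> carrier (dg_mod B n)"
  then show "wedge n (b \<oplus>\<^bsub>dg_mod B n\<^esub> b') (nabla p) \<oplus>\<^bsub>Om (Suc n)\<^esub> om (Suc n) p (diff B (b \<oplus>\<^bsub>dg_mod B n\<^esub> b')) =
       wedge n b (nabla p) \<oplus>\<^bsub>Om (Suc n)\<^esub> om (Suc n) p (diff B b) \<oplus>\<^bsub>Om (Suc n)\<^esub>
       (wedge n b' (nabla p) \<oplus>\<^bsub>Om (Suc n)\<^esub> om (Suc n) p (diff B b'))"
    by (simp add: wedge_add n_cl om_add_right diff_gr diff_add gr_carrier wedge_closed om_closed S.a_ac)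
qed

lemma cov_diff_hom: "cov_diff nabla n \<in> addhom (Om n) (Om (Suc n))"
  unfolding cov_diff_def by (rule tens_lift_hom[OF modOm AG_Om cov_diff_balanced])

lemma cov_diff_pure: "p \<in> carrier P \<Longrightarrow> b \<in> gr B n \<Longrightarrow>
    cov_diff nabla n (om n p b) = wedge n b (nabla p) \<oplus>\<^bsub>Om (Suc n)\<^esub> om (Suc n) p (diff B b)"
  unfolding cov_diff_def by (rule tens_lift_pure[OF modOm AG_Om cov_diff_balanced]) simp_all

lemma wedge_zero: "b \<in> gr B n \<Longrightarrow> wedge n b \<zero>\<^bsub>Om 1\<^esub> = \<zero>\<^bsub>Om (Suc n)\<^esub>"
  by (rule addhom_zero[OF wedge_hom AG_Om AG_Om])

lemma cov_diff_unit: "b \<in> gr B n \<Longrightarrow> cov_diff nabla n (om n \<one>\<^bsub>P\<^esub> b) = om (Suc n) \<one>\<^bsub>P\<^esub> (diff B b)"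
  by (simp add: cov_diff_pure der_one[OF der] wedge_zero abelian_groupE(5)[OF AG_Om] om_closed diff_gr)

lemma cov_diff_zero: "p \<in> carrier P \<Longrightarrow> cov_diff nabla 0 (om 0 p \<one>\<^bsub>B\<^esub>) = nabla p"
proof -
  assume p: "p \<in> carrier P"
  interpret O: abelian_group "Om 1" by (rule AG_Om)
  have "wedge 0 \<one>\<^bsub>B\<^esub> \<omega> = \<omega>" if "\<omega> \<in> carrier (Om 1)" for \<omega>
    by (rule Om_hom_eqI[OF wedge_hom[of _ 0, folded One_nat_def] addhom_id AG_Om _ that])
      (simp_all add: wedge_pure one_gr gr_carrier flip: One_nat_def)
  moreover have "om 1 p \<zero>\<^bsub>B\<^esub> = \<zero>\<^bsub>Om 1\<^esub>"
    using addhom_zero[OF pure_right_hom[OF modOm p, of 1] _ AG_Om] abelian_group_gr[of "dg_mod B 1" 1] by simp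
  ultimately show ?thesis
    using p by (simp add: cov_diff_pure one_gr diff_one n_cl flip: One_nat_def)
qed

lemma wedge_mult_left:
  assumes b: "b \<in> gr B m" and q: "q \<in> carrier P" "c \<in> gr B n" and \<omega>: "\<omega> \<in> carrier (Om 1)"
  shows "form_mult B P (Suc m) n (wedge m b \<omega>) (om n q c) = wedge (m + n) (b \<otimes>\<^bsub>B\<^esub> c) (form_smult B P q \<omega>)"
proof (rule Om_hom_eqI[OF addhom_comp[OF wedge_hom form_mult_hom_left[of _ n "Suc m", unfolded add_Suc]]
      addhom_comp[OF form_smult_hom wedge_hom] AG_Om _ \<omega>])
  fix p b' assume "p \<in> carrier P" "b' \<in> gr B 1"
  then show "form_mult B P (Suc m) n (wedge m b (om 1 p b')) (om n q c) = wedge (m + n) (b \<otimes>\<^bsub>B\<^esub> c) (form_smult B P q (om 1 p b'))"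
    using b q by (simp add: wedge_pure form_mult_pure form_smult_pure gr_mult_Suc mult_gr gr_carrier m_assoc P.m_comm)
qed (use b q in \<open>simp_all add: mult_gr om_closed\<close>)

text \<open>Moving \<open>b\<close> past the one-form produces exactly the sign in the graded Leibniz rule.\<close>

lemma wedge_mult_right:
  assumes b: "b \<in> gr B m" and p: "p \<in> carrier P" "c \<in> gr B n" and \<omega>: "\<omega> \<in> carrier (Om 1)"
  shows "signed (Om (Suc (m + n))) m (form_mult B P m (Suc n) (om m p b) (wedge n c \<omega>))
    = wedge (m + n) (b \<otimes>\<^bsub>B\<^esub> c) (form_smult B P p \<omega>)"
proof (rule Om_hom_eqI[OF signed_hom[OF AG_Om addhom_comp[OF wedge_hom form_mult_hom_right[of _ m "Suc n", unfolded add_Suc_right]]]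
      addhom_comp[OF form_smult_hom wedge_hom] AG_Om _ \<omega>])
  fix q b' assume h: "q \<in> carrier P" "b' \<in> gr B 1"
  have sc: "signed B m (b \<otimes>\<^bsub>B\<^esub> (b' \<otimes>\<^bsub>B\<^esub> c)) = b' \<otimes>\<^bsub>B\<^esub> (b \<otimes>\<^bsub>B\<^esub> c)"
    using graded_comm[OF b h(2)] b h p
    by (auto simp: signed_def gr_carrier l_minus minus_minus simp flip: m_assoc)
  have "form_mult B P m (Suc n) (om m p b) (wedge n c (om 1 q b')) = om (Suc (m + n)) (p \<otimes>\<^bsub>P\<^esub> q) (b \<otimes>\<^bsub>B\<^esub> (b' \<otimes>\<^bsub>B\<^esub> c))"
    using h b p form_mult_pure[of p b m q "b' \<otimes>\<^bsub>B\<^esub> c" "Suc n"] by (simp add: wedge_pure gr_mult_Suc)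
  then show "signed (Om (Suc (m + n))) m (form_mult B P m (Suc n) (om m p b) (wedge n c (om 1 q b')))
    = wedge (m + n) (b \<otimes>\<^bsub>B\<^esub> c) (form_smult B P p (om 1 q b'))"
    using h b p mult_gr[OF b gr_mult_Suc[OF h(2) p(2)]]
    by (simp add: om_signed sc form_smult_pure wedge_pure mult_gr)
qed (use b p in \<open>simp_all add: mult_gr om_closed\<close>)

lemma cov_diff_mult_pure:
  assumes p: "p \<in> carrier P" and b: "b \<in> gr B m" and q: "q \<in> carrier P" and c: "c \<in> gr B n"
  shows "cov_diff nabla (m + n) (form_mult B P m n (om m p b) (om n q c))
    = form_mult B P (Suc m) n (cov_diff nabla m (om m p b)) (om n q c) \<oplus>\<^bsub>Om (Suc (m + n))\<^esub>
      signed (Om (Suc (m + n))) m (form_mult B P m (Suc n) (om m p b) (cov_diff nabla n (om n q c)))"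
proof -
  interpret S: abelian_group "Om (Suc (m + n))" by (rule AG_Om)
  let ?k = "m + n" and ?S = "Om (Suc (m + n))"
  have bc: "b \<otimes>\<^bsub>B\<^esub> c \<in> gr B ?k" using mult_gr b c by simp
  have pq: "p \<otimes>\<^bsub>P\<^esub> q \<in> carrier P" using p q by simp
  have db: "diff B b \<otimes>\<^bsub>B\<^esub> c \<in> gr B (Suc ?k)" using mult_gr[OF diff_gr[OF b] c] by simp
  have dc: "b \<otimes>\<^bsub>B\<^esub> diff B c \<in> gr B (Suc ?k)" using mult_gr[OF b diff_gr[OF c]] by simp
  have sdc: "signed B m (b \<otimes>\<^bsub>B\<^esub> diff B c) \<in> gr B (Suc ?k)" using dc by (simp add: signed_def gr_minus)
  let ?w1 = "wedge ?k (b \<otimes>\<^bsub>B\<^esub> c) (form_smult B P q (nabla p))" and ?w2 = "wedge ?k (b \<otimes>\<^bsub>B\<^esub> c) (form_smult B P p (nabla q))"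
  let ?x1 = "om (Suc ?k) (p \<otimes>\<^bsub>P\<^esub> q) (diff B b \<otimes>\<^bsub>B\<^esub> c)" and ?x2 = "om (Suc ?k) (p \<otimes>\<^bsub>P\<^esub> q) (signed B m (b \<otimes>\<^bsub>B\<^esub> diff B c))"
  have f: "form_smult B P q (nabla p) \<in> carrier (Om 1)" "form_smult B P p (nabla q) \<in> carrier (Om 1)"
    using p q by (simp_all add: addhom_closed[OF form_smult_hom] n_cl)
  have cl: "?w1 \<in> carrier ?S" "?w2 \<in> carrier ?S" "?x1 \<in> carrier ?S" "?x2 \<in> carrier ?S"
    using f bc pq db sdc by (simp_all add: wedge_closed om_closed)
  have n: "nabla (p \<otimes>\<^bsub>P\<^esub> q) = form_smult B P q (nabla p) \<oplus>\<^bsub>Om 1\<^esub> form_smult B P p (nabla q)"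
    using der p q by (simp add: derivation_def)
  have L: "cov_diff nabla ?k (form_mult B P m n (om m p b) (om n q c)) = (?w1 \<oplus>\<^bsub>?S\<^esub> ?w2) \<oplus>\<^bsub>?S\<^esub> (?x1 \<oplus>\<^bsub>?S\<^esub> ?x2)"
    using p q b c bc pq db sdc f
    by (simp add: form_mult_pure cov_diff_pure n addhom_add[OF wedge_hom] diff_mult[OF b c] om_add_right)
  have R1: "form_mult B P (Suc m) n (cov_diff nabla m (om m p b)) (om n q c) = ?w1 \<oplus>\<^bsub>?S\<^esub> ?x1"
    using p q b c addhom_add[OF form_mult_hom_left[of "om n q c" n "Suc m", unfolded add_Suc], of "wedge m b (nabla p)" "om (Suc m) p (diff B b)"]
      form_mult_pure[of p "diff B b" "Suc m" q c n]
    by (simp add: cov_diff_pure wedge_closed n_cl om_closed diff_gr wedge_mult_left)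
  have R2: "signed ?S m (form_mult B P m (Suc n) (om m p b) (cov_diff nabla n (om n q c))) = ?w2 \<oplus>\<^bsub>?S\<^esub> ?x2"
  proof -
    have "signed ?S m (form_mult B P m (Suc n) (om m p b) (cov_diff nabla n (om n q c)))
      = signed ?S m (form_mult B P m (Suc n) (om m p b) (wedge n c (nabla q))) \<oplus>\<^bsub>?S\<^esub>
        signed ?S m (form_mult B P m (Suc n) (om m p b) (om (Suc n) q (diff B c)))"
      using p q b c addhom_add[OF signed_hom[OF AG_Om form_mult_hom_right[of "om m p b" m "Suc n", unfolded add_Suc_right]], of "wedge n c (nabla q)" "om (Suc n) q (diff B c)" m]
      by (simp add: cov_diff_pure wedge_closed n_cl om_closed diff_gr)
    moreover have "form_mult B P m (Suc n) (om m p b) (om (Suc n) q (diff B c)) = om (Suc ?k) (p \<otimes>\<^bsub>P\<^esub> q) (b \<otimes>\<^bsub>B\<^esub> diff B c)"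
      using p q b c form_mult_pure[of p b m q "diff B c" "Suc n"] by (simp add: diff_gr)
    ultimately show ?thesis
      using p q b c by (simp add: wedge_mult_right n_cl om_signed[OF pq dc])
  qed
  show ?thesis unfolding L R1 R2 using cl by (simp add: S.a_ac)
qed

lemma cov_diff_mult:
  assumes u: "u \<in> carrier (Om m)" and v: "v \<in> carrier (Om n)"
  shows "cov_diff nabla (m + n) (form_mult B P m n u v)
    = form_mult B P (Suc m) n (cov_diff nabla m u) v \<oplus>\<^bsub>Om (Suc (m + n))\<^esub>
      signed (Om (Suc (m + n))) m (form_mult B P m (Suc n) u (cov_diff nabla n v))"
proof -
  note lef = form_mult_hom_left[of _ n "Suc m", unfolded add_Suc] form_mult_hom_left[of _ "Suc n" m, unfolded add_Suc_right]
  note rig = form_mult_hom_right[of _ "Suc m" n, unfolded add_Suc] form_mult_hom_right[of _ m "Suc n", unfolded add_Suc_right]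
  have cl: "cov_diff nabla k w \<in> carrier (Om (Suc k))" if "w \<in> carrier (Om k)" for k w
    using addhom_closed[OF cov_diff_hom that] .
  have 1: "cov_diff nabla (m + n) (form_mult B P m n (om m p b) v)
    = form_mult B P (Suc m) n (cov_diff nabla m (om m p b)) v \<oplus>\<^bsub>Om (Suc (m + n))\<^esub>
      signed (Om (Suc (m + n))) m (form_mult B P m (Suc n) (om m p b) (cov_diff nabla n v))"
    if pb: "p \<in> carrier P" "b \<in> gr B m" for p b
    by (rule Om_hom_eqI[OF addhom_comp[OF form_mult_hom_right cov_diff_hom]
        addhom_plus[OF rig(1) signed_hom[OF AG_Om addhom_comp[OF cov_diff_hom rig(2)]] AG_Om] AG_Om _ v])
      (use pb in \<open>simp_all add: cl om_closed cov_diff_mult_pure\<close>)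
  show ?thesis
    by (rule Om_hom_eqI[OF addhom_comp[OF form_mult_hom_left[OF v] cov_diff_hom]
        addhom_plus[OF addhom_comp[OF cov_diff_hom lef(1)[OF v]] signed_hom[OF AG_Om lef(2)[OF cl[OF v]]] AG_Om] AG_Om _ u])
      (rule 1)
qed

text \<open>The square of \<open>cov_diff\<close> is linear over forms, so it vanishes as soon as it vanishes on functions: with
  \<open>\<nabla>(\<nabla>p) = 0\<close>, the Leibniz rule leaves \<open>-(\<nabla>p)\<partial>b\<close> from the first summand of \<open>cov_diff (p \<otimes> b)\<close>, which
  cancels against the second.\<close>

lemma cov_diff_cov_diff:
  assumes flat: "\<And>p. p \<in> carrier P \<Longrightarrow> cov_diff nabla 1 (nabla p) = \<zero>\<^bsub>Om 2\<^esub>" and u: "u \<in> carrier (Om n)"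
  shows "cov_diff nabla (Suc n) (cov_diff nabla n u) = \<zero>\<^bsub>Om (Suc (Suc n))\<^esub>"
proof (rule Om_hom_eqI[OF addhom_comp[OF cov_diff_hom cov_diff_hom] addhom_const_zero[OF AG_Om] AG_Om _ u])
  interpret S: abelian_group "Om (Suc (Suc n))" by (rule AG_Om)
  fix p b assume p: "p \<in> carrier P" and b: "b \<in> gr B n"
  let ?w = "wedge (Suc n) (diff B b) (nabla p)"
  have w: "?w \<in> carrier (Om (Suc (Suc n)))" using p b by (simp add: wedge_closed diff_gr n_cl)
  have "cov_diff nabla (Suc n) (wedge n b (nabla p)) = cov_diff nabla (1 + n) (form_mult B P 1 n (nabla p) (om n \<one>\<^bsub>P\<^esub> b))"
    using p b by (simp add: wedge_form_mult n_cl plus_1_eq_Suc)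
  also have "\<dots> = form_mult B P (Suc 1) n (cov_diff nabla 1 (nabla p)) (om n \<one>\<^bsub>P\<^esub> b) \<oplus>\<^bsub>Om (Suc (1 + n))\<^esub>
      signed (Om (Suc (1 + n))) 1 (form_mult B P 1 (Suc n) (nabla p) (cov_diff nabla n (om n \<one>\<^bsub>P\<^esub> b)))"
    using p b by (intro cov_diff_mult) (simp_all add: n_cl om_closed)
  also have "form_mult B P (Suc 1) n (cov_diff nabla 1 (nabla p)) (om n \<one>\<^bsub>P\<^esub> b) = \<zero>\<^bsub>Om (Suc (1 + n))\<^esub>"
    using addhom_zero[OF form_mult_hom_left[of "om n \<one>\<^bsub>P\<^esub> b" n 2] AG_Om AG_Om] p b
    by (simp add: flat om_closed plus_1_eq_Suc)
  also have "form_mult B P 1 (Suc n) (nabla p) (cov_diff nabla n (om n \<one>\<^bsub>P\<^esub> b)) = ?w"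
    using p b by (simp add: cov_diff_unit wedge_form_mult diff_gr n_cl)
  finally have 1: "cov_diff nabla (Suc n) (wedge n b (nabla p)) = \<ominus>\<^bsub>Om (Suc (Suc n))\<^esub> ?w"
    using w by (simp add: signed_def plus_1_eq_Suc)
  have "om (Suc (Suc n)) p \<zero>\<^bsub>B\<^esub> = \<zero>\<^bsub>Om (Suc (Suc n))\<^esub>"
    using addhom_zero[OF pure_right_hom[OF modOm p] _ AG_Om] abelian_group_gr[of "dg_mod B (Suc (Suc n))" "Suc (Suc n)"] by simp
  then have "cov_diff nabla (Suc n) (om (Suc n) p (diff B b)) = ?w"
    using p b w by (simp add: cov_diff_pure diff_gr diff_diff gr_carrier)
  then show "cov_diff nabla (Suc n) (cov_diff nabla n (om n p b)) = \<zero>\<^bsub>Om (Suc (Suc n))\<^esub>"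
    using p b w by (simp add: cov_diff_pure addhom_add[OF cov_diff_hom] wedge_closed n_cl om_closed diff_gr 1 S.l_neg)
qed

lemma cov_diff_form_differential:
  assumes flat: "\<And>p. p \<in> carrier P \<Longrightarrow> cov_diff nabla 1 (nabla p) = \<zero>\<^bsub>Om 2\<^esub>"
  shows "form_differential B P (cov_diff nabla)"
  unfolding form_differential_def Let_def
  by (intro conjI allI ballI funcsetI)
    (simp_all add: addhom_closed[OF cov_diff_hom] addhom_add[OF cov_diff_hom] cov_diff_mult cov_diff_unit cov_diff_cov_diff[OF flat])

end

text \<open>A differential on forms is determined by its values on functions, because \<open>p \<otimes> b\<close> is the product of
  \<open>p\<close> and \<open>b\<close>. So flatness may be tested on \<open>cov_diff\<close>.\<close>

lemma differential_is_cov_diff: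
  assumes der: "derivation nabla" and D: "form_differential B P D"
    and D0: "\<And>p. p \<in> carrier P \<Longrightarrow> D 0 (om 0 p \<one>\<^bsub>B\<^esub>) = nabla p" and u: "u \<in> carrier (Om 1)"
  shows "D 1 u = cov_diff nabla 1 u"
proof (rule Om_hom_eqI[OF _ cov_diff_hom[OF der] AG_Om _ u])
  have Dmult: "D (m + n) (form_mult B P m n u v) = form_mult B P (Suc m) n (D m u) v \<oplus>\<^bsub>Om (Suc (m + n))\<^esub>
           signed (Om (Suc (m + n))) m (form_mult B P m (Suc n) u (D n v))"
    if "u \<in> carrier (Om m)" "v \<in> carrier (Om n)" for m n u v
    using D that by (simp add: form_differential_def Let_def)
  have Dunit: "D n (om n \<one>\<^bsub>P\<^esub> b) = om (Suc n) \<one>\<^bsub>P\<^esub> (diff B b)" if "b \<in> gr B n" for n b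
    using D that by (simp add: form_differential_def Let_def)
  show "D 1 \<in> addhom (Om 1) (Om (Suc 1))"
    using D unfolding form_differential_def Let_def addhom_def by blast
  fix p b assume p: "p \<in> carrier P" and b: "b \<in> gr B 1"
  have "om 1 p b = form_mult B P 0 1 (om 0 p \<one>\<^bsub>B\<^esub>) (om 1 \<one>\<^bsub>P\<^esub> b)"
    using p b form_mult_pure[of p "\<one>\<^bsub>B\<^esub>" 0 "\<one>\<^bsub>P\<^esub>" b 1] by (simp add: one_gr gr_carrier)
  then have "D 1 (om 1 p b) = form_mult B P (Suc 0) 1 (nabla p) (om 1 \<one>\<^bsub>P\<^esub> b) \<oplus>\<^bsub>Om (Suc (0 + 1))\<^esub>
       signed (Om (Suc (0 + 1))) 0 (form_mult B P 0 (Suc 1) (om 0 p \<one>\<^bsub>B\<^esub>) (om (Suc 1) \<one>\<^bsub>P\<^esub> (diff B b)))"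
    using Dmult[of "om 0 p \<one>\<^bsub>B\<^esub>" 0 "om 1 \<one>\<^bsub>P\<^esub> b" 1] p b by (simp add: D0 Dunit om_closed one_gr)
  also have "form_mult B P (Suc 0) 1 (nabla p) (om 1 \<one>\<^bsub>P\<^esub> b) = wedge 1 b (nabla p)"
    using wedge_form_mult[OF b der_closed[OF der p]] by (simp add: One_nat_def[symmetric])
  also have "form_mult B P 0 (Suc 1) (om 0 p \<one>\<^bsub>B\<^esub>) (om (Suc 1) \<one>\<^bsub>P\<^esub> (diff B b)) = om (Suc 1) p (diff B b)"
    using p b form_mult_pure[of p "\<one>\<^bsub>B\<^esub>" 0 "\<one>\<^bsub>P\<^esub>" "diff B b" 2]
    by (simp add: one_gr diff_gr1 gr_carrier diff_carrier numeral_2_eq_2[symmetric])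
  finally show "D 1 (om 1 p b) = cov_diff nabla 1 (om 1 p b)"
    using p b by (simp add: cov_diff_pure[OF der] signed_def)
qed

lemma flat_connection_iff:
  "flat_connection B P nabla \<longleftrightarrow> derivation nabla \<and> (\<forall>p \<in> carrier P. cov_diff nabla 1 (nabla p) = \<zero>\<^bsub>Om 2\<^esub>)"
proof -
  have 1: "flat_connection B P nabla \<longleftrightarrow> derivation nabla \<and>
      (\<exists>D. form_differential B P D \<and> (\<forall>p \<in> carrier P. D 0 (om 0 p \<one>\<^bsub>B\<^esub>) = nabla p))"
    unfolding flat_connection_def derivation_def Let_def by blast
  show ?thesis
  proof
    assume "flat_connection B P nabla"
    then obtain D where der: "derivation nabla" and D: "form_differential B P D"
      and D0: "\<And>p. p \<in> carrier P \<Longrightarrow> D 0 (om 0 p \<one>\<^bsub>B\<^esub>) = nabla p" using 1 by blast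
    have DD: "D (Suc n) (D n u) = \<zero>\<^bsub>Om (Suc (Suc n))\<^esub>" if "u \<in> carrier (Om n)" for n u
      using D that by (simp add: form_differential_def Let_def)
    have "cov_diff nabla 1 (nabla p) = \<zero>\<^bsub>Om 2\<^esub>" if p: "p \<in> carrier P" for p
      using DD[of "om 0 p \<one>\<^bsub>B\<^esub>" 0] p differential_is_cov_diff[OF der D D0 der_closed[OF der p]]
      by (simp add: D0 om_closed one_gr One_nat_def[symmetric])
    then show "derivation nabla \<and> (\<forall>p \<in> carrier P. cov_diff nabla 1 (nabla p) = \<zero>\<^bsub>Om 2\<^esub>)" using der by blast
  next
    assume "derivation nabla \<and> (\<forall>p \<in> carrier P. cov_diff nabla 1 (nabla p) = \<zero>\<^bsub>Om 2\<^esub>)"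
    then show "flat_connection B P nabla"
      unfolding 1 using cov_diff_form_differential[of nabla] cov_diff_zero[of nabla] by blast
  qed
qed

end

section \<open>The cocycle condition\<close>

lemma (in dg_calg) th_ring_hom: "k \<le> 2 \<Longrightarrow> den_coface B 1 k \<in> ring_hom D1 D2"
proof -
  assume "k \<le> 2"
  then have "k = 0 \<or> k = 1 \<or> k = 2" by auto
  then show ?thesis using th_hom by auto
qed

lemma (in dg_calg) th_eqs:
  assumes "k \<le> 2" "x \<in> gr B 0" "y \<in> gr B 1"
  obtains b c z where "th k (elt1 x y) = elt2 x b c z" "b \<in> gr B 1" "c \<in> gr B 1" "z \<in> gr B 2"
proof -
  have "k = 0 \<or> k = 1 \<or> k = 2" using assms(1) by auto
  then show ?thesis
    using that assms th0_eq[of x y] th1_eq[of x y] th2_eq[of x y] gr_zero diff_gr0[of x] diff_gr1[of y]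
      gr_minus[of y 1] gr_add[of "diff B x" 1 "\<ominus>\<^bsub>B\<^esub> y"] by (auto simp: a_minus_def)
qed

context gspace_over_dg_zero
begin

abbreviation "NN k i \<equiv> restr (den_coface B 1 k \<circ> den_coface_zero B i) (self D2)"
abbreviation "W k i \<equiv> tens A0 P (NN k i)"
abbreviation "pw k i \<equiv> pure A0 P (NN k i)"
abbreviation "pull i \<equiv> pull1 R G B i P"

lemma comp_hom: "k \<le> 2 \<Longrightarrow> i \<le> 1 \<Longrightarrow> den_coface B 1 k \<circ> den_coface_zero B i \<in> ring_hom A0 D2"
  by (rule ring_hom_trans[OF d_ring_hom th_ring_hom])

lemma NN_algebra: "k \<le> 2 \<Longrightarrow> i \<le> 1 \<Longrightarrow> algebra A0 (NN k i)"
  by (rule bc_alg[OF P_alg D2_cring comp_hom])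

lemma NN_module: "k \<le> 2 \<Longrightarrow> i \<le> 1 \<Longrightarrow> module A0 (NN k i)"
  by (rule algebra.module[OF NN_algebra])

lemma W_cring: "k \<le> 2 \<Longrightarrow> i \<le> 1 \<Longrightarrow> cring (W k i)"
  by (rule bc_cring[OF P_alg D2_cring comp_hom])

lemma AG_W: "k \<le> 2 \<Longrightarrow> i \<le> 1 \<Longrightarrow> abelian_group (W k i)"
  by (rule tens_abelian_group[OF P.module NN_module])

lemma pw_closed: "k \<le> 2 \<Longrightarrow> i \<le> 1 \<Longrightarrow> p \<in> carrier P \<Longrightarrow> d \<in> carrier D2 \<Longrightarrow> pw k i p d \<in> carrier (W k i)"
  using pure_closed[OF P.module NN_module] by simp

lemma pw_scalar: "k \<le> 2 \<Longrightarrow> i \<le> 1 \<Longrightarrow> p \<in> carrier P \<Longrightarrow> c \<in> carrier D2 \<Longrightarrow> d \<in> carrier D2 \<Longrightarrow>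
    pw k i \<one>\<^bsub>P\<^esub> c \<otimes>\<^bsub>W k i\<^esub> pw k i p d = pw k i p (c \<otimes>\<^bsub>D2\<^esub> d)"
  by (rule bc_scalar_pure[OF P_alg D2_cring comp_hom])

lemma pw_add: "k \<le> 2 \<Longrightarrow> i \<le> 1 \<Longrightarrow> p \<in> carrier P \<Longrightarrow> c \<in> carrier D2 \<Longrightarrow> d \<in> carrier D2 \<Longrightarrow>
    pw k i p (c \<oplus>\<^bsub>D2\<^esub> d) = pw k i p c \<oplus>\<^bsub>W k i\<^esub> pw k i p d"
  using pure_add_right[OF P.module NN_module] by simp

lemma D2_one_closed: "\<one>\<^bsub>D2\<^esub> \<in> carrier D2"
  using cring.cring_simprules(6)[OF D2_cring] .

lemma W_hom_eqI:
  assumes "k \<le> 2" "i \<le> 1" "f \<in> addhom (W k i) Z" "g \<in> addhom (W k i) Z" "abelian_group Z"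
    and "\<And>p d. p \<in> carrier P \<Longrightarrow> d \<in> carrier D2 \<Longrightarrow> f (pw k i p d) = g (pw k i p d)"
    and u: "u \<in> carrier (W k i)"
  shows "f u = g u"
  by (rule tens_hom_eqI[OF P.module NN_module[OF assms(1,2)] assms(3-5) _ u]) (simp add: assms(6))

text \<open>The cosimplicial identities identify the modules of coefficients.\<close>

lemma NN_eqs: "W 2 1 = W 1 1" "pw 2 1 = pw 1 1" "W 2 0 = W 0 1" "pw 2 0 = pw 0 1"
  "W 0 0 = W 1 0" "pw 0 0 = pw 1 0"
proof -
  have 1: "a \<odot>\<^bsub>NN 2 1\<^esub> n = a \<odot>\<^bsub>NN 1 1\<^esub> n" "a \<odot>\<^bsub>NN 2 0\<^esub> n = a \<odot>\<^bsub>NN 0 1\<^esub> n" "a \<odot>\<^bsub>NN 0 0\<^esub> n = a \<odot>\<^bsub>NN 1 0\<^esub> n"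
    if "a \<in> carrier A0" for a n
    using cosimplicial[of a] that by simp_all
  show "W 2 1 = W 1 1" "pw 2 1 = pw 1 1"
    by (rule tens_cong_right; simp only: restr_simps(1-5) 1(1))+
  show "W 2 0 = W 0 1" "pw 2 0 = pw 0 1"
    by (rule tens_cong_right; simp only: restr_simps(1-5) 1(2))+
  show "W 0 0 = W 1 0" "pw 0 0 = pw 1 0"
    by (rule tens_cong_right; simp only: restr_simps(1-5) 1(3))+
qed

definition "coface_ext k = tens_map A0 P (NN k 0) id (den_coface B 1 k)"

lemma coface_ext_hom: "k \<le> 2 \<Longrightarrow> coface_ext k \<in> addhom (U 0) (W k 0)"
  unfolding coface_ext_def
  using bc_star_hom[OF P_alg D1_cring d_ring_hom D2_cring th_ring_hom, of 0 k]
    bc_star_def[OF P_alg D1_cring d_ring_hom D2_cring th_ring_hom, of 0 k] by simp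

lemma coface_ext_pure: "k \<le> 2 \<Longrightarrow> p \<in> carrier P \<Longrightarrow> c \<in> carrier D1 \<Longrightarrow> coface_ext k (pu 0 p c) = pw k 0 p (th k c)"
  unfolding coface_ext_def
  using bc_star_pure[OF P_alg D1_cring d_ring_hom D2_cring th_ring_hom, of 0 k p c]
    bc_star_def[OF P_alg D1_cring d_ring_hom D2_cring th_ring_hom, of 0 k] by simp

text \<open>After the two comparison isomorphisms are evaluated, the pullback of \<open>g\<close> along a coface applies the
  coface to the coefficients of \<open>g(p \<otimes> 1)\<close>.\<close>

lemma pull_iso_facts:
  assumes k: "k \<le> 2" and g: "g \<in> linmap D1 (pull 1) (pull 0)"
  shows "pull_iso R G B k P g \<in> addhom (W k 1) (W k 0)"
    and "\<And>p d. p \<in> carrier P \<Longrightarrow> d \<in> carrier D2 \<Longrightarrow>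
      pull_iso R G B k P g (pw k 1 p d) = pw k 0 \<one>\<^bsub>P\<^esub> d \<otimes>\<^bsub>W k 0\<^esub> coface_ext k (g (pu 1 p \<one>\<^bsub>D1\<^esub>))"
proof -
  let ?K = "restr (den_coface B 1 k) (self D2)"
  have l: "(0::nat) \<le> 1" "(1::nat) \<le> 1" by simp_all
  note ctx = P_alg D1_cring d_ring_hom[OF l(1)] D2_cring th_ring_hom[OF k]
  note ctx1 = P_alg D1_cring d_ring_hom[OF l(2)] D2_cring th_ring_hom[OF k]
  have m: "module D1 (pull 0)" "module D1 (pull 1)" "module D1 ?K"
    using algebra.module[OF pull1_algebra[OF l(1)]] algebra.module[OF pull1_algebra[OF l(2)]] bc_module2[OF ctx] .
  obtain s where s: "s \<in> addhom (W k 1) (tens D1 (pull 1) ?K)"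
    "\<And>p d. p \<in> carrier P \<Longrightarrow> d \<in> carrier D2 \<Longrightarrow> s (pw k 1 p d) = pure D1 (pull 1) ?K (pu 1 p \<one>\<^bsub>D1\<^esub>) d"
    "\<And>w. w \<in> carrier (W k 1) \<Longrightarrow>
      inv_into (carrier (tens D1 (pull 1) ?K)) (base_change_comp A0 D2 (den_coface_zero B 1) (den_coface B 1 k) P) w = s w"
    using base_change_comp_inverse[OF ctx1, of R G] unfolding pull1_def by metis
  let ?F = "\<lambda>w. base_change_comp A0 D2 (den_coface_zero B 0) (den_coface B 1 k) P
        (tens_map D1 (pull 0) ?K g id (s w))"
  have eq: "pull_iso R G B k P g w = ?F w" if "w \<in> carrier (W k 1)" for w
    using s(3)[OF that] by (simp add: pull_iso_def Let_def base_change_iso_def)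
  have c0: "base_change_comp A0 D2 (den_coface_zero B 0) (den_coface B 1 k) P \<in> addhom (tens D1 (pull 0) ?K) (W k 0)"
    using base_change_comp_hom[OF ctx, of R G] unfolding pull1_def .
  have h: "?F \<in> addhom (W k 1) (W k 0)"
    by (rule addhom_comp[OF addhom_comp[OF s(1) tens_map_hom[OF m(2,3,1,3) g linmap_id]] c0])
  show "pull_iso R G B k P g \<in> addhom (W k 1) (W k 0)"
    by (rule addhom_eq[OF h AG_W[OF k l(2)] eq])
  fix p d assume p: "p \<in> carrier P" and d: "d \<in> carrier D2"
  have pd: "pw k 1 p d \<in> carrier (W k 1)" using p d k by (simp add: pw_closed)
  have p1: "pu 1 p \<one>\<^bsub>D1\<^esub> \<in> carrier (pull 1)" using p by (simp add: pull1_simps pu_closed D1_one_closed)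
  have gp: "g (pu 1 p \<one>\<^bsub>D1\<^esub>) \<in> carrier (U 0)" using linmap_closed[OF g p1] by (simp add: pull1_simps)
  have "?F (pw k 1 p d) = base_change_comp A0 D2 (den_coface_zero B 0) (den_coface B 1 k) P
      (pure D1 (pull 0) ?K (g (pu 1 p \<one>\<^bsub>D1\<^esub>)) d)"
    using tens_map_pure[OF m(2,3,1,3) g linmap_id p1, of d] p d s(2) by simp
  also have "\<dots> = pw k 0 \<one>\<^bsub>P\<^esub> d \<otimes>\<^bsub>W k 0\<^esub> coface_ext k (g (pu 1 p \<one>\<^bsub>D1\<^esub>))"
    using base_change_comp_pure[OF ctx gp d, of R G] unfolding pull1_def coface_ext_def bc_star_def[OF ctx] .
  finally show "pull_iso R G B k P g (pw k 1 p d) = pw k 0 \<one>\<^bsub>P\<^esub> d \<otimes>\<^bsub>W k 0\<^esub> coface_ext k (g (pu 1 p \<one>\<^bsub>D1\<^esub>))"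
    using eq[OF pd] by simp
qed

lemma cocycle_iff: "cocycle R G B P g \<longleftrightarrow>
    (\<forall>u \<in> carrier (W 1 1). pull_iso R G B 1 P g u = pull_iso R G B 0 P g (pull_iso R G B 2 P g u))"
  by (simp add: cocycle_def pull2_def)

subsection \<open>The degree-zero part of a descent datum is the identity\<close>

text \<open>Reduction of a function on a pullback to \<open>D\<^sup>2B\<close> modulo all forms of positive degree.\<close>

definition "augment2 = tens_lift P (\<lambda>p d. d {1, 2} \<odot>\<^bsub>P\<^esub> p)"

lemma augment2_balanced: "k \<le> 2 \<Longrightarrow> i \<le> 1 \<Longrightarrow> balanced A0 P (NN k i) P (\<lambda>p d. d {1, 2} \<odot>\<^bsub>P\<^esub> p)"
proof (intro balancedI addhomI)
  assume k: "k \<le> 2" and i: "i \<le> 1"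
  fix a p d assume "a \<in> carrier A0" "p \<in> carrier P" "d \<in> carrier (NN k i)"
  then obtain w x y z where h: "d = elt2 w x y z" "w \<in> gr B 0" "x \<in> gr B 1" "y \<in> gr B 1" "z \<in> gr B 2"
    "a \<in> gr B 0" "p \<in> carrier P"
    using D2E by (metis restr_simps(1) self_simps(1) dg_zero_simps(1))
  define y0 where "y0 = (if i = 0 then diff B a else \<zero>\<^bsub>B\<^esub>)"
  have y0: "y0 \<in> gr B 1" using h(6) by (simp add: y0_def gr_zero diff_gr0)
  have di: "den_coface_zero B i a = elt1 a y0" using d_eq[OF i h(6)] by (simp add: y0_def)
  obtain b c v where "th k (elt1 a y0) = elt2 a b c v" "b \<in> gr B 1" "c \<in> gr B 1" "v \<in> gr B 2"
    by (rule th_eqs[OF k h(6) y0])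
  then have "th k (den_coface_zero B i a) = elt2 a b c v" "b \<in> gr B 1" "c \<in> gr B 1" "v \<in> gr B 2"
    by (simp_all add: di)
  then show "d {1, 2} \<odot>\<^bsub>P\<^esub> (a \<odot>\<^bsub>P\<^esub> p) = (a \<odot>\<^bsub>NN k i\<^esub> d) {1, 2} \<odot>\<^bsub>P\<^esub> p"
    using h P.smult_assoc1[of w a p] by (simp add: D2_mult mult0_comm[of a w 0])
next
  fix p p' d assume "p \<in> carrier P" "p' \<in> carrier P" "d \<in> carrier (NN k i)"
  then obtain w x y z where h: "d = elt2 w x y z" "w \<in> gr B 0" "p \<in> carrier P" "p' \<in> carrier P"
    using D2E by (metis restr_simps(1) self_simps(1))
  then show "d {1, 2} \<odot>\<^bsub>P\<^esub> (p \<oplus>\<^bsub>P\<^esub> p') = d {1, 2} \<odot>\<^bsub>P\<^esub> p \<oplus>\<^bsub>P\<^esub> d {1, 2} \<odot>\<^bsub>P\<^esub> p'"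
    by (simp add: P.smult_r_distr)
  from h show "d {1, 2} \<odot>\<^bsub>P\<^esub> p \<in> carrier P" by simp
  from h show "d {1, 2} \<odot>\<^bsub>P\<^esub> p \<in> carrier P" by simp
next
  fix p d d' assume "p \<in> carrier P" "d \<in> carrier (NN k i)" "d' \<in> carrier (NN k i)"
  then obtain w x y z w' x' y' z' where h: "d = elt2 w x y z" "w \<in> gr B 0" "d' = elt2 w' x' y' z'" "w' \<in> gr B 0" "p \<in> carrier P"
    using D2E by (metis restr_simps(1) self_simps(1))
  then show "(d \<oplus>\<^bsub>NN k i\<^esub> d') {1, 2} \<odot>\<^bsub>P\<^esub> p = d {1, 2} \<odot>\<^bsub>P\<^esub> p \<oplus>\<^bsub>P\<^esub> d' {1, 2} \<odot>\<^bsub>P\<^esub> p"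
    using P.smult_l_distr[of w w' p] by (simp add: D2_add)
qed

lemma augment2_hom: "k \<le> 2 \<Longrightarrow> i \<le> 1 \<Longrightarrow> augment2 \<in> addhom (W k i) P"
  unfolding augment2_def by (rule tens_lift_hom[OF P.module NN_module P.is_abelian_group augment2_balanced])

lemma augment2_pure: "k \<le> 2 \<Longrightarrow> i \<le> 1 \<Longrightarrow> p \<in> carrier P \<Longrightarrow> d \<in> carrier D2 \<Longrightarrow> augment2 (pw k i p d) = d {1, 2} \<odot>\<^bsub>P\<^esub> p"
  unfolding augment2_def
  using tens_lift_pure[OF P.module NN_module P.is_abelian_group augment2_balanced, where m = p and n = d] by simp

lemma augment2_coface_ext:
  assumes k: "k \<le> 2" and d: "d \<in> carrier D2" and u: "u \<in> carrier (U 0)"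
  shows "augment2 (pw k 0 \<one>\<^bsub>P\<^esub> d \<otimes>\<^bsub>W k 0\<^esub> coface_ext k u) = d {1, 2} \<odot>\<^bsub>P\<^esub> augment 0 u"
proof -
  obtain w x y z where e: "d = elt2 w x y z" "w \<in> gr B 0" "x \<in> gr B 1" "y \<in> gr B 1" "z \<in> gr B 2"
    using D2E[OF d] .
  have sm: "(\<lambda>p. w \<odot>\<^bsub>P\<^esub> p) \<in> addhom P P" using e by (intro addhomI) (simp_all add: P.smult_r_distr)
  show ?thesis
  proof (rule U_hom_eqI[OF _ addhom_comp[OF addhom_comp[OF coface_ext_hom[OF k] tens_mult_hom_right[OF P_alg NN_algebra]] augment2_hom]
        addhom_comp[OF augment_hom] P.is_abelian_group _ u])
    show "(\<lambda>p. d {1, 2} \<odot>\<^bsub>P\<^esub> p) \<in> addhom P P" using sm e by simp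
    fix p a b assume h: "p \<in> carrier P" "a \<in> gr B 0" "b \<in> gr B 1"
    obtain b' c' v where t: "th k (elt1 a b) = elt2 a b' c' v" "b' \<in> gr B 1" "c' \<in> gr B 1" "v \<in> gr B 2"
      using th_eqs[OF k h(2,3)] .
    have tc: "th k (elt1 a b) \<in> carrier D2" "d \<otimes>\<^bsub>D2\<^esub> th k (elt1 a b) \<in> carrier D2"
      using t h e d cring.cring_simprules(5)[OF D2_cring] by (simp_all add: D2_carrier)
    have "(d \<otimes>\<^bsub>D2\<^esub> th k (elt1 a b)) {1, 2} = w \<otimes>\<^bsub>B\<^esub> a" using t h e by (simp add: D2_mult)
    then show "augment2 (pw k 0 \<one>\<^bsub>P\<^esub> d \<otimes>\<^bsub>W k 0\<^esub> coface_ext k (pu 0 p (elt1 a b))) = d {1, 2} \<odot>\<^bsub>P\<^esub> augment 0 (pu 0 p (elt1 a b))"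
      using k h d tc e P.smult_assoc1[of w a p]
      by (simp add: coface_ext_pure D1_carrier pw_scalar augment2_pure augment_pure)
  qed (use k d in \<open>simp_all add: pw_closed\<close>)
qed

lemma augment_scalar:
  assumes x: "x \<in> gr B 0" "y \<in> gr B 1" and u: "u \<in> carrier (U 0)"
  shows "augment 0 (pu 0 \<one>\<^bsub>P\<^esub> (elt1 x y) \<otimes>\<^bsub>U 0\<^esub> u) = x \<odot>\<^bsub>P\<^esub> augment 0 u"
proof -
  have sm: "(\<lambda>p. x \<odot>\<^bsub>P\<^esub> p) \<in> addhom P P" using x by (intro addhomI) (simp_all add: P.smult_r_distr)
  show ?thesis
  proof (rule U_hom_eqI[OF _ addhom_comp[OF tens_mult_hom_right[OF P_alg fib_algebra] augment_hom]
        addhom_comp[OF augment_hom sm] P.is_abelian_group _ u])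
    fix p a b assume h: "p \<in> carrier P" "a \<in> gr B 0" "b \<in> gr B 1"
    then show "augment 0 (pu 0 \<one>\<^bsub>P\<^esub> (elt1 x y) \<otimes>\<^bsub>U 0\<^esub> pu 0 p (elt1 a b)) = x \<odot>\<^bsub>P\<^esub> augment 0 (pu 0 p (elt1 a b))"
      using x P.smult_assoc1[of x a p] by (simp add: sc_pu D1_carrier D1_mult augment_pure gr_closed)
  qed (use x in \<open>simp_all add: sc_closed D1_carrier\<close>)
qed

text \<open>Reduced modulo positive degrees, all three pullbacks of \<open>g\<close> become the same endomorphism \<open>\<phi>\<close> of \<open>O(P)\<close>, and
  the cocycle condition becomes \<open>\<phi> = \<phi> \<circ> \<phi>\<close>. A surjective idempotent is the identity.\<close>

lemma descent_degree_zero: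
  assumes g: "g \<in> alg_hom D1 (pull 1) (pull 0)" and bij: "bij_betw g (carrier (U 1)) (carrier (U 0))"
    and coc: "cocycle R G B P g" and q: "q \<in> carrier P"
  shows "augment 0 (g (pu 1 q \<one>\<^bsub>D1\<^esub>)) = q"
proof -
  have glin: "g \<in> linmap D1 (pull 1) (pull 0)"
    using g by (auto simp: alg_hom_def ring_hom_def linmap_def addhom_def)
  have g_hom: "g \<in> addhom (U 1) (U 0)" using linmap_addhom[OF glin] by (simp add: addhom_def pull1_simps)
  have g_scalar: "g (pu 1 \<one>\<^bsub>P\<^esub> c \<otimes>\<^bsub>U 1\<^esub> u) = pu 0 \<one>\<^bsub>P\<^esub> c \<otimes>\<^bsub>U 0\<^esub> g u" if "c \<in> carrier D1" "u \<in> carrier (U 1)" for c u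
    using linmap_smult[OF glin] that by (simp add: pull1_simps)
  define \<phi> where "\<phi> p = augment 0 (g (pu 1 p \<one>\<^bsub>D1\<^esub>))" for p
  have t_hom: "(\<lambda>p. g (pu 1 p \<one>\<^bsub>D1\<^esub>)) \<in> addhom P (U 0)"
    by (rule addhom_comp[OF pu_one_hom g_hom]) simp
  have \<phi>_hom: "\<phi> \<in> addhom P P" unfolding \<phi>_def by (rule addhom_comp[OF t_hom augment_hom]) simp
  have g_pu: "g (pu 1 p c) = pu 0 \<one>\<^bsub>P\<^esub> c \<otimes>\<^bsub>U 0\<^esub> g (pu 1 p \<one>\<^bsub>D1\<^esub>)" if "p \<in> carrier P" "c \<in> carrier D1" for p c
    using that g_scalar[OF that(2), of "pu 1 p \<one>\<^bsub>D1\<^esub>"] bc_pure_eq[OF P_alg D1_cring d_ring_hom, of 1 p c]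
    by (simp add: pu_closed D1_one_closed)
  have \<phi>_smult: "\<phi> (a \<odot>\<^bsub>P\<^esub> p) = a \<odot>\<^bsub>P\<^esub> \<phi> p" if "a \<in> gr B 0" "p \<in> carrier P" for a p
  proof -
    have "pu 1 (a \<odot>\<^bsub>P\<^esub> p) \<one>\<^bsub>D1\<^esub> = pu 1 p (elt1 a \<zero>\<^bsub>B\<^esub>)"
      using that by (simp add: pu_smult d1_eq D1_one D1_carrier D1_mult gr_closed gr_carrier)
    then show ?thesis
      using that g_pu[of p "elt1 a \<zero>\<^bsub>B\<^esub>"] augment_scalar[of a "\<zero>\<^bsub>B\<^esub>" "g (pu 1 p \<one>\<^bsub>D1\<^esub>)"] addhom_closed[OF t_hom]
      by (simp add: \<phi>_def D1_carrier gr_closed)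
  qed
  have \<phi>_augment: "augment 0 (g u) = \<phi> (augment 1 u)" if u: "u \<in> carrier (U 1)" for u
  proof (rule U_hom_eqI[OF _ addhom_comp[OF g_hom augment_hom] addhom_comp[OF augment_hom \<phi>_hom] P.is_abelian_group _ u])
    fix p x y assume "p \<in> carrier P" "x \<in> gr B 0" "y \<in> gr B 1"
    then show "augment 0 (g (pu 1 p (elt1 x y))) = \<phi> (augment 1 (pu 1 p (elt1 x y)))"
      by (simp add: g_pu[of p "elt1 x y"] D1_carrier augment_scalar addhom_closed[OF t_hom] augment_pure \<phi>_smult)
        (simp add: \<phi>_def)
  qed simp_all
  \<comment> \<open>Each pullback of \<open>g\<close> induces \<open>\<phi>\<close>, because every coface is the identity in degree zero.\<close>
  have \<phi>_augment2: "augment2 (pull_iso R G B k P g w) = \<phi> (augment2 w)" if k: "k \<le> 2" and w: "w \<in> carrier (W k 1)" for k w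
  proof (rule W_hom_eqI[OF k _ addhom_comp[OF pull_iso_facts(1)[OF k glin] augment2_hom] addhom_comp[OF augment2_hom \<phi>_hom]
        P.is_abelian_group _ w])
    fix p d assume p: "p \<in> carrier P" and d: "d \<in> carrier D2"
    have d12: "d {1, 2} \<in> gr B 0" using D2E[OF d] by (metis elt2_apply(1))
    show "augment2 (pull_iso R G B k P g (pw k 1 p d)) = \<phi> (augment2 (pw k 1 p d))"
      using k p d by (simp add: pull_iso_facts(2)[OF k glin] augment2_coface_ext addhom_closed[OF t_hom] augment2_pure \<phi>_smult[OF d12])
        (simp add: \<phi>_def)
  qed (use k in simp_all)
  \<comment> \<open>Apply the cocycle condition to \<open>p \<otimes> 1\<close> and reduce.\<close>
  have idem: "\<phi> (\<phi> p) = \<phi> p" if p: "p \<in> carrier P" for p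
  proof -
    let ?u = "pw 1 1 p \<one>\<^bsub>D2\<^esub>"
    have u: "?u \<in> carrier (W 1 1)" using p by (simp add: pw_closed D2_one_closed)
    have 2: "pull_iso R G B 2 P g ?u \<in> carrier (W 0 1)"
      using addhom_closed[OF pull_iso_facts(1)[OF _ glin, of 2]] u NN_eqs by simp
    have pr: "augment2 ?u = p"
      using p P.smult_one by (simp add: augment2_pure D2_one_closed) (simp add: D2_one)
    have "\<phi> (augment2 ?u) = augment2 (pull_iso R G B 0 P g (pull_iso R G B 2 P g ?u))"
      using \<phi>_augment2[of 1 ?u] coc u by (simp add: cocycle_iff)
    also have "\<dots> = \<phi> (\<phi> (augment2 ?u))"
      using \<phi>_augment2[of 0, OF _ 2] \<phi>_augment2[of 2 ?u] u NN_eqs by simp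
    finally show ?thesis by (simp add: pr)
  qed
  have "pu 0 q \<one>\<^bsub>D1\<^esub> \<in> g ` carrier (U 1)"
    using bij q by (simp add: bij_betw_def pu_closed D1_one_closed)
  then obtain u where u: "u \<in> carrier (U 1)" "pu 0 q \<one>\<^bsub>D1\<^esub> = g u" by blast
  have "q = augment 0 (pu 0 q \<one>\<^bsub>D1\<^esub>)"
    using q P.smult_one by (simp add: D1_one augment_pure gr_closed)
  then have "q = \<phi> (augment 1 u)" using u \<phi>_augment by simp
  moreover have "augment 1 u \<in> carrier P" using addhom_closed[OF augment_hom u(1)] by simp
  ultimately have "\<phi> q = q" using idem by metis
  then show ?thesis by (simp add: \<phi>_def)
qed

subsection \<open>Cocycles and curvature\<close>

text \<open>The inclusion of \<open>O(P) \<otimes> B\<^sup>2\<close> in the functions on the pullback of \<open>P\<close> along \<open>\<partial>\<^sup>1\<partial>\<^sup>0\<close>. On the coefficients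
  \<open>a\<close> acts through \<open>\<partial>\<^sup>1\<partial>\<^sup>0a = \<partial>\<^sup>2\<partial>\<^sup>1a + \<partial>\<^sup>1(\<partial>a)\<close>, whose second summand sends the component \<open>\<partial>\<^sup>2y\<close> to
  \<open>-(\<partial>a)y\<close> in top degree; adding \<open>\<partial>y\<close> compensates for this, which explains the retraction
  \<open>top_retract\<close>.\<close>

definition "top_incl = tens_map A0 P (NN 1 0) id (elt2 \<zero>\<^bsub>B\<^esub> \<zero>\<^bsub>B\<^esub> \<zero>\<^bsub>B\<^esub>)"

definition "top_retract = tens_map A0 P (dg_mod B 2) id (\<lambda>d. d {} \<oplus>\<^bsub>B\<^esub> diff B (d {2}))"

lemma th1_d0: "a \<in> gr B 0 \<Longrightarrow> th 1 (d0 a) = elt2 a (diff B a) \<zero>\<^bsub>B\<^esub> \<zero>\<^bsub>B\<^esub>"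
  by (simp add: d0_eq th1_eq diff_gr0)

lemma top_incl_linmap: "elt2 \<zero>\<^bsub>B\<^esub> \<zero>\<^bsub>B\<^esub> \<zero>\<^bsub>B\<^esub> \<in> linmap A0 (dg_mod B 2) (NN 1 0)"
  by (intro linmapI addhomI) (simp_all add: D2_carrier D2_add th1_d0 D2_mult gr_closed gr_carrier diff_carrier)

lemma top_incl_hom: "top_incl \<in> addhom (Om 2) (W 1 0)"
  unfolding top_incl_def by (rule tens_map_hom[OF modOm P.module NN_module linmap_id top_incl_linmap]) simp_all

lemma top_incl_pure: "p \<in> carrier P \<Longrightarrow> z \<in> gr B 2 \<Longrightarrow> top_incl (om 2 p z) = pw 1 0 p (elt2 \<zero>\<^bsub>B\<^esub> \<zero>\<^bsub>B\<^esub> \<zero>\<^bsub>B\<^esub> z)"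
  unfolding top_incl_def
  using tens_map_pure[OF modOm P.module NN_module linmap_id top_incl_linmap, where m = p and n = z] by simp

lemma top_retract_linmap: "(\<lambda>d. d {} \<oplus>\<^bsub>B\<^esub> diff B (d {2})) \<in> linmap A0 (NN 1 0) (dg_mod B 2)"
proof (intro linmapI addhomI)
  fix d d' assume "d \<in> carrier (NN 1 0)" "d' \<in> carrier (NN 1 0)"
  then obtain w x y z w' x' y' z' where h: "d = elt2 w x y z" "y \<in> gr B 1" "z \<in> gr B 2"
    "d' = elt2 w' x' y' z'" "y' \<in> gr B 1" "z' \<in> gr B 2"
    using D2E by (metis restr_simps(1) self_simps(1))
  then show "d {} \<oplus>\<^bsub>B\<^esub> diff B (d {2}) \<in> carrier (dg_mod B 2)" by (simp add: gr_closed)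
  show "(d \<oplus>\<^bsub>NN 1 0\<^esub> d') {} \<oplus>\<^bsub>B\<^esub> diff B ((d \<oplus>\<^bsub>NN 1 0\<^esub> d') {2}) =
       d {} \<oplus>\<^bsub>B\<^esub> diff B (d {2}) \<oplus>\<^bsub>dg_mod B 2\<^esub> (d' {} \<oplus>\<^bsub>B\<^esub> diff B (d' {2}))"
    using h by (simp add: D2_add gr_carrier diff_add diff_carrier a_ac)
next
  fix a d assume "a \<in> carrier A0" "d \<in> carrier (NN 1 0)"
  then obtain w x y z where h: "d = elt2 w x y z" "w \<in> gr B 0" "x \<in> gr B 1" "y \<in> gr B 1" "z \<in> gr B 2" "a \<in> gr B 0"
    using D2E by (metis restr_simps(1) self_simps(1) dg_zero_simps(1))
  note c = h(2-)[THEN gr_carrier]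
  have "a \<otimes>\<^bsub>B\<^esub> z \<oplus>\<^bsub>B\<^esub> \<ominus>\<^bsub>B\<^esub> (diff B a \<otimes>\<^bsub>B\<^esub> y) \<oplus>\<^bsub>B\<^esub> (diff B a \<otimes>\<^bsub>B\<^esub> y \<oplus>\<^bsub>B\<^esub> a \<otimes>\<^bsub>B\<^esub> diff B y) = a \<otimes>\<^bsub>B\<^esub> (z \<oplus>\<^bsub>B\<^esub> diff B y)"
    using c by (simp add: a_assoc r_distr diff_carrier r_neg1)
  then show "(a \<odot>\<^bsub>NN 1 0\<^esub> d) {} \<oplus>\<^bsub>B\<^esub> diff B ((a \<odot>\<^bsub>NN 1 0\<^esub> d) {2}) = a \<odot>\<^bsub>dg_mod B 2\<^esub> (d {} \<oplus>\<^bsub>B\<^esub> diff B (d {2}))"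
    using h c by (simp add: th1_d0 D2_mult gr_closed diff_carrier diff_mult0[OF h(6,4)])
qed

lemma top_retract_top_incl: "\<omega> \<in> carrier (Om 2) \<Longrightarrow> top_retract (top_incl \<omega>) = \<omega>"
proof (rule Om_hom_eqI[OF addhom_comp[OF top_incl_hom] addhom_id AG_Om])
  show "top_retract \<in> addhom (W 1 0) (Om 2)"
    unfolding top_retract_def by (rule tens_map_hom[OF P.module NN_module modOm linmap_id top_retract_linmap]) simp_all
  fix p b assume "p \<in> carrier P" "b \<in> gr B 2"
  then show "top_retract (top_incl (om 2 p b)) = om 2 p b"
    using tens_map_pure[OF P.module NN_module modOm linmap_id top_retract_linmap, where m = p and n = "elt2 \<zero>\<^bsub>B\<^esub> \<zero>\<^bsub>B\<^esub> \<zero>\<^bsub>B\<^esub> b"]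
    by (simp add: top_incl_pure top_retract_def D2_carrier gr_closed gr_carrier diff_zero)
qed

context
  fixes nabla assumes der: "derivation nabla"
begin

private lemmas nabla_closed = der_closed[OF der]
private abbreviation "FF k \<equiv> pull_iso R G B k P (transport nabla)"

lemma transport_linmap: "transport nabla \<in> linmap D1 (pull 1) (pull 0)"
  by (rule linmapI) (simp_all add: addhom_def pull1_simps transport_scalar[OF der]
      addhom_closed[OF transport_hom[OF der]] addhom_add[OF transport_hom[OF der]])

lemma FF_hom: "k \<le> 2 \<Longrightarrow> FF k \<in> addhom (W k 1) (W k 0)"
  by (rule pull_iso_facts(1)[OF _ transport_linmap])

lemma FF_pure: "k \<le> 2 \<Longrightarrow> p \<in> carrier P \<Longrightarrow> d \<in> carrier D2 \<Longrightarrow>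
    FF k (pw k 1 p d) = pw k 0 \<one>\<^bsub>P\<^esub> d \<otimes>\<^bsub>W k 0\<^esub> coface_ext k (translate nabla p)"
  by (simp add: pull_iso_facts(2)[OF _ transport_linmap] transport_pure_one[OF der])

lemma coface_ext_translate: "k \<le> 2 \<Longrightarrow> p \<in> carrier P \<Longrightarrow>
    coface_ext k (translate nabla p) = pw k 0 p \<one>\<^bsub>D2\<^esub> \<ominus>\<^bsub>W k 0\<^esub> coface_ext k (eps 0 (nabla p))"
  by (simp add: translate_def addhom_diff[OF coface_ext_hom AG_U AG_W] pu_closed D1_one_closed addhom_closed[OF eps_hom] nabla_closed
      coface_ext_pure ring_hom_one[OF th_ring_hom])

lemma FF_scalar:
  assumes k: "k \<le> 2" and d: "d \<in> carrier D2" and w: "w \<in> carrier (W k 1)"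
  shows "FF k (pw k 1 \<one>\<^bsub>P\<^esub> d \<otimes>\<^bsub>W k 1\<^esub> w) = pw k 0 \<one>\<^bsub>P\<^esub> d \<otimes>\<^bsub>W k 0\<^esub> FF k w"
proof -
  interpret Wk: cring "W k 0" by (rule W_cring[OF k]) simp
  show ?thesis
  proof (rule W_hom_eqI[OF k _ addhom_comp[OF tens_mult_hom_right[OF P_alg NN_algebra] FF_hom]
        addhom_comp[OF FF_hom tens_mult_hom_right[OF P_alg NN_algebra]] Wk.is_abelian_group _ w])
    fix p c assume h: "p \<in> carrier P" "c \<in> carrier D2"
    have dc: "d \<otimes>\<^bsub>D2\<^esub> c \<in> carrier D2" using d h cring.cring_simprules(5)[OF D2_cring] by blast
    have s: "coface_ext k (translate nabla p) \<in> carrier (W k 0)"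
      using addhom_closed[OF coface_ext_hom[OF k] addhom_closed[OF translate_hom[OF der] h(1)]] .
    have "pw k 0 \<one>\<^bsub>P\<^esub> (d \<otimes>\<^bsub>D2\<^esub> c) = pw k 0 \<one>\<^bsub>P\<^esub> d \<otimes>\<^bsub>W k 0\<^esub> pw k 0 \<one>\<^bsub>P\<^esub> c"
      using k d h by (simp add: pw_scalar)
    then have "pw k 0 \<one>\<^bsub>P\<^esub> (d \<otimes>\<^bsub>D2\<^esub> c) \<otimes>\<^bsub>W k 0\<^esub> coface_ext k (translate nabla p)
        = pw k 0 \<one>\<^bsub>P\<^esub> d \<otimes>\<^bsub>W k 0\<^esub> (pw k 0 \<one>\<^bsub>P\<^esub> c \<otimes>\<^bsub>W k 0\<^esub> coface_ext k (translate nabla p))"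
      using Wk.m_assoc[of "pw k 0 \<one>\<^bsub>P\<^esub> d" "pw k 0 \<one>\<^bsub>P\<^esub> c" "coface_ext k (translate nabla p)"] k d h s
      by (simp only: pw_closed P.one_closed le0)
    then show "FF k (pw k 1 \<one>\<^bsub>P\<^esub> d \<otimes>\<^bsub>W k 1\<^esub> pw k 1 p c) = pw k 0 \<one>\<^bsub>P\<^esub> d \<otimes>\<^bsub>W k 0\<^esub> FF k (pw k 1 p c)"
      using k d h dc by (simp add: pw_scalar FF_pure)
  qed (use k d in \<open>simp_all add: pw_closed\<close>)
qed

lemma coface_ext_eps_pure: "q \<in> carrier P \<Longrightarrow> b \<in> gr B 1 \<Longrightarrow>
    coface_ext 1 (eps 0 (om 1 q b)) = pw 1 0 q (elt2 \<zero>\<^bsub>B\<^esub> b \<zero>\<^bsub>B\<^esub> \<zero>\<^bsub>B\<^esub>)"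
  "q \<in> carrier P \<Longrightarrow> b \<in> gr B 1 \<Longrightarrow> coface_ext 2 (eps 0 (om 1 q b)) = pw 0 1 q (elt2 \<zero>\<^bsub>B\<^esub> \<zero>\<^bsub>B\<^esub> b \<zero>\<^bsub>B\<^esub>)"
  "q \<in> carrier P \<Longrightarrow> b \<in> gr B 1 \<Longrightarrow> coface_ext 0 (eps 0 (om 1 q b)) = pw 1 0 q (elt2 \<zero>\<^bsub>B\<^esub> b (\<ominus>\<^bsub>B\<^esub> b) (diff B b))"
  using NN_eqs
  by (simp_all add: eps_pure coface_ext_pure D1_carrier gr_closed th0_eq th1_eq th2_eq diff_zero a_minus_def gr_carrier)

lemma homs_to_X: "coface_ext 0 \<in> addhom (U 0) (W 1 0)" "coface_ext 1 \<in> addhom (U 0) (W 1 0)" "coface_ext 2 \<in> addhom (U 0) (W 0 1)"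
  "FF 0 \<in> addhom (W 0 1) (W 1 0)" "FF 1 \<in> addhom (W 1 1) (W 1 0)" "FF 2 \<in> addhom (W 1 1) (W 0 1)"
  using coface_ext_hom[of 0] coface_ext_hom[of 1] coface_ext_hom[of 2] FF_hom[of 0] FF_hom[of 1] FF_hom[of 2] NN_eqs by simp_all

text \<open>The one place where the order of two one-forms matters: \<open>\<partial>\<^sup>2b \<cdot> \<partial>\<^sup>1b' = bb' = -b'b\<close>.\<close>

lemma eps_wedge:
  assumes b: "b \<in> gr B 1" and \<eta>: "\<eta> \<in> carrier (Om 1)"
  shows "pw 1 0 \<one>\<^bsub>P\<^esub> (elt2 \<zero>\<^bsub>B\<^esub> \<zero>\<^bsub>B\<^esub> b \<zero>\<^bsub>B\<^esub>) \<otimes>\<^bsub>W 1 0\<^esub> coface_ext 0 (eps 0 \<eta>) = \<ominus>\<^bsub>W 1 0\<^esub> top_incl (wedge 1 b \<eta>)"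
proof -
  have X: "abelian_group (W 1 0)" by (rule AG_W) simp_all
  have w2: "wedge 1 b \<in> addhom (Om 1) (Om 2)" using wedge_hom[OF b] by simp
  have D2ag: "abelian_group D2" by (rule den_abelian_group)
  show ?thesis
  proof (rule Om_hom_eqI[OF addhom_comp[OF addhom_comp[OF eps_hom homs_to_X(1)] tens_mult_hom_right[OF P_alg NN_algebra]]
        addhom_uminus[OF addhom_comp[OF w2 top_incl_hom] X] X _ \<eta>])
    fix p b' assume h: "p \<in> carrier P" "b' \<in> gr B 1"
    have "elt2 \<zero>\<^bsub>B\<^esub> \<zero>\<^bsub>B\<^esub> b \<zero>\<^bsub>B\<^esub> \<otimes>\<^bsub>D2\<^esub> elt2 \<zero>\<^bsub>B\<^esub> b' (\<ominus>\<^bsub>B\<^esub> b') (diff B b') = elt2 \<zero>\<^bsub>B\<^esub> \<zero>\<^bsub>B\<^esub> \<zero>\<^bsub>B\<^esub> (\<ominus>\<^bsub>B\<^esub> (b' \<otimes>\<^bsub>B\<^esub> b))"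
      using b h mult11_comm[OF b h(2)] by (simp add: D2_mult gr_closed gr_carrier diff_carrier)
    moreover have "pw 1 0 p (elt2 \<zero>\<^bsub>B\<^esub> \<zero>\<^bsub>B\<^esub> \<zero>\<^bsub>B\<^esub> (\<ominus>\<^bsub>B\<^esub> (b' \<otimes>\<^bsub>B\<^esub> b))) = \<ominus>\<^bsub>W 1 0\<^esub> pw 1 0 p (elt2 \<zero>\<^bsub>B\<^esub> \<zero>\<^bsub>B\<^esub> \<zero>\<^bsub>B\<^esub> (b' \<otimes>\<^bsub>B\<^esub> b))"
    proof -
      have "om 2 p (\<ominus>\<^bsub>B\<^esub> (b' \<otimes>\<^bsub>B\<^esub> b)) = \<ominus>\<^bsub>Om 2\<^esub> om 2 p (b' \<otimes>\<^bsub>B\<^esub> b)"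
        using om_signed[OF h(1), of "b' \<otimes>\<^bsub>B\<^esub> b" 2 1] b h by (simp add: signed_def gr_mult11)
      then have "top_incl (om 2 p (\<ominus>\<^bsub>B\<^esub> (b' \<otimes>\<^bsub>B\<^esub> b))) = \<ominus>\<^bsub>W 1 0\<^esub> top_incl (om 2 p (b' \<otimes>\<^bsub>B\<^esub> b))"
        using b h by (simp add: addhom_minus[OF top_incl_hom AG_Om X] om_closed gr_mult11)
      then show ?thesis using b h by (simp add: top_incl_pure gr_mult11 gr_minus)
    qed
    ultimately show "pw 1 0 \<one>\<^bsub>P\<^esub> (elt2 \<zero>\<^bsub>B\<^esub> \<zero>\<^bsub>B\<^esub> b \<zero>\<^bsub>B\<^esub>) \<otimes>\<^bsub>W 1 0\<^esub> coface_ext 0 (eps 0 (om 1 p b')) = \<ominus>\<^bsub>W 1 0\<^esub> top_incl (wedge 1 b (om 1 p b'))"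
      using b h by (simp add: coface_ext_eps_pure pw_scalar D2_carrier gr_closed wedge_pure top_incl_pure)
  qed (use b in \<open>simp_all add: pw_closed D2_carrier gr_closed\<close>)
qed

text \<open>For \<open>\<omega> = \<nabla>p\<close> the two sides are, up to sign and up to the common summand \<open>p \<otimes> 1\<close>, the two sides of the
  cocycle condition at \<open>p\<close>, corrected by the curvature \<open>\<nabla>\<omega>\<close>. Both are additive in \<open>\<omega>\<close>, so it is enough
  to take \<open>\<omega> = q \<otimes> b\<close>, where the formula for \<open>\<partial>\<^sup>0\<close> on one-forms gives \<open>q \<otimes> \<partial>b\<close> and the product
  of two infinitesimals gives \<open>(\<nabla>q)b\<close>.\<close>

lemma curvature_identity:
  assumes \<omega>: "\<omega> \<in> carrier (Om 1)"
  shows "FF 0 (coface_ext 2 (eps 0 \<omega>)) \<oplus>\<^bsub>W 1 0\<^esub> coface_ext 0 (eps 0 \<omega>) = coface_ext 1 (eps 0 \<omega>) \<oplus>\<^bsub>W 1 0\<^esub> top_incl (cov_diff nabla 1 \<omega>)"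
proof -
  have X: "abelian_group (W 1 0)" by (rule AG_W) simp_all
  interpret X: cring "W 1 0" by (rule W_cring) simp_all
  have l: "(0::nat) \<le> 1" by simp
  note e = eps_hom[OF l]
  have c2: "cov_diff nabla 1 \<in> addhom (Om 1) (Om 2)" using cov_diff_hom[OF der, of 1] by simp
  show ?thesis
  proof (rule Om_hom_eqI[OF addhom_plus[OF addhom_comp[OF addhom_comp[OF e homs_to_X(3)] homs_to_X(4)] addhom_comp[OF e homs_to_X(1)] X]
        addhom_plus[OF addhom_comp[OF e homs_to_X(2)] addhom_comp[OF c2 top_incl_hom] X] X _ \<omega>])
    fix q b assume q: "q \<in> carrier P" and b: "b \<in> gr B 1"
    let ?y = "elt2 \<zero>\<^bsub>B\<^esub> \<zero>\<^bsub>B\<^esub> b \<zero>\<^bsub>B\<^esub>"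
    let ?w = "top_incl (wedge 1 b (nabla q))" and ?s = "coface_ext 0 (eps 0 (nabla q))"
    have y: "?y \<in> carrier D2" using b by (simp add: D2_carrier gr_closed)
    have wc: "wedge 1 b (nabla q) \<in> carrier (Om 2)" using wedge_closed[OF b nabla_closed[OF q]] by simp
    have cl: "?w \<in> carrier (W 1 0)" "pw 1 0 q \<one>\<^bsub>D2\<^esub> \<in> carrier (W 1 0)" "?s \<in> carrier (W 1 0)"
      "pw 1 0 \<one>\<^bsub>P\<^esub> ?y \<in> carrier (W 1 0)"
      using q y addhom_closed[OF top_incl_hom wc] addhom_closed[OF homs_to_X(1) addhom_closed[OF e nabla_closed[OF q]]]
      by (simp_all add: pw_closed D2_one_closed)
    have "FF 0 (coface_ext 2 (eps 0 (om 1 q b))) = pw 1 0 \<one>\<^bsub>P\<^esub> ?y \<otimes>\<^bsub>W 1 0\<^esub> (pw 1 0 q \<one>\<^bsub>D2\<^esub> \<ominus>\<^bsub>W 1 0\<^esub> ?s)"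
      using q b y FF_pure[of 0 q ?y] coface_ext_translate[of 0 q] NN_eqs by (simp add: coface_ext_eps_pure)
    also have "\<dots> = pw 1 0 \<one>\<^bsub>P\<^esub> ?y \<otimes>\<^bsub>W 1 0\<^esub> pw 1 0 q \<one>\<^bsub>D2\<^esub> \<ominus>\<^bsub>W 1 0\<^esub> (pw 1 0 \<one>\<^bsub>P\<^esub> ?y \<otimes>\<^bsub>W 1 0\<^esub> ?s)"
      using cl by (simp add: a_minus_def X.r_distr X.r_minus)
    also have "\<dots> = pw 1 0 q ?y \<oplus>\<^bsub>W 1 0\<^esub> ?w"
      using q y b cl eps_wedge[OF b nabla_closed[OF q]] monoid.r_one[OF ring.is_monoid[OF cring.axioms(1)[OF D2_cring]] y]
      by (simp add: pw_scalar D2_one_closed a_minus_def)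
    finally have 1: "FF 0 (coface_ext 2 (eps 0 (om 1 q b))) = pw 1 0 q ?y \<oplus>\<^bsub>W 1 0\<^esub> ?w" .
    let ?a = "pw 1 0 q (elt2 \<zero>\<^bsub>B\<^esub> b (\<ominus>\<^bsub>B\<^esub> b) (diff B b))" and ?b = "pw 1 0 q (elt2 \<zero>\<^bsub>B\<^esub> b \<zero>\<^bsub>B\<^esub> \<zero>\<^bsub>B\<^esub>)"
      and ?c = "pw 1 0 q (elt2 \<zero>\<^bsub>B\<^esub> \<zero>\<^bsub>B\<^esub> \<zero>\<^bsub>B\<^esub> (diff B b))"
    have cl2: "pw 1 0 q ?y \<in> carrier (W 1 0)" "?a \<in> carrier (W 1 0)" "?b \<in> carrier (W 1 0)" "?c \<in> carrier (W 1 0)"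
      using q b by (simp_all add: pw_closed D2_carrier gr_closed)
    have "pw 1 0 q ?y \<oplus>\<^bsub>W 1 0\<^esub> ?a = pw 1 0 q (?y \<oplus>\<^bsub>D2\<^esub> elt2 \<zero>\<^bsub>B\<^esub> b (\<ominus>\<^bsub>B\<^esub> b) (diff B b))"
      using q b by (simp add: pw_add D2_carrier gr_closed)
    also have "\<dots> = pw 1 0 q (elt2 \<zero>\<^bsub>B\<^esub> b \<zero>\<^bsub>B\<^esub> \<zero>\<^bsub>B\<^esub> \<oplus>\<^bsub>D2\<^esub> elt2 \<zero>\<^bsub>B\<^esub> \<zero>\<^bsub>B\<^esub> \<zero>\<^bsub>B\<^esub> (diff B b))"
      using b by (simp add: D2_add gr_carrier diff_carrier r_neg)
    also have "\<dots> = ?b \<oplus>\<^bsub>W 1 0\<^esub> ?c"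
      using q b by (simp add: pw_add D2_carrier gr_closed)
    finally have 2: "pw 1 0 q ?y \<oplus>\<^bsub>W 1 0\<^esub> ?a = ?b \<oplus>\<^bsub>W 1 0\<^esub> ?c" .
    have 3: "top_incl (cov_diff nabla 1 (om 1 q b)) = ?w \<oplus>\<^bsub>W 1 0\<^esub> ?c"
      using q b wc by (simp add: cov_diff_pure[OF der] addhom_add[OF top_incl_hom] om_closed diff_gr1 top_incl_pure)
    show "FF 0 (coface_ext 2 (eps 0 (om 1 q b))) \<oplus>\<^bsub>W 1 0\<^esub> coface_ext 0 (eps 0 (om 1 q b)) =
        coface_ext 1 (eps 0 (om 1 q b)) \<oplus>\<^bsub>W 1 0\<^esub> top_incl (cov_diff nabla 1 (om 1 q b))"
      unfolding 1 3 using q b cl cl2 2 by (simp add: coface_ext_eps_pure X.a_ac)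
  qed
qed

text \<open>The pullbacks of a transport are linear over \<open>D\<^sup>2B\<close>, so the cocycle condition need only be checked at
  the elements \<open>p \<otimes> 1\<close>.\<close>

lemma cocycle_transport_iff:
  "cocycle R G B P (transport nabla) \<longleftrightarrow> (\<forall>p \<in> carrier P. cov_diff nabla 1 (nabla p) = \<zero>\<^bsub>Om 2\<^esub>)"
proof -
  have X: "abelian_group (W 1 0)" by (rule AG_W) simp_all
  interpret X: cring "W 1 0" by (rule W_cring) simp_all
  have l: "(0::nat) \<le> 1" by simp
  note e = eps_hom[OF l]
  have key: "FF 1 (pw 1 1 p \<one>\<^bsub>D2\<^esub>) = FF 0 (FF 2 (pw 1 1 p \<one>\<^bsub>D2\<^esub>)) \<longleftrightarrow> cov_diff nabla 1 (nabla p) = \<zero>\<^bsub>Om 2\<^esub>"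
    if p: "p \<in> carrier P" for p
  proof -
    let ?x = "pw 1 0 p \<one>\<^bsub>D2\<^esub>" and ?s0 = "coface_ext 0 (eps 0 (nabla p))" and ?s1 = "coface_ext 1 (eps 0 (nabla p))"
      and ?f = "FF 0 (coface_ext 2 (eps 0 (nabla p)))" and ?c = "top_incl (cov_diff nabla 1 (nabla p))"
    have ec: "eps 0 (nabla p) \<in> carrier (U 0)" by (rule addhom_closed[OF e nabla_closed[OF p]])
    have cc: "cov_diff nabla 1 (nabla p) \<in> carrier (Om 2)" using addhom_closed[OF cov_diff_hom[OF der, of 1] nabla_closed[OF p]] by simp
    have cl: "?x \<in> carrier (W 1 0)" "?s0 \<in> carrier (W 1 0)" "?s1 \<in> carrier (W 1 0)" "?f \<in> carrier (W 1 0)" "?c \<in> carrier (W 1 0)"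
      using p addhom_closed[OF homs_to_X(1) ec] addhom_closed[OF homs_to_X(2) ec]
        addhom_closed[OF homs_to_X(4) addhom_closed[OF homs_to_X(3) ec]] addhom_closed[OF top_incl_hom cc]
      by (simp_all add: pw_closed D2_one_closed)
    have unit: "FF k (pw k 1 p \<one>\<^bsub>D2\<^esub>) = pw k 0 p \<one>\<^bsub>D2\<^esub> \<ominus>\<^bsub>W k 0\<^esub> coface_ext k (eps 0 (nabla p))" if k: "k \<le> 2" for k
    proof -
      interpret Wk: cring "W k 0" by (rule W_cring[OF k]) simp
      have "pw k 0 \<one>\<^bsub>P\<^esub> \<one>\<^bsub>D2\<^esub> = \<one>\<^bsub>W k 0\<^esub>" by (simp add: tens_def)
      moreover have "coface_ext k (translate nabla p) \<in> carrier (W k 0)"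
        using addhom_closed[OF coface_ext_hom[OF k] addhom_closed[OF translate_hom[OF der] p]] .
      ultimately show ?thesis using k p by (simp add: FF_pure D2_one_closed coface_ext_translate[symmetric])
    qed
    have 1: "FF 1 (pw 1 1 p \<one>\<^bsub>D2\<^esub>) = ?x \<ominus>\<^bsub>W 1 0\<^esub> ?s1" using unit[of 1] by simp
    have 2: "FF 2 (pw 1 1 p \<one>\<^bsub>D2\<^esub>) = pw 0 1 p \<one>\<^bsub>D2\<^esub> \<ominus>\<^bsub>W 0 1\<^esub> coface_ext 2 (eps 0 (nabla p))"
      using unit[of 2] NN_eqs by simp
    have Y: "abelian_group (W 0 1)" by (rule AG_W) simp_all
    have "FF 0 (FF 2 (pw 1 1 p \<one>\<^bsub>D2\<^esub>)) = FF 0 (pw 0 1 p \<one>\<^bsub>D2\<^esub>) \<ominus>\<^bsub>W 1 0\<^esub> ?f"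
      unfolding 2 using p addhom_closed[OF homs_to_X(3) ec]
      by (simp add: addhom_diff[OF homs_to_X(4) Y X] pw_closed D2_one_closed)
    also have "\<dots> = ?x \<ominus>\<^bsub>W 1 0\<^esub> ?s0 \<ominus>\<^bsub>W 1 0\<^esub> ?f" using unit[of 0] NN_eqs by simp
    also have "\<dots> = ?x \<ominus>\<^bsub>W 1 0\<^esub> (?f \<oplus>\<^bsub>W 1 0\<^esub> ?s0)" using cl by algebra
    also have "\<dots> = ?x \<ominus>\<^bsub>W 1 0\<^esub> (?s1 \<oplus>\<^bsub>W 1 0\<^esub> ?c)" using curvature_identity[OF nabla_closed[OF p]] by simp
    also have "\<dots> = (?x \<ominus>\<^bsub>W 1 0\<^esub> ?s1) \<ominus>\<^bsub>W 1 0\<^esub> ?c" using cl by algebra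
    finally have 3: "FF 0 (FF 2 (pw 1 1 p \<one>\<^bsub>D2\<^esub>)) = (?x \<ominus>\<^bsub>W 1 0\<^esub> ?s1) \<ominus>\<^bsub>W 1 0\<^esub> ?c" .
    have d: "?x \<ominus>\<^bsub>W 1 0\<^esub> ?s1 \<in> carrier (W 1 0)" using cl by simp
    have "a = a \<ominus>\<^bsub>W 1 0\<^esub> c \<longleftrightarrow> c = \<zero>\<^bsub>W 1 0\<^esub>" if a: "a \<in> carrier (W 1 0)" and c: "c \<in> carrier (W 1 0)" for a c
    proof
      assume "a = a \<ominus>\<^bsub>W 1 0\<^esub> c"
      then have "a \<oplus>\<^bsub>W 1 0\<^esub> c = a \<ominus>\<^bsub>W 1 0\<^esub> c \<oplus>\<^bsub>W 1 0\<^esub> c" by simp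
      also have "\<dots> = a \<oplus>\<^bsub>W 1 0\<^esub> \<zero>\<^bsub>W 1 0\<^esub>" using a c by algebra
      finally show "c = \<zero>\<^bsub>W 1 0\<^esub>" using a c by simp
    next
      assume "c = \<zero>\<^bsub>W 1 0\<^esub>"
      then show "a = a \<ominus>\<^bsub>W 1 0\<^esub> c" using a by (simp add: a_minus_def)
    qed
    then have "FF 1 (pw 1 1 p \<one>\<^bsub>D2\<^esub>) = FF 0 (FF 2 (pw 1 1 p \<one>\<^bsub>D2\<^esub>)) \<longleftrightarrow> ?c = \<zero>\<^bsub>W 1 0\<^esub>"
      unfolding 1 3 using d cl(5) by blast
    also have "\<dots> \<longleftrightarrow> cov_diff nabla 1 (nabla p) = \<zero>\<^bsub>Om 2\<^esub>"
      using top_retract_top_incl[OF cc] top_retract_top_incl[OF abelian_groupE(2)[OF AG_Om]] addhom_zero[OF top_incl_hom AG_Om X] by metis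
    finally show ?thesis .
  qed
  show ?thesis
  proof
    assume "cocycle R G B P (transport nabla)"
    then show "\<forall>p \<in> carrier P. cov_diff nabla 1 (nabla p) = \<zero>\<^bsub>Om 2\<^esub>"
      using key by (simp add: cocycle_iff pw_closed D2_one_closed)
  next
    assume flat: "\<forall>p \<in> carrier P. cov_diff nabla 1 (nabla p) = \<zero>\<^bsub>Om 2\<^esub>"
    have "FF 1 u = FF 0 (FF 2 u)" if u: "u \<in> carrier (W 1 1)" for u
    proof (rule W_hom_eqI[OF _ _ homs_to_X(5) addhom_comp[OF homs_to_X(6,4)] X _ u])
      fix p d assume p: "p \<in> carrier P" and d: "d \<in> carrier D2"
      let ?v = "pw 1 1 p \<one>\<^bsub>D2\<^esub>"
      have v: "?v \<in> carrier (W 1 1)" using p by (simp add: pw_closed D2_one_closed)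
      have v2: "FF 2 ?v \<in> carrier (W 0 1)" by (rule addhom_closed[OF homs_to_X(6) v])
      have pd: "pw 1 1 p d = pw 1 1 \<one>\<^bsub>P\<^esub> d \<otimes>\<^bsub>W 1 1\<^esub> ?v"
        using p d monoid.r_one[OF ring.is_monoid[OF cring.axioms(1)[OF D2_cring]] d] by (simp add: pw_scalar D2_one_closed)
      have "FF 1 (pw 1 1 p d) = pw 1 0 \<one>\<^bsub>P\<^esub> d \<otimes>\<^bsub>W 1 0\<^esub> FF 1 ?v"
        unfolding pd using FF_scalar[of 1 d ?v] d v by simp
      moreover have "FF 2 (pw 1 1 p d) = pw 0 1 \<one>\<^bsub>P\<^esub> d \<otimes>\<^bsub>W 0 1\<^esub> FF 2 ?v"
        unfolding pd using FF_scalar[of 2 d ?v] d v NN_eqs by simp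
      moreover have "FF 0 (pw 0 1 \<one>\<^bsub>P\<^esub> d \<otimes>\<^bsub>W 0 1\<^esub> FF 2 ?v) = pw 1 0 \<one>\<^bsub>P\<^esub> d \<otimes>\<^bsub>W 1 0\<^esub> FF 0 (FF 2 ?v)"
        using FF_scalar[of 0 d "FF 2 ?v"] d v2 NN_eqs by simp
      ultimately show "FF 1 (pw 1 1 p d) = FF 0 (FF 2 (pw 1 1 p d))"
        using key[OF p] flat p by simp
    qed simp_all
    then show "cocycle R G B P (transport nabla)" by (simp add: cocycle_iff)
  qed
qed

end

end

section \<open>Isomorphic groupoids\<close>

text \<open>The groupoid axioms are carried along the bijection, so they have to be verified on one side only, and
  the two natural transformations consist of identities.\<close>

lemma equivalent_of_isomorphic:
  assumes D: "groupoid D" and K: "bij_betw K (ob D) (ob C)"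
    and arr: "\<And>x y. x \<in> ob D \<Longrightarrow> y \<in> ob D \<Longrightarrow> arr C (K x) (K y) = arr D x y"
    and idn: "\<And>x. x \<in> ob D \<Longrightarrow> idn C (K x) = idn D x"
    and cmp: "\<And>x y z g f. x \<in> ob D \<Longrightarrow> y \<in> ob D \<Longrightarrow> z \<in> ob D \<Longrightarrow>
      cmp C (K x) (K y) (K z) g f = cmp D x y z g f"
  shows "equivalent_groupoids C D"
proof -
  interpret D: groupoid D by (rule D)
  define L where "L = inv_into (ob D) K"
  have L: "L x \<in> ob D" "K (L x) = x" if "x \<in> ob C" for x
    using that K unfolding L_def bij_betw_def by (auto simp: inv_into_into f_inv_into_f)
  have LK: "L (K x) = x" if "x \<in> ob D" for x
    using that K unfolding L_def bij_betw_def by simp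
  have KD: "K x \<in> ob C" if "x \<in> ob D" for x using that K unfolding bij_betw_def by blast
  have arr': "arr C x y = arr D (L x) (L y)" if "x \<in> ob C" "y \<in> ob C" for x y
    using arr[of "L x" "L y"] L that by simp
  have idn': "idn C x = idn D (L x)" if "x \<in> ob C" for x using idn[of "L x"] L that by simp
  have cmp': "cmp C x y z g f = cmp D (L x) (L y) (L z) g f"
    if "x \<in> ob C" "y \<in> ob C" "z \<in> ob C" for x y z g f
    using cmp[of "L x" "L y" "L z"] L that by simp
  have C: "groupoid C"
  proof
    fix x y f assume h: "x \<in> ob C" "y \<in> ob C" "f \<in> arr C x y"
    then show "\<exists>g\<in>arr C y x. cmp C x y x g f = idn C x \<and> cmp C y x y f g = idn C y"
      using D.arr_inv[of "L x" "L y" f] by (simp add: arr' idn' cmp' L)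
    from h show "cmp C x x y f (idn C x) = f" "cmp C x y y (idn C y) f = f"
      by (simp_all add: arr' idn' cmp' L D.cmp_idn_right D.cmp_idn_left)
  next
    fix x y z f g assume "x \<in> ob C" "y \<in> ob C" "z \<in> ob C" "f \<in> arr C x y" "g \<in> arr C y z"
    then show "cmp C x y z g f \<in> arr C x z"
      using D.cmp_arr[of "L x" "L y" "L z" f g] by (simp add: arr' cmp' L)
  next
    fix x y z w f g h assume "x \<in> ob C" "y \<in> ob C" "z \<in> ob C" "w \<in> ob C" "f \<in> arr C x y" "g \<in> arr C y z" "h \<in> arr C z w"
    then show "cmp C x z w h (cmp C x y z g f) = cmp C x y w (cmp C y z w h g) f"
      using D.cmp_assoc[of "L x" "L y" "L z" "L w" f g h] by (simp add: arr' cmp' L)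
  qed (simp add: arr' idn' L D.idn_arr)
  interpret C: groupoid C by (rule C)
  have 1: "is_functor C D L (\<lambda>x y f. f)"
    unfolding is_functor_def by (auto simp: L arr' idn' cmp')
  have 2: "is_functor D C K (\<lambda>x y f. f)"
    unfolding is_functor_def by (auto simp: KD arr idn cmp)
  have 3: "nat_from_id C (\<lambda>x. K (L x)) (\<lambda>x y f. f) (idn C)"
    unfolding nat_from_id_def by (auto simp: L C.idn_arr C.cmp_idn_right C.cmp_idn_left)
  have 4: "nat_from_id D (\<lambda>x. L (K x)) (\<lambda>x y f. f) (idn D)"
    unfolding nat_from_id_def by (auto simp: LK D.idn_arr D.cmp_idn_right D.cmp_idn_left)
  show ?thesis
    unfolding equivalent_groupoids_def using C D 1 2 3 4 by blast
qed

section \<open>Isomorphisms of spaces with action\<close>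

context
  fixes R :: "('r, 'w) ring_scheme" and G :: "('r, 'h) hopf" and A :: "('r, 'a) module"
  assumes A: "algebra R A" and G: "algebra R G"
begin

lemma alg_hom_linmap: "f \<in> alg_hom A S T \<Longrightarrow> f \<in> linmap A S T"
  by (auto simp: alg_hom_def ring_hom_def linmap_def addhom_def)

lemma gspace_iso_R_linmap: "h \<in> gspace_iso R G A P P' \<Longrightarrow>
    h \<in> linmap R (restr (unit_map A) P') (restr (unit_map A) P)"
  using ring_hom_closed[OF unit_map_hom[OF A]]
  by (auto simp: gspace_iso_def alg_hom_def ring_hom_def linmap_def addhom_def)

private lemma gspace_mods: "gspace_over R G A P \<Longrightarrow> module R (restr (unit_map A) P)"
  by (rule module_restr[OF unit_map_hom[OF A] _ algebra.module[OF gspace_over.alg]])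
    (use A in \<open>simp_all add: algebra.R_cring\<close>)

private lemma Gm: "module R G" by (rule algebra.module[OF G])

private lemma co_closed: "gspace_over R G A P \<Longrightarrow> p \<in> carrier P \<Longrightarrow>
    coact P p \<in> carrier (tens R (restr (unit_map A) P) G)"
  using ring_hom_closed[OF gspace_over.coact_ring_hom] .

lemma gspace_iso_id:
  assumes P: "gspace_over R G A P"
  shows "(\<lambda>p \<in> carrier P. p) \<in> gspace_iso R G A P P"
proof -
  interpret P: algebra A P by (rule gspace_over.alg[OF P])
  have "tens_map R (restr (unit_map A) P) G (\<lambda>p \<in> carrier P. p) id w = w"
    if "w \<in> carrier (tens R (restr (unit_map A) P) G)" for w
    by (rule tens_map_id[OF gspace_mods[OF P] Gm _ that]) simp
  moreover have "(\<lambda>p \<in> carrier P. p) \<in> alg_hom A P P"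
    by (auto simp: alg_hom_def ring_hom_def)
  ultimately show ?thesis
    using co_closed[OF P] by (auto simp: gspace_iso_def bij_betw_def inj_on_def)
qed

lemma gspace_iso_compose:
  assumes P: "gspace_over R G A P" "gspace_over R G A P'" "gspace_over R G A P''"
    and h: "h \<in> gspace_iso R G A P P'" and h': "h' \<in> gspace_iso R G A P' P''"
  shows "compose (carrier P'') h h' \<in> gspace_iso R G A P P''"
proof -
  interpret P'': algebra A P'' by (rule gspace_over.alg[OF P(3)])
  let ?r = "restr (unit_map A)" and ?c = "compose (carrier P'') h h'"
  have cl: "h' u \<in> carrier P'" if "u \<in> carrier P''" for u
    using h' that by (auto simp: gspace_iso_def alg_hom_def ring_hom_def)
  have cl': "h u \<in> carrier P" if "u \<in> carrier P'" for u
    using h that by (auto simp: gspace_iso_def alg_hom_def ring_hom_def)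
  have alg: "?c \<in> alg_hom A P'' P"
    using h h' cl cl' by (auto simp: gspace_iso_def alg_hom_def ring_hom_def compose_def)
  have bij: "bij_betw ?c (carrier P'') (carrier P)"
    using h h' by (intro bij_betw_compose[of h' _ "carrier P'"]) (simp_all add: gspace_iso_def)
  have "coact P (?c u) = tens_map R (?r P) G ?c id (coact P'' u)" if u: "u \<in> carrier P''" for u
  proof -
    note l = linmap_comp[OF gspace_iso_R_linmap[OF h'] gspace_iso_R_linmap[OF h]]
    have "coact P (?c u) = tens_map R (?r P) G h id (coact P' (h' u))"
      using h cl[OF u] u by (simp add: gspace_iso_def compose_def)
    also have "\<dots> = tens_map R (?r P) G h id (tens_map R (?r P') G h' id (coact P'' u))"
      using h' u by (simp add: gspace_iso_def)
    also have "\<dots> = tens_map R (?r P) G (\<lambda>x. h (h' x)) id (coact P'' u)"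
      by (rule tens_map_comp[OF gspace_mods[OF P(3)] gspace_mods[OF P(2)] gspace_mods[OF P(1)] Gm gspace_iso_R_linmap[OF h']
            gspace_iso_R_linmap[OF h] co_closed[OF P(3) u]])
    also have "\<dots> = tens_map R (?r P) G ?c id (coact P'' u)"
      by (rule tens_map_cong[OF gspace_mods[OF P(3)] gspace_mods[OF P(1)] Gm l _ co_closed[OF P(3) u]]) (simp add: compose_def)
    finally show ?thesis .
  qed
  then show ?thesis using alg bij by (simp add: gspace_iso_def)
qed

lemma gspace_iso_inverse:
  assumes P: "gspace_over R G A P" "gspace_over R G A P'" and h: "h \<in> gspace_iso R G A P P'"
  shows "restrict (inv_into (carrier P') h) (carrier P) \<in> gspace_iso R G A P' P" (is "?k \<in> _")
proof -
  interpret P: algebra A P by (rule gspace_over.alg[OF P(1)])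
  interpret P': algebra A P' by (rule gspace_over.alg[OF P(2)])
  let ?r = "restr (unit_map A)"
  have bij: "bij_betw h (carrier P') (carrier P)" and hom: "h \<in> alg_hom A P' P"
    using h by (simp_all add: gspace_iso_def)
  have kcl: "?k p \<in> carrier P'" and hk: "h (?k p) = p" if "p \<in> carrier P" for p
    using bij that by (auto simp: bij_betw_def inv_into_into f_inv_into_f)
  have eqI: "u = v" if "u \<in> carrier P'" "v \<in> carrier P'" "h u = h v" for u v
    using bij that by (auto simp: bij_betw_def inj_on_def)
  have kh: "?k (h u) = u" if "u \<in> carrier P'" for u
    using bij that by (auto simp: bij_betw_def)
  have "?k \<in> ring_hom P P'"
  proof (rule ring_hom_memI)
    fix x y assume x: "x \<in> carrier P" and y: "y \<in> carrier P"
    have "h (?k x \<otimes>\<^bsub>P'\<^esub> ?k y) = x \<otimes>\<^bsub>P\<^esub> y" "h (?k x \<oplus>\<^bsub>P'\<^esub> ?k y) = x \<oplus>\<^bsub>P\<^esub> y"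
      using hom kcl[OF x] kcl[OF y] hk[OF x] hk[OF y] by (simp_all add: alg_hom_def ring_hom_def)
    then show "?k (x \<otimes>\<^bsub>P\<^esub> y) = ?k x \<otimes>\<^bsub>P'\<^esub> ?k y" "?k (x \<oplus>\<^bsub>P\<^esub> y) = ?k x \<oplus>\<^bsub>P'\<^esub> ?k y"
      using kh[of "?k x \<otimes>\<^bsub>P'\<^esub> ?k y"] kh[of "?k x \<oplus>\<^bsub>P'\<^esub> ?k y"] kcl[OF x] kcl[OF y] by simp_all
  next
    show "?k \<one>\<^bsub>P\<^esub> = \<one>\<^bsub>P'\<^esub>" using kh[of "\<one>\<^bsub>P'\<^esub>"] hom by (simp add: alg_hom_def ring_hom_def)
  qed (rule kcl)
  moreover have "?k (a \<odot>\<^bsub>P\<^esub> p) = a \<odot>\<^bsub>P'\<^esub> ?k p" if "a \<in> carrier A" "p \<in> carrier P" for a p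
  proof -
    have "h (a \<odot>\<^bsub>P'\<^esub> ?k p) = a \<odot>\<^bsub>P\<^esub> p"
      using hom that kcl[OF that(2)] hk[OF that(2)] by (simp add: alg_hom_def)
    then show ?thesis using kh[of "a \<odot>\<^bsub>P'\<^esub> ?k p"] kcl[OF that(2)] that by simp
  qed
  ultimately have alg: "?k \<in> alg_hom A P P'" unfolding alg_hom_def by blast
  have bij': "bij_betw ?k (carrier P) (carrier P')"
  proof (rule bij_betw_byWitness[where f' = h])
    show "\<forall>p\<in>carrier P. h (?k p) = p" using hk by blast
    show "\<forall>u\<in>carrier P'. ?k (h u) = u" using kh by blast
    show "?k ` carrier P \<subseteq> carrier P'" using kcl by blast
    show "h ` carrier P' \<subseteq> carrier P" using bij by (simp add: bij_betw_def)
  qed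
  have k_lin: "?k \<in> linmap R (?r P) (?r P')"
    using ring_hom_closed[OF unit_map_hom[OF A]] alg
    by (auto simp: alg_hom_def ring_hom_def linmap_def addhom_def simp del: restrict_apply)
  have "coact P' (?k p) = tens_map R (?r P') G ?k id (coact P p)" if p: "p \<in> carrier P" for p
  proof -
    have "coact P p = tens_map R (?r P) G h id (coact P' (?k p))"
    proof -
      have "coact P (h (?k p)) = tens_map R (?r P) G h id (coact P' (?k p))"
        using h kcl[OF p] unfolding gspace_iso_def by blast
      then show ?thesis by (simp only: hk[OF p])
    qed
    then have "tens_map R (?r P') G ?k id (coact P p)
        = tens_map R (?r P') G (\<lambda>x. ?k (h x)) id (coact P' (?k p))"
      using tens_map_comp[OF gspace_mods[OF P(2)] gspace_mods[OF P(1)] gspace_mods[OF P(2)] Gm gspace_iso_R_linmap[OF h]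
            k_lin co_closed[OF P(2) kcl[OF p]]] by simp
    also have "\<dots> = coact P' (?k p)"
      by (rule tens_map_id[OF gspace_mods[OF P(2)] Gm _ co_closed[OF P(2) kcl[OF p]]]) (use kh in simp)
    finally show ?thesis by simp
  qed
  then show ?thesis using alg bij' by (simp add: gspace_iso_def)
qed

end

section \<open>The groupoid of flat connections\<close>

context dg_calg
begin

lemma connection_arr_comp:
  assumes P: "module A0 P" "module A0 P'" "module A0 P''"
    and h: "h \<in> linmap A0 P' P" and h': "h' \<in> linmap A0 P'' P'"
    and \<omega>: "\<omega> \<in> carrier (tens A0 P'' (dg_mod B 1))"
  shows "tens_map A0 P (dg_mod B 1) (compose (carrier P'') h h') id \<omega>
    = tens_map A0 P (dg_mod B 1) h id (tens_map A0 P' (dg_mod B 1) h' id \<omega>)"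
proof -
  have "tens_map A0 P (dg_mod B 1) (\<lambda>x. h (h' x)) id \<omega> = tens_map A0 P (dg_mod B 1) (compose (carrier P'') h h') id \<omega>"
    by (rule tens_map_cong[OF P(3,1) dg_mod_module linmap_comp[OF h' h] _ \<omega>]) (simp add: compose_def)
  then show ?thesis
    using tens_map_comp[OF P(3,2,1) dg_mod_module h' h \<omega>] by simp
qed

lemma flat_connections_groupoid:
  assumes G: "algebra R G"
  shows "groupoid (flat_connections R G B)"
proof -
  let ?C = "flat_connections R G B"
  note iso = gspace_iso_id[OF A0_algebra G] gspace_iso_compose[OF A0_algebra G] gspace_iso_inverse[OF A0_algebra G]
  have space: "gspace_over R G A0 P" if "(P, nabla) \<in> ob ?C" for P nabla
    using that by (simp add: flat_connections_def torsor_def)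
  have alg: "algebra A0 P" if "(P, nabla) \<in> ob ?C" for P nabla
    using gspace_over.alg[OF space[OF that]] .
  have mod: "module A0 P" if "(P, nabla) \<in> ob ?C" for P nabla
    using algebra.module[OF alg[OF that]] .
  have ncl: "nabla p \<in> carrier (tens A0 P (dg_mod B 1))" if "(P, nabla) \<in> ob ?C" "p \<in> carrier P" for P nabla p
    using that by (auto simp: flat_connections_def flat_connection_def Let_def)
  have arr: "h \<in> arr ?C (P, nabla) (P', nabla') \<longleftrightarrow> h \<in> gspace_iso R G A0 P P' \<and>
      (\<forall>p \<in> carrier P'. tens_map A0 P (dg_mod B 1) h id (nabla' p) = nabla (h p))" for h P nabla P' nabla'
    by (simp add: flat_connections_def)
  have lin: "h \<in> linmap A0 P' P" if "h \<in> gspace_iso R G A0 P P'" for h P P'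
    using that by (intro alg_hom_linmap[OF A0_algebra G]) (simp add: gspace_iso_def)
  have cl: "h u \<in> carrier P" if "h \<in> gspace_iso R G A0 P P'" "u \<in> carrier P'" for h P P' u
    using linmap_closed[OF lin[OF that(1)] that(2)] .
  have ext: "h \<in> extensional (carrier P')" if "h \<in> gspace_iso R G A0 P P'" for h P P'
    using that by (simp add: gspace_iso_def)
  show ?thesis
  proof
    fix x assume x: "x \<in> ob ?C"
    obtain P nabla where e: "x = (P, nabla)" by (cases x)
    interpret P: algebra A0 P by (rule alg[OF x[unfolded e]])
    have "tens_map A0 P (dg_mod B 1) (\<lambda>p \<in> carrier P. p) id (nabla p) = nabla p" if "p \<in> carrier P" for p
      by (rule tens_map_id[OF P.module dg_mod_module _ ncl[OF x[unfolded e] that]]) simp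
    then show "idn ?C x \<in> arr ?C x x"
      using iso(1)[OF space[OF x[unfolded e]]] by (simp add: e arr) (simp add: flat_connections_def)
  next
    fix x y z f g assume x: "x \<in> ob ?C" and y: "y \<in> ob ?C" and z: "z \<in> ob ?C"
      and f: "f \<in> arr ?C x y" and g: "g \<in> arr ?C y z"
    obtain P n P' n' P'' n'' where e: "x = (P, n)" "y = (P', n')" "z = (P'', n'')"
      by (cases x, cases y, cases z)
    note o = x[unfolded e] y[unfolded e] z[unfolded e]
    have f1: "f \<in> gspace_iso R G A0 P P'" and g1: "g \<in> gspace_iso R G A0 P' P''"
      using f g unfolding e arr by blast+
    have "compose (carrier P'') f g \<in> arr ?C x z"
      unfolding e arr
    proof (intro conjI ballI)
      show "compose (carrier P'') f g \<in> gspace_iso R G A0 P P''"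
        by (rule iso(2)[OF space[OF o(1)] space[OF o(2)] space[OF o(3)] f1 g1])
      fix p assume p: "p \<in> carrier P''"
      show "tens_map A0 P (dg_mod B 1) (compose (carrier P'') f g) id (n'' p) = n (compose (carrier P'') f g p)"
      proof -
        have "tens_map A0 P' (dg_mod B 1) g id (n'' p) = n' (g p)" "tens_map A0 P (dg_mod B 1) f id (n' (g p)) = n (f (g p))"
          using f g p cl[OF g1 p] unfolding e arr by blast+
        moreover have "compose (carrier P'') f g p = f (g p)" using p by (simp add: compose_def)
        ultimately show ?thesis
          using connection_arr_comp[OF mod[OF o(1)] mod[OF o(2)] mod[OF o(3)] lin[OF f1] lin[OF g1] ncl[OF o(3) p]]
          by simp
      qed
    qed
    then show "cmp ?C x y z g f \<in> arr ?C x z" by (simp add: e flat_connections_def)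
  next
    fix x y f assume x: "x \<in> ob ?C" and y: "y \<in> ob ?C" and f: "f \<in> arr ?C x y"
    obtain P n P' n' where e: "x = (P, n)" "y = (P', n')" by (cases x, cases y)
    note o = x[unfolded e] y[unfolded e]
    have f1: "f \<in> gspace_iso R G A0 P P'" and fn: "\<And>p. p \<in> carrier P' \<Longrightarrow> tens_map A0 P (dg_mod B 1) f id (n' p) = n (f p)"
      using f unfolding e arr by blast+
    show "cmp ?C x x y f (idn ?C x) = f"
      by (rule extensionalityI[of _ "carrier P'"])
        (use ext[OF f1] cl[OF f1] in \<open>auto simp: e flat_connections_def compose_def\<close>)
    show "cmp ?C x y y (idn ?C y) f = f"
      by (rule extensionalityI[of _ "carrier P'"])
        (use ext[OF f1] cl[OF f1] in \<open>auto simp: e flat_connections_def compose_def\<close>)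
    let ?k = "restrict (inv_into (carrier P') f) (carrier P)"
    have bij: "bij_betw f (carrier P') (carrier P)" using f1 by (simp add: gspace_iso_def)
    have kcl: "?k p \<in> carrier P'" and fk: "f (?k p) = p" if "p \<in> carrier P" for p
      using bij that by (auto simp: bij_betw_def inv_into_into f_inv_into_f)
    have kf: "?k (f u) = u" if "u \<in> carrier P'" for u
      using bij that by (auto simp: bij_betw_def)
    have k1: "?k \<in> gspace_iso R G A0 P' P" by (rule iso(3)[OF space[OF o(1)] space[OF o(2)] f1])
    have k: "?k \<in> arr ?C y x"
      unfolding e arr
    proof (intro conjI ballI)
      fix q assume q: "q \<in> carrier P"
      let ?p = "?k q"
      have p: "?p \<in> carrier P'" by (rule kcl[OF q])
      have "tens_map A0 P' (dg_mod B 1) ?k id (n q) = tens_map A0 P' (dg_mod B 1) ?k id (tens_map A0 P (dg_mod B 1) f id (n' ?p))"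
        using fn[OF p] fk[OF q] by simp
      also have "\<dots> = tens_map A0 P' (dg_mod B 1) (\<lambda>u. ?k (f u)) id (n' ?p)"
        by (rule tens_map_comp[OF mod[OF o(2)] mod[OF o(1)] mod[OF o(2)] dg_mod_module lin[OF f1] lin[OF k1] ncl[OF o(2) p]])
      also have "\<dots> = n' ?p"
        by (rule tens_map_id[OF mod[OF o(2)] dg_mod_module _ ncl[OF o(2) p]]) (use kf in simp)
      finally show "tens_map A0 P' (dg_mod B 1) ?k id (n q) = n' (?k q)" .
    qed (rule k1)
    have "cmp ?C x y x ?k f = idn ?C x"
      by (rule extensionalityI[of _ "carrier P"])
        (use fk in \<open>simp_all add: e flat_connections_def compose_def\<close>)
    moreover have "cmp ?C y x y f ?k = idn ?C y"
      by (rule extensionalityI[of _ "carrier P'"])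
        (use kf in \<open>simp_all add: e flat_connections_def compose_def\<close>)
    ultimately show "\<exists>g\<in>arr ?C y x. cmp ?C x y x g f = idn ?C x \<and> cmp ?C y x y f g = idn ?C y"
      using k by blast
  next
    fix x y z w f g h assume "x \<in> ob ?C" "y \<in> ob ?C" "z \<in> ob ?C" "w \<in> ob ?C"
      and f: "f \<in> arr ?C x y" and g: "g \<in> arr ?C y z" and h: "h \<in> arr ?C z w"
    obtain P n P' n' P'' n'' Q m where e: "x = (P, n)" "y = (P', n')" "z = (P'', n'')" "w = (Q, m)"
      by (cases x, cases y, cases z, cases w)
    have h1: "h \<in> gspace_iso R G A0 P'' Q" using h unfolding e arr by blast
    show "cmp ?C x z w h (cmp ?C x y z g f) = cmp ?C x y w (cmp ?C y z w h g) f"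
      by (rule extensionalityI[of _ "carrier Q"])
        (use cl[OF h1] in \<open>simp_all add: e flat_connections_def compose_def\<close>)
  qed
qed

section \<open>Descent data and connections\<close>

text \<open>Both base changes of \<open>h\<close> act on \<open>p \<otimes> 1 - \<nabla>'p\<close> through \<open>h\<close> on \<open>O(P')\<close>, so the two conditions differ by
  the degree-zero term \<open>h(p) \<otimes> 1\<close> only.\<close>

lemma morphism_iff:
  assumes P: "algebra A0 P" "algebra A0 P'" and h: "h \<in> linmap A0 P' P"
    and der: "algebra_over_dg_zero.derivation B P nabla" and der': "algebra_over_dg_zero.derivation B P' nabla'"
  shows "(\<forall>u \<in> carrier (pull1 R G B 1 P').
        base_change_iso A0 D1 d0 P h (algebra_over_dg_zero.transport B P' nabla' u)
        = algebra_over_dg_zero.transport B P nabla (base_change_iso A0 D1 d1 P h u)) \<longleftrightarrow>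
    (\<forall>p \<in> carrier P'. tens_map A0 P (dg_mod B 1) h id (nabla' p) = nabla (h p))"
proof -
  interpret Q: algebra_over_dg_zero R B P
    by (intro algebra_over_dg_zero.intro algebra_over_dg_zero_axioms.intro dg_calg_axioms P)
  interpret Q': algebra_over_dg_zero R B P'
    by (intro algebra_over_dg_zero.intro algebra_over_dg_zero_axioms.intro dg_calg_axioms P)
  have l: "(0::nat) \<le> 1" "(1::nat) \<le> 1" by simp_all
  let ?hO = "tens_map A0 P (dg_mod B 1) h id" and ?hU = "\<lambda>i. tens_map A0 P (fib i) h id"
  have hO: "?hO \<in> addhom (Q'.Om 1) (Q.Om 1)"
    by (rule tens_map_hom[OF Q'.P.module dg_mod_module Q.P.module dg_mod_module h linmap_id])
  have hO_pure: "?hO (Q'.om 1 p b) = Q.om 1 (h p) b" if "p \<in> carrier P'" "b \<in> gr B 1" for p b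
    using tens_map_pure[OF Q'.P.module dg_mod_module Q.P.module dg_mod_module h linmap_id, where m = p and n = b] that by simp
  have hU: "?hU i \<in> addhom (Q'.U i) (Q.U i)" if "i \<le> 1" for i
    by (rule tens_map_hom[OF Q'.P.module Q'.fib_module[OF that] Q.P.module Q.fib_module[OF that] h linmap_id])
  have hU_pure: "?hU i (Q'.pu i p c) = Q.pu i (h p) c" if "i \<le> 1" "p \<in> carrier P'" "c \<in> carrier D1" for i p c
    using tens_map_pure[OF Q'.P.module Q'.fib_module[OF that(1)] Q.P.module Q.fib_module[OF that(1)] h linmap_id, where m = p and n = c] that by simp
  have hcl: "h p \<in> carrier P" if "p \<in> carrier P'" for p using linmap_closed[OF h that] .
  have h_eps: "?hU 0 (Q'.eps 0 \<omega>) = Q.eps 0 (?hO \<omega>)" if \<omega>: "\<omega> \<in> carrier (Q'.Om 1)" for \<omega>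
    by (rule Q'.Om_hom_eqI[OF addhom_comp[OF Q'.eps_hom[OF l(1)] hU[OF l(1)]] addhom_comp[OF hO Q.eps_hom[OF l(1)]] Q.AG_U[OF l(1)] _ \<omega>])
      (simp add: Q'.eps_pure hU_pure hO_pure Q.eps_pure hcl D1_carrier gr_closed)
  have h_scalar: "?hU 0 (Q'.pu 0 \<one>\<^bsub>P'\<^esub> c \<otimes>\<^bsub>Q'.U 0\<^esub> u) = Q.pu 0 \<one>\<^bsub>P\<^esub> c \<otimes>\<^bsub>Q.U 0\<^esub> ?hU 0 u"
    if c: "c \<in> carrier D1" and u: "u \<in> carrier (Q'.U 0)" for c u
  proof (rule tens_hom_eqI[OF Q'.P.module Q'.fib_module[OF l(1)]
        addhom_comp[OF tens_mult_hom_right[OF P(2) Q'.fib_algebra[OF l(1)] Q'.sc_closed[OF l(1) c]] hU[OF l(1)]]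
        addhom_comp[OF hU[OF l(1)] tens_mult_hom_right[OF P(1) Q.fib_algebra[OF l(1)] Q.sc_closed[OF l(1) c]]] Q.AG_U[OF l(1)] _ u])
    fix p d assume "p \<in> carrier P'" "d \<in> carrier (fib 0)"
    then show "?hU 0 (Q'.pu 0 \<one>\<^bsub>P'\<^esub> c \<otimes>\<^bsub>Q'.U 0\<^esub> Q'.pu 0 p d) = Q.pu 0 \<one>\<^bsub>P\<^esub> c \<otimes>\<^bsub>Q.U 0\<^esub> ?hU 0 (Q'.pu 0 p d)"
      using c by (simp add: Q'.sc_pu Q.sc_pu hU_pure hcl cring.cring_simprules(5)[OF D1_cring])
  qed
  have h_translate: "?hU 0 (Q'.translate nabla' p) = Q.pu 0 (h p) \<one>\<^bsub>D1\<^esub> \<ominus>\<^bsub>Q.U 0\<^esub> Q.eps 0 (?hO (nabla' p))"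
    if "p \<in> carrier P'" for p
    using that by (simp add: Q'.translate_def addhom_diff[OF hU[OF l(1)] Q'.AG_U[OF l(1)] Q.AG_U[OF l(1)]] Q'.pu_closed
        Q.D1_one_closed addhom_closed[OF Q'.eps_hom] Q'.der_closed[OF der'] hU_pure h_eps)
  have L: "?hU 0 (Q'.transport nabla' (Q'.pu 1 p c)) = Q.pu 0 \<one>\<^bsub>P\<^esub> c \<otimes>\<^bsub>Q.U 0\<^esub> ?hU 0 (Q'.translate nabla' p)"
    if "p \<in> carrier P'" "c \<in> carrier D1" for p c
    using that by (simp add: Q'.transport_pure[OF der'] h_scalar addhom_closed[OF Q'.translate_hom[OF der']])
  have Rr: "Q.transport nabla (?hU 1 (Q'.pu 1 p c)) = Q.pu 0 \<one>\<^bsub>P\<^esub> c \<otimes>\<^bsub>Q.U 0\<^esub> Q.translate nabla (h p)"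
    if "p \<in> carrier P'" "c \<in> carrier D1" for p c
    using that by (simp add: hU_pure Q.transport_pure[OF der] hcl)
  have lhs: "(\<forall>u \<in> carrier (pull1 R G B 1 P').
        base_change_iso A0 D1 d0 P h (Q'.transport nabla' u) = Q.transport nabla (base_change_iso A0 D1 d1 P h u)) \<longleftrightarrow>
      (\<forall>u \<in> carrier (Q'.U 1). ?hU 0 (Q'.transport nabla' u) = Q.transport nabla (?hU 1 u))"
    by (simp add: pull1_def base_change_iso_def)
  also have "\<dots> \<longleftrightarrow> (\<forall>p \<in> carrier P'. ?hU 0 (Q'.translate nabla' p) = Q.translate nabla (h p))"
  proof (intro iffI ballI)
    fix p assume a: "\<forall>u \<in> carrier (Q'.U 1). ?hU 0 (Q'.transport nabla' u) = Q.transport nabla (?hU 1 u)" and p: "p \<in> carrier P'"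
    have "Q'.pu 1 p \<one>\<^bsub>D1\<^esub> \<in> carrier (Q'.U 1)" using p by (simp add: Q'.pu_closed Q.D1_one_closed)
    with a have "?hU 0 (Q'.transport nabla' (Q'.pu 1 p \<one>\<^bsub>D1\<^esub>)) = Q.transport nabla (?hU 1 (Q'.pu 1 p \<one>\<^bsub>D1\<^esub>))" by blast
    then show "?hU 0 (Q'.translate nabla' p) = Q.translate nabla (h p)"
      using p by (simp add: Q'.transport_pure_one[OF der'] hU_pure Q.D1_one_closed Q.transport_pure_one[OF der] hcl)
  next
    fix u assume a: "\<forall>p \<in> carrier P'. ?hU 0 (Q'.translate nabla' p) = Q.translate nabla (h p)" and u: "u \<in> carrier (Q'.U 1)"
    show "?hU 0 (Q'.transport nabla' u) = Q.transport nabla (?hU 1 u)"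
      by (rule tens_hom_eqI[OF Q'.P.module Q'.fib_module[OF l(2)] addhom_comp[OF Q'.transport_hom[OF der'] hU[OF l(1)]]
          addhom_comp[OF hU[OF l(2)] Q.transport_hom[OF der]] Q.AG_U[OF l(1)] _ u])
        (use a in \<open>simp add: L Rr\<close>)
  qed
  also have "\<dots> \<longleftrightarrow> (\<forall>p \<in> carrier P'. ?hO (nabla' p) = nabla (h p))"
  proof (intro ball_cong HOL.refl)
    fix p assume p: "p \<in> carrier P'"
    have c: "?hO (nabla' p) \<in> carrier (Q.Om 1)" using addhom_closed[OF hO Q'.der_closed[OF der' p]] .
    interpret O: abelian_group "Q.Om 1" by (rule Q.AG_Om)
    have "Q.eps_retract (?hU 0 (Q'.translate nabla' p)) = \<zero>\<^bsub>Q.Om 1\<^esub> \<ominus>\<^bsub>Q.Om 1\<^esub> ?hO (nabla' p)"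
      using p c by (simp add: h_translate addhom_diff[OF Q.eps_retract_hom Q.AG_U[OF l(1)] Q.AG_Om] Q.pu_closed Q.D1_one_closed hcl
          addhom_closed[OF Q.eps_hom] Q.eps_retract_pu_one Q.eps_retract_eps)
    then have 1: "Q.eps_retract (?hU 0 (Q'.translate nabla' p)) = \<ominus>\<^bsub>Q.Om 1\<^esub> ?hO (nabla' p)" using c by (simp add: a_minus_def)
    show "?hU 0 (Q'.translate nabla' p) = Q.translate nabla (h p) \<longleftrightarrow> ?hO (nabla' p) = nabla (h p)"
    proof
      assume "?hU 0 (Q'.translate nabla' p) = Q.translate nabla (h p)"
      then have "\<ominus>\<^bsub>Q.Om 1\<^esub> ?hO (nabla' p) = \<ominus>\<^bsub>Q.Om 1\<^esub> nabla (h p)"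
        using 1 Q.eps_retract_translate[OF der hcl[OF p]] by simp
      then show "?hO (nabla' p) = nabla (h p)"
        using c Q.der_closed[OF der hcl[OF p]] O.minus_minus by metis
    next
      assume "?hO (nabla' p) = nabla (h p)"
      then show "?hU 0 (Q'.translate nabla' p) = Q.translate nabla (h p)" using p by (simp add: h_translate Q.translate_def)
    qed
  qed
  finally show ?thesis .
qed

end

lemma (in gspace_over_dg_zero) descent_datum_iff:
  "g \<in> gspace_iso R G D1 (pull 0) (pull 1) \<and> cocycle R G B P g \<longleftrightarrow>
    (\<exists>nabla. g = transport nabla \<and> flat_connection B P nabla \<and> equivariant_connection R G B P nabla)"
proof
  assume a: "g \<in> gspace_iso R G D1 (pull 0) (pull 1) \<and> cocycle R G B P g"
  then have g: "g \<in> alg_hom D1 (pull 1) (pull 0)" "g \<in> extensional (carrier (U 1))"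
    "bij_betw g (carrier (U 1)) (carrier (U 0))"
    "\<forall>u \<in> carrier (U 1). coact (pull 0) (g u) = tens_map R (MU 0) G g id (coact (pull 1) u)"
    by (simp_all add: gspace_iso_def pull1_simps)
  obtain nabla where n: "derivation nabla" "g = transport nabla"
    using derivation_of_descent[OF g(1,2) descent_degree_zero[OF g(1,3)]] a by blast
  then show "\<exists>nabla. g = transport nabla \<and> flat_connection B P nabla \<and> equivariant_connection R G B P nabla"
    using a g(4) transport_equivariant_iff[OF n(1)] cocycle_transport_iff[OF n(1)] flat_connection_iff by blast
next
  assume "\<exists>nabla. g = transport nabla \<and> flat_connection B P nabla \<and> equivariant_connection R G B P nabla"
  then obtain nabla where n: "derivation nabla" "g = transport nabla" "\<forall>p \<in> carrier P. cov_diff nabla 1 (nabla p) = \<zero>\<^bsub>Om 2\<^esub>"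
    "equivariant_connection R G B P nabla" using flat_connection_iff by blast
  have "transport nabla \<in> extensional (carrier (U 1))" by (simp add: transport_def)
  then show "g \<in> gspace_iso R G D1 (pull 0) (pull 1) \<and> cocycle R G B P g"
    using n(2-) cocycle_transport_iff[OF n(1)] transport_alg_hom[OF n(1), of G] transport_bij[OF n(1)] transport_equivariant_iff[OF n(1)]
    by (simp add: gspace_iso_def pull1_simps)
qed

theorem mainTheorem5:
  fixes R :: "'r ring" and G :: "('r, 'h) hopf" and B :: "('r, 'b) dga"
  assumes "comm_Q_algebra R"
    and "linear_algebraic_group R G"
    and "dg_calg R B"
  shows "equivalent_groupoids
    (Dstar_BG R G B :: (('b, 'p, 'h) descent_obj, 'p \<Rightarrow> 'p) cat)
    (flat_connections R G B :: (('b, 'p, 'h) connection_obj, 'p \<Rightarrow> 'p) cat)"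
proof -
  interpret dg_calg R B by fact
  have G: "algebra R G" using assms(2) by (rule linear_algebraic_group.axioms(1))
  let ?C = "Dstar_BG R G B :: (('b, 'p, 'h) descent_obj, 'p \<Rightarrow> 'p) cat"
  let ?D = "flat_connections R G B :: (('b, 'p, 'h) connection_obj, 'p \<Rightarrow> 'p) cat"
  let ?transport = "\<lambda>P. algebra_over_dg_zero.transport B P"
  let ?K = "\<lambda>(P, nabla). (P, ?transport P nabla)"
  have space: "gspace_over_dg_zero R B G P" if "torsor R G A0 P" for P :: "('b, 'p, 'h) gspace"
    using that G by (intro gspace_over_dg_zero.intro gspace_over_dg_zero_axioms.intro dg_calg_axioms)
      (simp_all add: torsor_def)
  have over: "algebra_over_dg_zero R B P" if "torsor R G A0 P" for P :: "('b, 'p, 'h) gspace"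
    using that gspace_over.alg[of R G A0 P]
    by (intro algebra_over_dg_zero.intro algebra_over_dg_zero_axioms.intro dg_calg_axioms) (simp add: torsor_def)
  have obD: "(P, nabla) \<in> ob ?D \<longleftrightarrow> torsor R G A0 P \<and> flat_connection B P nabla \<and>
      equivariant_connection R G B P nabla" for P nabla
    by (simp add: flat_connections_def)
  have der: "algebra_over_dg_zero.derivation B P nabla" if "(P, nabla) \<in> ob ?D" for P nabla
    using that algebra_over_dg_zero.flat_connection_iff[OF over] unfolding obD by blast
  have obC: "(P, g) \<in> ob ?C \<longleftrightarrow> torsor R G A0 P \<and> (\<exists>nabla. g = ?transport P nabla \<and> flat_connection B P nabla \<and>
      equivariant_connection R G B P nabla)" for P g
    using gspace_over_dg_zero.descent_datum_iff[OF space, of P g] by (auto simp: Dstar_BG_def)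
  have inj: "inj_on ?K (ob ?D)"
  proof (rule inj_onI)
    fix x y assume xy: "x \<in> ob ?D" "y \<in> ob ?D" "?K x = ?K y"
    obtain P n P' n' where e: "x = (P, n)" "y = (P', n')" by (cases x, cases y)
    have eq: "P' = P" "?transport P n = ?transport P n'" using xy(3) by (auto simp: e)
    have t: "torsor R G A0 P" using xy(1) unfolding e obD by blast
    have "n = n'"
      using algebra_over_dg_zero.transport_inj[OF over[OF t] der[OF xy(1)[unfolded e]] _ eq(2)] der[OF xy(2)[unfolded e]] eq(1)
      by simp
    then show "x = y" using e eq by simp
  qed
  have surj: "?K ` ob ?D = ob ?C"
  proof (intro Set.equalityI subsetI)
    fix z assume "z \<in> ?K ` ob ?D"
    then obtain P n where "(P, n) \<in> ob ?D" "z = (P, ?transport P n)" by auto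
    then show "z \<in> ob ?C" using obD obC by blast
  next
    fix z assume z: "z \<in> ob ?C"
    obtain P g where e: "z = (P, g)" by (cases z)
    obtain n where "torsor R G A0 P" "g = ?transport P n" "flat_connection B P n" "equivariant_connection R G B P n"
      using z unfolding e obC by blast
    then have m: "(P, n) \<in> ob ?D" and "z = ?K (P, n)" by (simp_all add: obD e)
    then show "z \<in> ?K ` ob ?D" by (rule image_eqI[rotated])
  qed
  show ?thesis
  proof (rule equivalent_of_isomorphic[where K = ?K])
    show "groupoid ?D" by (rule flat_connections_groupoid[OF G])
    show "bij_betw ?K (ob ?D) (ob ?C)" using inj surj by (simp add: bij_betw_def)
  next
    fix x y assume xy: "x \<in> ob ?D" "y \<in> ob ?D"
    obtain P n P' n' where e: "x = (P, n)" "y = (P', n')" by (cases x, cases y)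
    have t: "torsor R G A0 P" "torsor R G A0 P'" using xy unfolding e obD by blast+
    have alg: "algebra A0 P" "algebra A0 P'" using over[OF t(1)] over[OF t(2)]
      by (simp_all add: algebra_over_dg_zero_def algebra_over_dg_zero_axioms_def)
    have "h \<in> linmap A0 P' P" if "h \<in> gspace_iso R G A0 P P'" for h
      using that by (intro alg_hom_linmap[OF A0_algebra G]) (simp add: gspace_iso_def)
    then show "arr ?C (?K x) (?K y) = arr ?D x y"
      using morphism_iff[OF alg _ der[OF xy(1)[unfolded e]] der[OF xy(2)[unfolded e]], of _ G]
      by (auto simp: e Dstar_BG_def flat_connections_def)
  next
    fix x assume "x \<in> ob ?D"
    show "idn ?C (?K x) = idn ?D x" by (cases x) (simp add: Dstar_BG_def flat_connections_def)
  next
    fix x y z g f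
    show "cmp ?C (?K x) (?K y) (?K z) g f = cmp ?D x y z g f"
      by (cases z) (simp add: Dstar_BG_def flat_connections_def)
  qed
qed

end
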